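(* Let $\Omega\subset\mathbb{R}^2$ be an open bounded domain with Lipschitz continuous boundary, and let $\gamma>0$ and $C_1>0$. There is a constant $C$, independent of the viscosity $\nu$ and of the forcing $f$ (depending only on $\Omega,\gamma,C_1$), such that the following holds for every $\nu>0$. Let $f,g$ be any two forcing functions with $f(t),g(t)\in V'$ satisfying $$\lim_{t\to\infty}\|f(t)-g(t)\|_{V'}=0,$$ and let $u,v$ (with $u(t),v(t)\in V$) be corresponding weak solutions of the two-dimensional Navier-Stokes equations with viscosity $\nu$ and forcing $f$, $g$, respectively. Suppose there exists a projection operator $R_N:V\to V_N\subset \mathbf{L}^2(\Omega)$, $N=\dim(V_N)$, satisfying $$\lim_{t\to\infty}\|R_N(u(t)-v(t))\|_{L^2(\Omega)}=0$$ and satisfying the approximation inequality $$\|\phi-R_N\phi\|_{L^2(\Omega)}\le C_1N^{-\gamma}\|\phi\|_{H^1(\Omega)}\qquad\text{for all }\phi\in V.$$ If $$\infty>N>C\left(\frac{1}{\nu^2}\limsup_{t\to\infty}\|f(t)\|_{V'}\right)^{1/\gamma},$$ then $$\lim_{t\to\infty}|u(t)-v(t)|=0 .$$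
   Context: Let $d=2$. Spaces: bold letters denote spaces of $\mathbb{R}^d$-valued functions, e.g. $\mathbf{L}^2(\Omega)=(L^2(\Omega))^d$, with norms extended in the Euclidean way and subscripted as in the scalar case. Let $\mathcal{V}=\{\phi\in \mathbf{C}_0^\infty(\Omega):\nabla\cdot\phi=0\}$, $H$ = closure of $\mathcal{V}$ in $\mathbf{L}^2(\Omega)$, $V$ = closure of $\mathcal{V}$ in $\mathbf{H}^1_0(\Omega)$, and $V'$ the dual of $V$, with $V\subset H=H'\subset V'$ ($H$ identified with its dual) and $\langle\cdot,\cdot\rangle$ the duality pairing of $V'$ and $V$. Write $|u|=\|u\|_H=\|u\|_{L^2(\Omega)}$, $((u,v))=(\nabla u,\nabla v)_{L^2}$, $\|u\|=((u,u))^{1/2}$ (a norm on $V$ equivalent to the $H^1$-norm). The $H^1$ norm is $\|u\|_{H^1(\Omega)}^2=|\Omega|^{-1/d}\|u\|_{L^2(\Omega)}^2+|u|_{H^1(\Omega)}^2$, where $|u|_{H^1(\Omega)}=\|\nabla u\|_{L^2(\Omega)}$ and $|\Omega|$ is the measure of $\Omega$. Let $b(u,v,w)=\int_\Omega ((u\cdot\nabla)v)\cdot w\,dx$. Weak solutions: the Navier-Stokes equations are $\partial_t u-\nu\Delta u+(u\cdot\nabla)u+\nabla p=f$, $\nabla\cdot u=0$ in $\Omega\times(0,\infty)$, with initial condition $u(0)=u_0$ and no-slip boundary conditions (encoded in $V$). Given $f\in L^2([0,T];V')$ for every $T>0$, a weak solution is a function $u$ such that for every $T>0$, $u\in L^2([0,T];V)\cap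 C_w([0,T];H)$, $du/dt\in L^1_{\mathrm{loc}}((0,T];V')$, and $$\left\langle \frac{du}{dt},v\right\rangle+\nu((u,v))+b(u,u,v)=\langle f,v\rangle\quad\forall v\in V,\ \text{for almost every } t,\qquad u(0)=u_0 .$$ Here $C_w([0,T];H)$ is the space of weakly continuous functions in $L^\infty([0,T];H)$. The two solutions $u,v$ may have different initial data. A "projection operator" $R_N:V\to V_N\subset\mathbf{L}^2(\Omega)$ is a linear operator into a finite-dimensional space $V_N$, e.g. of the form $R_Nu=\sum_i l_i(u)\phi_i$ with $\{\phi_i\}$ a basis of $V_N$ and $l_i\in V'$ bounded linear functionals; $V_N$ is not required to be a subspace of $V$ (the $\phi_i$ need not be divergence-free). *)

theory Defs
  imports "HOL-Analysis.Analysis"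
begin

text \<open>
  Elements of the function spaces are represented by functions on the whole plane of which only
  the values on \<open>\<Omega>\<close> matter, up to null sets.  The norms below are therefore seminorms on
  representatives, and identities between elements of these spaces hold almost everywhere
  in \<open>\<Omega>\<close>.
\<close>

type_synonym field2 = "real^2 \<Rightarrow> real^2"
type_synonym functional = "field2 \<Rightarrow> real"


subsection \<open>Domains with Lipschitz boundary\<close>

text \<open>
  After a rotation or reflection \<open>Q\<close>, the domain lies locally on one side of the graph of a
  Lipschitz function.
\<close>

definition lipschitz_boundary :: "(real^2) set \<Rightarrow> bool" where
  "lipschitz_boundary \<Omega> \<longleftrightarrow>
     (\<forall>z\<in>frontier \<Omega>. \<exists>r>0. \<exists>Q::real^2 \<Rightarrow> real^2. \<exists>h::real \<Rightarrow> real. \<exists>L.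
        orthogonal_transformation Q \<and> lipschitz_on L UNIV h \<and>
        (\<forall>y\<in>ball z r. y \<in> \<Omega> \<longleftrightarrow> h (Q y $ 1) < Q y $ 2))"

definition bounded_lipschitz_domain :: "(real^2) set \<Rightarrow> bool" where
  "bounded_lipschitz_domain \<Omega> \<longleftrightarrow>
     \<Omega> \<noteq> {} \<and> open \<Omega> \<and> connected \<Omega> \<and> bounded \<Omega> \<and> lipschitz_boundary \<Omega>"


subsection \<open>Smooth compactly supported functions\<close>

primrec Ck :: "nat \<Rightarrow> ('a::euclidean_space \<Rightarrow> 'b::euclidean_space) \<Rightarrow> bool" where
  "Ck 0 f \<longleftrightarrow> continuous_on UNIV f"
| "Ck (Suc k) f \<longleftrightarrow> (\<forall>x. f differentiable (at x)) \<and>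
     (\<forall>b\<in>Basis. Ck k (\<lambda>x. frechet_derivative f (at x) b))"

definition test_functions :: "'a::euclidean_space set \<Rightarrow> ('a \<Rightarrow> 'b::euclidean_space) set" where
  "test_functions U = {\<psi>. (\<forall>k. Ck k \<psi>) \<and>
     compact (closure {x. \<psi> x \<noteq> 0}) \<and> closure {x. \<psi> x \<noteq> 0} \<subseteq> U}"

definition partial :: "2 \<Rightarrow> (real^2 \<Rightarrow> 'b::real_normed_vector) \<Rightarrow> real^2 \<Rightarrow> 'b" where
  "partial j f x = frechet_derivative f (at x) (axis j 1)"

definition solenoidal_tests :: "(real^2) set \<Rightarrow> field2 set" where
  "solenoidal_tests \<Omega> = {\<phi>\<in>test_functions \<Omega>. \<forall>x\<in>\<Omega>. (\<Sum>i\<in>UNIV. partial i \<phi> x $ i) = 0}"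


subsection \<open>Lebesgue and Sobolev spaces\<close>

definition L2_space :: "(real^2) set \<Rightarrow> (real^2 \<Rightarrow> 'b::euclidean_space) set" where
  "L2_space \<Omega> = {u \<in> borel_measurable (lebesgue_on \<Omega>).
     integrable (lebesgue_on \<Omega>) (\<lambda>x. (norm (u x))\<^sup>2)}"

definition L2_inner ::
    "(real^2) set \<Rightarrow> (real^2 \<Rightarrow> 'b::euclidean_space) \<Rightarrow> (real^2 \<Rightarrow> 'b) \<Rightarrow> real" where
  "L2_inner \<Omega> u v = (LINT x|lebesgue_on \<Omega>. u x \<bullet> v x)"

definition L2_norm :: "(real^2) set \<Rightarrow> (real^2 \<Rightarrow> 'b::euclidean_space) \<Rightarrow> real" where
  "L2_norm \<Omega> u = sqrt (L2_inner \<Omega> u u)"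

text \<open>
  The matrix \<open>G x\<close> has entries \<open>G x $ i $ j = \<partial>\<^sub>j u\<^sub>i\<close>; the inner product and norm on
  \<^typ>\<open>real^2^2\<close> are the Frobenius ones.
\<close>

definition is_weak_grad :: "(real^2) set \<Rightarrow> field2 \<Rightarrow> (real^2 \<Rightarrow> real^2^2) \<Rightarrow> bool" where
  "is_weak_grad \<Omega> u G \<longleftrightarrow>
     (\<forall>\<psi>\<in>test_functions \<Omega>. \<forall>i j.
        (LINT x|lebesgue_on \<Omega>. u x $ i * partial j \<psi> x)
          = - (LINT x|lebesgue_on \<Omega>. G x $ i $ j * \<psi> x))"

definition H1_space :: "(real^2) set \<Rightarrow> field2 set" where
  "H1_space \<Omega> = {u \<in> L2_space \<Omega>. \<exists>G\<in>L2_space \<Omega>. is_weak_grad \<Omega> u G}"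

definition weak_grad :: "(real^2) set \<Rightarrow> field2 \<Rightarrow> real^2 \<Rightarrow> real^2^2" where
  "weak_grad \<Omega> u = (SOME G. G \<in> L2_space \<Omega> \<and> is_weak_grad \<Omega> u G)"

definition H1_seminorm :: "(real^2) set \<Rightarrow> field2 \<Rightarrow> real" where
  "H1_seminorm \<Omega> u = L2_norm \<Omega> (weak_grad \<Omega> u)"

text \<open>The weight \<open>|\<Omega>| powr (- 1 / d)\<close> for \<open>d = 2\<close>.\<close>

definition H1_norm :: "(real^2) set \<Rightarrow> field2 \<Rightarrow> real" where
  "H1_norm \<Omega> u =
     sqrt (measure lebesgue \<Omega> powr (- 1 / 2) * (L2_norm \<Omega> u)\<^sup>2 + (H1_seminorm \<Omega> u)\<^sup>2)"

definition closure_wrt :: "(field2 \<Rightarrow> real) \<Rightarrow> field2 set \<Rightarrow> field2 set \<Rightarrow> field2 set" where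
  "closure_wrt nrm X A = {u\<in>X. \<forall>e>0. \<exists>\<phi>\<in>A. nrm (u - \<phi>) < e}"

definition H10_space :: "(real^2) set \<Rightarrow> field2 set" where
  "H10_space \<Omega> = closure_wrt (H1_norm \<Omega>) (H1_space \<Omega>) (test_functions \<Omega>)"

definition H_space :: "(real^2) set \<Rightarrow> field2 set" where
  "H_space \<Omega> = closure_wrt (L2_norm \<Omega>) (L2_space \<Omega>) (solenoidal_tests \<Omega>)"

definition V_space :: "(real^2) set \<Rightarrow> field2 set" where
  "V_space \<Omega> = closure_wrt (H1_norm \<Omega>) (H10_space \<Omega>) (solenoidal_tests \<Omega>)"

definition V_inner :: "(real^2) set \<Rightarrow> field2 \<Rightarrow> field2 \<Rightarrow> real" where
  "V_inner \<Omega> u v = L2_inner \<Omega> (weak_grad \<Omega> u) (weak_grad \<Omega> v)"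

definition V_norm :: "(real^2) set \<Rightarrow> field2 \<Rightarrow> real" where
  "V_norm \<Omega> u = sqrt (V_inner \<Omega> u u)"


subsection \<open>The dual of \<open>V\<close>\<close>

text \<open>Only the values of a functional on \<open>V\<close> matter; the duality pairing is application.\<close>

definition V_dual :: "(real^2) set \<Rightarrow> functional set" where
  "V_dual \<Omega> = {F.
     (\<forall>\<phi>\<in>V_space \<Omega>. \<forall>\<psi>\<in>V_space \<Omega>. F (\<lambda>x. \<phi> x + \<psi> x) = F \<phi> + F \<psi>) \<and>
     (\<forall>c. \<forall>\<phi>\<in>V_space \<Omega>. F (\<lambda>x. c *\<^sub>R \<phi> x) = c * F \<phi>) \<and>
     (\<exists>K. \<forall>\<phi>\<in>V_space \<Omega>. \<bar>F \<phi>\<bar> \<le> K * V_norm \<Omega> \<phi>)}"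

definition V_dual_norm :: "(real^2) set \<Rightarrow> functional \<Rightarrow> real" where
  "V_dual_norm \<Omega> F = (SUP \<phi>\<in>{\<phi>\<in>V_space \<Omega>. V_norm \<Omega> \<phi> \<le> 1}. \<bar>F \<phi>\<bar>)"

definition H_to_V_dual :: "(real^2) set \<Rightarrow> field2 \<Rightarrow> functional" where
  "H_to_V_dual \<Omega> u = (\<lambda>\<phi>. L2_inner \<Omega> u \<phi>)"


subsection \<open>Spaces of vector-valued functions of time\<close>

text \<open>
  Strong measurability: almost everywhere a limit, in the norm \<open>nrm\<close> of the space \<open>X\<close>, of
  simple functions.
\<close>

definition strongly_measurable ::
    "real set \<Rightarrow> ('a \<Rightarrow> 'b::real_normed_vector) set \<Rightarrow> (('a \<Rightarrow> 'b) \<Rightarrow> real)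
      \<Rightarrow> (real \<Rightarrow> 'a \<Rightarrow> 'b) \<Rightarrow> bool" where
  "strongly_measurable I X nrm u \<longleftrightarrow>
     (\<exists>s::nat \<Rightarrow> real \<Rightarrow> 'a \<Rightarrow> 'b.
        (\<forall>n. simple_function (lebesgue_on I) (s n) \<and> s n ` I \<subseteq> X) \<and>
        (AE t in lebesgue_on I. u t \<in> X \<and> (\<lambda>n. nrm (u t - s n t)) \<longlonglongrightarrow> 0))"

definition Bochner_Lp ::
    "nat \<Rightarrow> real set \<Rightarrow> ('a \<Rightarrow> 'b::real_normed_vector) set \<Rightarrow> (('a \<Rightarrow> 'b) \<Rightarrow> real)
      \<Rightarrow> (real \<Rightarrow> 'a \<Rightarrow> 'b) set" where
  "Bochner_Lp p I X nrm = {u. strongly_measurable I X nrm u \<and>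
     integrable (lebesgue_on I) (\<lambda>t. nrm (u t) ^ p)}"

definition Bochner_Linf ::
    "real set \<Rightarrow> ('a \<Rightarrow> 'b::real_normed_vector) set \<Rightarrow> (('a \<Rightarrow> 'b) \<Rightarrow> real)
      \<Rightarrow> (real \<Rightarrow> 'a \<Rightarrow> 'b) set" where
  "Bochner_Linf I X nrm = {u. strongly_measurable I X nrm u \<and>
     (\<exists>K. AE t in lebesgue_on I. nrm (u t) \<le> K)}"

text \<open>\<open>L\<^sup>1\<^sub>l\<^sub>o\<^sub>c\<close> on the half-open interval \<open>(0, T]\<close>.\<close>

definition Bochner_L1_loc ::
    "real \<Rightarrow> ('a \<Rightarrow> 'b::real_normed_vector) set \<Rightarrow> (('a \<Rightarrow> 'b) \<Rightarrow> real)
      \<Rightarrow> (real \<Rightarrow> 'a \<Rightarrow> 'b) set" where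
  "Bochner_L1_loc T X nrm = {w. \<forall>s. 0 < s \<and> s < T \<longrightarrow> w \<in> Bochner_Lp 1 {s..T} X nrm}"

definition Cw_H :: "real \<Rightarrow> (real^2) set \<Rightarrow> (real \<Rightarrow> field2) set" where
  "Cw_H T \<Omega> = {u \<in> Bochner_Linf {0..T} (H_space \<Omega>) (L2_norm \<Omega>).
     (\<forall>t\<in>{0..T}. u t \<in> H_space \<Omega>) \<and>
     (\<forall>h\<in>H_space \<Omega>. continuous_on {0..T} (\<lambda>t. L2_inner \<Omega> (u t) h))}"

text \<open>
  The derivative in the sense of \<open>V'\<close>-valued distributions on \<open>(0, T)\<close>, tested against
  elements of \<open>V\<close>.
\<close>

definition is_time_deriv ::
    "real \<Rightarrow> (real^2) set \<Rightarrow> (real \<Rightarrow> functional) \<Rightarrow> (real \<Rightarrow> functional) \<Rightarrow> bool" where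
  "is_time_deriv T \<Omega> U w \<longleftrightarrow>
     (\<forall>\<phi>\<in>V_space \<Omega>. \<forall>\<theta>\<in>test_functions {0<..<T}.
        (LINT t|lebesgue_on {0<..<T}. U t \<phi> * deriv \<theta> t)
          = - (LINT t|lebesgue_on {0<..<T}. w t \<phi> * \<theta> t))"


subsection \<open>Weak solutions of the Navier--Stokes equations\<close>

text \<open>Here \<open>weak_grad \<Omega> v x *v u x\<close> is \<open>((u \<cdot> \<nabla>) v)(x)\<close>.\<close>

definition nse_b :: "(real^2) set \<Rightarrow> field2 \<Rightarrow> field2 \<Rightarrow> field2 \<Rightarrow> real" where
  "nse_b \<Omega> u v w = (LINT x|lebesgue_on \<Omega>. (weak_grad \<Omega> v x *v u x) \<bullet> w x)"

definition admissible_forcing :: "(real^2) set \<Rightarrow> (real \<Rightarrow> functional) \<Rightarrow> bool" where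
  "admissible_forcing \<Omega> f \<longleftrightarrow> (\<forall>t\<ge>0. f t \<in> V_dual \<Omega>) \<and>
     (\<forall>T>0. f \<in> Bochner_Lp 2 {0..T} (V_dual \<Omega>) (V_dual_norm \<Omega>))"

definition weak_solution ::
    "(real^2) set \<Rightarrow> real \<Rightarrow> (real \<Rightarrow> functional) \<Rightarrow> field2 \<Rightarrow> (real \<Rightarrow> field2) \<Rightarrow> bool" where
  "weak_solution \<Omega> \<nu> f u0 u \<longleftrightarrow>
     (\<forall>T>0. u \<in> Bochner_Lp 2 {0..T} (V_space \<Omega>) (V_norm \<Omega>) \<and> u \<in> Cw_H T \<Omega> \<and>
        (\<exists>w \<in> Bochner_L1_loc T (V_dual \<Omega>) (V_dual_norm \<Omega>).
           is_time_deriv T \<Omega> (\<lambda>t. H_to_V_dual \<Omega> (u t)) w \<and>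
           (\<forall>\<phi>\<in>V_space \<Omega>. AE t in lebesgue_on {0..T}.
              w t \<phi> + \<nu> * V_inner \<Omega> (u t) \<phi> + nse_b \<Omega> (u t) (u t) \<phi> = f t \<phi>))) \<and>
     (AE x in lebesgue_on \<Omega>. u 0 x = u0 x)"


subsection \<open>Projection operators\<close>

text \<open>\<open>W\<close> is an \<open>N\<close>-dimensional subspace of \<open>L\<^sup>2\<close>, dimension being counted modulo null sets.\<close>

definition L2_subspace_dim :: "(real^2) set \<Rightarrow> nat \<Rightarrow> field2 set \<Rightarrow> bool" where
  "L2_subspace_dim \<Omega> N W \<longleftrightarrow>
     (\<exists>e::nat \<Rightarrow> field2. (\<forall>i<N. e i \<in> L2_space \<Omega>) \<and>
        (\<forall>c::nat \<Rightarrow> real. (AE x in lebesgue_on \<Omega>. (\<Sum>i<N. c i *\<^sub>R e i x) = 0) \<longrightarrow> (\<forall>i<N. c i = 0)) \<and>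
        W = {u \<in> L2_space \<Omega>. \<exists>c::nat \<Rightarrow> real. AE x in lebesgue_on \<Omega>. u x = (\<Sum>i<N. c i *\<^sub>R e i x)})"

text \<open>The first condition says that \<open>R\<close> is well defined on almost-everywhere classes.\<close>

definition projection_operator ::
    "(real^2) set \<Rightarrow> field2 set \<Rightarrow> (field2 \<Rightarrow> field2) \<Rightarrow> bool" where
  "projection_operator \<Omega> W R \<longleftrightarrow>
     (\<forall>\<phi>\<in>V_space \<Omega>. \<forall>\<psi>\<in>V_space \<Omega>. (AE x in lebesgue_on \<Omega>. \<phi> x = \<psi> x) \<longrightarrow>
        (AE x in lebesgue_on \<Omega>. R \<phi> x = R \<psi> x)) \<and>
     (\<forall>\<phi>\<in>V_space \<Omega>. R \<phi> \<in> W) \<and>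
     (\<forall>\<phi>\<in>V_space \<Omega>. \<forall>\<psi>\<in>V_space \<Omega>.
        AE x in lebesgue_on \<Omega>. R (\<lambda>x. \<phi> x + \<psi> x) x = R \<phi> x + R \<psi> x) \<and>
     (\<forall>c. \<forall>\<phi>\<in>V_space \<Omega>. AE x in lebesgue_on \<Omega>. R (\<lambda>x. c *\<^sub>R \<phi> x) x = c *\<^sub>R R \<phi> x)"

text \<open>
  A weak solution lies in \<open>V\<close> only for almost every time, and \<open>R\<close> is defined on \<open>V\<close> only.
  The following filter describes \<open>t \<rightarrow> \<infinity>\<close> along the times at which both solutions are in \<open>V\<close>;
  it is \<^const>\<open>at_top\<close> if they are in \<open>V\<close> at all positive times.
\<close>

definition at_top_in_V ::
    "(real^2) set \<Rightarrow> (real \<Rightarrow> field2) \<Rightarrow> (real \<Rightarrow> field2) \<Rightarrow> real filter" where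
  "at_top_in_V \<Omega> u v = inf at_top (principal {t. u t \<in> V_space \<Omega> \<and> v t \<in> V_space \<Omega>})"

end

theory Submission
  imports Defs
begin

text \<open>
  The difference \<open>w = u - v\<close> satisfies
  \<open>\<bar>w\<bar>\<^sup>2' = 2 \<langle>f - g, w\<rangle> - 2 \<nu> \<parallel>w\<parallel>\<^sup>2 - 2 b(w, u, w)\<close>, and Ladyzhenskaya's inequality gives
  \<open>\<bar>b(w, u, w)\<bar> \<le> 2 \<parallel>u\<parallel> \<bar>w\<bar> \<parallel>w\<parallel>\<close>.  The approximation inequality bounds \<open>\<bar>w\<bar>\<close> by a vanishing term plus
  \<open>m \<parallel>w\<parallel>\<close> with \<open>m \<sim> N\<^sup>-\<^sup>\<gamma>\<close>, so half of the dissipation controls \<open>\<nu> \<bar>w\<bar>\<^sup>2 / (2 m\<^sup>2)\<close>.  Hence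
  \<open>\<bar>w\<bar>\<^sup>2' \<le> \<beta> - \<alpha> \<bar>w\<bar>\<^sup>2\<close> with \<open>\<beta> \<rightarrow> 0\<close> and \<open>\<alpha> = \<nu> / (2 m\<^sup>2) - 8 \<parallel>u\<parallel>\<^sup>2 / \<nu>\<close>.  The energy balance of \<open>u\<close>
  bounds the integral of \<open>\<parallel>u\<parallel>\<^sup>2\<close> over windows of length \<open>P\<^sup>2 / \<nu>\<close>, \<open>P\<close> being the Poincare constant,
  by a multiple of \<open>F\<^sup>2 P\<^sup>2 / \<nu>\<^sup>3\<close>; for large \<open>N\<close> the integral of \<open>\<alpha>\<close> over such windows is bounded below
  by a positive constant, and Gronwall's inequality yields \<open>\<bar>w\<bar> \<rightarrow> 0\<close>.

  The energy balance is not part of the definition of a weak solution.  It follows from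
  \<open>\<bar>u(t + h)\<bar>\<^sup>2 - \<bar>u(t)\<bar>\<^sup>2 = \<langle>u(t + h) - u(t), u(t + h) + u(t)\<rangle>\<close>: the first factor is the integral of
  the derivative over \<open>[t, t + h]\<close>, the second one is close to \<open>2 u\<close> in \<open>L\<^sup>2(0, T; V)\<close>, and one
  integrates over \<open>t\<close>, divides by \<open>h\<close> and passes to Lebesgue points.
\<close>

subsection \<open>Smooth functions with compact support\<close>

text \<open>A weak solution comes with a time derivative that is merely locally integrable in the
  dual of V, too little to pair it with \<open>u\<close>, and is itself only weakly continuous in H.
  The planar bound |b(u, u, \<phi>)| \<le> 2 |u| ||u|| ||\<phi>|| and boundedness in H show that the
  right-hand side of the equation is square integrable in the dual of V. Closeness of u(t + h) +
  u(t) to 2 u comes from a Lusin-type property of strongly measurable functions, which takes the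
  place of mollification in time. The difference of two solutions solves another equation, so the
  energy balance is proved for an abstract evolution and used for \<open>u\<close> and for the
  difference. Only the gradient of \<open>u\<close> survives in the nonlinear term of the
  difference, so only the forcing of \<open>u\<close> enters the threshold. The window P^2 / \<nu>
  is the relaxation time of the energy, over which its homogeneous part decays by exp (- 1). P^2
  then occurs on both sides of the comparison and cancels; what remains is a bound on m F / \<nu>^2,
  and the 9 in the constant is the least integer whose square exceeds the 80 that the estimates
  produce.\<close>

lemma Ck_SucI:
  assumes "\<And>x. (f has_derivative D x) (at x)" and "\<And>b. b \<in> Basis \<Longrightarrow> Ck k (\<lambda>x. D x b)"
  shows "Ck (Suc k) f"
proof -
  have "frechet_derivative f (at x) = D x" for x
    using frechet_derivative_at[OF assms(1)] by metis
  then show ?thesis using assms by (auto simp: differentiable_def)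
qed

lemma Ck_Suc_derivative:
  "Ck (Suc k) f \<Longrightarrow> (f has_derivative frechet_derivative f (at x)) (at x)"
  by (simp add: frechet_derivative_works)

lemma Ck_SucD: "Ck (Suc k) f \<Longrightarrow> Ck k f"
proof (induction k arbitrary: f)
  case 0
  then show ?case
    by (simp add: continuous_on_eq_continuous_at differentiable_imp_continuous_within)
qed auto

lemma Ck_continuous: "Ck k f \<Longrightarrow> continuous_on UNIV f"
  by (cases k) (auto simp: continuous_on_eq_continuous_at differentiable_imp_continuous_within)

lemma Ck_const [simp]: "Ck k (\<lambda>x. c)"
proof (induction k arbitrary: c)
  case (Suc k)
  then show ?case by (intro Ck_SucI[where D="\<lambda>x h. 0"]) auto
qed simp

lemma Ck_add: "Ck k f \<Longrightarrow> Ck k g \<Longrightarrow> Ck k (\<lambda>x. f x + g x)"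
proof (induction k arbitrary: f g)
  case 0
  then show ?case by (simp add: continuous_intros)
next
  case (Suc k)
  show ?case
    by (rule Ck_SucI[OF has_derivative_add[OF Ck_Suc_derivative Ck_Suc_derivative]])
      (use Suc in auto)
qed

text \<open>By the Leibniz rule each directional derivative is a sum of two such products whose
  factors are again of class \<open>Ck k\<close>, so the induction runs over all pairs at once;
  scaling and multiplication are then instances.\<close>

lemma Ck_bilinear:
  assumes "bounded_bilinear B"
  shows "Ck k f \<Longrightarrow> Ck k g \<Longrightarrow> Ck k (\<lambda>x. B (f x) (g x))"
proof (induction k arbitrary: f g)
  case 0
  then show ?case by (simp add: bounded_bilinear.continuous_on[OF assms])
next
  case (Suc k)
  have "Ck k (\<lambda>x. B (f x) (frechet_derivative g (at x) b) + B (frechet_derivative f (at x) b) (g x))"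
    if "b \<in> Basis" for b
    by (intro Ck_add Suc.IH Ck_SucD[OF Suc.prems(1)] Ck_SucD[OF Suc.prems(2)])
      (use Suc.prems that in auto)
  then show ?case
    by (rule Ck_SucI[OF bounded_bilinear.FDERIV[OF assms Ck_Suc_derivative[OF Suc.prems(1)]
            Ck_Suc_derivative[OF Suc.prems(2)]]])
qed

lemmas Ck_scaleR = Ck_bilinear[OF bounded_bilinear_scaleR]
lemmas Ck_mult = Ck_bilinear[OF bounded_bilinear_mult[where 'a=real]]

lemma Ck_prod:
  fixes f :: "'i \<Rightarrow> 'a::euclidean_space \<Rightarrow> real"
  shows "(\<And>i. i \<in> I \<Longrightarrow> Ck k (f i)) \<Longrightarrow> Ck k (\<lambda>x. \<Prod>i\<in>I. f i x)"
  by (induction I rule: infinite_finite_induct) (auto intro!: Ck_mult)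

text \<open>Affine inner maps keep the chain rule inside the induction: each directional derivative
  is a constant times the derivative of \<open>f\<close> along the same affine map.\<close>

lemma Ck_compose_affine:
  fixes f :: "real \<Rightarrow> real" and e :: "'a::euclidean_space"
  shows "Ck k f \<Longrightarrow> Ck k (\<lambda>x. f (c * (x \<bullet> e) + d))"
proof (induction k arbitrary: f)
  case 0
  then have "continuous_on UNIV f" by simp
  then show ?case
    by (auto intro!: continuous_on_compose2[of UNIV f] continuous_intros)
next
  case (Suc k)
  let ?l = "\<lambda>x. c * (x \<bullet> e) + d"
  have l: "(?l has_derivative (\<lambda>h. c * (h \<bullet> e))) (at x)" for x
    by (auto intro!: derivative_eq_intros)
  have D: "((\<lambda>x. f (?l x)) has_derivative (\<lambda>h. frechet_derivative f (at (?l x)) (c * (h \<bullet> e)))) (at x)" for x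
    using has_derivative_compose[OF l Ck_Suc_derivative[OF Suc.prems]] by simp
  have lin: "frechet_derivative f (at y) r = r * frechet_derivative f (at y) 1" for y r
  proof -
    have "linear (frechet_derivative f (at y))"
      by (rule has_derivative_linear[OF Ck_Suc_derivative[OF Suc.prems]])
    from linear_scale[OF this, of r 1] show ?thesis by simp
  qed
  show ?case
    by (rule Ck_SucI[OF D]) (subst lin, intro Ck_mult Ck_const Suc.IH, use Suc.prems in auto)
qed

section \<open>Bump functions built from exp (- 1 / x)\<close>

definition flat :: "nat \<Rightarrow> real \<Rightarrow> real" where
  "flat n x = (if x > 0 then exp (- inverse x) * inverse x ^ n else 0)"

lemma flat_nonneg: "0 \<le> flat n x"
  by (simp add: flat_def)

lemma flat_0_le_1: "flat 0 x \<le> 1"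
  by (simp add: flat_def)

text \<open>With y = 1 / x this is y ^ (n + 2) / fact (n + 2) \<le> exp y, a single term of the
  exponential series. The quadratic decay is what makes the difference quotient at 0 vanish.\<close>

lemma flat_le_square: "flat n x \<le> fact (n + 2) * x\<^sup>2"
proof (cases "x > 0")
  case True
  define y where "y = inverse x"
  have y: "y > 0" using True by (simp add: y_def)
  have "y ^ (n + 2) / fact (n + 2) \<le> exp y"
    using y sum_le_suminf[OF summable_exp_generic[of y], of "{n + 2}"]
    by (simp add: exp_def divide_inverse_commute del: fact_Suc inverse_eq_divide)
  then have "exp (- y) * y ^ (n + 2) \<le> fact (n + 2)"
    by (simp add: exp_minus field_simps del: fact_Suc)
  then have "exp (- y) * y ^ (n + 2) * x\<^sup>2 \<le> fact (n + 2) * x\<^sup>2"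
    by (rule mult_right_mono) simp
  moreover have "y ^ (n + 2) * x\<^sup>2 = y ^ n"
    using True by (simp add: y_def power_add power2_eq_square field_simps)
  ultimately have "exp (- y) * y ^ n \<le> fact (n + 2) * x\<^sup>2"
    by (simp only: mult.assoc)
  then show ?thesis
    using True by (simp add: flat_def y_def del: fact_Suc)
qed (auto simp: flat_def)

text \<open>The powers of 1 / x are carried along so that the family is closed under
  differentiation: the derivative combines two further members, and smoothness follows by induction
  over all \<open>n\<close> together.\<close>

lemma flat_derivative:
  "(flat n has_real_derivative (flat (n + 2) x - n * flat (n + 1) x)) (at x)"
proof -
  consider "x > 0" | "x < 0" | "x = 0" by linarith
  then show ?thesis
  proof cases
    case 1
    have "((\<lambda>x. exp (- inverse x) * inverse x ^ n) has_real_derivative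
        (flat (n + 2) x - n * flat (n + 1) x)) (at x)"
    proof (cases n)
      case 0
      then show ?thesis using 1
        by (auto intro!: derivative_eq_intros simp: flat_def power2_eq_square)
    next
      case (Suc m)
      then show ?thesis using 1
        by (intro DERIV_cong[OF DERIV_mult[OF DERIV_fun_exp[OF DERIV_minus[OF DERIV_inverse]]
                DERIV_power[OF DERIV_inverse]]])
          (auto simp: flat_def power2_eq_square algebra_simps)
    qed
    then show ?thesis
      by (rule has_field_derivative_transform_within_open[where S="{0<..}"])
        (use 1 in \<open>auto simp: flat_def\<close>)
  next
    case 2
    have "((\<lambda>x. 0) has_real_derivative (flat (n + 2) x - n * flat (n + 1) x)) (at x)"
      using 2 by (simp add: flat_def)
    then show ?thesis
      by (rule has_field_derivative_transform_within_open[where S="{..<0}"])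
        (use 2 in \<open>auto simp: flat_def\<close>)
  next
    case 3
    have "((\<lambda>h. flat n h / h) \<longlongrightarrow> 0) (at 0)"
    proof (rule Lim_null_comparison)
      show "\<forall>\<^sub>F h in at 0. norm (flat n h / h) \<le> fact (n + 2) * \<bar>h\<bar>"
        using flat_le_square[of n] flat_nonneg[of n]
        by (intro always_eventually allI)
          (auto simp: abs_mult abs_mult_self_eq power2_eq_square divide_simps mult.assoc simp del: fact_Suc)
      show "((\<lambda>h. fact (n + 2) * \<bar>h\<bar>) \<longlongrightarrow> 0) (at (0::real))"
        by (auto intro!: tendsto_eq_intros)
    qed
    then show ?thesis using 3
      by (simp add: has_field_derivative_iff flat_def)
  qed
qed

lemma Ck_flat: "Ck k (flat n)"
proof (induction k arbitrary: n)
  case 0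
  then show ?case
    using DERIV_isCont[OF flat_derivative] by (auto simp: continuous_on_eq_continuous_at)
next
  case (Suc k)
  show ?case
  proof (rule Ck_SucI[OF flat_derivative[unfolded has_field_derivative_def]])
    have "Ck k (\<lambda>x. (flat (n + 2) x + (- real n) * flat (n + 1) x) * c)" for c
      by (intro Ck_add Ck_mult Ck_const Suc.IH)
    then show "Ck k (\<lambda>x. (flat (n + 2) x - real n * flat (n + 1) x) * b)" for b
      by simp
  qed
qed

text \<open>A smooth approximation from below to the indicator of the open box: as \<open>s\<close>
  grows, each factor exp (- 1 / (s r)) tends to 1 at interior points, while the function stays 0
  outside of the box.\<close>

definition box_bump :: "real \<Rightarrow> 'a::euclidean_space \<Rightarrow> 'a \<Rightarrow> 'a \<Rightarrow> real" where
  "box_bump s a b x = (\<Prod>i\<in>Basis. flat 0 (s * (x \<bullet> i - a \<bullet> i)) * flat 0 (s * (b \<bullet> i - x \<bullet> i)))"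

lemma Ck_box_bump: "Ck k (box_bump s a b)"
proof -
  have "Ck k (\<lambda>x. flat 0 (s * (x \<bullet> i) + - (s * (a \<bullet> i))) * flat 0 ((- s) * (x \<bullet> i) + s * (b \<bullet> i)))" for i
    by (intro Ck_mult Ck_compose_affine Ck_flat)
  then have "Ck k (\<lambda>x. flat 0 (s * (x \<bullet> i - a \<bullet> i)) * flat 0 (s * (b \<bullet> i - x \<bullet> i)))" for i
    by (simp add: algebra_simps)
  then show ?thesis
    unfolding box_bump_def by (intro Ck_prod)
qed

lemma box_bump_bounds: "0 \<le> box_bump s a b x" "box_bump s a b x \<le> 1"
  unfolding box_bump_def
  by (auto intro!: prod_nonneg prod_le_1 mult_nonneg_nonneg mult_le_one flat_nonneg flat_0_le_1)

lemma box_bump_eq_0: "s > 0 \<Longrightarrow> x \<notin> box a b \<Longrightarrow> box_bump s a b x = 0"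
  by (force simp: box_bump_def mem_box flat_def zero_less_mult_iff)

lemma box_bump_pos: "s > 0 \<Longrightarrow> x \<in> box a b \<Longrightarrow> 0 < box_bump s a b x"
  by (auto simp: box_bump_def mem_box flat_def zero_less_mult_iff intro!: prod_pos)

lemma box_bump_test:
  assumes "s > 0" "cbox a b \<subseteq> U"
  shows "box_bump s a b \<in> test_functions U"
proof -
  have "{x. box_bump s a b x \<noteq> 0} \<subseteq> cbox a b"
    using box_bump_eq_0[OF assms(1)] box_subset_cbox by blast
  then have "closure {x. box_bump s a b x \<noteq> 0} \<subseteq> cbox a b"
    by (simp add: closure_minimal closed_cbox)
  then show ?thesis
    using assms(2) Ck_box_bump
    by (auto simp: test_functions_def compact_eq_bounded_closed intro: bounded_subset[of "cbox a b"])
qed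

lemma box_bump_tendsto: "(\<lambda>n. box_bump (real (Suc n)) a b x) \<longlonglongrightarrow> indicator (box a b) x"
proof (cases "x \<in> box a b")
  case True
  have fl: "(\<lambda>n. flat 0 (real (Suc n) * r)) \<longlonglongrightarrow> 1" if "r > 0" for r
  proof -
    have "(\<lambda>n. exp (- (inverse (real (Suc n)) * inverse r))) \<longlonglongrightarrow> exp (- (0 * inverse r))"
      by (intro tendsto_intros LIMSEQ_inverse_real_of_nat)
    then show ?thesis using that by (simp add: flat_def del: of_nat_Suc)
  qed
  have "(\<lambda>n. box_bump (real (Suc n)) a b x) \<longlonglongrightarrow> (\<Prod>i\<in>(Basis::'a set). 1 * 1)"
    unfolding box_bump_def
    by (intro tendsto_prod tendsto_mult fl) (use True in \<open>auto simp: mem_box\<close>)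
  then show ?thesis using True by simp
qed (simp add: box_bump_eq_0 del: of_nat_Suc)

text \<open>Testing with box bumps and dominated convergence makes the integral over every closed
  box inside \<open>U\<close> vanish; the Lebesgue differentiation theorem then recovers the value
  of \<open>g\<close> at almost every point.\<close>

lemma fundamental_lemma:
  fixes g :: "'a::euclidean_space \<Rightarrow> real"
  assumes U: "open U" and g: "integrable (lebesgue_on U) g"
    and 0: "\<And>\<psi>. \<psi> \<in> test_functions U \<Longrightarrow> (LINT x|lebesgue_on U. g x * \<psi> x) = 0"
  shows "AE x in lebesgue_on U. g x = 0"
proof -
  have Um: "U \<in> sets lebesgue" using U by simp
  define G where "G x = indicator U x * g x" for x
  have G: "integrable lebesgue G"
    using g Um unfolding G_def by (subst (asm) integrable_restrict_space) auto
  have box0: "integral (cbox a b) G = 0" if ab: "cbox a b \<subseteq> U" for a b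
  proof -
    have "(\<lambda>n. LINT x|lebesgue_on U. g x * box_bump (real (Suc n)) a b x) \<longlonglongrightarrow>
        (LINT x|lebesgue_on U. g x * indicator (box a b) x)"
    proof (rule integral_dominated_convergence[where w="\<lambda>x. \<bar>g x\<bar>"])
      have "box_bump s a b \<in> borel_measurable (lebesgue_on U)" for s
        by (rule continuous_imp_measurable_on_sets_lebesgue[OF _ Um])
          (rule continuous_on_subset[OF Ck_continuous[OF Ck_box_bump[of 0]]], simp)
      then show "(\<lambda>x. g x * box_bump (real (Suc n)) a b x) \<in> borel_measurable (lebesgue_on U)" for n
        using g by (intro borel_measurable_times) auto
      have "indicator (box a b) \<in> borel_measurable (lebesgue_on U)"
        by (intro borel_measurable_indicator) (use ab Um in \<open>auto simp: sets_restrict_space_iff box_subset_cbox[THEN subset_trans]\<close>)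
      then show "(\<lambda>x. g x * indicator (box a b) x) \<in> borel_measurable (lebesgue_on U)"
        using g by (intro borel_measurable_times) auto
      show "integrable (lebesgue_on U) (\<lambda>x. \<bar>g x\<bar>)" using g by simp
      show "AE x in lebesgue_on U. (\<lambda>n. g x * box_bump (real (Suc n)) a b x) \<longlonglongrightarrow> g x * indicator (box a b) x"
        by (intro AE_I2 tendsto_mult tendsto_const box_bump_tendsto)
      show "AE x in lebesgue_on U. norm (g x * box_bump (real (Suc n)) a b x) \<le> \<bar>g x\<bar>" for n
        using box_bump_bounds[of "real (Suc n)" a b]
        by (auto simp: abs_mult mult_left_le)
    qed
    moreover have "(LINT x|lebesgue_on U. g x * box_bump (real (Suc n)) a b x) = 0" for n
      by (intro 0 box_bump_test ab) simp
    ultimately have "(LINT x|lebesgue_on U. g x * indicator (box a b) x) = 0"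
      by (simp add: LIMSEQ_const_iff)
    then have "(LINT x|lebesgue. indicator U x *\<^sub>R (g x * indicator (box a b) x)) = 0"
      using Um by (subst (asm) integral_restrict_space) auto
    then have "(LINT x|lebesgue_on (box a b). G x) = 0"
      by (subst integral_restrict_space) (auto simp: G_def mult_ac)
    moreover have "integrable (lebesgue_on (box a b)) G"
      using integrable_mult_indicator[OF _ G, of "box a b"] by (simp add: integrable_restrict_space)
    ultimately show ?thesis
      using lebesgue_integral_eq_integral[of "box a b" G] integral_open_interval[of a b G] by simp
  qed
  \<comment> \<open>The differentiation theorem is used for cubes that have \<open>x\<close> as
    their lower corner.\<close>
  have "G integrable_on cbox a b" for a b
    using G integrable_on_lebesgue integrable_on_subcbox by blast
  then obtain N where N: "negligible N" "\<And>x e. x \<notin> N \<Longrightarrow> 0 < e \<Longrightarrow> \<exists>d>0. \<forall>h. 0 < h \<and> h < d \<longrightarrow>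
       norm (integral (cbox x (x + h *\<^sub>R One)) G /\<^sub>R h ^ DIM('a) - G x) < e"
    using integrable_ccontinuous_explicit[of G] by metis
  have "g x = 0" if x: "x \<in> U" "x \<notin> N" for x
  proof (rule ccontr)
    assume "g x \<noteq> 0"
    then obtain d where d: "d > 0" "\<And>h. 0 < h \<Longrightarrow> h < d \<Longrightarrow>
        norm (integral (cbox x (x + h *\<^sub>R One)) G /\<^sub>R h ^ DIM('a) - G x) < \<bar>g x\<bar>"
      using N(2)[OF x(2), of "\<bar>g x\<bar>"] by auto
    obtain r where r: "r > 0" "cball x r \<subseteq> U"
      using U x(1) open_contains_cball by blast
    \<comment> \<open>In the l1 norm a cube of side \<open>h\<close> stays within
      \<open>h * DIM('a)\<close> of its corner; the second bound keeps it in the ball inside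
      \<open>U\<close>.\<close>
    define h where "h = min (d/2) (r / DIM('a))"
    have h: "0 < h" "h < d" "h * DIM('a) \<le> r"
      using d(1) r(1) by (auto simp: h_def min_def field_simps)
    have "cbox x (x + h *\<^sub>R One) \<subseteq> cball x r"
    proof
      fix y assume y: "y \<in> cbox x (x + h *\<^sub>R One)"
      have "norm (y - x) \<le> (\<Sum>i\<in>Basis. \<bar>(y - x) \<bullet> i\<bar>)" by (rule norm_le_l1)
      also have "\<dots> \<le> (\<Sum>i\<in>(Basis::'a set). h)"
        using y by (intro sum_mono) (auto simp: mem_box inner_diff_left inner_add_left)
      also have "\<dots> \<le> r" using h by (simp add: mult.commute)
      finally show "y \<in> cball x r" by (simp add: dist_norm norm_minus_commute)
    qed
    then have "integral (cbox x (x + h *\<^sub>R One)) G = 0" using r by (intro box0) auto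
    with d(2)[OF h(1,2)] x show False by (simp add: G_def)
  qed
  moreover have "AE x in lebesgue. x \<notin> N"
    using N(1) by (simp add: negligible_iff_null_sets AE_not_in)
  ultimately have "AE x in lebesgue. x \<in> U \<longrightarrow> g x = 0" by auto
  then show ?thesis using Um by (subst AE_restrict_space_iff) auto
qed

subsection \<open>Cauchy--Schwarz\<close>

text \<open>The best choice is s = sqrt (B / A). Adding a small \<open>d\<close> to both numbers
  keeps the quotient defined and positive when one of them is 0, and letting \<open>d\<close> tend
  to 0 gives the claim.\<close>

lemma le_sqrt_mult_sqrtI:
  fixes X A B :: real
  assumes "0 \<le> A" "0 \<le> B" and le: "\<And>s. s > 0 \<Longrightarrow> 2 * X \<le> s * A + B / s"
  shows "X \<le> sqrt A * sqrt B"
proof (rule field_le_epsilon)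
  fix e :: real assume e: "e > 0"
  have "(\<lambda>d. sqrt (A + d) * sqrt (B + d)) \<midarrow>0\<rightarrow> sqrt (A + 0) * sqrt (B + 0)"
    by (intro tendsto_intros)
  then have "\<forall>\<^sub>F d in at_right 0. sqrt (A + d) * sqrt (B + d) < sqrt A * sqrt B + e"
    using e by (intro order_tendstoD(2)[where y="sqrt A * sqrt B"]) (auto simp: filterlim_at_split)
  then have "\<forall>\<^sub>F d in at_right 0. 0 < d \<and> sqrt (A + d) * sqrt (B + d) < sqrt A * sqrt B + e"
    by (intro eventually_conj eventually_at_right_less)
  then obtain d where d: "d > 0" "sqrt (A + d) * sqrt (B + d) < sqrt A * sqrt B + e"
    using eventually_happens trivial_limit_at_right_real by blast
  define a b where "a = sqrt (A + d)" and "b = sqrt (B + d)"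
  have ab: "a > 0" "b > 0" "a\<^sup>2 = A + d" "b\<^sup>2 = B + d"
    using assms d(1) by (auto simp: a_def b_def)
  have "2 * X \<le> b / a * A + B / (b / a)" using ab by (intro le) auto
  also have "\<dots> \<le> b / a * a\<^sup>2 + b\<^sup>2 / (b / a)"
    using ab d(1) by (intro add_mono mult_left_mono divide_right_mono) auto
  also have "\<dots> = 2 * (a * b)" using ab(1,2) by (simp add: power2_eq_square)
  finally show "X \<le> sqrt A * sqrt B + e" using d(2) by (simp add: a_def b_def)
qed

text \<open>Integrates 2 |f g| \<le> s f^2 + g^2 / s and optimises in \<open>s\<close>; the case s =
  1 already gives integrability of the product.\<close>

lemma cauchy_schwarz_integral:
  fixes f g :: "'a \<Rightarrow> real"
  assumes [measurable]: "f \<in> borel_measurable M" "g \<in> borel_measurable M"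
    and f: "integrable M (\<lambda>x. (f x)\<^sup>2)" and g: "integrable M (\<lambda>x. (g x)\<^sup>2)"
  shows "integrable M (\<lambda>x. f x * g x)"
    and "(LINT x|M. \<bar>f x * g x\<bar>) \<le> sqrt (LINT x|M. (f x)\<^sup>2) * sqrt (LINT x|M. (g x)\<^sup>2)"
proof -
  have amgm: "2 * \<bar>f x * g x\<bar> \<le> s * (f x)\<^sup>2 + (g x)\<^sup>2 / s" if "s > 0" for s x
  proof -
    have "0 \<le> (s * \<bar>f x\<bar> - \<bar>g x\<bar>)\<^sup>2" by simp
    then show ?thesis using that
      by (simp add: power2_diff abs_mult divide_simps power_mult_distrib) (simp add: power2_eq_square algebra_simps)
  qed
  have dom: "integrable M (\<lambda>x. (f x)\<^sup>2 + (g x)\<^sup>2)" using f g by simp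
  show int: "integrable M (\<lambda>x. f x * g x)"
  proof (rule Bochner_Integration.integrable_bound[OF dom])
    show "AE x in M. norm (f x * g x) \<le> norm ((f x)\<^sup>2 + (g x)\<^sup>2)"
      using amgm[of 1] by (intro AE_I2) (smt (verit) div_by_1 mult_1 real_norm_def zero_le_power2)
  qed simp
  show "(LINT x|M. \<bar>f x * g x\<bar>) \<le> sqrt (LINT x|M. (f x)\<^sup>2) * sqrt (LINT x|M. (g x)\<^sup>2)"
  proof (rule le_sqrt_mult_sqrtI)
    fix s :: real assume s: "s > 0"
    have "2 * (LINT x|M. \<bar>f x * g x\<bar>) = (LINT x|M. 2 * \<bar>f x * g x\<bar>)" by simp
    also have "\<dots> \<le> (LINT x|M. s * (f x)\<^sup>2 + (g x)\<^sup>2 / s)"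
      using int f g amgm[OF s] by (intro integral_mono) auto
    also have "\<dots> = s * (LINT x|M. (f x)\<^sup>2) + (LINT x|M. (g x)\<^sup>2) / s"
      using f g by simp
    finally show "2 * (LINT x|M. \<bar>f x * g x\<bar>) \<le> s * (LINT x|M. (f x)\<^sup>2) + (LINT x|M. (g x)\<^sup>2) / s" .
  qed auto
qed

subsection \<open>The space \<open>L\<^sup>2\<close>\<close>

lemma L2_spaceD:
  assumes "u \<in> L2_space \<Omega>"
  shows "u \<in> borel_measurable (lebesgue_on \<Omega>)" "integrable (lebesgue_on \<Omega>) (\<lambda>x. (norm (u x))\<^sup>2)"
  using assms by (auto simp: L2_space_def)

lemma L2_norm_mult:
  assumes "u \<in> L2_space \<Omega>" "v \<in> L2_space \<Omega>"
  shows "integrable (lebesgue_on \<Omega>) (\<lambda>x. norm (u x) * norm (v x))"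
    and "(LINT x|lebesgue_on \<Omega>. norm (u x) * norm (v x)) \<le> L2_norm \<Omega> u * L2_norm \<Omega> v"
  using cauchy_schwarz_integral[of "\<lambda>x. norm (u x)" "lebesgue_on \<Omega>" "\<lambda>x. norm (v x)"]
    L2_spaceD[OF assms(1)] L2_spaceD[OF assms(2)]
  by (auto simp: L2_norm_def L2_inner_def power2_norm_eq_inner)

lemma L2_space_bound:
  assumes "v \<in> L2_space \<Omega>" "u \<in> borel_measurable (lebesgue_on \<Omega>)"
    "AE x in lebesgue_on \<Omega>. norm (u x) \<le> c * norm (v x)"
  shows "u \<in> L2_space \<Omega>"
proof -
  have "integrable (lebesgue_on \<Omega>) (\<lambda>x. (norm (u x))\<^sup>2)"
  proof (rule Bochner_Integration.integrable_bound)
    show "integrable (lebesgue_on \<Omega>) (\<lambda>x. c\<^sup>2 * (norm (v x))\<^sup>2)" using L2_spaceD[OF assms(1)] by simp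
    show "AE x in lebesgue_on \<Omega>. norm ((norm (u x))\<^sup>2) \<le> norm (c\<^sup>2 * (norm (v x))\<^sup>2)"
      using assms(3) by eventually_elim (simp flip: power_mult_distrib add: power_mono)
  qed (use assms in simp)
  then show ?thesis using assms by (simp add: L2_space_def)
qed

lemma L2_scaleR: "u \<in> L2_space \<Omega> \<Longrightarrow> (\<lambda>x. c *\<^sub>R u x) \<in> L2_space \<Omega>"
  by (rule L2_space_bound[where c="\<bar>c\<bar>"]) (auto dest: L2_spaceD)

lemma L2_add:
  assumes "u \<in> L2_space \<Omega>" "v \<in> L2_space \<Omega>"
  shows "(\<lambda>x. u x + v x) \<in> L2_space \<Omega>"
proof -
  have "integrable (lebesgue_on \<Omega>) (\<lambda>x. (norm (u x + v x))\<^sup>2)"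
  proof (rule Bochner_Integration.integrable_bound)
    show "integrable (lebesgue_on \<Omega>) (\<lambda>x. 2 * (norm (u x))\<^sup>2 + 2 * (norm (v x))\<^sup>2)"
      using L2_spaceD(2)[OF assms(1)] L2_spaceD(2)[OF assms(2)] by simp
    have "(norm (u x + v x))\<^sup>2 \<le> 2 * (norm (u x))\<^sup>2 + 2 * (norm (v x))\<^sup>2" for x
    proof -
      have "(norm (u x + v x))\<^sup>2 \<le> (norm (u x) + norm (v x))\<^sup>2"
        by (intro power_mono norm_triangle_ineq) simp
      then show ?thesis
        using sum_squares_bound[of "norm (u x)" "norm (v x)"] by (simp add: power2_sum)
    qed
    then show "AE x in lebesgue_on \<Omega>. norm ((norm (u x + v x))\<^sup>2) \<le> norm (2 * (norm (u x))\<^sup>2 + 2 * (norm (v x))\<^sup>2)"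
      by (intro AE_I2) (smt (verit) real_norm_def zero_le_power2)
  qed (use L2_spaceD(1)[OF assms(1)] L2_spaceD(1)[OF assms(2)] in simp)
  then show ?thesis using L2_spaceD(1)[OF assms(1)] L2_spaceD(1)[OF assms(2)] by (simp add: L2_space_def)
qed

lemma L2_uminus: "u \<in> L2_space \<Omega> \<Longrightarrow> (\<lambda>x. - u x) \<in> L2_space \<Omega>"
  using L2_scaleR[of u \<Omega> "-1"] by simp

lemma L2_diff: "u \<in> L2_space \<Omega> \<Longrightarrow> v \<in> L2_space \<Omega> \<Longrightarrow> (\<lambda>x. u x - v x) \<in> L2_space \<Omega>"
  using L2_add[OF _ L2_uminus] by fastforce

lemma L2_inner_integrable:
  assumes "u \<in> L2_space \<Omega>" "v \<in> L2_space \<Omega>"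
  shows "integrable (lebesgue_on \<Omega>) (\<lambda>x. u x \<bullet> v x)"
  by (rule Bochner_Integration.integrable_bound[OF L2_norm_mult(1)[OF assms]])
    (use L2_spaceD(1)[OF assms(1)] L2_spaceD(1)[OF assms(2)] in
      \<open>auto simp: Cauchy_Schwarz_ineq2\<close>)

lemma L2_inner_add_left:
  "u \<in> L2_space \<Omega> \<Longrightarrow> v \<in> L2_space \<Omega> \<Longrightarrow> w \<in> L2_space \<Omega> \<Longrightarrow>
    L2_inner \<Omega> (\<lambda>x. u x + v x) w = L2_inner \<Omega> u w + L2_inner \<Omega> v w"
  by (simp add: L2_inner_def inner_add_left L2_inner_integrable)

lemma L2_inner_scaleR_left: "L2_inner \<Omega> (\<lambda>x. c *\<^sub>R u x) w = c * L2_inner \<Omega> u w"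
  by (simp add: L2_inner_def)

lemma L2_inner_commute: "L2_inner \<Omega> u v = L2_inner \<Omega> v u"
  by (simp add: L2_inner_def inner_commute)

lemma L2_inner_add_right:
  "u \<in> L2_space \<Omega> \<Longrightarrow> v \<in> L2_space \<Omega> \<Longrightarrow> w \<in> L2_space \<Omega> \<Longrightarrow>
    L2_inner \<Omega> w (\<lambda>x. u x + v x) = L2_inner \<Omega> w u + L2_inner \<Omega> w v"
  by (simp add: L2_inner_def inner_add_right L2_inner_integrable)

lemma L2_inner_diff_left:
  "u \<in> L2_space \<Omega> \<Longrightarrow> v \<in> L2_space \<Omega> \<Longrightarrow> w \<in> L2_space \<Omega> \<Longrightarrow>
    L2_inner \<Omega> (\<lambda>x. u x - v x) w = L2_inner \<Omega> u w - L2_inner \<Omega> v w"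
  by (simp add: L2_inner_def inner_diff_left L2_inner_integrable)

lemma L2_inner_scaleR_right: "L2_inner \<Omega> w (\<lambda>x. c *\<^sub>R u x) = c * L2_inner \<Omega> w u"
  by (simp add: L2_inner_def)

lemma L2_inner_self_nonneg: "0 \<le> L2_inner \<Omega> u u"
  by (simp add: L2_inner_def)

lemma L2_norm_nonneg: "0 \<le> L2_norm \<Omega> u"
  by (simp add: L2_norm_def L2_inner_self_nonneg)

lemma L2_norm_squared: "(L2_norm \<Omega> u)\<^sup>2 = L2_inner \<Omega> u u"
  by (simp add: L2_norm_def L2_inner_self_nonneg)

lemma L2_inner_bound:
  assumes "u \<in> L2_space \<Omega>" "v \<in> L2_space \<Omega>"
  shows "\<bar>L2_inner \<Omega> u v\<bar> \<le> L2_norm \<Omega> u * L2_norm \<Omega> v"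
proof -
  have "\<bar>L2_inner \<Omega> u v\<bar> \<le> (LINT x|lebesgue_on \<Omega>. norm (u x) * norm (v x))"
    unfolding L2_inner_def
    by (rule order_trans[OF integral_abs_bound integral_mono[OF _ L2_norm_mult(1)[OF assms]]])
      (use L2_inner_integrable[OF assms] in \<open>auto simp: Cauchy_Schwarz_ineq2\<close>)
  with L2_norm_mult(2)[OF assms] show ?thesis by simp
qed

lemma L2_norm_scaleR: "L2_norm \<Omega> (\<lambda>x. c *\<^sub>R u x) = \<bar>c\<bar> * L2_norm \<Omega> u"
  by (simp add: L2_norm_def L2_inner_scaleR_left L2_inner_scaleR_right real_sqrt_mult)

lemma L2_norm_add:
  assumes "u \<in> L2_space \<Omega>" "v \<in> L2_space \<Omega>"
  shows "L2_norm \<Omega> (\<lambda>x. u x + v x) \<le> L2_norm \<Omega> u + L2_norm \<Omega> v"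
proof (rule power2_le_imp_le)
  have "(L2_norm \<Omega> (\<lambda>x. u x + v x))\<^sup>2 = (L2_norm \<Omega> u)\<^sup>2 + 2 * L2_inner \<Omega> u v + (L2_norm \<Omega> v)\<^sup>2"
    using assms by (simp add: L2_norm_squared L2_inner_add_left L2_inner_add_right L2_add L2_inner_commute)
  then show "(L2_norm \<Omega> (\<lambda>x. u x + v x))\<^sup>2 \<le> (L2_norm \<Omega> u + L2_norm \<Omega> v)\<^sup>2"
    using L2_inner_bound[OF assms] by (simp add: power2_sum)
qed (simp add: L2_norm_nonneg)

lemma L2_norm_cong_AE:
  assumes "u \<in> borel_measurable (lebesgue_on \<Omega>)" "v \<in> borel_measurable (lebesgue_on \<Omega>)"
    "AE x in lebesgue_on \<Omega>. u x = v x"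
  shows "L2_norm \<Omega> u = L2_norm \<Omega> v"
  unfolding L2_norm_def L2_inner_def
  by (intro arg_cong[of _ _ sqrt] integral_cong_AE) (use assms in auto)

lemma L2_inner_cong_AE:
  assumes "u \<in> L2_space \<Omega>" "v \<in> L2_space \<Omega>" "u' \<in> L2_space \<Omega>" "v' \<in> L2_space \<Omega>"
    "AE x in lebesgue_on \<Omega>. u x = u' x" "AE x in lebesgue_on \<Omega>. v x = v' x"
  shows "L2_inner \<Omega> u v = L2_inner \<Omega> u' v'"
  unfolding L2_inner_def
  by (intro integral_cong_AE) (use assms in \<open>auto dest!: L2_spaceD(1)\<close>)

lemma L2_component:
  fixes u :: "real^2 \<Rightarrow> 'b::euclidean_space^2"
  assumes "u \<in> L2_space \<Omega>"
  shows "(\<lambda>x. u x $ i) \<in> L2_space \<Omega>"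
proof (rule L2_space_bound[OF assms, where c=1])
  show "(\<lambda>x. u x $ i) \<in> borel_measurable (lebesgue_on \<Omega>)"
    by (rule measurable_compose[OF L2_spaceD(1)[OF assms] borel_measurable_continuous_onI])
      (intro continuous_intros)
qed (simp add: Finite_Cartesian_Product.norm_nth_le)

subsection \<open>Compactly supported functions\<close>

lemma integrable_lborel_compact_support:
  fixes f :: "'a::euclidean_space \<Rightarrow> 'b::euclidean_space"
  assumes "continuous_on UNIV f" "\<And>x. x \<notin> cball 0 R \<Longrightarrow> f x = 0"
  shows "integrable lborel f"
proof -
  have "integrable lborel (\<lambda>x. indicator (cball 0 R) x *\<^sub>R f x)"
    using assms(1) by (intro borel_integrable_compact) (auto intro: continuous_on_subset)
  also have "(\<lambda>x. indicator (cball 0 R) x *\<^sub>R f x) = f"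
    using assms(2) by (fastforce simp: indicator_def)
  finally show ?thesis .
qed

text \<open>Translation invariance makes every difference quotient of \<open>F\<close> integrate to
  0, and dominated convergence carries this to the derivative; the mean value theorem supplies both
  the pointwise limit and the bound. Applied to products, this is integration by parts.\<close>

lemma integral_directional_derivative_eq_0:
  fixes F :: "'a::euclidean_space \<Rightarrow> real"
  assumes F: "\<And>x. (F has_derivative F' x) (at x)"
    and cont: "continuous_on UNIV (\<lambda>x. F' x b)" and bdd: "bounded {x. F x \<noteq> 0}"
  shows "(LINT x|lborel. F' x b) = 0"
proof -
  obtain R where R: "R > 0" "\<And>x. F x \<noteq> 0 \<Longrightarrow> norm x \<le> R"
    using bdd unfolding bounded_pos by auto
  have F'0: "F' x b = 0" if "R < norm x" for x
  proof -
    have "((\<lambda>y. 0) has_derivative F' x) (at x)"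
      by (rule has_derivative_transform_within_open[OF F, where s="- cball 0 R"])
        (use that R(2) in \<open>force simp: open_Compl\<close>)+
    then have "F' x = (\<lambda>h. 0)"
      using has_derivative_unique has_derivative_const by blast
    then show ?thesis by simp
  qed
  \<comment> \<open>Shifts by h b with h \<le> 1 move the support by at most \<open>norm b\<close>,
    so every quotient \<open>q n\<close> vanishes outside \<open>cball 0 C\<close>.\<close>
  define C where "C = R + norm b + 1"
  have RC: "R < C" using norm_ge_zero[of b] by (simp add: C_def add_nonneg_pos del: norm_ge_zero)
  have "compact ((\<lambda>x. F' x b) ` cball 0 C)"
    by (intro compact_continuous_image continuous_on_subset[OF cont]) auto
  from compact_imp_bounded[OF this] obtain K
    where K: "K > 0" "\<And>x. x \<in> cball 0 C \<Longrightarrow> \<bar>F' x b\<bar> \<le> K"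
    unfolding bounded_pos by (auto simp del: mem_cball_0)
  have K': "\<bar>F' x b\<bar> \<le> K" for x
    using K(2)[of x] K(1) F'0[of x] RC by (cases "norm x \<le> C") auto
  have contF: "continuous_on UNIV F"
    using has_derivative_continuous[OF F] by (auto simp: continuous_on_eq_continuous_at)
  have intF: "integrable lborel F"
    by (rule integrable_lborel_compact_support[OF contF, of R]) (use R in force)
  define q where "q n x = (F (x + inverse (real (Suc n)) *\<^sub>R b) - F x) / inverse (real (Suc n))" for n x
  have shift: "integrable lborel (\<lambda>x. F (x + c))" "(LINT x|lborel. F (x + c)) = (LINT x|lborel. F x)" for c
  proof -
    have meas: "F \<in> borel_measurable borel" using contF by (rule borel_measurable_continuous_onI)
    have "integrable (distr lborel borel ((+) c)) F" using intF by (simp add: lborel_distr_plus)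
    then show "integrable lborel (\<lambda>x. F (x + c))"
      by (subst (asm) integrable_distr_eq) (auto simp: meas add.commute)
    have "(LINT x|lborel. F x) = (LINT x|distr lborel borel ((+) c). F x)" by (simp add: lborel_distr_plus)
    also have "\<dots> = (LINT x|lborel. F (x + c))"
      by (subst integral_distr) (auto simp: meas add.commute)
    finally show "(LINT x|lborel. F (x + c)) = (LINT x|lborel. F x)" ..
  qed
  have q0: "(LINT x|lborel. q n x) = 0" for n
    using shift intF by (simp add: q_def)
  have mvt: "\<exists>z. 0 < z \<and> z < h \<and> F (x + h *\<^sub>R b) - F x = h * F' (x + z *\<^sub>R b) b" if "h > 0" for h x
  proof -
    have "((\<lambda>t. F (x + t *\<^sub>R b)) has_real_derivative F' (x + t *\<^sub>R b) b) (at t)" for t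
    proof -
      have "((\<lambda>t. F (x + t *\<^sub>R b)) has_derivative (\<lambda>s. F' (x + t *\<^sub>R b) (s *\<^sub>R b))) (at t)"
        by (rule has_derivative_compose[OF _ F]) (auto intro!: derivative_eq_intros)
      moreover have "F' (x + t *\<^sub>R b) (s *\<^sub>R b) = F' (x + t *\<^sub>R b) b * s" for s
        using linear_scale[OF has_derivative_linear[OF F[of "x + t *\<^sub>R b"]]] by simp
      ultimately show ?thesis by (simp add: has_field_derivative_def)
    qed
    from MVT2[OF \<open>h > 0\<close> this] show ?thesis by auto
  qed
  have "(\<lambda>n. LINT x|lborel. q n x) \<longlonglongrightarrow> (LINT x|lborel. F' x b)"
  proof (rule integral_dominated_convergence[where w="\<lambda>x. indicator (cball 0 C) x *\<^sub>R K"])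
    show "(\<lambda>x. F' x b) \<in> borel_measurable lborel"
      using cont by (simp add: borel_measurable_continuous_onI)
    show "q n \<in> borel_measurable lborel" for n
      unfolding q_def using contF
      by (intro borel_measurable_divide borel_measurable_diff) (auto intro!: borel_measurable_continuous_onI continuous_intros continuous_on_compose2[OF contF])
    show "integrable lborel (\<lambda>x. indicator (cball 0 C) x *\<^sub>R K)"
      by (intro borel_integrable_compact) auto
    show "AE x in lborel. (\<lambda>n. q n x) \<longlonglongrightarrow> F' x b"
    proof (rule AE_I2)
      fix x
      have "\<forall>n. \<exists>z. 0 < z \<and> z < inverse (real (Suc n)) \<and> q n x = F' (x + z *\<^sub>R b) b"
      proof
        fix n
        from mvt[of "inverse (real (Suc n))" x] obtain z where z: "0 < z" "z < inverse (real (Suc n))"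
          "F (x + inverse (real (Suc n)) *\<^sub>R b) - F x = inverse (real (Suc n)) * F' (x + z *\<^sub>R b) b"
          by (auto simp del: of_nat_Suc)
        then show "\<exists>z. 0 < z \<and> z < inverse (real (Suc n)) \<and> q n x = F' (x + z *\<^sub>R b) b"
          by (intro exI[of _ z]) (simp add: q_def del: of_nat_Suc)
      qed
      then obtain z where z: "\<And>n. 0 < z n" "\<And>n. z n < inverse (real (Suc n))"
        "\<And>n. q n x = F' (x + z n *\<^sub>R b) b" by metis
      have "z \<longlonglongrightarrow> 0"
        by (rule real_tendsto_sandwich[OF _ _ tendsto_const LIMSEQ_inverse_real_of_nat])
          (use z(1,2) less_imp_le in \<open>auto intro!: always_eventually simp del: of_nat_Suc\<close>)
      then have "(\<lambda>n. x + z n *\<^sub>R b) \<longlonglongrightarrow> x + 0 *\<^sub>R b" by (intro tendsto_intros)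
      moreover have "isCont (\<lambda>x. F' x b) (x + 0 *\<^sub>R b)"
        using cont by (simp add: continuous_on_eq_continuous_at)
      ultimately have "(\<lambda>n. F' (x + z n *\<^sub>R b) b) \<longlonglongrightarrow> F' (x + 0 *\<^sub>R b) b"
        by (rule isCont_tendsto_compose[rotated])
      then show "(\<lambda>n. q n x) \<longlonglongrightarrow> F' x b" by (simp add: z(3))
    qed
    show "AE x in lborel. norm (q n x) \<le> indicator (cball 0 C) x *\<^sub>R K" for n
    proof (rule AE_I2)
      fix x
      define h where "h = inverse (real (Suc n))"
      have h: "h > 0" "h \<le> 1" by (auto simp: h_def divide_simps)
      obtain z where z: "F (x + h *\<^sub>R b) - F x = h * F' (x + z *\<^sub>R b) b" using mvt[OF h(1)] by blast
      then have qz: "q n x = F' (x + z *\<^sub>R b) b" using h by (simp add: q_def z del: of_nat_Suc flip: h_def)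
      show "norm (q n x) \<le> indicator (cball 0 C) x *\<^sub>R K"
      proof (cases "x \<in> cball 0 C")
        case True
        then show ?thesis using K' qz by simp
      next
        case False
        have "norm (h *\<^sub>R b) \<le> norm b" using h by (simp add: mult_left_le_one_le)
        then have "norm x \<le> norm (x + h *\<^sub>R b) + norm b"
          using norm_triangle_ineq4[of "x + h *\<^sub>R b" "h *\<^sub>R b"] by simp
        then have "F (x + h *\<^sub>R b) = 0" "F x = 0"
          using R(2)[of "x + h *\<^sub>R b"] R(2)[of x] False RC by (auto simp: C_def)
        then show ?thesis using h False by (simp add: q_def del: of_nat_Suc flip: h_def)
      qed
    qed
  qed
  then show ?thesis by (simp add: q0 LIMSEQ_const_iff)
qed

subsection \<open>Weak gradients and the spaces \<open>H\<close> and \<open>V\<close>\<close>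

lemma test_functionsD:
  fixes \<phi> :: "'a::euclidean_space \<Rightarrow> 'b::euclidean_space"
  assumes "\<phi> \<in> test_functions U"
  shows test_continuous: "continuous_on UNIV \<phi>"
    and test_has_derivative: "(\<phi> has_derivative frechet_derivative \<phi> (at x)) (at x)"
    and test_eq_0: "x \<notin> U \<Longrightarrow> \<phi> x = 0"
    and test_bounded: "bounded {x. \<phi> x \<noteq> 0}"
    and test_derivative_eq_0: "x \<notin> U \<Longrightarrow> frechet_derivative \<phi> (at x) = (\<lambda>h. 0)"
    and test_derivative_continuous:
      "b \<in> Basis \<Longrightarrow> continuous_on UNIV (\<lambda>x. frechet_derivative \<phi> (at x) b)"
proof -
  have Ck: "Ck k \<phi>" for k using assms by (simp add: test_functions_def)
  show "continuous_on UNIV \<phi>" using Ck[of 0] by simp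
  show D: "(\<phi> has_derivative frechet_derivative \<phi> (at x)) (at x)" for x
    using Ck_Suc_derivative[OF Ck[of "Suc 0"]] .
  let ?S = "{x. \<phi> x \<noteq> 0}"
  have S: "closure ?S \<subseteq> U" "compact (closure ?S)" using assms by (auto simp: test_functions_def)
  show "x \<notin> U \<Longrightarrow> \<phi> x = 0"
    using S(1) closure_subset[of ?S] by auto
  show "bounded {x. \<phi> x \<noteq> 0}"
    by (rule bounded_subset[OF compact_imp_bounded[OF S(2)] closure_subset])
  show "frechet_derivative \<phi> (at x) = (\<lambda>h. 0)" if "x \<notin> U"
  proof -
    have "((\<lambda>y. 0) has_derivative frechet_derivative \<phi> (at x)) (at x)"
      by (rule has_derivative_transform_within_open[OF D, where s="- closure {x. \<phi> x \<noteq> 0}"])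
        (use that S(1) closure_subset[of ?S] in auto)
    then show ?thesis using has_derivative_unique has_derivative_const by blast
  qed
  show "b \<in> Basis \<Longrightarrow> continuous_on UNIV (\<lambda>x. frechet_derivative \<phi> (at x) b)"
    using Ck[of "Suc 0"] by simp
qed

lemma test_functions_add:
  fixes \<phi> \<psi> :: "'a::euclidean_space \<Rightarrow> 'b::euclidean_space"
  assumes "\<phi> \<in> test_functions U" "\<psi> \<in> test_functions U"
  shows "(\<lambda>x. \<phi> x + \<psi> x) \<in> test_functions U"
proof -
  have "{x. \<phi> x + \<psi> x \<noteq> 0} \<subseteq> {x. \<phi> x \<noteq> 0} \<union> {x. \<psi> x \<noteq> 0}" by auto
  from closure_mono[OF this]
  have *: "closure {x. \<phi> x + \<psi> x \<noteq> 0} \<subseteq> closure {x. \<phi> x \<noteq> 0} \<union> closure {x. \<psi> x \<noteq> 0}"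
    by simp
  have "compact (closure {x. \<phi> x + \<psi> x \<noteq> 0})"
    using bounded_subset[OF _ *] assms
    by (auto simp: test_functions_def compact_eq_bounded_closed)
  then show ?thesis using * assms by (auto simp: test_functions_def intro: Ck_add)
qed

lemma test_functions_scaleR:
  fixes \<phi> :: "'a::euclidean_space \<Rightarrow> 'b::euclidean_space"
  assumes "\<phi> \<in> test_functions U"
  shows "(\<lambda>x. c *\<^sub>R \<phi> x) \<in> test_functions U"
proof -
  have "{x. c *\<^sub>R \<phi> x \<noteq> 0} \<subseteq> {x. \<phi> x \<noteq> 0}" by auto
  from closure_mono[OF this]
  have *: "closure {x. c *\<^sub>R \<phi> x \<noteq> 0} \<subseteq> closure {x. \<phi> x \<noteq> 0}" .
  have "compact (closure {x. c *\<^sub>R \<phi> x \<noteq> 0})"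
    using bounded_subset[OF _ *] assms
    by (auto simp: test_functions_def compact_eq_bounded_closed)
  then show ?thesis using * assms by (auto simp: test_functions_def intro: Ck_scaleR)
qed

lemma axis_1_in_Basis: "axis j (1::real) \<in> Basis"
  by (simp add: axis_in_Basis_iff)

lemma partial_eqI: "(\<phi> has_derivative D) (at x) \<Longrightarrow> partial j \<phi> x = D (axis j 1)"
  unfolding partial_def by (simp flip: frechet_derivative_at)

lemma partial_add:
  assumes "\<phi> \<in> test_functions U" "\<psi> \<in> test_functions U"
  shows "partial j (\<lambda>x. \<phi> x + \<psi> x) x = partial j \<phi> x + partial j \<psi> x"
  using partial_eqI[OF has_derivative_add[OF test_has_derivative[OF assms(1)] test_has_derivative[OF assms(2)]]]
  by (simp add: partial_def)

lemma partial_scaleR: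
  assumes "\<phi> \<in> test_functions U"
  shows "partial j (\<lambda>x. c *\<^sub>R \<phi> x) x = c *\<^sub>R partial j \<phi> x"
  using partial_eqI[OF has_derivative_scaleR_right[OF test_has_derivative[OF assms]]]
  by (simp add: partial_def)

lemma solenoidal_tests_add:
  assumes "\<phi> \<in> solenoidal_tests \<Omega>" "\<psi> \<in> solenoidal_tests \<Omega>"
  shows "(\<lambda>x. \<phi> x + \<psi> x) \<in> solenoidal_tests \<Omega>"
  using assms by (auto simp: solenoidal_tests_def test_functions_add partial_add sum.distrib)

lemma solenoidal_tests_scaleR:
  assumes "\<phi> \<in> solenoidal_tests \<Omega>"
  shows "(\<lambda>x. c *\<^sub>R \<phi> x) \<in> solenoidal_tests \<Omega>"
  using assms by (auto simp: solenoidal_tests_def test_functions_scaleR partial_scaleR simp flip: sum_distrib_left)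

lemma test_partial:
  assumes "\<phi> \<in> test_functions U"
  shows "continuous_on UNIV (partial j \<phi>)" "x \<notin> U \<Longrightarrow> partial j \<phi> x = 0"
  using test_derivative_continuous[OF assms axis_1_in_Basis] test_derivative_eq_0[OF assms]
  by (auto simp: partial_def[abs_def])

section \<open>Classical and weak gradients\<close>

definition classical_grad :: "field2 \<Rightarrow> real^2 \<Rightarrow> real^2^2" where
  "classical_grad \<phi> x = (\<chi> i j. partial j \<phi> x $ i)"

text \<open>Square integrability of test functions and of their derivatives enters as a hypothesis,
  because it depends on the domain and is established only in the locale below.\<close>

lemma is_weak_grad_add:
  assumes "u \<in> L2_space \<Omega>" "v \<in> L2_space \<Omega>" "G \<in> L2_space \<Omega>" "K \<in> L2_space \<Omega>"
    and int: "\<And>\<psi>::real^2 \<Rightarrow> real. \<psi> \<in> test_functions \<Omega> \<Longrightarrow> \<psi> \<in> L2_space \<Omega>"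
      "\<And>j. \<And>\<psi>::real^2 \<Rightarrow> real. \<psi> \<in> test_functions \<Omega> \<Longrightarrow> partial j \<psi> \<in> L2_space \<Omega>"
    and "is_weak_grad \<Omega> u G" "is_weak_grad \<Omega> v K"
  shows "is_weak_grad \<Omega> (\<lambda>x. u x + v x) (\<lambda>x. G x + K x)"
  unfolding is_weak_grad_def
proof (intro ballI allI)
  fix \<psi> :: "real^2 \<Rightarrow> real" and i j assume \<psi>: "\<psi> \<in> test_functions \<Omega>"
  have "integrable (lebesgue_on \<Omega>) (\<lambda>x. w x $ i * partial j \<psi> x)" if "w \<in> L2_space \<Omega>" for w :: field2
    using L2_inner_integrable[OF L2_component[OF that] int(2)[OF \<psi>]] by simp
  moreover have "integrable (lebesgue_on \<Omega>) (\<lambda>x. H x $ i $ j * \<psi> x)" if "H \<in> L2_space \<Omega>" for H :: "real^2 \<Rightarrow> real^2^2"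
    using L2_inner_integrable[OF L2_component[OF L2_component[OF that]] int(1)[OF \<psi>]] by simp
  ultimately show "(LINT x|lebesgue_on \<Omega>. (u x + v x) $ i * partial j \<psi> x)
          = - (LINT x|lebesgue_on \<Omega>. (G x + K x) $ i $ j * \<psi> x)"
    using assms \<psi> by (simp add: distrib_right is_weak_grad_def)
qed

lemma is_weak_grad_scaleR:
  assumes "is_weak_grad \<Omega> u G"
  shows "is_weak_grad \<Omega> (\<lambda>x. c *\<^sub>R u x) (\<lambda>x. c *\<^sub>R G x)"
  using assms by (simp add: is_weak_grad_def mult.assoc)

lemma weak_grad_props:
  assumes "u \<in> H1_space \<Omega>"
  shows "weak_grad \<Omega> u \<in> L2_space \<Omega>" "is_weak_grad \<Omega> u (weak_grad \<Omega> u)"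
proof -
  have "\<exists>G. G \<in> L2_space \<Omega> \<and> is_weak_grad \<Omega> u G" using assms by (auto simp: H1_space_def)
  from someI_ex[OF this] show "weak_grad \<Omega> u \<in> L2_space \<Omega>" "is_weak_grad \<Omega> u (weak_grad \<Omega> u)"
    by (auto simp: weak_grad_def)
qed

lemma H1_L2: "u \<in> H1_space \<Omega> \<Longrightarrow> u \<in> L2_space \<Omega>"
  by (simp add: H1_space_def)

lemma V_norm_eq: "V_norm \<Omega> u = L2_norm \<Omega> (weak_grad \<Omega> u)"
  by (simp add: V_norm_def V_inner_def L2_norm_def)

lemma V_norm_nonneg: "0 \<le> V_norm \<Omega> u"
  by (simp add: V_norm_eq L2_norm_nonneg)

lemma V_norm_squared: "(V_norm \<Omega> u)\<^sup>2 = V_inner \<Omega> u u"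
  by (simp add: V_norm_eq L2_norm_squared V_inner_def)

lemma H1_norm_eq:
  "H1_norm \<Omega> u = sqrt (measure lebesgue \<Omega> powr (- 1 / 2) * (L2_norm \<Omega> u)\<^sup>2 + (V_norm \<Omega> u)\<^sup>2)"
  by (simp add: H1_norm_def H1_seminorm_def V_norm_eq)

locale bounded_open_set =
  fixes \<Omega> :: "(real^2) set"
  assumes open_\<Omega>: "open \<Omega>" and bounded_\<Omega>: "bounded \<Omega>" and nonempty_\<Omega>: "\<Omega> \<noteq> {}"
begin

lemma \<Omega>_lebesgue: "\<Omega> \<in> sets lebesgue"
  using open_\<Omega> by simp

lemma finite_measure_\<Omega>: "finite_measure (lebesgue_on \<Omega>)"
  using bounded_\<Omega> \<Omega>_lebesgue by (intro finite_measure_lebesgue_on bounded_set_imp_lmeasurable)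

lemma measure_\<Omega>_pos: "measure lebesgue \<Omega> > 0"
proof -
  have "\<Omega> \<in> lmeasurable" using bounded_\<Omega> \<Omega>_lebesgue by (rule bounded_set_imp_lmeasurable)
  then show ?thesis
    using open_not_negligible[OF open_\<Omega> nonempty_\<Omega>]
    by (metis measure_nonneg negligible_iff_measure order_le_less)
qed

lemma
  fixes f :: "real^2 \<Rightarrow> 'b::euclidean_space"
  assumes "f \<in> borel_measurable borel" "\<And>x. x \<notin> \<Omega> \<Longrightarrow> f x = 0"
  shows integral_on_eq_lborel: "(LINT x|lebesgue_on \<Omega>. f x) = (LINT x|lborel. f x)"
    and integrable_on_iff_lborel: "integrable (lebesgue_on \<Omega>) f \<longleftrightarrow> integrable lborel f"
proof -
  have eq: "(\<lambda>x. indicator \<Omega> x *\<^sub>R f x) = f"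
    using assms(2) by (auto simp: indicator_def)
  show "(LINT x|lebesgue_on \<Omega>. f x) = (LINT x|lborel. f x)"
    using \<Omega>_lebesgue assms(1) by (subst integral_restrict_space) (auto simp: eq integral_completion)
  show "integrable (lebesgue_on \<Omega>) f \<longleftrightarrow> integrable lborel f"
    using \<Omega>_lebesgue assms(1) by (subst integrable_restrict_space) (auto simp: eq integrable_completion)
qed

lemma L2_continuous_support:
  fixes f :: "real^2 \<Rightarrow> 'b::euclidean_space"
  assumes "continuous_on UNIV f" "\<And>x. x \<notin> \<Omega> \<Longrightarrow> f x = 0"
  shows "f \<in> L2_space \<Omega>"
proof -
  obtain R where R: "\<And>x. x \<in> \<Omega> \<Longrightarrow> norm x \<le> R" using bounded_\<Omega> by (auto simp: bounded_iff)
  have c: "continuous_on UNIV (\<lambda>x. (norm (f x))\<^sup>2)"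
    using assms(1) by (intro continuous_intros)
  have "integrable lborel (\<lambda>x. (norm (f x))\<^sup>2)"
    by (rule integrable_lborel_compact_support[OF c, of R]) (use R assms(2) in force)
  then have "integrable (lebesgue_on \<Omega>) (\<lambda>x. (norm (f x))\<^sup>2)"
    by (subst integrable_on_iff_lborel) (use assms(2) c in \<open>auto intro: borel_measurable_continuous_onI\<close>)
  moreover have "f \<in> borel_measurable (lebesgue_on \<Omega>)"
    by (rule continuous_imp_measurable_on_sets_lebesgue[OF continuous_on_subset[OF assms(1)] \<Omega>_lebesgue]) simp
  ultimately show ?thesis by (simp add: L2_space_def)
qed

lemma test_L2: "\<phi> \<in> test_functions \<Omega> \<Longrightarrow> \<phi> \<in> L2_space \<Omega>"
  by (intro L2_continuous_support) (auto simp: test_continuous test_eq_0)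

lemma test_partial_L2: "\<phi> \<in> test_functions \<Omega> \<Longrightarrow> partial j \<phi> \<in> L2_space \<Omega>"
  by (intro L2_continuous_support) (auto simp: test_partial)

lemma classical_grad_L2:
  assumes "\<phi> \<in> test_functions \<Omega>"
  shows "classical_grad \<phi> \<in> L2_space \<Omega>"
proof (rule L2_continuous_support)
  show "continuous_on UNIV (classical_grad \<phi>)"
    unfolding classical_grad_def using test_partial(1)[OF assms]
    by (intro continuous_on_vec_lambda continuous_intros)
  show "classical_grad \<phi> x = 0" if "x \<notin> \<Omega>" for x
    using test_partial(2)[OF assms that] by (simp add: classical_grad_def vec_eq_iff)
qed

lemma integral_partial_eq_0:
  fixes F :: "real^2 \<Rightarrow> real"
  assumes F: "\<And>x. (F has_derivative F' x) (at x)"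
    and cont: "continuous_on UNIV (\<lambda>x. F' x (axis j 1))"
    and 0: "\<And>x. x \<notin> \<Omega> \<Longrightarrow> F x = 0" "\<And>x. x \<notin> \<Omega> \<Longrightarrow> F' x (axis j 1) = 0"
  shows "(LINT x|lebesgue_on \<Omega>. F' x (axis j 1)) = 0"
proof -
  have "bounded {x. F x \<noteq> 0}" by (rule bounded_subset[OF bounded_\<Omega>]) (use 0 in auto)
  then show ?thesis
    using integral_directional_derivative_eq_0[OF F cont]
    by (subst integral_on_eq_lborel) (auto simp: 0 cont borel_measurable_continuous_onI)
qed

text \<open>Integration by parts: the derivative of a component of \<open>\<phi>\<close> times
  \<open>\<psi>\<close> integrates to 0.\<close>

lemma classical_grad_is_weak:
  assumes \<phi>: "\<phi> \<in> test_functions \<Omega>"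
  shows "is_weak_grad \<Omega> \<phi> (classical_grad \<phi>)"
  unfolding is_weak_grad_def
proof (intro ballI allI)
  fix \<psi> :: "real^2 \<Rightarrow> real" and i j assume \<psi>: "\<psi> \<in> test_functions \<Omega>"
  let ?F = "\<lambda>x. \<phi> x $ i * \<psi> x"
  let ?F' = "\<lambda>x h. \<phi> x $ i * frechet_derivative \<psi> (at x) h + frechet_derivative \<phi> (at x) h $ i * \<psi> x"
  have D: "(?F has_derivative ?F' x) (at x)" for x
    by (intro has_derivative_mult bounded_linear.has_derivative[OF bounded_linear_vec_nth]
        test_has_derivative[OF \<phi>] test_has_derivative[OF \<psi>])
  have "(LINT x|lebesgue_on \<Omega>. ?F' x (axis j 1)) = 0"
    by (rule integral_partial_eq_0[OF D])
      (use test_derivative_continuous[OF \<phi> axis_1_in_Basis] test_derivative_continuous[OF \<psi> axis_1_in_Basis]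
        test_continuous[OF \<phi>] test_continuous[OF \<psi>] test_eq_0[OF \<phi>] test_eq_0[OF \<psi>]
        in \<open>auto intro!: continuous_intros\<close>)
  moreover have "?F' x (axis j 1) = \<phi> x $ i * partial j \<psi> x + classical_grad \<phi> x $ i $ j * \<psi> x" for x
    by (simp add: partial_def classical_grad_def)
  moreover have "integrable (lebesgue_on \<Omega>) (\<lambda>x. \<phi> x $ i * partial j \<psi> x)"
    using L2_inner_integrable[OF L2_component[OF test_L2[OF \<phi>]] test_partial_L2[OF \<psi>]] by simp
  moreover have "integrable (lebesgue_on \<Omega>) (\<lambda>x. classical_grad \<phi> x $ i $ j * \<psi> x)"
    using L2_inner_integrable[OF L2_component[OF L2_component[OF classical_grad_L2[OF \<phi>]]] test_L2[OF \<psi>]] by simp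
  ultimately show "(LINT x|lebesgue_on \<Omega>. \<phi> x $ i * partial j \<psi> x)
      = - (LINT x|lebesgue_on \<Omega>. classical_grad \<phi> x $ i $ j * \<psi> x)"
    by simp
qed

lemma test_H1: "\<phi> \<in> test_functions \<Omega> \<Longrightarrow> \<phi> \<in> H1_space \<Omega>"
  using test_L2 classical_grad_L2 classical_grad_is_weak by (auto simp: H1_space_def)

lemma L2_const: "(\<lambda>x. c) \<in> L2_space \<Omega>"
proof -
  interpret finite_measure "lebesgue_on \<Omega>" by (rule finite_measure_\<Omega>)
  show ?thesis by (simp add: L2_space_def)
qed

text \<open>\<open>weak_grad\<close> picks an arbitrary representative by choice, so uniqueness is
  behind every rule of computation for it, and these rules hold only almost everywhere. The reason
  is the fundamental lemma, applied to the entries of the difference.\<close>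

lemma weak_grad_unique:
  assumes L2: "G \<in> L2_space \<Omega>" "K \<in> L2_space \<Omega>" and wg: "is_weak_grad \<Omega> u G" "is_weak_grad \<Omega> u K"
  shows "AE x in lebesgue_on \<Omega>. G x = K x"
proof -
  have comp: "(\<lambda>x. H x $ i $ j) \<in> L2_space \<Omega>" if "H \<in> L2_space \<Omega>" for H :: "real^2 \<Rightarrow> real^2^2" and i j
    using L2_component[OF L2_component[OF that]] .
  have int: "integrable (lebesgue_on \<Omega>) (\<lambda>x. H x $ i $ j * h x)"
    if "H \<in> L2_space \<Omega>" "h \<in> L2_space \<Omega>" for H :: "real^2 \<Rightarrow> real^2^2" and h :: "real^2 \<Rightarrow> real" and i j
    using L2_inner_integrable[OF comp[OF that(1)] that(2)] by simp
  have "AE x in lebesgue_on \<Omega>. G x $ i $ j - K x $ i $ j = 0" for i j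
  proof (rule fundamental_lemma[OF open_\<Omega>])
    show "integrable (lebesgue_on \<Omega>) (\<lambda>x. G x $ i $ j - K x $ i $ j)"
      using int[OF _ L2_const[of 1]] L2 by simp
    fix \<psi> :: "real^2 \<Rightarrow> real" assume \<psi>: "\<psi> \<in> test_functions \<Omega>"
    then have "(LINT x|lebesgue_on \<Omega>. G x $ i $ j * \<psi> x) = (LINT x|lebesgue_on \<Omega>. K x $ i $ j * \<psi> x)"
      using wg(1)[unfolded is_weak_grad_def, rule_format, OF \<psi>, of i j]
        wg(2)[unfolded is_weak_grad_def, rule_format, OF \<psi>, of i j] by simp
    then show "(LINT x|lebesgue_on \<Omega>. (G x $ i $ j - K x $ i $ j) * \<psi> x) = 0"
      using int[OF _ test_L2[OF \<psi>]] L2 by (simp add: left_diff_distrib)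
  qed
  then have "AE x in lebesgue_on \<Omega>. \<forall>i j. G x $ i $ j - K x $ i $ j = 0"
    by (simp only: eventually_all_finite)
  then show ?thesis by eventually_elim (simp add: vec_eq_iff)
qed

lemma weak_grad_AE:
  assumes "u \<in> L2_space \<Omega>" "G \<in> L2_space \<Omega>" "is_weak_grad \<Omega> u G"
  shows "AE x in lebesgue_on \<Omega>. weak_grad \<Omega> u x = G x"
proof -
  have "u \<in> H1_space \<Omega>" using assms by (auto simp: H1_space_def)
  then show ?thesis using weak_grad_unique[OF _ assms(2) _ assms(3)] weak_grad_props by blast
qed

lemma weak_grad_test: "\<phi> \<in> test_functions \<Omega> \<Longrightarrow> AE x in lebesgue_on \<Omega>. weak_grad \<Omega> \<phi> x = classical_grad \<phi> x"
  by (intro weak_grad_AE test_L2 classical_grad_L2 classical_grad_is_weak)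

lemma H1_add:
  assumes "u \<in> H1_space \<Omega>" "v \<in> H1_space \<Omega>"
  shows "(\<lambda>x. u x + v x) \<in> H1_space \<Omega>"
    and "AE x in lebesgue_on \<Omega>. weak_grad \<Omega> (\<lambda>x. u x + v x) x = weak_grad \<Omega> u x + weak_grad \<Omega> v x"
proof -
  have "is_weak_grad \<Omega> (\<lambda>x. u x + v x) (\<lambda>x. weak_grad \<Omega> u x + weak_grad \<Omega> v x)"
    by (intro is_weak_grad_add weak_grad_props H1_L2 assms test_L2 test_partial_L2)
  then show "(\<lambda>x. u x + v x) \<in> H1_space \<Omega>"
    "AE x in lebesgue_on \<Omega>. weak_grad \<Omega> (\<lambda>x. u x + v x) x = weak_grad \<Omega> u x + weak_grad \<Omega> v x"
    using L2_add[OF H1_L2 H1_L2, OF assms] L2_add[OF weak_grad_props(1) weak_grad_props(1), OF assms]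
    by (auto simp: H1_space_def intro: weak_grad_AE)
qed

lemma H1_scaleR:
  assumes "u \<in> H1_space \<Omega>"
  shows "(\<lambda>x. c *\<^sub>R u x) \<in> H1_space \<Omega>"
    and "AE x in lebesgue_on \<Omega>. weak_grad \<Omega> (\<lambda>x. c *\<^sub>R u x) x = c *\<^sub>R weak_grad \<Omega> u x"
proof -
  have "is_weak_grad \<Omega> (\<lambda>x. c *\<^sub>R u x) (\<lambda>x. c *\<^sub>R weak_grad \<Omega> u x)"
    by (intro is_weak_grad_scaleR weak_grad_props assms)
  then show "(\<lambda>x. c *\<^sub>R u x) \<in> H1_space \<Omega>"
    "AE x in lebesgue_on \<Omega>. weak_grad \<Omega> (\<lambda>x. c *\<^sub>R u x) x = c *\<^sub>R weak_grad \<Omega> u x"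
    using L2_scaleR[OF H1_L2[OF assms]] L2_scaleR[OF weak_grad_props(1)[OF assms]]
    by (auto simp: H1_space_def intro: weak_grad_AE)
qed

lemma H1_diff:
  assumes "u \<in> H1_space \<Omega>" "v \<in> H1_space \<Omega>"
  shows "(\<lambda>x. u x - v x) \<in> H1_space \<Omega>"
    and "AE x in lebesgue_on \<Omega>. weak_grad \<Omega> (\<lambda>x. u x - v x) x = weak_grad \<Omega> u x - weak_grad \<Omega> v x"
  using H1_add[OF assms(1) H1_scaleR(1)[OF assms(2), of "-1"]] H1_scaleR(2)[OF assms(2), of "-1"]
  by (auto elim: eventually_elim2)

section \<open>Inner product and norms on V\<close>

lemma V_inner_add_left:
  assumes "u \<in> H1_space \<Omega>" "v \<in> H1_space \<Omega>" "w \<in> H1_space \<Omega>"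
  shows "V_inner \<Omega> (\<lambda>x. u x + v x) w = V_inner \<Omega> u w + V_inner \<Omega> v w"
proof -
  note L = weak_grad_props(1)
  have "V_inner \<Omega> (\<lambda>x. u x + v x) w = L2_inner \<Omega> (\<lambda>x. weak_grad \<Omega> u x + weak_grad \<Omega> v x) (weak_grad \<Omega> w)"
    unfolding V_inner_def by (rule L2_inner_cong_AE) (use assms in \<open>auto intro: L L2_add H1_add\<close>)
  then show ?thesis by (simp add: V_inner_def L2_inner_add_left L assms)
qed

lemma V_inner_scaleR_left:
  assumes "u \<in> H1_space \<Omega>" "w \<in> H1_space \<Omega>"
  shows "V_inner \<Omega> (\<lambda>x. c *\<^sub>R u x) w = c * V_inner \<Omega> u w"
proof -
  note L = weak_grad_props(1)
  have "V_inner \<Omega> (\<lambda>x. c *\<^sub>R u x) w = L2_inner \<Omega> (\<lambda>x. c *\<^sub>R weak_grad \<Omega> u x) (weak_grad \<Omega> w)"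
    unfolding V_inner_def by (rule L2_inner_cong_AE) (use assms in \<open>auto intro: L L2_scaleR H1_scaleR\<close>)
  then show ?thesis by (simp add: V_inner_def L2_inner_scaleR_left)
qed

lemma V_inner_commute: "V_inner \<Omega> u v = V_inner \<Omega> v u"
  by (simp add: V_inner_def L2_inner_commute)

lemma V_inner_diff_left:
  assumes "u \<in> H1_space \<Omega>" "v \<in> H1_space \<Omega>" "w \<in> H1_space \<Omega>"
  shows "V_inner \<Omega> (\<lambda>x. u x - v x) w = V_inner \<Omega> u w - V_inner \<Omega> v w"
  using V_inner_add_left[OF assms(1) H1_scaleR(1)[OF assms(2), of "-1"] assms(3)]
    V_inner_scaleR_left[OF assms(2,3), of "-1"] by simp

lemma V_inner_bound:
  assumes "u \<in> H1_space \<Omega>" "v \<in> H1_space \<Omega>"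
  shows "\<bar>V_inner \<Omega> u v\<bar> \<le> V_norm \<Omega> u * V_norm \<Omega> v"
  unfolding V_inner_def V_norm_eq by (intro L2_inner_bound weak_grad_props assms)

lemma V_norm_add:
  assumes "u \<in> H1_space \<Omega>" "v \<in> H1_space \<Omega>"
  shows "V_norm \<Omega> (\<lambda>x. u x + v x) \<le> V_norm \<Omega> u + V_norm \<Omega> v"
proof -
  have "V_norm \<Omega> (\<lambda>x. u x + v x) = L2_norm \<Omega> (\<lambda>x. weak_grad \<Omega> u x + weak_grad \<Omega> v x)"
    unfolding V_norm_eq
    by (intro L2_norm_cong_AE L2_spaceD(1) L2_add weak_grad_props H1_add assms)
  then show ?thesis
    using L2_norm_add[OF weak_grad_props(1) weak_grad_props(1), OF assms] by (simp add: V_norm_eq)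
qed

lemma V_norm_scaleR:
  assumes "u \<in> H1_space \<Omega>"
  shows "V_norm \<Omega> (\<lambda>x. c *\<^sub>R u x) = \<bar>c\<bar> * V_norm \<Omega> u"
proof -
  have "V_norm \<Omega> (\<lambda>x. c *\<^sub>R u x) = L2_norm \<Omega> (\<lambda>x. c *\<^sub>R weak_grad \<Omega> u x)"
    unfolding V_norm_eq
    by (intro L2_norm_cong_AE L2_spaceD(1) L2_scaleR weak_grad_props H1_scaleR assms)
  then show ?thesis by (simp add: V_norm_eq L2_norm_scaleR)
qed

text \<open>Taking the root turns the H1 norm into the Euclidean norm of the pair (\<kappa> |u|,
  ||u||).\<close>

definition \<kappa> :: real where "\<kappa> = sqrt (measure lebesgue \<Omega> powr (- 1 / 2))"

lemma \<kappa>_pos: "\<kappa> > 0"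
  using measure_\<Omega>_pos by (simp add: \<kappa>_def)

lemma H1_norm_bounds:
  "\<kappa> * L2_norm \<Omega> u \<le> H1_norm \<Omega> u" "V_norm \<Omega> u \<le> H1_norm \<Omega> u"
  "H1_norm \<Omega> u \<le> \<kappa> * L2_norm \<Omega> u + V_norm \<Omega> u"
proof -
  have eq: "H1_norm \<Omega> u = sqrt ((\<kappa> * L2_norm \<Omega> u)\<^sup>2 + (V_norm \<Omega> u)\<^sup>2)"
    by (simp add: H1_norm_eq \<kappa>_def power_mult_distrib)
  show "\<kappa> * L2_norm \<Omega> u \<le> H1_norm \<Omega> u" "V_norm \<Omega> u \<le> H1_norm \<Omega> u"
    unfolding eq by (auto intro: real_le_rsqrt)
  show "H1_norm \<Omega> u \<le> \<kappa> * L2_norm \<Omega> u + V_norm \<Omega> u"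
    unfolding eq using \<kappa>_pos by (intro sqrt_sum_squares_le_sum) (auto simp: L2_norm_nonneg V_norm_nonneg)
qed

lemma H1_norm_nonneg: "0 \<le> H1_norm \<Omega> u"
  using V_norm_nonneg H1_norm_bounds(2) by (rule order_trans)

lemma H1_norm_tendsto_iff:
  "(\<lambda>n. H1_norm \<Omega> (w n)) \<longlonglongrightarrow> 0 \<longleftrightarrow> (\<lambda>n. L2_norm \<Omega> (w n)) \<longlonglongrightarrow> 0 \<and> (\<lambda>n. V_norm \<Omega> (w n)) \<longlonglongrightarrow> 0"
proof
  assume *: "(\<lambda>n. H1_norm \<Omega> (w n)) \<longlonglongrightarrow> 0"
  have "(\<lambda>n. H1_norm \<Omega> (w n) / \<kappa>) \<longlonglongrightarrow> 0" using tendsto_divide_zero[OF *] .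
  then have "(\<lambda>n. L2_norm \<Omega> (w n)) \<longlonglongrightarrow> 0"
    by (rule Lim_null_comparison[OF always_eventually, rotated])
      (use \<kappa>_pos H1_norm_bounds(1) in \<open>simp add: L2_norm_nonneg field_simps\<close>)
  moreover have "(\<lambda>n. V_norm \<Omega> (w n)) \<longlonglongrightarrow> 0"
    by (rule Lim_null_comparison[OF _ *]) (use H1_norm_bounds(2) in \<open>auto simp: V_norm_nonneg\<close>)
  ultimately show "(\<lambda>n. L2_norm \<Omega> (w n)) \<longlonglongrightarrow> 0 \<and> (\<lambda>n. V_norm \<Omega> (w n)) \<longlonglongrightarrow> 0" ..
next
  assume *: "(\<lambda>n. L2_norm \<Omega> (w n)) \<longlonglongrightarrow> 0 \<and> (\<lambda>n. V_norm \<Omega> (w n)) \<longlonglongrightarrow> 0"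
  have lim: "(\<lambda>n. \<kappa> * L2_norm \<Omega> (w n) + V_norm \<Omega> (w n)) \<longlonglongrightarrow> 0"
    using * by (intro tendsto_add_zero tendsto_mult_right_zero) auto
  show "(\<lambda>n. H1_norm \<Omega> (w n)) \<longlonglongrightarrow> 0"
    by (rule Lim_null_comparison[OF always_eventually lim]) (simp add: H1_norm_nonneg H1_norm_bounds(3))
qed

section \<open>Linear structure of V and H through approximation by solenoidal test
  functions\<close>

lemma V_space_approx:
  assumes "u \<in> V_space \<Omega>"
  obtains \<phi> where "\<And>n. \<phi> n \<in> solenoidal_tests \<Omega>" "(\<lambda>n. L2_norm \<Omega> (\<lambda>x. u x - \<phi> n x)) \<longlonglongrightarrow> 0"
    "(\<lambda>n. V_norm \<Omega> (\<lambda>x. u x - \<phi> n x)) \<longlonglongrightarrow> 0"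
proof -
  have "\<forall>n. \<exists>\<phi>. \<phi> \<in> solenoidal_tests \<Omega> \<and> H1_norm \<Omega> (\<lambda>x. u x - \<phi> x) < inverse (real (Suc n))"
    using assms by (simp add: V_space_def closure_wrt_def fun_diff_def Bex_def)
  then obtain \<phi> where \<phi>: "\<And>n. \<phi> n \<in> solenoidal_tests \<Omega>"
    "\<And>n. H1_norm \<Omega> (\<lambda>x. u x - \<phi> n x) < inverse (real (Suc n))"
    unfolding choice_iff by blast
  have "(\<lambda>n. H1_norm \<Omega> (\<lambda>x. u x - \<phi> n x)) \<longlonglongrightarrow> 0"
    by (rule Lim_null_comparison[OF always_eventually LIMSEQ_inverse_real_of_nat])
      (simp add: H1_norm_nonneg less_imp_le[OF \<phi>(2)] del: of_nat_Suc)
  then show ?thesis using that[of \<phi>] \<phi>(1) by (simp add: H1_norm_tendsto_iff)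
qed

lemma V_H1: "u \<in> V_space \<Omega> \<Longrightarrow> u \<in> H1_space \<Omega>"
  by (simp add: V_space_def H10_space_def closure_wrt_def)

lemma V_L2: "u \<in> V_space \<Omega> \<Longrightarrow> u \<in> L2_space \<Omega>"
  by (intro H1_L2 V_H1)

lemma solenoidal_test: "\<phi> \<in> solenoidal_tests \<Omega> \<Longrightarrow> \<phi> \<in> test_functions \<Omega>"
  by (simp add: solenoidal_tests_def)

lemma solenoidal_H1: "\<phi> \<in> solenoidal_tests \<Omega> \<Longrightarrow> \<phi> \<in> H1_space \<Omega>"
  by (intro test_H1 solenoidal_test)

text \<open>Solenoidal test functions are test functions, so one and the same sequence places
  \<open>u\<close> in \<open>H10_space \<Omega>\<close> and in the closure formed inside it.\<close>

lemma V_spaceI: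
  assumes "u \<in> H1_space \<Omega>" and \<phi>: "\<And>n. \<phi> n \<in> solenoidal_tests \<Omega>"
    and lim: "(\<lambda>n. L2_norm \<Omega> (\<lambda>x. u x - \<phi> n x)) \<longlonglongrightarrow> 0" "(\<lambda>n. V_norm \<Omega> (\<lambda>x. u x - \<phi> n x)) \<longlonglongrightarrow> 0"
  shows "u \<in> V_space \<Omega>"
proof -
  have lim0: "(\<lambda>n. H1_norm \<Omega> (\<lambda>x. u x - \<phi> n x)) \<longlonglongrightarrow> 0"
    using lim by (simp add: H1_norm_tendsto_iff)
  have "\<exists>\<psi>\<in>solenoidal_tests \<Omega>. H1_norm \<Omega> (u - \<psi>) < e" if e: "e > 0" for e
  proof -
    obtain n where "H1_norm \<Omega> (\<lambda>x. u x - \<phi> n x) < e"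
      using eventually_happens'[OF sequentially_bot order_tendstoD(2)[OF lim0 e]] by blast
    then show ?thesis using \<phi>[of n] by (auto simp: fun_diff_def)
  qed
  then show ?thesis
    using assms(1) solenoidal_test unfolding V_space_def H10_space_def closure_wrt_def by blast
qed

lemma V_add:
  assumes "u \<in> V_space \<Omega>" "v \<in> V_space \<Omega>"
  shows "(\<lambda>x. u x + v x) \<in> V_space \<Omega>"
proof -
  obtain \<phi> where \<phi>: "\<And>n. \<phi> n \<in> solenoidal_tests \<Omega>" "(\<lambda>n. L2_norm \<Omega> (\<lambda>x. u x - \<phi> n x)) \<longlonglongrightarrow> 0"
    "(\<lambda>n. V_norm \<Omega> (\<lambda>x. u x - \<phi> n x)) \<longlonglongrightarrow> 0" by (rule V_space_approx[OF assms(1)]) blast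
  obtain \<psi> where \<psi>: "\<And>n. \<psi> n \<in> solenoidal_tests \<Omega>" "(\<lambda>n. L2_norm \<Omega> (\<lambda>x. v x - \<psi> n x)) \<longlonglongrightarrow> 0"
    "(\<lambda>n. V_norm \<Omega> (\<lambda>x. v x - \<psi> n x)) \<longlonglongrightarrow> 0" by (rule V_space_approx[OF assms(2)]) blast
  have eq: "(\<lambda>x. u x + v x - (\<phi> n x + \<psi> n x)) = (\<lambda>x. (u x - \<phi> n x) + (v x - \<psi> n x))" for n by auto
  have H1: "(\<lambda>x. u x - \<phi> n x) \<in> H1_space \<Omega>" "(\<lambda>x. v x - \<psi> n x) \<in> H1_space \<Omega>" for n
    using assms \<phi>(1) \<psi>(1) by (auto intro!: H1_diff intro: V_H1 solenoidal_H1)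
  show ?thesis
  proof (rule V_spaceI[where \<phi>="\<lambda>n x. \<phi> n x + \<psi> n x"])
    show "(\<lambda>n. L2_norm \<Omega> (\<lambda>x. u x + v x - (\<phi> n x + \<psi> n x))) \<longlonglongrightarrow> 0"
      by (rule Lim_null_comparison[OF _ tendsto_add_zero[OF \<phi>(2) \<psi>(2)]])
        (use L2_norm_add[OF H1_L2 H1_L2, OF H1] in \<open>auto simp: L2_norm_nonneg eq\<close>)
    show "(\<lambda>n. V_norm \<Omega> (\<lambda>x. u x + v x - (\<phi> n x + \<psi> n x))) \<longlonglongrightarrow> 0"
      by (rule Lim_null_comparison[OF _ tendsto_add_zero[OF \<phi>(3) \<psi>(3)]])
        (use V_norm_add[OF H1] in \<open>auto simp: V_norm_nonneg eq\<close>)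
  qed (use assms \<phi> \<psi> in \<open>auto intro: H1_add V_H1 solenoidal_tests_add\<close>)
qed

lemma V_scaleR:
  assumes "u \<in> V_space \<Omega>"
  shows "(\<lambda>x. c *\<^sub>R u x) \<in> V_space \<Omega>"
proof -
  obtain \<phi> where \<phi>: "\<And>n. \<phi> n \<in> solenoidal_tests \<Omega>" "(\<lambda>n. L2_norm \<Omega> (\<lambda>x. u x - \<phi> n x)) \<longlonglongrightarrow> 0"
    "(\<lambda>n. V_norm \<Omega> (\<lambda>x. u x - \<phi> n x)) \<longlonglongrightarrow> 0" by (rule V_space_approx[OF assms(1)]) blast
  have eq: "(\<lambda>x. c *\<^sub>R u x - c *\<^sub>R \<phi> n x) = (\<lambda>x. c *\<^sub>R (u x - \<phi> n x))" for n by (auto simp: scaleR_diff_right)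
  have H1: "(\<lambda>x. u x - \<phi> n x) \<in> H1_space \<Omega>" for n
    using assms \<phi>(1) by (auto intro!: H1_diff intro: V_H1 solenoidal_H1)
  show ?thesis
  proof (rule V_spaceI[where \<phi>="\<lambda>n x. c *\<^sub>R \<phi> n x"])
    show "(\<lambda>n. L2_norm \<Omega> (\<lambda>x. c *\<^sub>R u x - c *\<^sub>R \<phi> n x)) \<longlonglongrightarrow> 0"
      unfolding eq L2_norm_scaleR by (rule tendsto_mult_right_zero[OF \<phi>(2)])
    show "(\<lambda>n. V_norm \<Omega> (\<lambda>x. c *\<^sub>R u x - c *\<^sub>R \<phi> n x)) \<longlonglongrightarrow> 0"
      unfolding eq V_norm_scaleR[OF H1] by (rule tendsto_mult_right_zero[OF \<phi>(3)])
  qed (use assms \<phi> in \<open>auto intro: H1_scaleR V_H1 solenoidal_tests_scaleR\<close>)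
qed

lemma V_diff: "u \<in> V_space \<Omega> \<Longrightarrow> v \<in> V_space \<Omega> \<Longrightarrow> (\<lambda>x. u x - v x) \<in> V_space \<Omega>"
  using V_add[OF _ V_scaleR[of v "-1"], of u] by simp

lemma solenoidal_V: "\<phi> \<in> solenoidal_tests \<Omega> \<Longrightarrow> \<phi> \<in> V_space \<Omega>"
proof (rule V_spaceI[where \<phi>="\<lambda>n. \<phi>"])
  assume \<phi>: "\<phi> \<in> solenoidal_tests \<Omega>"
  have "V_norm \<Omega> (\<lambda>x. 0) = 0"
    using V_norm_scaleR[OF solenoidal_H1[OF \<phi>], of 0] by simp
  then show "(\<lambda>n. V_norm \<Omega> (\<lambda>x. \<phi> x - \<phi> x)) \<longlonglongrightarrow> 0" by simp
  show "(\<lambda>n. L2_norm \<Omega> (\<lambda>x. \<phi> x - \<phi> x)) \<longlonglongrightarrow> 0" by (simp add: L2_norm_def L2_inner_def)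
qed (auto intro: solenoidal_H1)

lemma zero_V: "(\<lambda>x. 0) \<in> V_space \<Omega>"
proof -
  have "(\<lambda>x. 0::real^2) \<in> solenoidal_tests \<Omega>"
    by (simp add: solenoidal_tests_def test_functions_def partial_def)
  then show ?thesis by (rule solenoidal_V)
qed

lemma V_norm_zero: "V_norm \<Omega> (\<lambda>x. 0) = 0"
  using V_norm_scaleR[OF V_H1[OF zero_V], of 0] by simp

lemma V_H:
  assumes "u \<in> V_space \<Omega>"
  shows "u \<in> H_space \<Omega>"
proof -
  have "\<exists>\<psi>\<in>solenoidal_tests \<Omega>. L2_norm \<Omega> (u - \<psi>) < e" if e: "e > 0" for e
  proof -
    have "\<kappa> * e > 0" using e \<kappa>_pos by simp
    then obtain \<psi> where \<psi>: "\<psi> \<in> solenoidal_tests \<Omega>" "H1_norm \<Omega> (u - \<psi>) < \<kappa> * e"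
      using assms unfolding V_space_def closure_wrt_def by blast
    then have "\<kappa> * L2_norm \<Omega> (u - \<psi>) < \<kappa> * e"
      using H1_norm_bounds(1) le_less_trans by blast
    then show ?thesis using \<psi>(1) \<kappa>_pos by auto
  qed
  then show ?thesis using V_L2[OF assms] by (simp add: H_space_def closure_wrt_def)
qed

lemma H_L2: "u \<in> H_space \<Omega> \<Longrightarrow> u \<in> L2_space \<Omega>"
  by (simp add: H_space_def closure_wrt_def)

lemma H_diff:
  assumes "u \<in> H_space \<Omega>" "v \<in> H_space \<Omega>"
  shows "(\<lambda>x. u x - v x) \<in> H_space \<Omega>"
proof -
  have "\<exists>\<psi>\<in>solenoidal_tests \<Omega>. L2_norm \<Omega> ((\<lambda>x. u x - v x) - \<psi>) < e" if e: "e > 0" for e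
  proof -
    obtain \<phi> where \<phi>: "\<phi> \<in> solenoidal_tests \<Omega>" "L2_norm \<Omega> (u - \<phi>) < e / 2"
      using assms(1) half_gt_zero[OF e] unfolding H_space_def closure_wrt_def by blast
    obtain \<psi> where \<psi>: "\<psi> \<in> solenoidal_tests \<Omega>" "L2_norm \<Omega> (v - \<psi>) < e / 2"
      using assms(2) half_gt_zero[OF e] unfolding H_space_def closure_wrt_def by blast
    let ?\<chi> = "\<lambda>x. \<phi> x + (-1) *\<^sub>R \<psi> x"
    have "?\<chi> \<in> solenoidal_tests \<Omega>" by (intro solenoidal_tests_add solenoidal_tests_scaleR \<phi> \<psi>)
    moreover have "L2_norm \<Omega> ((\<lambda>x. u x - v x) - ?\<chi>) < e"
    proof -
      have "(\<lambda>x. u x - v x) - ?\<chi> = (\<lambda>x. (u x - \<phi> x) + (-1) *\<^sub>R (v x - \<psi> x))"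
        by (auto simp: fun_diff_def)
      moreover have "(\<lambda>x. u x - \<phi> x) \<in> L2_space \<Omega>" "(\<lambda>x. v x - \<psi> x) \<in> L2_space \<Omega>"
        using assms \<phi> \<psi> by (auto intro!: L2_diff intro: H_L2 test_L2 solenoidal_test)
      ultimately have "L2_norm \<Omega> ((\<lambda>x. u x - v x) - ?\<chi>) \<le> L2_norm \<Omega> (\<lambda>x. u x - \<phi> x) + \<bar>-1\<bar> * L2_norm \<Omega> (\<lambda>x. v x - \<psi> x)"
        using L2_norm_add[OF _ L2_scaleR, of "\<lambda>x. u x - \<phi> x" \<Omega> "\<lambda>x. v x - \<psi> x" "-1"]
          L2_norm_scaleR[of \<Omega> "-1" "\<lambda>x. v x - \<psi> x"] by simp
      then show ?thesis using \<phi>(2) \<psi>(2) by (simp add: fun_diff_def)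
    qed
    ultimately show ?thesis by blast
  qed
  then show ?thesis using L2_diff[OF H_L2 H_L2, OF assms] by (simp add: H_space_def closure_wrt_def)
qed

end

subsection \<open>The inequalities of Poincare and Ladyzhenskaya\<close>

text \<open>Cauchy--Schwarz in every row: the Frobenius norm dominates the operator norm.\<close>

lemma norm_matrix_vector_mult_le: "norm (A *v x) \<le> norm A * norm x"
  for A :: "real^'n^'m" and x :: "real^'n"
proof -
  have "norm (A *v x) \<le> L2_set (\<lambda>i. norm (A $ i) * norm x) UNIV"
    unfolding norm_vec_def[of "A *v x"] by (intro L2_set_mono) (auto simp: matrix_vector_mul_component Cauchy_Schwarz_ineq2)
  also have "\<dots> = norm A * norm x"
    by (simp add: norm_vec_def[of A] L2_set_left_distrib)
  finally show ?thesis .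
qed

lemma partial_eq_classical_grad: "partial j \<phi> x = classical_grad \<phi> x *v axis j 1"
  by (simp add: vec_eq_iff matrix_vector_mul_component classical_grad_def inner_axis)

lemma norm_partial_le: "norm (partial j \<phi> x) \<le> norm (classical_grad \<phi> x)" for \<phi> :: field2
  using norm_matrix_vector_mult_le[of "classical_grad \<phi> x" "axis j 1"]
  by (simp add: partial_eq_classical_grad norm_axis_1)

section \<open>Iterated integrals in the plane\<close>

definition point2 :: "real \<Rightarrow> real \<Rightarrow> real^2" where
  "point2 s t = (\<chi> i. if i = 1 then s else t)"

lemma point2_nth [simp]: "point2 s t $ 1 = s" "point2 s t $ 2 = t"
  by (simp_all add: point2_def)

lemma point2_eq: "point2 s t = s *\<^sub>R axis 1 1 + t *\<^sub>R axis 2 1"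
  by (simp add: vec_eq_iff forall_2 axis_def)

lemma Basis_real2: "(Basis :: (real^2) set) = {axis 1 1, axis 2 1}"
  by (auto simp: Basis_vec_def UNIV_2)

lemma continuous_point2: "continuous_on UNIV (\<lambda>p. point2 (fst p) (snd p))"
  unfolding point2_eq by (intro continuous_intros)

lemma measurable_point2 [measurable]: "(\<lambda>p. point2 (fst p) (snd p)) \<in> borel_measurable (lborel \<Otimes>\<^sub>M lborel)"
  using borel_measurable_continuous_onI[OF continuous_point2] by (simp add: borel_prod[symmetric])

text \<open>\<open>real^2\<close> is not a product type, so Tonelli's theorem has to be transported
  along \<open>point2\<close>. Lebesgue measure is determined by its values on boxes, and there the
  two sides agree.\<close>

lemma lborel_real2: "(lborel :: (real^2) measure) = distr (lborel \<Otimes>\<^sub>M lborel) borel (\<lambda>p. point2 (fst p) (snd p))"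
proof (rule lborel_eqI)
  fix l u :: "real^2" assume lu: "\<And>b. b \<in> Basis \<Longrightarrow> l \<bullet> b \<le> u \<bullet> b"
  have le: "l $ 1 \<le> u $ 1" "l $ 2 \<le> u $ 2"
    using lu[of "axis 1 1"] lu[of "axis 2 1"] by (simp_all add: Basis_real2 inner_axis)
  have ne: "axis 1 (1::real) \<noteq> (axis 2 1 :: real^2)" by (simp add: axis_eq_axis)
  have "(\<lambda>p. point2 (fst p) (snd p)) -` box l u \<inter> space (lborel \<Otimes>\<^sub>M lborel) = {l$1<..<u$1} \<times> {l$2<..<u$2}"
    by (auto simp: mem_box_cart forall_2 space_pair_measure)
  then have "emeasure (distr (lborel \<Otimes>\<^sub>M lborel) borel (\<lambda>p. point2 (fst p) (snd p))) (box l u)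
      = emeasure (lborel \<Otimes>\<^sub>M lborel) ({l$1<..<u$1} \<times> {l$2<..<u$2})"
    by (subst emeasure_distr) auto
  also have "\<dots> = ennreal (u$1 - l$1) * ennreal (u$2 - l$2)"
    using le by (subst lborel.emeasure_pair_measure_Times) auto
  also have "\<dots> = ennreal (\<Prod>b\<in>Basis. (u - l) \<bullet> b)"
    using le ne by (simp add: Basis_real2 inner_axis ennreal_mult inner_diff_left)
  finally show "emeasure (distr (lborel \<Otimes>\<^sub>M lborel) borel (\<lambda>p. point2 (fst p) (snd p))) (box l u)
      = (\<Prod>b\<in>Basis. (u - l) \<bullet> b)" .
qed simp

lemma nn_integral_real2:
  assumes [measurable]: "f \<in> borel_measurable borel"
  shows "(\<integral>\<^sup>+x. f x \<partial>lborel) = (\<integral>\<^sup>+s. \<integral>\<^sup>+t. f (point2 s t) \<partial>lborel \<partial>lborel)"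
    and "(\<integral>\<^sup>+x. f x \<partial>lborel) = (\<integral>\<^sup>+t. \<integral>\<^sup>+s. f (point2 s t) \<partial>lborel \<partial>lborel)"
proof -
  have [measurable]: "(\<lambda>p. f (point2 (fst p) (snd p))) \<in> borel_measurable (lborel \<Otimes>\<^sub>M lborel)"
    by (rule measurable_compose[OF measurable_point2 assms])
  have eq: "(\<integral>\<^sup>+x. f x \<partial>lborel) = (\<integral>\<^sup>+p. f (point2 (fst p) (snd p)) \<partial>(lborel \<Otimes>\<^sub>M lborel))"
    by (subst lborel_real2, subst nn_integral_distr) auto
  show "(\<integral>\<^sup>+x. f x \<partial>lborel) = (\<integral>\<^sup>+s. \<integral>\<^sup>+t. f (point2 s t) \<partial>lborel \<partial>lborel)"
    unfolding eq by (subst lborel.nn_integral_fst[symmetric]) auto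
  show "(\<integral>\<^sup>+x. f x \<partial>lborel) = (\<integral>\<^sup>+t. \<integral>\<^sup>+s. f (point2 s t) \<partial>lborel \<partial>lborel)"
    unfolding eq by (subst lborel_pair.nn_integral_snd[symmetric]) (auto simp: case_prod_beta)
qed

text \<open>The fundamental theorem of calculus, started at \<open>a\<close>, where \<open>h\<close>
  vanishes. The integral is extended to the whole line so that the bound no longer depends on
  \<open>s\<close>.\<close>

lemma abs_le_nn_integral_derivative:
  fixes h :: "real \<Rightarrow> real"
  assumes h: "\<And>s. (h has_real_derivative h' s) (at s)" and cont: "continuous_on UNIV h'"
    and 0: "\<And>s. s \<le> a \<Longrightarrow> h s = 0"
  shows "ennreal \<bar>h s\<bar> \<le> (\<integral>\<^sup>+r. ennreal \<bar>h' r\<bar> \<partial>lborel)"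
proof (cases "s \<le> a")
  case False
  have "has_bochner_integral lborel (\<lambda>r. h' r * indicator {a .. s} r) (h s - h a)"
    using False h cont
    by (intro has_bochner_integral_FTC_Icc_real) (auto simp: continuous_on_eq_continuous_at)
  then have "h s = (LINT r|lborel. h' r * indicator {a..s} r)" "integrable lborel (\<lambda>r. h' r * indicator {a .. s} r)"
    using 0[of a] by (auto simp: has_bochner_integral_iff)
  then have "ennreal \<bar>h s\<bar> \<le> (\<integral>\<^sup>+r. norm (h' r * indicator {a..s} r) \<partial>lborel)"
    using integral_norm_bound_ennreal[of lborel "\<lambda>r. h' r * indicator {a..s} r"] by simp
  also have "\<dots> \<le> (\<integral>\<^sup>+r. ennreal \<bar>h' r\<bar> \<partial>lborel)"
    by (intro nn_integral_mono) (auto simp: indicator_def)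
  finally show ?thesis .
qed (simp add: 0)

text \<open>Both factors of \<open>g\<^sup>2 = g \<cdot> g\<close> are bounded by integrals along the two coordinate lines.\<close>

lemma nn_integral_square_le_partials:
  fixes g :: "real^2 \<Rightarrow> real"
  assumes g: "\<And>x. (g has_derivative g' x) (at x)"
    and cont: "\<And>j. continuous_on UNIV (\<lambda>x. g' x (axis j 1))"
    and bdd: "bounded {x. g x \<noteq> 0}"
  shows "(\<integral>\<^sup>+x. ennreal ((g x)\<^sup>2) \<partial>lborel)
    \<le> (\<integral>\<^sup>+x. ennreal \<bar>g' x (axis 1 1)\<bar> \<partial>lborel) * (\<integral>\<^sup>+x. ennreal \<bar>g' x (axis 2 1)\<bar> \<partial>lborel)"
proof -
  obtain R where R: "R > 0" "\<And>x. g x \<noteq> 0 \<Longrightarrow> norm x \<le> R"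
    using bdd unfolding bounded_pos by auto
  have g0: "g x = 0" if "x $ i \<le> - R - 1" for x i
    using R(2)[of x] component_le_norm_cart[of x i] that R(1) by fastforce
  have [measurable]: "(\<lambda>x. g' x (axis j 1)) \<in> borel_measurable borel" for j
    using cont by (rule borel_measurable_continuous_onI)
  have "continuous_on UNIV g"
    using has_derivative_continuous[OF g] by (auto simp: continuous_on_eq_continuous_at)
  then have gm [measurable]: "g \<in> borel_measurable borel" by (rule borel_measurable_continuous_onI)
  have lin: "g' x (c *\<^sub>R e) = g' x e * c" for x e c
    using linear_scale[OF has_derivative_linear[OF g[of x]]] by simp
  \<comment> \<open>\<open>A\<close> bounds |g| on the line of height \<open>t\<close> and
    \<open>B\<close> on the line over \<open>s\<close>. Since neither depends on the other
    coordinate, the integral of \<open>B s * A t\<close> splits into a product.\<close>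
  define A where "A t = (\<integral>\<^sup>+s. ennreal \<bar>g' (point2 s t) (axis 1 1)\<bar> \<partial>lborel)" for t
  define B where "B s = (\<integral>\<^sup>+t. ennreal \<bar>g' (point2 s t) (axis 2 1)\<bar> \<partial>lborel)" for s
  have m: "(\<lambda>p. ennreal \<bar>g' (point2 (fst p) (snd p)) (axis j 1)\<bar>) \<in> borel_measurable (lborel \<Otimes>\<^sub>M lborel)" for j
    by (intro measurable_compose[OF measurable_point2]) measurable
  have [measurable]: "B \<in> borel_measurable lborel"
    unfolding B_def using lborel.borel_measurable_nn_integral_fst[OF m[of 2]] by simp
  have [measurable]: "A \<in> borel_measurable lborel"
    unfolding A_def
    using measurable_compose[OF measurable_pair_swap' m[of 1]]
    by (intro lborel.borel_measurable_nn_integral) (simp add: case_prod_beta)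
  have gA: "ennreal \<bar>g (point2 s t)\<bar> \<le> A t" for s t
    unfolding A_def
  proof (rule abs_le_nn_integral_derivative[where a="-R-1" and h="\<lambda>s. g (point2 s t)"])
    show "((\<lambda>s. g (point2 s t)) has_real_derivative g' (point2 s t) (axis 1 1)) (at s)" for s
    proof -
      have "((\<lambda>s. point2 s t) has_derivative (\<lambda>h. h *\<^sub>R axis 1 1)) (at s)"
        unfolding point2_eq by (auto intro!: derivative_eq_intros)
      from has_derivative_compose[OF this g] show ?thesis
        by (simp add: has_field_derivative_def lin)
    qed
    show "continuous_on UNIV (\<lambda>s. g' (point2 s t) (axis 1 1))"
      by (rule continuous_on_compose2[OF cont]) (auto simp: point2_eq intro!: continuous_intros)
  qed (use g0[of _ 1] in auto)
  have gB: "ennreal \<bar>g (point2 s t)\<bar> \<le> B s" for s t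
    unfolding B_def
  proof (rule abs_le_nn_integral_derivative[where a="-R-1" and h="\<lambda>t. g (point2 s t)"])
    show "((\<lambda>t. g (point2 s t)) has_real_derivative g' (point2 s t) (axis 2 1)) (at t)" for t
    proof -
      have "((\<lambda>t. point2 s t) has_derivative (\<lambda>h. h *\<^sub>R axis 2 1)) (at t)"
        unfolding point2_eq by (auto intro!: derivative_eq_intros)
      from has_derivative_compose[OF this g] show ?thesis
        by (simp add: has_field_derivative_def lin)
    qed
    show "continuous_on UNIV (\<lambda>t. g' (point2 s t) (axis 2 1))"
      by (rule continuous_on_compose2[OF cont]) (auto simp: point2_eq intro!: continuous_intros)
  qed (use g0[of _ 2] in auto)
  have "(\<integral>\<^sup>+x. ennreal ((g x)\<^sup>2) \<partial>lborel) = (\<integral>\<^sup>+s. \<integral>\<^sup>+t. ennreal ((g (point2 s t))\<^sup>2) \<partial>lborel \<partial>lborel)"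
    by (rule nn_integral_real2) measurable
  also have "\<dots> \<le> (\<integral>\<^sup>+s. \<integral>\<^sup>+t. B s * A t \<partial>lborel \<partial>lborel)"
  proof (intro nn_integral_mono)
    fix s t :: real
    have "ennreal ((g (point2 s t))\<^sup>2) = ennreal \<bar>g (point2 s t)\<bar> * ennreal \<bar>g (point2 s t)\<bar>"
      by (simp add: power2_eq_square flip: ennreal_mult abs_mult)
    also have "\<dots> \<le> B s * A t" by (intro mult_mono gA gB) auto
    finally show "ennreal ((g (point2 s t))\<^sup>2) \<le> B s * A t" .
  qed
  also have "\<dots> = (\<integral>\<^sup>+t. A t \<partial>lborel) * (\<integral>\<^sup>+s. B s \<partial>lborel)"
    by (simp add: nn_integral_cmult nn_integral_multc mult.commute)
  also have "(\<integral>\<^sup>+t. A t \<partial>lborel) = (\<integral>\<^sup>+x. ennreal \<bar>g' x (axis 1 1)\<bar> \<partial>lborel)"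
    unfolding A_def by (rule nn_integral_real2(2)[symmetric]) measurable
  also have "(\<integral>\<^sup>+s. B s \<partial>lborel) = (\<integral>\<^sup>+x. ennreal \<bar>g' x (axis 2 1)\<bar> \<partial>lborel)"
    unfolding B_def by (rule nn_integral_real2(1)[symmetric]) measurable
  finally show ?thesis .
qed

section \<open>Estimates for test functions and their extension to V\<close>

context bounded_open_set begin

lemma V_norm_test: "\<phi> \<in> test_functions \<Omega> \<Longrightarrow> V_norm \<Omega> \<phi> = L2_norm \<Omega> (classical_grad \<phi>)"
  unfolding V_norm_eq
  by (intro L2_norm_cong_AE L2_spaceD(1) weak_grad_props classical_grad_L2 test_H1 weak_grad_test)

lemma integral_norm_mult_partial_le:
  assumes \<phi>: "\<phi> \<in> test_functions \<Omega>"
  shows "(LINT x|lebesgue_on \<Omega>. norm (\<phi> x) * norm (partial j \<phi> x)) \<le> L2_norm \<Omega> \<phi> * V_norm \<Omega> \<phi>"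
proof -
  have "(LINT x|lebesgue_on \<Omega>. norm (\<phi> x) * norm (partial j \<phi> x))
    \<le> (LINT x|lebesgue_on \<Omega>. norm (\<phi> x) * norm (classical_grad \<phi> x))"
    by (intro integral_mono L2_norm_mult(1) test_L2 test_partial_L2 classical_grad_L2 \<phi>
        mult_left_mono norm_partial_le) auto
  also have "\<dots> \<le> L2_norm \<Omega> \<phi> * V_norm \<Omega> \<phi>"
    unfolding V_norm_test[OF \<phi>] by (intro L2_norm_mult(2) test_L2 classical_grad_L2 \<phi>)
  finally show ?thesis .
qed

lemma norm_square_has_derivative:
  assumes \<phi>: "\<phi> \<in> test_functions \<Omega>"
  shows "((\<lambda>x. \<phi> x \<bullet> \<phi> x) has_derivative (\<lambda>h. 2 * (\<phi> x \<bullet> frechet_derivative \<phi> (at x) h))) (at x)"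
  using has_derivative_inner[OF test_has_derivative[OF \<phi>] test_has_derivative[OF \<phi>], of x]
  by (simp add: inner_commute)

text \<open>The factor 2 comes from differentiating the square: in a domain inside the ball of
  radius R, integration by parts bounds the squared L2 norm of \<phi> by 2 R |\<phi>|
  ||\<phi>||.\<close>

definition poincare_const :: real where
  "poincare_const = 2 * (SOME R. R > 0 \<and> (\<forall>x\<in>\<Omega>. norm x \<le> R))"

lemma poincare_const_props:
  "poincare_const > 0" "x \<in> \<Omega> \<Longrightarrow> 2 * norm x \<le> poincare_const"
proof -
  have "\<exists>R. R > 0 \<and> (\<forall>x\<in>\<Omega>. norm x \<le> R)" using bounded_\<Omega> by (auto simp: bounded_pos)
  from someI_ex[OF this] show "poincare_const > 0" "x \<in> \<Omega> \<Longrightarrow> 2 * norm x \<le> poincare_const"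
    by (auto simp: poincare_const_def)
qed

text \<open>Integrate \<open>\<bar>\<phi>\<bar>\<^sup>2 = \<bar>\<phi>\<bar>\<^sup>2 \<partial>\<^sub>1 x\<^sub>1\<close> by parts.\<close>

lemma poincare_test:
  assumes \<phi>: "\<phi> \<in> test_functions \<Omega>"
  shows "L2_norm \<Omega> \<phi> \<le> poincare_const * V_norm \<Omega> \<phi>"
proof -
  let ?F = "\<lambda>x::real^2. x $ 1 * (\<phi> x \<bullet> \<phi> x)"
  let ?F' = "\<lambda>x h. x $ 1 * (2 * (\<phi> x \<bullet> frechet_derivative \<phi> (at x) h)) + h $ 1 * (\<phi> x \<bullet> \<phi> x)"
  have D: "(?F has_derivative ?F' x) (at x)" for x
    by (intro has_derivative_mult norm_square_has_derivative[OF \<phi>]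
        bounded_linear.has_derivative[OF bounded_linear_vec_nth] has_derivative_ident)
  have cF': "continuous_on UNIV (\<lambda>x. ?F' x (axis 1 1))"
    using test_derivative_continuous[OF \<phi> axis_1_in_Basis] test_continuous[OF \<phi>]
    by (intro continuous_intros) auto
  have "(LINT x|lebesgue_on \<Omega>. ?F' x (axis 1 1)) = 0"
    by (rule integral_partial_eq_0[OF D cF']) (use test_eq_0[OF \<phi>] in auto)
  moreover have i1: "integrable (lebesgue_on \<Omega>) (\<lambda>x. \<phi> x \<bullet> \<phi> x)"
    by (intro L2_inner_integrable test_L2 \<phi>)
  moreover have i2: "integrable (lebesgue_on \<Omega>) (\<lambda>x. x $ 1 * (2 * (\<phi> x \<bullet> partial 1 \<phi> x)))"
  proof -
    have "(\<lambda>x. x $ 1 * (2 * (\<phi> x \<bullet> partial 1 \<phi> x))) \<in> L2_space \<Omega>"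
      using test_partial[OF \<phi>] test_continuous[OF \<phi>] test_eq_0[OF \<phi>]
      by (intro L2_continuous_support continuous_intros) auto
    from L2_inner_integrable[OF this L2_const[of 1]] show ?thesis by simp
  qed
  ultimately have eq: "L2_inner \<Omega> \<phi> \<phi> = - (LINT x|lebesgue_on \<Omega>. x $ 1 * (2 * (\<phi> x \<bullet> partial 1 \<phi> x)))"
    by (simp add: partial_def L2_inner_def)
  have "(L2_norm \<Omega> \<phi>)\<^sup>2 \<le> (LINT x|lebesgue_on \<Omega>. poincare_const * (norm (\<phi> x) * norm (partial 1 \<phi> x)))"
    unfolding L2_norm_squared eq integral_minus[symmetric]
  proof (rule integral_mono)
    show "integrable (lebesgue_on \<Omega>) (\<lambda>x. poincare_const * (norm (\<phi> x) * norm (partial 1 \<phi> x)))"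
      by (intro integrable_mult_right L2_norm_mult(1) test_L2 test_partial_L2 \<phi>)
    fix x assume "x \<in> space (lebesgue_on \<Omega>)"
    then have x: "x \<in> \<Omega>" by (simp add: space_restrict_space)
    have "- (x $ 1 * (2 * (\<phi> x \<bullet> partial 1 \<phi> x))) \<le> \<bar>2 * x $ 1\<bar> * \<bar>\<phi> x \<bullet> partial 1 \<phi> x\<bar>"
      using abs_ge_minus_self[of "2 * x $ 1 * (\<phi> x \<bullet> partial 1 \<phi> x)"]
      unfolding abs_mult[symmetric] by (simp only: mult_ac)
    also have "\<dots> \<le> poincare_const * (norm (\<phi> x) * norm (partial 1 \<phi> x))"
      using poincare_const_props(2)[OF x] component_le_norm_cart[of x 1]
      by (intro mult_mono Cauchy_Schwarz_ineq2) (auto simp: less_imp_le[OF poincare_const_props(1)])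
    finally show "- (x $ 1 * (2 * (\<phi> x \<bullet> partial 1 \<phi> x))) \<le> poincare_const * (norm (\<phi> x) * norm (partial 1 \<phi> x))" .
  qed (use i2 in simp)
  also have "\<dots> \<le> poincare_const * (L2_norm \<Omega> \<phi> * V_norm \<Omega> \<phi>)"
    using integral_norm_mult_partial_le[OF \<phi>] poincare_const_props(1) by simp
  finally have "L2_norm \<Omega> \<phi> * L2_norm \<Omega> \<phi> \<le> L2_norm \<Omega> \<phi> * (poincare_const * V_norm \<Omega> \<phi>)"
    by (simp add: power2_eq_square mult_ac)
  then show ?thesis
    using L2_norm_nonneg[of \<Omega> \<phi>] V_norm_nonneg[of \<Omega> \<phi>] poincare_const_props(1)
    by (cases "L2_norm \<Omega> \<phi> = 0") auto
qed

text \<open>The estimate by the two partial derivatives is applied to the pointwise square of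
  \<phi>. By Cauchy--Schwarz both of its derivatives have L1 norm at most 2 |\<phi>|
  ||\<phi>||.\<close>

lemma ladyzhenskaya_test:
  assumes \<phi>: "\<phi> \<in> test_functions \<Omega>"
  shows "(\<integral>\<^sup>+x. ennreal (norm (\<phi> x) ^ 4) \<partial>lebesgue_on \<Omega>) \<le> ennreal ((2 * L2_norm \<Omega> \<phi> * V_norm \<Omega> \<phi>)\<^sup>2)"
proof -
  let ?g = "\<lambda>x. \<phi> x \<bullet> \<phi> x"
  let ?g' = "\<lambda>x h. 2 * (\<phi> x \<bullet> frechet_derivative \<phi> (at x) h)"
  define L where "L = 2 * L2_norm \<Omega> \<phi> * V_norm \<Omega> \<phi>"
  have L: "L \<ge> 0" by (simp add: L_def L2_norm_nonneg V_norm_nonneg)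
  have c: "continuous_on UNIV (\<lambda>x. ?g' x (axis j 1))" for j
    using test_derivative_continuous[OF \<phi> axis_1_in_Basis] test_continuous[OF \<phi>]
    by (intro continuous_intros) auto
  have "{x. ?g x \<noteq> 0} = {x. \<phi> x \<noteq> 0}" by auto
  then have bdd: "bounded {x. ?g x \<noteq> 0}" using test_bounded[OF \<phi>] by simp
  have part: "(\<integral>\<^sup>+x. ennreal \<bar>?g' x (axis j 1)\<bar> \<partial>lborel) \<le> ennreal L" for j
  proof -
    have sup: "?g' x (axis j 1) = 0" if "x \<notin> \<Omega>" for x using test_eq_0[OF \<phi> that] by simp
    have m: "(\<lambda>x. ?g' x (axis j 1)) \<in> borel_measurable borel" using c by (rule borel_measurable_continuous_onI)
    have L2: "(\<lambda>x. ?g' x (axis j 1)) \<in> L2_space \<Omega>" using c sup by (rule L2_continuous_support)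
    have int: "integrable (lebesgue_on \<Omega>) (\<lambda>x. ?g' x (axis j 1))"
      using L2_inner_integrable[OF L2 L2_const[of 1]] by simp
    then have "integrable lborel (\<lambda>x. \<bar>?g' x (axis j 1)\<bar>)"
      using integrable_on_iff_lborel[OF m sup] by simp
    then have "(\<integral>\<^sup>+x. ennreal \<bar>?g' x (axis j 1)\<bar> \<partial>lborel) = ennreal (LINT x|lborel. \<bar>?g' x (axis j 1)\<bar>)"
      by (intro nn_integral_eq_integral) auto
    also have "(LINT x|lborel. \<bar>?g' x (axis j 1)\<bar>) = (LINT x|lebesgue_on \<Omega>. \<bar>?g' x (axis j 1)\<bar>)"
      by (rule integral_on_eq_lborel[symmetric]) (use m sup in auto)
    also have "\<dots> \<le> (LINT x|lebesgue_on \<Omega>. 2 * (norm (\<phi> x) * norm (partial j \<phi> x)))"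
    proof (rule integral_mono)
      show "integrable (lebesgue_on \<Omega>) (\<lambda>x. 2 * (norm (\<phi> x) * norm (partial j \<phi> x)))"
        by (intro integrable_mult_right L2_norm_mult(1) test_L2 test_partial_L2 \<phi>)
      show "\<bar>?g' x (axis j 1)\<bar> \<le> 2 * (norm (\<phi> x) * norm (partial j \<phi> x))" for x
        using Cauchy_Schwarz_ineq2[of "\<phi> x" "partial j \<phi> x"] by (simp add: partial_def)
    qed (use int in simp)
    also have "\<dots> \<le> L" using integral_norm_mult_partial_le[OF \<phi>, of j] by (simp add: L_def)
    finally show ?thesis by (simp add: ennreal_leI)
  qed
  have "(\<integral>\<^sup>+x. ennreal (norm (\<phi> x) ^ 4) \<partial>lebesgue_on \<Omega>) = (\<integral>\<^sup>+x. ennreal ((?g x)\<^sup>2) \<partial>lborel)"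
  proof -
    have m: "(\<lambda>x. (?g x)\<^sup>2) \<in> borel_measurable borel"
      using test_continuous[OF \<phi>] by (intro borel_measurable_continuous_onI continuous_intros)
    have "norm (\<phi> x) ^ 4 = (?g x)\<^sup>2" for x
      by (simp add: power2_norm_eq_inner[symmetric] flip: power_mult)
    moreover have "ennreal ((?g x)\<^sup>2) * indicator \<Omega> x = ennreal ((?g x)\<^sup>2)" for x
      using test_eq_0[OF \<phi>, of x] by (auto simp: indicator_def)
    ultimately show ?thesis
      using \<Omega>_lebesgue by (subst nn_integral_restrict_space) (auto simp: nn_integral_completion)
  qed
  also have "\<dots> \<le> ennreal L * ennreal L"
    by (rule order_trans[OF nn_integral_square_le_partials[OF norm_square_has_derivative[OF \<phi>] c bdd]])
      (intro mult_mono part, auto)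
  also have "\<dots> = ennreal (L\<^sup>2)" using L by (simp add: power2_eq_square ennreal_mult)
  finally show ?thesis by (simp add: L_def)
qed

lemma L2_norm_approx:
  assumes "u \<in> L2_space \<Omega>" "\<And>n. \<phi> n \<in> L2_space \<Omega>" and lim: "(\<lambda>n. L2_norm \<Omega> (\<lambda>x. u x - \<phi> n x)) \<longlonglongrightarrow> 0"
  shows "(\<lambda>n. L2_norm \<Omega> (\<phi> n)) \<longlonglongrightarrow> L2_norm \<Omega> u"
proof (rule LIM_zero_cancel, rule Lim_null_comparison[OF always_eventually lim], rule allI)
  fix n
  have d: "(\<lambda>x. u x - \<phi> n x) \<in> L2_space \<Omega>" by (intro L2_diff assms)
  have "L2_norm \<Omega> u \<le> L2_norm \<Omega> (\<lambda>x. u x - \<phi> n x) + L2_norm \<Omega> (\<phi> n)"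
    using L2_norm_add[OF d assms(2)[of n]] by simp
  moreover have "L2_norm \<Omega> (\<phi> n) \<le> L2_norm \<Omega> (\<lambda>x. u x - \<phi> n x) + L2_norm \<Omega> u"
    using L2_norm_add[OF L2_scaleR[OF d, of "-1"] assms(1)] L2_norm_scaleR[of \<Omega> "-1" "\<lambda>x. u x - \<phi> n x"] by simp
  ultimately show "norm (L2_norm \<Omega> (\<phi> n) - L2_norm \<Omega> u) \<le> L2_norm \<Omega> (\<lambda>x. u x - \<phi> n x)"
    by simp
qed

lemma V_norm_triangle:
  assumes "u \<in> H1_space \<Omega>" "v \<in> H1_space \<Omega>"
  shows "V_norm \<Omega> u \<le> V_norm \<Omega> (\<lambda>x. u x - v x) + V_norm \<Omega> v"
    and "V_norm \<Omega> v \<le> V_norm \<Omega> (\<lambda>x. u x - v x) + V_norm \<Omega> u"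
proof -
  have d: "(\<lambda>x. u x - v x) \<in> H1_space \<Omega>" by (intro H1_diff assms)
  show "V_norm \<Omega> u \<le> V_norm \<Omega> (\<lambda>x. u x - v x) + V_norm \<Omega> v"
    using V_norm_add[OF d assms(2)] by simp
  show "V_norm \<Omega> v \<le> V_norm \<Omega> (\<lambda>x. u x - v x) + V_norm \<Omega> u"
    using V_norm_add[OF H1_scaleR(1)[OF d, of "-1"] assms(1)] V_norm_scaleR[OF d, of "-1"] by simp
qed

lemma V_norm_approx:
  assumes "u \<in> H1_space \<Omega>" "\<And>n. \<phi> n \<in> H1_space \<Omega>" and lim: "(\<lambda>n. V_norm \<Omega> (\<lambda>x. u x - \<phi> n x)) \<longlonglongrightarrow> 0"
  shows "(\<lambda>n. V_norm \<Omega> (\<phi> n)) \<longlonglongrightarrow> V_norm \<Omega> u"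
  by (rule LIM_zero_cancel, rule Lim_null_comparison[OF always_eventually lim], rule allI)
    (use V_norm_triangle[OF assms(1,2)] in \<open>simp add: abs_le_iff diff_le_eq\<close>)

lemma poincare:
  assumes "u \<in> V_space \<Omega>"
  shows "L2_norm \<Omega> u \<le> poincare_const * V_norm \<Omega> u"
proof -
  obtain \<phi> where \<phi>: "\<And>n. \<phi> n \<in> solenoidal_tests \<Omega>" "(\<lambda>n. L2_norm \<Omega> (\<lambda>x. u x - \<phi> n x)) \<longlonglongrightarrow> 0"
    "(\<lambda>n. V_norm \<Omega> (\<lambda>x. u x - \<phi> n x)) \<longlonglongrightarrow> 0" by (rule V_space_approx[OF assms]) blast
  show ?thesis
  proof (rule LIMSEQ_le)
    show "(\<lambda>n. L2_norm \<Omega> (\<phi> n)) \<longlonglongrightarrow> L2_norm \<Omega> u"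
      by (intro L2_norm_approx \<phi> V_L2 assms test_L2 solenoidal_test)
    show "(\<lambda>n. poincare_const * V_norm \<Omega> (\<phi> n)) \<longlonglongrightarrow> poincare_const * V_norm \<Omega> u"
      by (intro tendsto_mult tendsto_const V_norm_approx \<phi> V_H1 assms solenoidal_H1)
  qed (use poincare_test[OF solenoidal_test[OF \<phi>(1)]] in auto)
qed

text \<open>Convergence in L2 does not control fourth powers. Along a subsequence the approximating
  test functions converge almost everywhere, and Fatou's lemma transfers their bound, whose
  right-hand side converges.\<close>

lemma ladyzhenskaya:
  assumes u: "u \<in> V_space \<Omega>"
  shows "(\<lambda>x. (norm (u x))\<^sup>2) \<in> L2_space \<Omega>"
    and "L2_norm \<Omega> (\<lambda>x. (norm (u x))\<^sup>2) \<le> 2 * L2_norm \<Omega> u * V_norm \<Omega> u"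
proof -
  obtain \<phi> where \<phi>: "\<And>n. \<phi> n \<in> solenoidal_tests \<Omega>" "(\<lambda>n. L2_norm \<Omega> (\<lambda>x. u x - \<phi> n x)) \<longlonglongrightarrow> 0"
    "(\<lambda>n. V_norm \<Omega> (\<lambda>x. u x - \<phi> n x)) \<longlonglongrightarrow> 0" by (rule V_space_approx[OF u]) blast
  have \<phi>L2: "\<phi> n \<in> L2_space \<Omega>" for n by (intro test_L2 solenoidal_test \<phi>)
  have um [measurable]: "u \<in> borel_measurable (lebesgue_on \<Omega>)" and [measurable]: "\<phi> n \<in> borel_measurable (lebesgue_on \<Omega>)" for n
    using L2_spaceD(1)[OF V_L2[OF u]] L2_spaceD(1)[OF \<phi>L2] .
  have "\<exists>r::nat\<Rightarrow>nat. strict_mono r \<and> (AE x in lebesgue_on \<Omega>. (\<lambda>n. (norm (u x - \<phi> (r n) x))\<^sup>2) \<longlonglongrightarrow> 0)"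
  proof (rule tendsto_L1_AE_subseq)
    show "integrable (lebesgue_on \<Omega>) (\<lambda>x. (norm (u x - \<phi> n x))\<^sup>2)" for n
      by (intro L2_spaceD(2) L2_diff \<phi>L2 V_L2 u)
    have "(\<lambda>n. (L2_norm \<Omega> (\<lambda>x. u x - \<phi> n x))\<^sup>2) \<longlonglongrightarrow> 0\<^sup>2"
      by (intro tendsto_power \<phi>)
    then show "(\<lambda>n. LINT x|lebesgue_on \<Omega>. norm ((norm (u x - \<phi> n x))\<^sup>2)) \<longlonglongrightarrow> 0"
      by (simp add: L2_norm_squared L2_inner_def power2_norm_eq_inner)
  qed
  then obtain r :: "nat \<Rightarrow> nat" where r: "strict_mono r" "AE x in lebesgue_on \<Omega>. (\<lambda>n. (norm (u x - \<phi> (r n) x))\<^sup>2) \<longlonglongrightarrow> 0"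
    by blast
  define L where "L = 2 * L2_norm \<Omega> u * V_norm \<Omega> u"
  have L: "L \<ge> 0" by (simp add: L_def L2_norm_nonneg V_norm_nonneg)
  have limAE: "AE x in lebesgue_on \<Omega>. ennreal (norm (u x) ^ 4) = liminf (\<lambda>n. ennreal (norm (\<phi> (r n) x) ^ 4))"
    using r(2)
  proof eventually_elim
    case (elim x)
    have "(\<lambda>n. norm (u x - \<phi> (r n) x)) \<longlonglongrightarrow> 0"
      using tendsto_real_sqrt[OF elim] by simp
    then have "(\<lambda>n. u x - \<phi> (r n) x) \<longlonglongrightarrow> 0" by (simp add: tendsto_norm_zero_iff)
    from tendsto_diff[OF tendsto_const[of "u x"] this] have "(\<lambda>n. \<phi> (r n) x) \<longlonglongrightarrow> u x" by simp
    then have "(\<lambda>n. ennreal (norm (\<phi> (r n) x) ^ 4)) \<longlonglongrightarrow> ennreal (norm (u x) ^ 4)"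
      by (intro tendsto_ennrealI tendsto_intros)
    then show ?case by (rule lim_imp_Liminf[OF sequentially_bot, symmetric])
  qed
  have "(\<integral>\<^sup>+x. ennreal (norm (u x) ^ 4) \<partial>lebesgue_on \<Omega>)
      = (\<integral>\<^sup>+x. liminf (\<lambda>n. ennreal (norm (\<phi> (r n) x) ^ 4)) \<partial>lebesgue_on \<Omega>)"
    by (rule nn_integral_cong_AE[OF limAE])
  also have "\<dots> \<le> liminf (\<lambda>n. \<integral>\<^sup>+x. ennreal (norm (\<phi> (r n) x) ^ 4) \<partial>lebesgue_on \<Omega>)"
    by (rule nn_integral_liminf) measurable
  also have "\<dots> \<le> liminf (\<lambda>n. ennreal ((2 * L2_norm \<Omega> (\<phi> (r n)) * V_norm \<Omega> (\<phi> (r n)))\<^sup>2))"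
    by (intro Liminf_mono always_eventually allI ladyzhenskaya_test solenoidal_test \<phi>)
  also have "\<dots> = ennreal (L\<^sup>2)"
  proof (rule lim_imp_Liminf)
    have "(\<lambda>n. (2 * L2_norm \<Omega> (\<phi> n) * V_norm \<Omega> (\<phi> n))\<^sup>2) \<longlonglongrightarrow> L\<^sup>2"
      unfolding L_def
      by (intro tendsto_intros L2_norm_approx V_norm_approx V_L2 V_H1 \<phi>L2 u \<phi> solenoidal_H1)
    from LIMSEQ_subseq_LIMSEQ[OF this r(1)]
    show "(\<lambda>n. ennreal ((2 * L2_norm \<Omega> (\<phi> (r n)) * V_norm \<Omega> (\<phi> (r n)))\<^sup>2)) \<longlonglongrightarrow> ennreal (L\<^sup>2)"
      by (intro tendsto_ennrealI) (simp add: o_def)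
  qed simp
  finally have le: "(\<integral>\<^sup>+x. ennreal (norm (u x) ^ 4) \<partial>lebesgue_on \<Omega>) \<le> ennreal (L\<^sup>2)" .
  have int: "integrable (lebesgue_on \<Omega>) (\<lambda>x. norm (u x) ^ 4)"
    by (rule integrableI_bounded) (use le_less_trans[OF le ennreal_less_top] in auto)
  have p4: "(norm ((norm y)\<^sup>2))\<^sup>2 = norm y ^ 4" for y :: "real^2" by (simp flip: power_mult)
  show *: "(\<lambda>x. (norm (u x))\<^sup>2) \<in> L2_space \<Omega>"
    unfolding L2_space_def mem_Collect_eq p4 using int by simp
  have "(L2_norm \<Omega> (\<lambda>x. (norm (u x))\<^sup>2))\<^sup>2 = (LINT x|lebesgue_on \<Omega>. norm (u x) ^ 4)"
    unfolding L2_norm_squared L2_inner_def power2_norm_eq_inner[symmetric] p4 ..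
  also have "ennreal \<dots> \<le> ennreal (L\<^sup>2)"
    using le int by (subst (asm) nn_integral_eq_integral) auto
  finally have "(L2_norm \<Omega> (\<lambda>x. (norm (u x))\<^sup>2))\<^sup>2 \<le> L\<^sup>2" by simp
  from power2_le_imp_le[OF this L]
  show "L2_norm \<Omega> (\<lambda>x. (norm (u x))\<^sup>2) \<le> 2 * L2_norm \<Omega> u * V_norm \<Omega> u"
    by (simp add: L_def)
qed

end

subsection \<open>The dual of \<open>V\<close>\<close>

lemma V_dual_add: "F \<in> V_dual \<Omega> \<Longrightarrow> \<phi> \<in> V_space \<Omega> \<Longrightarrow> \<psi> \<in> V_space \<Omega> \<Longrightarrow> F (\<lambda>x. \<phi> x + \<psi> x) = F \<phi> + F \<psi>"
  and V_dual_scaleR: "F \<in> V_dual \<Omega> \<Longrightarrow> \<phi> \<in> V_space \<Omega> \<Longrightarrow> F (\<lambda>x. c *\<^sub>R \<phi> x) = c * F \<phi>"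
  by (simp_all add: V_dual_def)

lemma V_dual_bounded: "F \<in> V_dual \<Omega> \<Longrightarrow> \<exists>K. \<forall>\<phi>\<in>V_space \<Omega>. \<bar>F \<phi>\<bar> \<le> K * V_norm \<Omega> \<phi>"
  by (simp add: V_dual_def)

lemma V_dual_diff:
  assumes "F \<in> V_dual \<Omega>" "G \<in> V_dual \<Omega>"
  shows "F - G \<in> V_dual \<Omega>"
proof -
  obtain K L where KL: "\<And>\<phi>. \<phi> \<in> V_space \<Omega> \<Longrightarrow> \<bar>F \<phi>\<bar> \<le> K * V_norm \<Omega> \<phi>"
    "\<And>\<phi>. \<phi> \<in> V_space \<Omega> \<Longrightarrow> \<bar>G \<phi>\<bar> \<le> L * V_norm \<Omega> \<phi>"
    using assms[THEN V_dual_bounded] by blast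
  have "\<bar>(F - G) \<phi>\<bar> \<le> (K + L) * V_norm \<Omega> \<phi>" if "\<phi> \<in> V_space \<Omega>" for \<phi>
    using KL[OF that] by (simp add: distrib_right)
  then have "\<exists>K. \<forall>\<phi>\<in>V_space \<Omega>. \<bar>(F - G) \<phi>\<bar> \<le> K * V_norm \<Omega> \<phi>" by blast
  moreover have "(F - G) (\<lambda>x. \<phi> x + \<psi> x) = (F - G) \<phi> + (F - G) \<psi>" if "\<phi> \<in> V_space \<Omega>" "\<psi> \<in> V_space \<Omega>" for \<phi> \<psi>
    using V_dual_add[OF assms(1) that] V_dual_add[OF assms(2) that] by simp
  moreover have "(F - G) (\<lambda>x. c *\<^sub>R \<phi> x) = c * (F - G) \<phi>" if "\<phi> \<in> V_space \<Omega>" for c \<phi>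
    using V_dual_scaleR[OF assms(1) that] V_dual_scaleR[OF assms(2) that] by (simp add: right_diff_distrib)
  ultimately show ?thesis unfolding V_dual_def by blast
qed

context bounded_open_set begin

lemma V_dual_norm_bdd:
  assumes "F \<in> V_dual \<Omega>"
  shows "bdd_above ((\<lambda>\<phi>. \<bar>F \<phi>\<bar>) ` {\<phi>\<in>V_space \<Omega>. V_norm \<Omega> \<phi> \<le> 1})"
proof -
  obtain K where K: "\<And>\<phi>. \<phi> \<in> V_space \<Omega> \<Longrightarrow> \<bar>F \<phi>\<bar> \<le> K * V_norm \<Omega> \<phi>"
    using V_dual_bounded[OF assms] by blast
  have "\<bar>F \<phi>\<bar> \<le> \<bar>K\<bar>" if "\<phi> \<in> V_space \<Omega>" "V_norm \<Omega> \<phi> \<le> 1" for \<phi>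
  proof -
    have "\<bar>F \<phi>\<bar> \<le> K * V_norm \<Omega> \<phi>" by (rule K[OF that(1)])
    also have "\<dots> \<le> \<bar>K\<bar> * 1" by (rule mult_mono) (use that V_norm_nonneg[of \<Omega> \<phi>] in auto)
    finally show ?thesis by simp
  qed
  then show ?thesis by (intro bdd_aboveI2[where M="\<bar>K\<bar>"]) auto
qed

lemma V_dual_norm_nonneg:
  assumes "F \<in> V_dual \<Omega>"
  shows "0 \<le> V_dual_norm \<Omega> F"
proof -
  have "\<bar>F (\<lambda>x. 0)\<bar> \<le> V_dual_norm \<Omega> F"
    unfolding V_dual_norm_def by (rule cSUP_upper[OF _ V_dual_norm_bdd[OF assms]]) (simp add: zero_V V_norm_zero)
  then show ?thesis using abs_ge_zero order_trans by blast
qed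

lemma V_dual_bound:
  assumes F: "F \<in> V_dual \<Omega>" and \<phi>: "\<phi> \<in> V_space \<Omega>"
  shows "\<bar>F \<phi>\<bar> \<le> V_dual_norm \<Omega> F * V_norm \<Omega> \<phi>"
proof (cases "V_norm \<Omega> \<phi> = 0")
  case True
  \<comment> \<open>\<open>V_norm\<close> is a seminorm on representatives, and rescaling to norm 1
    fails here; boundedness of \<open>F\<close> gives the value 0 directly.\<close>
  obtain K where "\<bar>F \<phi>\<bar> \<le> K * V_norm \<Omega> \<phi>" using assms by (auto simp: V_dual_def)
  then show ?thesis using True by simp
next
  case False
  then have pos: "V_norm \<Omega> \<phi> > 0" using V_norm_nonneg[of \<Omega> \<phi>] by simp
  let ?c = "inverse (V_norm \<Omega> \<phi>)"
  have "V_norm \<Omega> (\<lambda>x. ?c *\<^sub>R \<phi> x) = 1"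
    using pos V_norm_scaleR[OF V_H1[OF \<phi>], of ?c] by simp
  then have "\<bar>F (\<lambda>x. ?c *\<^sub>R \<phi> x)\<bar> \<le> V_dual_norm \<Omega> F"
    unfolding V_dual_norm_def
    by (intro cSUP_upper[OF _ V_dual_norm_bdd[OF F]]) (simp add: V_scaleR[OF \<phi>])
  then show ?thesis
    using pos by (simp add: V_dual_scaleR[OF F \<phi>] abs_mult field_simps)
qed

subsection \<open>The trilinear form\<close>

text \<open>Cauchy--Schwarz for |u|^2 and |w|^2, both square integrable by Ladyzhenskaya's
  inequality.\<close>

lemma norm_mult_L2:
  assumes u: "u \<in> V_space \<Omega>" and w: "w \<in> V_space \<Omega>"
  shows "(\<lambda>x. norm (u x) * norm (w x)) \<in> L2_space \<Omega>"
    and "L2_norm \<Omega> (\<lambda>x. norm (u x) * norm (w x))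
      \<le> 2 * sqrt ((L2_norm \<Omega> u * V_norm \<Omega> u) * (L2_norm \<Omega> w * V_norm \<Omega> w))"
proof -
  have [measurable]: "u \<in> borel_measurable (lebesgue_on \<Omega>)" "w \<in> borel_measurable (lebesgue_on \<Omega>)"
    using u w by (auto intro: L2_spaceD(1) V_L2)
  have eq: "(norm (norm (u x) * norm (w x)))\<^sup>2 = norm ((norm (u x))\<^sup>2) * norm ((norm (w x))\<^sup>2)" for x
    by (simp add: power_mult_distrib)
  note m = L2_norm_mult[OF ladyzhenskaya(1)[OF u] ladyzhenskaya(1)[OF w]]
  show "(\<lambda>x. norm (u x) * norm (w x)) \<in> L2_space \<Omega>"
    unfolding L2_space_def mem_Collect_eq eq using m(1) by simp
  have "L2_norm \<Omega> (\<lambda>x. norm (u x) * norm (w x))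
      = sqrt (LINT x|lebesgue_on \<Omega>. norm ((norm (u x))\<^sup>2) * norm ((norm (w x))\<^sup>2))"
    unfolding L2_norm_def L2_inner_def power2_norm_eq_inner[symmetric] eq ..
  also have "\<dots> \<le> sqrt (2 * L2_norm \<Omega> u * V_norm \<Omega> u * (2 * L2_norm \<Omega> w * V_norm \<Omega> w))"
    by (intro real_sqrt_le_mono order_trans[OF m(2)] mult_mono ladyzhenskaya(2) u w)
      (auto simp: L2_norm_nonneg V_norm_nonneg)
  also have "\<dots> = sqrt (2\<^sup>2 * ((L2_norm \<Omega> u * V_norm \<Omega> u) * (L2_norm \<Omega> w * V_norm \<Omega> w)))"
    by (simp add: power2_eq_square mult_ac)
  also have "\<dots> = 2 * sqrt ((L2_norm \<Omega> u * V_norm \<Omega> u) * (L2_norm \<Omega> w * V_norm \<Omega> w))"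
    by (simp add: real_sqrt_mult)
  finally show "L2_norm \<Omega> (\<lambda>x. norm (u x) * norm (w x))
      \<le> 2 * sqrt ((L2_norm \<Omega> u * V_norm \<Omega> u) * (L2_norm \<Omega> w * V_norm \<Omega> w))" .
qed

text \<open>An arbitrary square integrable matrix field \<open>G\<close> stands in for the gradient,
  so that the lemma applies to weak gradients, to classical ones and to their sums.\<close>

lemma trilinear_integrable:
  assumes "u \<in> V_space \<Omega>" "G \<in> L2_space \<Omega>" "w \<in> V_space \<Omega>"
  shows "integrable (lebesgue_on \<Omega>) (\<lambda>x. (G x *v u x) \<bullet> w x)"
    and "\<bar>LINT x|lebesgue_on \<Omega>. (G x *v u x) \<bullet> w x\<bar> \<le> L2_norm \<Omega> G * L2_norm \<Omega> (\<lambda>x. norm (u x) * norm (w x))"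
proof -
  have [measurable]: "u \<in> borel_measurable (lebesgue_on \<Omega>)" "w \<in> borel_measurable (lebesgue_on \<Omega>)"
     "G \<in> borel_measurable (lebesgue_on \<Omega>)"
    using assms by (auto intro: L2_spaceD(1) V_L2)
  have bb: "bounded_bilinear ((*v) :: real^2^2 \<Rightarrow> real^2 \<Rightarrow> real^2)"
    \<comment> \<open>Bilinearity suffices in finite dimension; the joint continuity that follows
      makes the product of two measurable factors measurable.\<close>
    by (simp add: bilinear_conv_bounded_bilinear[symmetric] bilinear_def linear_iff
        matrix_vector_right_distrib matrix_vector_mult_add_rdistrib matrix_vector_mult_scaleR
        scaleR_matrix_vector_assoc)
  have "(\<lambda>p. fst p *v snd p :: real^2) \<in> borel_measurable (borel :: ((real^2^2) \<times> (real^2)) measure)"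
    by (intro borel_measurable_continuous_onI bounded_bilinear.continuous_on[OF bb] continuous_intros)
  from measurable_compose[OF _ this, of "\<lambda>x. (G x, u x)" "lebesgue_on \<Omega>"]
  have meas: "(\<lambda>x. (G x *v u x) \<bullet> w x) \<in> borel_measurable (lebesgue_on \<Omega>)"
    by (simp add: borel_prod[symmetric])
  note m = L2_norm_mult[OF assms(2) norm_mult_L2(1)[OF assms(1,3)]]
  have le: "\<bar>(G x *v u x) \<bullet> w x\<bar> \<le> norm (G x) * norm (norm (u x) * norm (w x))" for x
  proof -
    have "\<bar>(G x *v u x) \<bullet> w x\<bar> \<le> norm (G x *v u x) * norm (w x)" by (rule Cauchy_Schwarz_ineq2)
    also have "\<dots> \<le> norm (G x) * norm (u x) * norm (w x)"
      by (intro mult_right_mono norm_matrix_vector_mult_le) simp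
    finally show ?thesis by (simp add: mult.assoc)
  qed
  show int: "integrable (lebesgue_on \<Omega>) (\<lambda>x. (G x *v u x) \<bullet> w x)"
    by (rule Bochner_Integration.integrable_bound[OF m(1) meas]) (use le in auto)
  show "\<bar>LINT x|lebesgue_on \<Omega>. (G x *v u x) \<bullet> w x\<bar> \<le> L2_norm \<Omega> G * L2_norm \<Omega> (\<lambda>x. norm (u x) * norm (w x))"
    by (rule order_trans[OF integral_abs_bound_integral[OF int m(1) le] m(2)])
qed

lemma nse_b_bound:
  assumes "u \<in> V_space \<Omega>" "v \<in> V_space \<Omega>" "w \<in> V_space \<Omega>"
  shows "\<bar>nse_b \<Omega> u v w\<bar>
    \<le> V_norm \<Omega> v * (2 * sqrt ((L2_norm \<Omega> u * V_norm \<Omega> u) * (L2_norm \<Omega> w * V_norm \<Omega> w)))"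
  unfolding nse_b_def
  by (rule order_trans[OF trilinear_integrable(2)[OF assms(1) weak_grad_props(1)[OF V_H1[OF assms(2)]] assms(3)]])
    (simp add: V_norm_eq[symmetric] mult_left_mono[OF norm_mult_L2(2)[OF assms(1,3)] V_norm_nonneg])

lemma nse_b_bound_self:
  assumes "u \<in> V_space \<Omega>" "v \<in> V_space \<Omega>"
  shows "\<bar>nse_b \<Omega> u v u\<bar> \<le> 2 * V_norm \<Omega> v * (L2_norm \<Omega> u * V_norm \<Omega> u)"
proof -
  have "sqrt ((L2_norm \<Omega> u * V_norm \<Omega> u) * (L2_norm \<Omega> u * V_norm \<Omega> u)) = L2_norm \<Omega> u * V_norm \<Omega> u"
    using L2_norm_nonneg[of \<Omega> u] V_norm_nonneg[of \<Omega> u] by simp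
  then show ?thesis using nse_b_bound[OF assms(1,2,1)] by (simp only: mult_ac)
qed

text \<open>Continuity of the trilinear form on V, which serves for limits and measurability. The
  energy estimates use the bounds that keep the L2 norms.\<close>

lemma nse_b_bound_V:
  assumes "u \<in> V_space \<Omega>" "v \<in> V_space \<Omega>" "w \<in> V_space \<Omega>"
  shows "\<bar>nse_b \<Omega> u v w\<bar> \<le> 2 * poincare_const * (V_norm \<Omega> u * V_norm \<Omega> v * V_norm \<Omega> w)"
proof -
  note nn = L2_norm_nonneg[of \<Omega>] V_norm_nonneg[of \<Omega>] poincare_const_props(1)
  have "sqrt ((L2_norm \<Omega> u * V_norm \<Omega> u) * (L2_norm \<Omega> w * V_norm \<Omega> w))
    \<le> sqrt (((poincare_const * V_norm \<Omega> u) * V_norm \<Omega> u) * ((poincare_const * V_norm \<Omega> w) * V_norm \<Omega> w))"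
    by (intro real_sqrt_le_mono mult_mono poincare assms mult_nonneg_nonneg) (use nn in \<open>auto simp: less_imp_le\<close>)
  also have "\<dots> = sqrt ((poincare_const * V_norm \<Omega> u * V_norm \<Omega> w)\<^sup>2)"
    by (simp add: power2_eq_square mult_ac)
  also have "\<dots> = poincare_const * V_norm \<Omega> u * V_norm \<Omega> w"
    using nn by (simp add: less_imp_le)
  finally have "V_norm \<Omega> v * (2 * sqrt ((L2_norm \<Omega> u * V_norm \<Omega> u) * (L2_norm \<Omega> w * V_norm \<Omega> w)))
    \<le> V_norm \<Omega> v * (2 * (poincare_const * V_norm \<Omega> u * V_norm \<Omega> w))"
    by (intro mult_left_mono) (use nn in auto)
  then show ?thesis using nse_b_bound[OF assms] by (simp add: mult_ac)
qed

lemma nse_b_add3: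
  assumes "u \<in> V_space \<Omega>" "v \<in> V_space \<Omega>" "w \<in> V_space \<Omega>" "w' \<in> V_space \<Omega>"
  shows "nse_b \<Omega> u v (\<lambda>x. w x + w' x) = nse_b \<Omega> u v w + nse_b \<Omega> u v w'"
  using trilinear_integrable(1)[OF assms(1) weak_grad_props(1)[OF V_H1[OF assms(2)]]] assms
  by (simp add: nse_b_def inner_add_right)

lemma nse_b_scaleR3: "nse_b \<Omega> u v (\<lambda>x. c *\<^sub>R w x) = c * nse_b \<Omega> u v w"
  by (simp add: nse_b_def)

lemma nse_b_diff3:
  assumes "u \<in> V_space \<Omega>" "v \<in> V_space \<Omega>" "w \<in> V_space \<Omega>" "w' \<in> V_space \<Omega>"
  shows "nse_b \<Omega> u v (\<lambda>x. w x - w' x) = nse_b \<Omega> u v w - nse_b \<Omega> u v w'"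
  using trilinear_integrable(1)[OF assms(1) weak_grad_props(1)[OF V_H1[OF assms(2)]]] assms
  by (simp add: nse_b_def inner_diff_right)

lemma nse_b_diff1:
  assumes "u \<in> V_space \<Omega>" "u' \<in> V_space \<Omega>" "v \<in> V_space \<Omega>" "w \<in> V_space \<Omega>"
  shows "nse_b \<Omega> (\<lambda>x. u x - u' x) v w = nse_b \<Omega> u v w - nse_b \<Omega> u' v w"
  using trilinear_integrable(1)[OF _ weak_grad_props(1)[OF V_H1[OF assms(3)]] assms(4)] assms
  by (simp add: nse_b_def inner_diff_left matrix_vector_mult_diff_distrib)

lemma nse_b_add2:
  assumes "u \<in> V_space \<Omega>" "v \<in> V_space \<Omega>" "v' \<in> V_space \<Omega>" "w \<in> V_space \<Omega>"
  shows "nse_b \<Omega> u (\<lambda>x. v x + v' x) w = nse_b \<Omega> u v w + nse_b \<Omega> u v' w"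
proof -
  note L = weak_grad_props(1)[OF V_H1]
  note int = trilinear_integrable(1)[OF assms(1) _ assms(4)]
  have "nse_b \<Omega> u (\<lambda>x. v x + v' x) w
      = (LINT x|lebesgue_on \<Omega>. ((weak_grad \<Omega> v x + weak_grad \<Omega> v' x) *v u x) \<bullet> w x)"
    unfolding nse_b_def
  proof (rule integral_cong_AE)
    show "AE x in lebesgue_on \<Omega>. (weak_grad \<Omega> (\<lambda>x. v x + v' x) x *v u x) \<bullet> w x
        = ((weak_grad \<Omega> v x + weak_grad \<Omega> v' x) *v u x) \<bullet> w x"
      using H1_add(2)[OF V_H1[OF assms(2)] V_H1[OF assms(3)]] by eventually_elim simp
  qed (intro borel_measurable_integrable int L V_add L2_add assms)+
  then show ?thesis
    using int[OF L[OF assms(2)]] int[OF L[OF assms(3)]]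
    by (simp add: nse_b_def matrix_vector_mult_add_rdistrib inner_add_left)
qed

lemma nse_b_scaleR2:
  assumes "u \<in> V_space \<Omega>" "v \<in> V_space \<Omega>" "w \<in> V_space \<Omega>"
  shows "nse_b \<Omega> u (\<lambda>x. c *\<^sub>R v x) w = c * nse_b \<Omega> u v w"
proof -
  note L = weak_grad_props(1)[OF V_H1]
  note int = trilinear_integrable(1)[OF assms(1) _ assms(3)]
  have "nse_b \<Omega> u (\<lambda>x. c *\<^sub>R v x) w = (LINT x|lebesgue_on \<Omega>. ((c *\<^sub>R weak_grad \<Omega> v x) *v u x) \<bullet> w x)"
    unfolding nse_b_def
  proof (rule integral_cong_AE)
    show "AE x in lebesgue_on \<Omega>. (weak_grad \<Omega> (\<lambda>x. c *\<^sub>R v x) x *v u x) \<bullet> w x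
        = ((c *\<^sub>R weak_grad \<Omega> v x) *v u x) \<bullet> w x"
      using H1_scaleR(2)[OF V_H1[OF assms(2)], of c] by eventually_elim simp
  qed (intro borel_measurable_integrable int L V_scaleR L2_scaleR assms)+
  then show ?thesis by (simp add: nse_b_def scaleR_matrix_vector_assoc[symmetric])
qed

lemma nse_b_diff2:
  assumes "u \<in> V_space \<Omega>" "v \<in> V_space \<Omega>" "v' \<in> V_space \<Omega>" "w \<in> V_space \<Omega>"
  shows "nse_b \<Omega> u (\<lambda>x. v x - v' x) w = nse_b \<Omega> u v w - nse_b \<Omega> u v' w"
  using nse_b_add2[OF assms(1,2) V_scaleR[OF assms(3), of "-1"] assms(4)] nse_b_scaleR2[OF assms(1,3,4), of "-1"]
  by simp

text \<open>The integrand is half the divergence of \<open>\<bar>\<psi>\<bar>\<^sup>2 \<phi>\<close>.\<close>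

lemma nse_b_test_eq_0:
  assumes \<phi>: "\<phi> \<in> solenoidal_tests \<Omega>" and \<psi>: "\<psi> \<in> test_functions \<Omega>"
  shows "(LINT x|lebesgue_on \<Omega>. (classical_grad \<psi> x *v \<phi> x) \<bullet> \<psi> x) = 0"
proof -
  note \<phi>' = solenoidal_test[OF \<phi>]
  let ?F = "\<lambda>j x. \<phi> x $ j * (\<psi> x \<bullet> \<psi> x)"
  let ?F' = "\<lambda>j x h. \<phi> x $ j * (2 * (\<psi> x \<bullet> frechet_derivative \<psi> (at x) h))
      + frechet_derivative \<phi> (at x) h $ j * (\<psi> x \<bullet> \<psi> x)"
  have D: "(?F j has_derivative ?F' j x) (at x)" for j x
    by (intro has_derivative_mult norm_square_has_derivative[OF \<psi>]
        bounded_linear.has_derivative[OF bounded_linear_vec_nth] test_has_derivative[OF \<phi>'])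
  have cF': "continuous_on UNIV (\<lambda>x. ?F' j x (axis k 1))" for j k
    using test_derivative_continuous[OF \<psi> axis_1_in_Basis] test_derivative_continuous[OF \<phi>' axis_1_in_Basis]
      test_continuous[OF \<psi>] test_continuous[OF \<phi>']
    by (intro continuous_intros) auto
  have supp: "?F' j x (axis k 1) = 0" if "x \<notin> \<Omega>" for j k x
    using test_eq_0[OF \<psi> that] test_eq_0[OF \<phi>' that] by simp
  have int: "integrable (lebesgue_on \<Omega>) (\<lambda>x. ?F' j x (axis k 1))" for j k
    using L2_inner_integrable[OF L2_continuous_support[OF cF'[of j k]] L2_const[of 1]] supp by simp
  have 0: "(LINT x|lebesgue_on \<Omega>. ?F' j x (axis j 1)) = 0" for j
    by (rule integral_partial_eq_0[OF D cF']) (use test_eq_0[OF \<phi>'] test_eq_0[OF \<psi>] in auto)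
  have "(LINT x|lebesgue_on \<Omega>. 2 * ((classical_grad \<psi> x *v \<phi> x) \<bullet> \<psi> x))
      = (LINT x|lebesgue_on \<Omega>. (\<Sum>j\<in>UNIV. ?F' j x (axis j 1)))"
  proof (rule Bochner_Integration.integral_cong)
    fix x assume "x \<in> space (lebesgue_on \<Omega>)"
    then have "x \<in> \<Omega>" by (simp add: space_restrict_space)
    then have div: "(\<Sum>i\<in>UNIV. partial i \<phi> x $ i) = 0" using \<phi> by (simp add: solenoidal_tests_def)
    have "(\<Sum>j\<in>UNIV. ?F' j x (axis j 1)) = (\<Sum>j\<in>UNIV. \<phi> x $ j * (2 * (\<psi> x \<bullet> partial j \<psi> x)))
        + (\<Sum>j\<in>UNIV. partial j \<phi> x $ j) * (\<psi> x \<bullet> \<psi> x)"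
      by (simp only: sum.distrib sum_distrib_right partial_def)
    also have "\<dots> = 2 * ((classical_grad \<psi> x *v \<phi> x) \<bullet> \<psi> x)"
      unfolding div by (simp add: UNIV_2 inner_vec_def matrix_vector_mult_def classical_grad_def algebra_simps)
    finally show "2 * ((classical_grad \<psi> x *v \<phi> x) \<bullet> \<psi> x) = (\<Sum>j\<in>UNIV. ?F' j x (axis j 1))" ..
  qed simp
  also have "\<dots> = 0" using int 0 by (subst Bochner_Integration.integral_sum) auto
  finally show ?thesis by simp
qed

lemma nse_b_solenoidal_eq_0:
  assumes \<phi>: "\<phi> \<in> solenoidal_tests \<Omega>" and \<psi>: "\<psi> \<in> solenoidal_tests \<Omega>"
  shows "nse_b \<Omega> \<phi> \<psi> \<psi> = 0"
proof -
  have "nse_b \<Omega> \<phi> \<psi> \<psi> = (LINT x|lebesgue_on \<Omega>. (classical_grad \<psi> x *v \<phi> x) \<bullet> \<psi> x)"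
    unfolding nse_b_def
  proof (rule integral_cong_AE)
    show "AE x in lebesgue_on \<Omega>. (weak_grad \<Omega> \<psi> x *v \<phi> x) \<bullet> \<psi> x = (classical_grad \<psi> x *v \<phi> x) \<bullet> \<psi> x"
      using weak_grad_test[OF solenoidal_test[OF \<psi>]] by eventually_elim simp
  qed (intro borel_measurable_integrable trilinear_integrable(1) solenoidal_V \<phi> \<psi> weak_grad_props
      solenoidal_H1 classical_grad_L2 solenoidal_test)+
  then show ?thesis using nse_b_test_eq_0[OF \<phi> solenoidal_test[OF \<psi>]] by simp
qed

text \<open>Both fields are approximated by solenoidal test functions and replaced one argument at a
  time; the three errors vanish by continuity on V, and the remaining term is 0 by integration by
  parts.\<close>

lemma nse_b_eq_0:
  assumes u: "u \<in> V_space \<Omega>" and w: "w \<in> V_space \<Omega>"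
  shows "nse_b \<Omega> u w w = 0"
proof -
  obtain \<phi> where \<phi>: "\<And>n. \<phi> n \<in> solenoidal_tests \<Omega>" "(\<lambda>n. L2_norm \<Omega> (\<lambda>x. u x - \<phi> n x)) \<longlonglongrightarrow> 0"
    "(\<lambda>n. V_norm \<Omega> (\<lambda>x. u x - \<phi> n x)) \<longlonglongrightarrow> 0" by (rule V_space_approx[OF u]) blast
  obtain \<psi> where \<psi>: "\<And>n. \<psi> n \<in> solenoidal_tests \<Omega>" "(\<lambda>n. L2_norm \<Omega> (\<lambda>x. w x - \<psi> n x)) \<longlonglongrightarrow> 0"
    "(\<lambda>n. V_norm \<Omega> (\<lambda>x. w x - \<psi> n x)) \<longlonglongrightarrow> 0" by (rule V_space_approx[OF w]) blast
  have \<phi>V: "\<phi> n \<in> V_space \<Omega>" and \<psi>V: "\<psi> n \<in> V_space \<Omega>" for n by (intro solenoidal_V \<phi> \<psi>)+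
  define a where "a n = V_norm \<Omega> (\<lambda>x. u x - \<phi> n x)" for n
  define b where "b n = V_norm \<Omega> (\<lambda>x. w x - \<psi> n x)" for n
  let ?C = "2 * poincare_const"
  have bd: "\<bar>nse_b \<Omega> u w w\<bar> \<le> ?C * (a n * V_norm \<Omega> w * V_norm \<Omega> w)
      + ?C * (V_norm \<Omega> (\<phi> n) * b n * V_norm \<Omega> w) + ?C * (V_norm \<Omega> (\<phi> n) * V_norm \<Omega> (\<psi> n) * b n)" for n
  proof -
    have "nse_b \<Omega> u w w = nse_b \<Omega> (\<lambda>x. u x - \<phi> n x) w w + nse_b \<Omega> (\<phi> n) (\<lambda>x. w x - \<psi> n x) w
        + nse_b \<Omega> (\<phi> n) (\<psi> n) (\<lambda>x. w x - \<psi> n x)"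
      using nse_b_diff1[OF u \<phi>V[of n] w w] nse_b_diff2[OF \<phi>V[of n] w \<psi>V[of n] w] nse_b_diff3[OF \<phi>V[of n] \<psi>V[of n] w \<psi>V[of n]]
        nse_b_solenoidal_eq_0[OF \<phi>(1) \<psi>(1), of n n] by simp
    then show ?thesis
      using nse_b_bound_V[OF V_diff[OF u \<phi>V[of n]] w w] nse_b_bound_V[OF \<phi>V[of n] V_diff[OF w \<psi>V[of n]] w]
        nse_b_bound_V[OF \<phi>V[of n] \<psi>V[of n] V_diff[OF w \<psi>V[of n]]]
      unfolding a_def b_def by linarith
  qed
  have "(\<lambda>n. ?C * (a n * V_norm \<Omega> w * V_norm \<Omega> w) + ?C * (V_norm \<Omega> (\<phi> n) * b n * V_norm \<Omega> w)
      + ?C * (V_norm \<Omega> (\<phi> n) * V_norm \<Omega> (\<psi> n) * b n))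
    \<longlonglongrightarrow> ?C * (0 * V_norm \<Omega> w * V_norm \<Omega> w) + ?C * (V_norm \<Omega> u * 0 * V_norm \<Omega> w) + ?C * (V_norm \<Omega> u * V_norm \<Omega> w * 0)"
    using \<phi>(3) \<psi>(3) V_norm_approx[OF V_H1[OF u] V_H1[OF \<phi>V] \<phi>(3)] V_norm_approx[OF V_H1[OF w] V_H1[OF \<psi>V] \<psi>(3)]
    unfolding a_def b_def by (intro tendsto_add tendsto_mult tendsto_const)
  from LIMSEQ_le_const[OF this] bd have "\<bar>nse_b \<Omega> u w w\<bar> \<le> 0" by fastforce
  then show ?thesis by simp
qed

text \<open>Polarisation of \<open>nse_b_eq_0\<close> at v + w.\<close>

lemma nse_b_antisym:
  assumes u: "u \<in> V_space \<Omega>" and v: "v \<in> V_space \<Omega>" and w: "w \<in> V_space \<Omega>"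
  shows "nse_b \<Omega> u v w = - nse_b \<Omega> u w v"
proof -
  have "0 = nse_b \<Omega> u (\<lambda>x. v x + w x) (\<lambda>x. v x + w x)" by (simp add: nse_b_eq_0 V_add assms)
  also have "\<dots> = nse_b \<Omega> u v v + nse_b \<Omega> u v w + (nse_b \<Omega> u w v + nse_b \<Omega> u w w)"
    by (simp add: nse_b_add2 nse_b_add3 V_add assms)
  finally show ?thesis by (simp add: nse_b_eq_0 assms)
qed

text \<open>Antisymmetry moves the gradient to \<open>w\<close>, after which \<open>u\<close>
  contributes |u| ||u||; the direct bound would contain ||u|| to the power 3/2. For \<open>u\<close>
  bounded in H the expression is linear in ||u||, hence square integrable in time.\<close>

lemma nse_b_bound_energy:
  assumes "u \<in> V_space \<Omega>" "w \<in> V_space \<Omega>"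
  shows "\<bar>nse_b \<Omega> u u w\<bar> \<le> 2 * (L2_norm \<Omega> u * V_norm \<Omega> u) * V_norm \<Omega> w"
  using nse_b_bound_self[OF assms] nse_b_antisym[OF assms(1,1,2)] by (simp add: mult_ac)

text \<open>Bilinearity gives b(w, u, w) + b(v, w, w), and the last term vanishes. Only the gradient
  of \<open>u\<close> is left, so the dissipation of \<open>u\<close> alone controls the nonlinear
  term.\<close>

lemma nse_b_difference:
  assumes u: "u \<in> V_space \<Omega>" and v: "v \<in> V_space \<Omega>" and w: "w = (\<lambda>x. u x - v x)"
  shows "nse_b \<Omega> u u w - nse_b \<Omega> v v w = nse_b \<Omega> w u w"
proof -
  have wV: "w \<in> V_space \<Omega>" unfolding w by (rule V_diff[OF u v])
  have "nse_b \<Omega> w u w = nse_b \<Omega> u u w - nse_b \<Omega> v u w"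
    using nse_b_diff1[OF u v u wV] by (simp add: w)
  moreover have "nse_b \<Omega> v w w = nse_b \<Omega> v u w - nse_b \<Omega> v v w"
    using nse_b_diff2[OF v u v wV] by (simp add: w)
  ultimately show ?thesis using nse_b_eq_0[OF v wV] by simp
qed

end

subsection \<open>Functions of time with an integrable weak derivative\<close>

lemma absolutely_integrable_on_iff_lebesgue_on:
  fixes f :: "'a::euclidean_space \<Rightarrow> 'b::euclidean_space"
  assumes "S \<in> sets lebesgue"
  shows "f absolutely_integrable_on S \<longleftrightarrow> integrable (lebesgue_on S) f"
  using assms by (simp add: set_integrable_def integrable_restrict_space)

lemma integrable_lebesgue_on_subset:
  fixes f :: "'a::euclidean_space \<Rightarrow> 'b::euclidean_space"
  assumes "integrable (lebesgue_on S) f" "S \<in> sets lebesgue" "T \<in> sets lebesgue" "T \<subseteq> S"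
  shows "integrable (lebesgue_on T) f"
  using assms set_integrable_subset[of lebesgue S f T]
  by (simp add: absolutely_integrable_on_iff_lebesgue_on[symmetric])

lemma integral_open_eq_integral:
  fixes f :: "real \<Rightarrow> real"
  assumes "integrable (lebesgue_on {a<..<b}) f"
  shows "(LINT x|lebesgue_on {a<..<b}. f x) = integral {a..b} f"
  using lebesgue_integral_eq_integral[OF assms] by (simp add: integral_open_interval_real)

section \<open>Smooth steps and one-sided approximate identities\<close>

abbreviation bump1 :: "real \<Rightarrow> real" where
  "bump1 \<equiv> box_bump 1 0 (1::real)"

lemma bump1_continuous: "continuous_on S bump1"
  using Ck_continuous[OF Ck_box_bump[of 0]] continuous_on_subset by blast

lemma bump1_eq_0: "x \<le> 0 \<or> 1 \<le> x \<Longrightarrow> bump1 x = 0"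
  by (rule box_bump_eq_0) (auto simp: mem_box)

text \<open>The lower limit -1 lies to the left of the support, so that every x \<ge> 0 is interior
  to the interval on which the indefinite integral is differentiated.\<close>

definition bump1_integral :: "real \<Rightarrow> real" where
  "bump1_integral x = integral {-1..x} bump1"

lemma bump1_integral_eq_0: "x \<le> 0 \<Longrightarrow> bump1_integral x = 0"
  unfolding bump1_integral_def
  by (subst Henstock_Kurzweil_Integration.integral_cong[where g="\<lambda>_. 0"]) (auto simp: bump1_eq_0)

lemma bump1_integral_derivative: "(bump1_integral has_real_derivative bump1 x) (at x)"
proof (cases "x < 0")
  case True
  have "((\<lambda>x. 0) has_real_derivative bump1 x) (at x)" using True by (simp add: bump1_eq_0)
  then show ?thesis
    by (rule has_field_derivative_transform_within_open[where S="{..<0}"])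
      (use True in \<open>auto simp: bump1_integral_eq_0\<close>)
next
  case False
  have "((\<lambda>x. integral {-1..x} bump1) has_real_derivative bump1 x) (at x within {-1..x+1})"
    by (rule integral_has_real_derivative) (use False in \<open>auto simp: bump1_continuous\<close>)
  moreover have "at x within {-1..x+1} = at x"
    using False by (intro at_within_interior) (auto simp: interior_atLeastAtMost_real)
  ultimately show ?thesis by (simp add: bump1_integral_def[abs_def])
qed

lemma bump1_integral_mono: "x \<le> y \<Longrightarrow> bump1_integral x \<le> bump1_integral y"
  by (rule DERIV_nonneg_imp_nondecreasing)
    (auto intro: exI[of _ "bump1 x" for x] bump1_integral_derivative box_bump_bounds(1))

lemma bump1_integral_1_pos: "bump1_integral 1 > 0"
proof -
  have "bump1_integral 1 \<noteq> 0"
  proof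
    assume "bump1_integral 1 = 0"
    then have "\<forall>x\<in>{-1..1}. bump1 x = 0"
      unfolding bump1_integral_def
      by (subst (asm) integral_eq_0_iff) (auto simp: bump1_continuous box_bump_bounds)
    then have "bump1 (1/2) = 0" by simp
    then show False using box_bump_pos[of 1 "1/2" 0 "1::real"] by (simp add: mem_box)
  qed
  then show ?thesis
    using bump1_integral_mono[of 0 1] bump1_integral_eq_0[of 0] by simp
qed

definition smooth_step :: "real \<Rightarrow> real" where
  "smooth_step x = bump1_integral x / bump1_integral 1"

lemma smooth_step_derivative:
  "(smooth_step has_real_derivative bump1 x / bump1_integral 1) (at x)"
  unfolding smooth_step_def by (intro DERIV_cdivide bump1_integral_derivative)

lemma smooth_step_eq_0: "x \<le> 0 \<Longrightarrow> smooth_step x = 0"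
  by (simp add: smooth_step_def bump1_integral_eq_0)

lemma smooth_step_eq_1:
  assumes "1 \<le> x"
  shows "smooth_step x = 1"
proof -
  have "bump1_integral x = bump1_integral 1"
  proof (cases "x = 1")
    case False
    have "\<exists>z. 1 < z \<and> z < x \<and> bump1_integral x - bump1_integral 1 = (x - 1) * bump1 z"
      using assms False by (intro MVT2 bump1_integral_derivative) auto
    then show ?thesis by (auto simp: bump1_eq_0)
  qed simp
  then show ?thesis using bump1_integral_1_pos by (simp add: smooth_step_def)
qed

lemma smooth_step_bounds: "0 \<le> smooth_step x" "smooth_step x \<le> 1"
proof -
  have "smooth_step (min x 0) \<le> smooth_step x" "smooth_step x \<le> smooth_step (max x 1)"
    unfolding smooth_step_def using bump1_integral_1_pos
    by (auto intro!: divide_right_mono bump1_integral_mono)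
  then show "0 \<le> smooth_step x" "smooth_step x \<le> 1"
    by (simp_all add: smooth_step_eq_0 smooth_step_eq_1)
qed

lemma Ck_smooth_step: "Ck k smooth_step"
proof -
  have "Ck (Suc k) smooth_step"
  proof (rule Ck_SucI[OF smooth_step_derivative[unfolded has_field_derivative_def]])
    have "Ck k (\<lambda>x. bump1 x * c)" for c
      by (intro Ck_mult Ck_const Ck_box_bump)
    from this[of "b / bump1_integral 1" for b] show "Ck k (\<lambda>x. bump1 x / bump1_integral 1 * b)" for b
      by simp
  qed
  then show ?thesis by (rule Ck_SucD)
qed

text \<open>The derivative of the step of width 1 / n that starts at \<open>c\<close>: for positive
  \<open>n\<close> an approximate identity supported on [c, c + 1 / n], hence to the right of
  \<open>c\<close>.\<close>

definition kernel1 :: "real \<Rightarrow> real \<Rightarrow> real \<Rightarrow> real" where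
  "kernel1 n c r = n * bump1 (n * r - n * c) / bump1_integral 1"

lemma scaled_step_derivative:
  "((\<lambda>r. smooth_step (n * r - n * c)) has_real_derivative kernel1 n c r) (at r)"
  unfolding kernel1_def
  by (rule DERIV_chain2[OF smooth_step_derivative, THEN DERIV_cong]) (auto intro!: derivative_eq_intros)

lemma kernel1_continuous: "continuous_on S (kernel1 n c)"
  unfolding kernel1_def
  by (intro continuous_intros continuous_on_compose2[OF bump1_continuous[of UNIV]]) (use bump1_integral_1_pos in auto)

lemma kernel1_nonneg: "n \<ge> 0 \<Longrightarrow> 0 \<le> kernel1 n c r"
  unfolding kernel1_def using bump1_integral_1_pos by (auto intro!: divide_nonneg_pos mult_nonneg_nonneg box_bump_bounds)

lemma kernel1_eq_0: "n > 0 \<Longrightarrow> r \<le> c \<or> c + 1 / n \<le> r \<Longrightarrow> kernel1 n c r = 0"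
  unfolding kernel1_def by (subst bump1_eq_0) (auto simp: field_simps)

lemma integrable_lebesgue_on_continuous:
  fixes f :: "real \<Rightarrow> real"
  assumes "continuous_on {a..b} f"
  shows "integrable (lebesgue_on {a<..<b}) f"
  by (rule integrable_lebesgue_on_subset[of "{a..b}"])
    (use absolutely_integrable_continuous_real[OF assms] in \<open>auto simp: absolutely_integrable_on_iff_lebesgue_on\<close>)

text \<open>The kernel has mass 1, being the derivative of a function that rises from 0 to 1, and
  its support shrinks to \<open>c\<close>.\<close>

lemma kernel1_tendsto:
  fixes y :: "real \<Rightarrow> real"
  assumes y: "continuous_on {0..T} y" and c: "0 < c" "c < T"
  shows "(\<lambda>n. LINT r|lebesgue_on {0<..<T}. y r * kernel1 (real (Suc n)) c r) \<longlonglongrightarrow> y c"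
proof (rule LIMSEQ_I)
  fix e :: real assume e: "e > 0"
  have "\<exists>d>0. \<forall>r\<in>{0..T}. \<bar>r - c\<bar> < d \<longrightarrow> \<bar>y r - y c\<bar> < e / 2"
    using y c half_gt_zero[OF e] unfolding continuous_on_iff dist_real_def
    by (metis atLeastAtMost_iff less_imp_le)
  then obtain d where d: "d > 0" "\<And>r. r \<in> {0..T} \<Longrightarrow> \<bar>r - c\<bar> < d \<Longrightarrow> \<bar>y r - y c\<bar> < e / 2" by blast
  \<comment> \<open>The first bound keeps the support where \<open>y\<close> is close to
    \<open>y c\<close>, the second keeps it to the left of \<open>T\<close>, so that the full mass
    is seen.\<close>
  define D where "D = min d (T - c)"
  have D: "D > 0" using d c by (simp add: D_def)
  obtain m :: nat where m: "inverse (real (Suc m)) < D" using reals_Archimedean[OF D] by blast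
  have "norm ((LINT r|lebesgue_on {0<..<T}. y r * kernel1 (real (Suc n)) c r) - y c) < e" if n: "n \<ge> m" for n
  proof -
    let ?n = "real (Suc n)"
    have "inverse ?n \<le> inverse (real (Suc m))" using n by (intro le_imp_inverse_le) auto
    then have n1: "1 / ?n < D" using m by (simp add: inverse_eq_divide)
    have k: "kernel1 ?n c integrable_on {0..T}" by (intro integrable_continuous_real kernel1_continuous)
    have yk: "continuous_on {0..T} (\<lambda>r. y r * kernel1 ?n c r)"
      by (intro continuous_intros y kernel1_continuous)
    have "(kernel1 ?n c has_integral (smooth_step (?n * T - ?n * c) - smooth_step (?n * 0 - ?n * c))) {0..T}"
      using c by (intro fundamental_theorem_of_calculus)
        (auto simp del: of_nat_Suc simp flip: has_real_derivative_iff_has_vector_derivative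
          intro: has_field_derivative_at_within scaled_step_derivative)
    moreover have "smooth_step (?n * T - ?n * c) = 1"
    proof (rule smooth_step_eq_1)
      have "1 / ?n \<le> T - c" using n1 by (simp add: D_def)
      then have "?n * (1 / ?n) \<le> ?n * (T - c)" by (intro mult_left_mono) auto
      then show "1 \<le> ?n * T - ?n * c" by (simp add: right_diff_distrib del: of_nat_Suc)
    qed
    moreover have "smooth_step (?n * 0 - ?n * c) = 0"
      using c by (intro smooth_step_eq_0) (simp del: of_nat_Suc)
    ultimately have k1: "integral {0..T} (kernel1 ?n c) = 1"
      by (simp add: integral_unique del: of_nat_Suc)
    have "(LINT r|lebesgue_on {0<..<T}. y r * kernel1 ?n c r) = integral {0..T} (\<lambda>r. y r * kernel1 ?n c r)"
      by (intro integral_open_eq_integral integrable_lebesgue_on_continuous yk)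
    then have "(LINT r|lebesgue_on {0<..<T}. y r * kernel1 ?n c r) - y c
        = integral {0..T} (\<lambda>r. y r * kernel1 ?n c r) - integral {0..T} (\<lambda>r. y c * kernel1 ?n c r)"
      by (simp add: k1 del: of_nat_Suc)
    also have "\<dots> = integral {0..T} (\<lambda>r. (y r - y c) * kernel1 ?n c r)"
      using yk kernel1_continuous
      by (subst Henstock_Kurzweil_Integration.integral_diff[symmetric])
        (auto simp: left_diff_distrib simp del: of_nat_Suc intro!: integrable_continuous_real continuous_intros)
    also have "norm \<dots> \<le> integral {0..T} (\<lambda>r. e / 2 * kernel1 ?n c r)"
    proof (rule integral_norm_bound_integral)
      show "(\<lambda>r. (y r - y c) * kernel1 ?n c r) integrable_on {0..T}" "(\<lambda>r. e / 2 * kernel1 ?n c r) integrable_on {0..T}"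
        by (intro integrable_continuous_real continuous_intros y kernel1_continuous)+
      fix r assume r: "r \<in> {0..T}"
      show "norm ((y r - y c) * kernel1 ?n c r) \<le> e / 2 * kernel1 ?n c r"
      proof (cases "c < r \<and> r < c + 1 / ?n")
        case True
        then have "\<bar>r - c\<bar> < d" using n1 by (simp add: D_def)
        then show ?thesis using kernel1_nonneg[of ?n c r] mult_right_mono[OF less_imp_le[OF d(2)[OF r]]]
            by (simp add: abs_mult del: of_nat_Suc)
      next
        case False
        then have "kernel1 ?n c r = 0" by (intro kernel1_eq_0) auto
        then show ?thesis by simp
      qed
    qed
    also have "\<dots> = e / 2" by (simp add: k1 del: of_nat_Suc)
    finally show ?thesis using e by simp
  qed
  then show "\<exists>no. \<forall>n\<ge>no. norm ((LINT r|lebesgue_on {0<..<T}. y r * kernel1 (real (Suc n)) c r) - y c) < e"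
    by blast
qed

text \<open>The test function is a smooth step at \<open>s\<close> minus one at \<open>t\<close>,
  which tends to the indicator of (s, t]. Its derivative is a difference of two approximate
  identities, so continuity of \<open>y\<close> gives the limit y s - y t on one side, and dominated
  convergence gives minus the integral of \<open>z\<close> on the other.\<close>

lemma weak_derivative_integral:
  fixes y z :: "real \<Rightarrow> real"
  assumes y: "continuous_on {0..T} y" and z: "integrable (lebesgue_on {0<..<T}) z"
    and weak: "\<And>\<theta>. \<theta> \<in> test_functions {0<..<T} \<Longrightarrow>
      (LINT t|lebesgue_on {0<..<T}. y t * deriv \<theta> t) = - (LINT t|lebesgue_on {0<..<T}. z t * \<theta> t)"
    and st: "0 < s" "s < t" "t < T"
  shows "y t - y s = integral {s..t} z"
proof -
  define \<theta> where "\<theta> n r = smooth_step (n * r - n * s) - smooth_step (n * r - n * t)" for n r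
  have \<theta>Ck: "Ck k (\<theta> n)" for k n
  proof -
    have "Ck k (\<lambda>r::real. smooth_step (n * (r \<bullet> 1) + - (n * s)) + (-1) * smooth_step (n * (r \<bullet> 1) + - (n * t)))"
      by (intro Ck_add Ck_mult Ck_const Ck_compose_affine Ck_smooth_step)
    then show ?thesis by (simp add: \<theta>_def[abs_def])
  qed
  have \<theta>0: "\<theta> n r = 0" if n: "n > 0" and r: "r \<notin> {s..t + 1 / n}" for n r
  proof -
    consider "r < s" | "r > t + 1 / n" using r by force
    then show ?thesis
    proof cases
      case 1
      then have "n * r - n * s \<le> 0" "n * r - n * t \<le> 0" using n st by auto
      then show ?thesis by (simp add: \<theta>_def smooth_step_eq_0)
    next
      case 2
      then have "n * (r - t) \<ge> n * (1 / n)" using n by (intro mult_left_mono) auto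
      then have "n * r - n * t \<ge> 1" using n by (simp add: right_diff_distrib)
      moreover have "n * s \<le> n * t" using n st by auto
      ultimately have "n * r - n * s \<ge> 1" by linarith
      with \<open>n * r - n * t \<ge> 1\<close> show ?thesis by (simp add: \<theta>_def smooth_step_eq_1)
    qed
  qed
  have \<theta>test: "\<theta> n \<in> test_functions {0<..<T}" if n: "n > 0" "1 / n < T - t" for n
  proof -
    have "{r. \<theta> n r \<noteq> 0} \<subseteq> {s..t + 1 / n}" using \<theta>0[OF n(1)] by blast
    then have *: "closure {r. \<theta> n r \<noteq> 0} \<subseteq> {s..t + 1 / n}" by (simp add: closure_minimal)
    then show ?thesis
      using n st \<theta>Ck bounded_subset[OF _ *]
      by (auto simp: test_functions_def compact_eq_bounded_closed subset_iff)
  qed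
  have \<theta>': "deriv (\<theta> n) r = kernel1 n s r - kernel1 n t r" for n r
    unfolding \<theta>_def by (intro DERIV_imp_deriv DERIV_diff scaled_step_derivative)
  have ky: "integrable (lebesgue_on {0<..<T}) (\<lambda>r. y r * kernel1 n c r)" for n c
    by (intro integrable_lebesgue_on_continuous continuous_intros y kernel1_continuous)
  have "(\<lambda>n. (LINT r|lebesgue_on {0<..<T}. y r * kernel1 (real (Suc n)) s r)
      - (LINT r|lebesgue_on {0<..<T}. y r * kernel1 (real (Suc n)) t r)) \<longlonglongrightarrow> y s - y t"
    by (intro tendsto_diff kernel1_tendsto y) (use st in auto)
  then have lim1: "(\<lambda>n. LINT r|lebesgue_on {0<..<T}. y r * deriv (\<theta> (real (Suc n))) r) \<longlonglongrightarrow> y s - y t"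
    using ky by (simp add: \<theta>' right_diff_distrib del: of_nat_Suc)
  have lim2: "(\<lambda>n. LINT r|lebesgue_on {0<..<T}. z r * \<theta> (real (Suc n)) r) \<longlonglongrightarrow>
      (LINT r|lebesgue_on {0<..<T}. z r * indicator {s<..t} r)"
  proof (rule integral_dominated_convergence[where w="\<lambda>r. \<bar>z r\<bar>"])
    show "(\<lambda>r. z r * \<theta> (real (Suc n)) r) \<in> borel_measurable (lebesgue_on {0<..<T})" for n
      by (intro borel_measurable_times borel_measurable_integrable[OF z]
          continuous_imp_measurable_on_sets_lebesgue continuous_on_subset[OF Ck_continuous[OF \<theta>Ck[of 0]]]) auto
    have "indicat_real {s<..t} \<in> borel_measurable (lebesgue_on {0<..<T})"
      by (intro borel_measurable_indicator) (use st in \<open>auto simp: sets_restrict_space_iff\<close>)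
    then show "(\<lambda>r. z r * indicator {s<..t} r) \<in> borel_measurable (lebesgue_on {0<..<T})"
      by (intro borel_measurable_times borel_measurable_integrable[OF z])
    show "integrable (lebesgue_on {0<..<T}) (\<lambda>r. \<bar>z r\<bar>)" using z by simp
    have step: "(\<lambda>n. smooth_step (real (Suc n) * r - real (Suc n) * c)) \<longlonglongrightarrow> indicator {c<..} r" for r c
    proof (cases "c < r")
      case True
      then obtain m :: nat where m: "inverse (real (Suc m)) < r - c" using reals_Archimedean[of "r - c"] by auto
      have "smooth_step (real (Suc n) * r - real (Suc n) * c) = 1" if "n \<ge> m" for n
      proof (rule smooth_step_eq_1)
        have "1 \<le> real (Suc m) * (r - c)" using m by (simp add: inverse_eq_divide divide_simps mult.commute del: of_nat_Suc)
        also have "\<dots> \<le> real (Suc n) * (r - c)" using that True by (intro mult_right_mono) auto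
        finally show "1 \<le> real (Suc n) * r - real (Suc n) * c" by (simp add: right_diff_distrib)
      qed
      then have "\<forall>\<^sub>F n in sequentially. smooth_step (real (Suc n) * r - real (Suc n) * c) = 1"
        by (auto simp: eventually_sequentially)
      then show ?thesis using True by (simp add: tendsto_eventually)
    next
      case False
      then have "smooth_step (real (Suc n) * r - real (Suc n) * c) = 0" for n
        by (intro smooth_step_eq_0) (simp add: mult_left_mono)
      then show ?thesis using False by simp
    qed
    show "AE r in lebesgue_on {0<..<T}. (\<lambda>n. z r * \<theta> (real (Suc n)) r) \<longlonglongrightarrow> z r * indicator {s<..t} r"
    proof (rule AE_I2)
      fix r
      have "(\<lambda>n. z r * \<theta> (real (Suc n)) r) \<longlonglongrightarrow> z r * (indicator {s<..} r - indicator {t<..} r)"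
        unfolding \<theta>_def by (intro tendsto_mult tendsto_const tendsto_diff step)
      also have "indicator {s<..} r - indicator {t<..} r = indicat_real {s<..t} r"
        using st by (auto simp: indicator_def)
      finally show "(\<lambda>n. z r * \<theta> (real (Suc n)) r) \<longlonglongrightarrow> z r * indicator {s<..t} r" .
    qed
    have "\<bar>\<theta> n r\<bar> \<le> 1" for n r
      using smooth_step_bounds[of "n * r - n * s"] smooth_step_bounds[of "n * r - n * t"] by (simp add: \<theta>_def)
    then show "AE r in lebesgue_on {0<..<T}. norm (z r * \<theta> (real (Suc n)) r) \<le> \<bar>z r\<bar>" for n
      by (intro AE_I2) (simp add: abs_mult mult_left_le)
  qed
  have "(LINT r|lebesgue_on {0<..<T}. z r * indicator {s<..t} r) = integral {s..t} z"
  proof -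
    have "integrable (lebesgue_on {s<..t}) z"
      by (rule integrable_lebesgue_on_subset[OF z]) (use st in auto)
    moreover have "(LINT r|lebesgue_on {0<..<T}. z r * indicator {s<..t} r) = (LINT r|lebesgue_on {s<..t}. z r)"
      by (subst (1 2) integral_restrict_space)
        (use st in \<open>auto intro!: Bochner_Integration.integral_cong simp: indicator_def\<close>)
    moreover have "integral {s<..t} z = integral {s..t} z"
      by (rule integral_spike_set) (auto intro: negligible_subset[of "{s}"])
    ultimately show ?thesis using lebesgue_integral_eq_integral[of "{s<..t}" z] by simp
  qed
  with lim2 have lim2: "(\<lambda>n. - (LINT r|lebesgue_on {0<..<T}. z r * \<theta> (real (Suc n)) r)) \<longlonglongrightarrow> - integral {s..t} z"
    by (simp add: tendsto_minus)
  \<comment> \<open>From this index on the second step is completed before \<open>T\<close>, so the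
    difference of the steps has compact support in (0, T).\<close>
  obtain m :: nat where m: "inverse (real (Suc m)) < T - t" using reals_Archimedean[of "T - t"] st by auto
  have "(LINT r|lebesgue_on {0<..<T}. y r * deriv (\<theta> (real (Suc n))) r) = - (LINT r|lebesgue_on {0<..<T}. z r * \<theta> (real (Suc n)) r)"
    if "n \<ge> m" for n
  proof (intro weak \<theta>test)
    have "inverse (real (Suc n)) \<le> inverse (real (Suc m))" using that by (intro le_imp_inverse_le) auto
    then show "1 / real (Suc n) < T - t" using m by (simp add: inverse_eq_divide)
  qed simp
  then have "\<forall>\<^sub>F n in sequentially. - (LINT r|lebesgue_on {0<..<T}. z r * \<theta> (real (Suc n)) r) = (LINT r|lebesgue_on {0<..<T}. y r * deriv (\<theta> (real (Suc n))) r)"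
    by (intro eventually_sequentiallyI[of m]) simp
  from Lim_transform_eventually[OF lim2 this] have "y s - y t = - integral {s..t} z"
    using lim1 LIMSEQ_unique by blast
  then show ?thesis by simp
qed

subsection \<open>Gronwall's inequality\<close>

text \<open>Monotonicity over short distances adds up along a partition of mesh below
  \<open>d\<close>.\<close>

lemma locally_nonincreasing_imp_le:
  fixes F :: "real \<Rightarrow> real"
  assumes "a \<le> b" "d > 0" and F: "\<And>x y. a \<le> x \<Longrightarrow> x \<le> y \<Longrightarrow> y \<le> b \<Longrightarrow> y - x < d \<Longrightarrow> F y \<le> F x"
  shows "F b \<le> F a"
proof -
  obtain m :: nat where m: "(b - a) / d < real m" using reals_Archimedean2 by blast
  have m0: "m > 0" using m assms by (metis divide_nonneg_pos diff_ge_0_iff_ge gr0I not_less of_nat_0)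
  define x where "x k = a + real k * ((b - a) / real m)" for k
  have st: "0 \<le> (b - a) / real m" "(b - a) / real m < d"
    using m m0 assms by (auto simp: field_simps)
  have "k \<le> m \<Longrightarrow> F (x k) \<le> F a" for k
  proof (induction k)
    case (Suc k)
    have "x (Suc k) \<le> a + real m * ((b - a) / real m)"
      unfolding x_def using Suc st by (intro add_left_mono mult_right_mono) auto
    then have "x (Suc k) \<le> b" using m0 by simp
    moreover have "x (Suc k) - x k = (b - a) / real m" unfolding x_def of_nat_Suc distrib_right by simp
    moreover have "a \<le> x k" using st by (simp add: x_def del: times_divide_eq_right)
    ultimately have "F (x (Suc k)) \<le> F (x k)" using st by (intro F) auto
    then show ?case using Suc by simp
  qed (simp add: x_def)
  from this[of m] show ?thesis using m0 by (simp add: x_def)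
qed

lemma integrable_mult_continuous:
  fixes A \<alpha> :: "real \<Rightarrow> real"
  assumes A: "continuous_on {a..b} A" and \<alpha>: "\<alpha> absolutely_integrable_on {a..b}" and "a \<le> x" "y \<le> b"
  shows "(\<lambda>t. \<alpha> t * A t) integrable_on {x..y}"
proof -
  have "(\<lambda>t. A t * \<alpha> t) absolutely_integrable_on {a..b}"
  proof (rule absolutely_integrable_bounded_measurable_product_real)
    show "A \<in> borel_measurable (lebesgue_on {a..b})"
      by (rule continuous_imp_measurable_on_sets_lebesgue[OF A]) simp
    show "bounded (A ` {a..b})"
      by (intro compact_imp_bounded compact_continuous_image A) simp
  qed (use \<alpha> in auto)
  then have "(\<lambda>t. A t * \<alpha> t) absolutely_integrable_on {x..y}"
    by (rule set_integrable_subset) (use assms in auto)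
  then show ?thesis by (simp add: absolutely_integrable_on_def mult.commute)
qed

text \<open>
  The coefficient \<open>\<alpha>\<close> is merely integrable, so \<open>exp (\<integral>\<alpha>)\<close> need not be differentiable.  Instead,
  \<open>1 - z \<le> exp (- z)\<close> is used on the pieces of a fine partition.
\<close>

lemma gronwall:
  fixes A \<alpha> :: "real \<Rightarrow> real"
  assumes ab: "a \<le> b" and A: "continuous_on {a..b} A" "\<And>t. t \<in> {a..b} \<Longrightarrow> 0 \<le> A t"
    and \<alpha>: "\<alpha> absolutely_integrable_on {a..b}" and \<beta>: "\<beta> \<ge> 0"
    and le: "\<And>x y. a \<le> x \<Longrightarrow> x \<le> y \<Longrightarrow> y \<le> b \<Longrightarrow>
      A y - A x \<le> \<beta> * (y - x) - integral {x..y} (\<lambda>t. \<alpha> t * A t)"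
    and M: "\<And>x. x \<in> {a..b} \<Longrightarrow> - integral {x..b} \<alpha> \<le> M"
  shows "A b \<le> exp (- integral {a..b} \<alpha>) * A a + exp M * \<beta> * (b - a)"
proof -
  define \<theta> where "\<theta> t = integral {a..t} \<alpha>" for t
  define \<Theta> where "\<Theta> t = integral {a..t} (\<lambda>r. \<bar>\<alpha> r\<bar>)" for t
  \<comment> \<open>By the hypothesis on \<open>M\<close>, this bounds exp (\<theta> y) for every
    \<open>y\<close> in the interval; it multiplies all error terms.\<close>
  define C where "C = exp (\<theta> b + M)"
  have C: "C > 0" by (simp add: C_def)
  have sub: "\<alpha> integrable_on {x..y}" "(\<lambda>r. \<bar>\<alpha> r\<bar>) integrable_on {x..y}" if "a \<le> x" "y \<le> b" for x y
  proof -
    have "\<alpha> absolutely_integrable_on {x..y}"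
      by (rule set_integrable_subset[OF \<alpha>]) (use that in auto)
    then show "\<alpha> integrable_on {x..y}" "(\<lambda>r. \<bar>\<alpha> r\<bar>) integrable_on {x..y}"
      by (auto simp: absolutely_integrable_on_def)
  qed
  have comb: "\<theta> y = \<theta> x + integral {x..y} \<alpha>" "\<Theta> y = \<Theta> x + integral {x..y} (\<lambda>r. \<bar>\<alpha> r\<bar>)"
    if "a \<le> x" "x \<le> y" "y \<le> b" for x y
    unfolding \<theta>_def \<Theta>_def using that
    by (auto intro!: Henstock_Kurzweil_Integration.integral_combine[symmetric] sub)
  note \<alpha>A = integrable_mult_continuous[OF A(1) \<alpha>]
  have step: "A b * exp (\<theta> b) \<le> A a + C * (\<beta> * (b - a) + \<omega> * \<Theta> b)" if \<omega>: "\<omega> > 0" for \<omega>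
  proof -
    have "uniformly_continuous_on {a..b} A" by (intro compact_uniformly_continuous A) simp
    then obtain d where d: "d > 0" "\<And>x y. x \<in> {a..b} \<Longrightarrow> y \<in> {a..b} \<Longrightarrow> dist y x < d \<Longrightarrow> dist (A y) (A x) < \<omega>"
      using \<omega> unfolding uniformly_continuous_on_def by metis
    \<comment> \<open>The function \<open>A\<close> with its integrating factor, less the errors
      accumulated so far; the term with \<open>\<omega>\<close> pays for freezing \<open>A\<close>
      at the left end of each piece.\<close>
    define F where "F t = A t * exp (\<theta> t) - C * (\<beta> * t + \<omega> * \<Theta> t)" for t
    have "F b \<le> F a"
    proof (rule locally_nonincreasing_imp_le[OF ab d(1)])
      fix x y assume xy: "a \<le> x" "x \<le> y" "y \<le> b" "y - x < d"
      let ?z = "integral {x..y} \<alpha>" and ?w = "integral {x..y} (\<lambda>r. \<bar>\<alpha> r\<bar>)"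
      have i: "(\<lambda>r. A x * \<alpha> r) integrable_on {x..y}" "(\<lambda>r. \<omega> * \<bar>\<alpha> r\<bar>) integrable_on {x..y}"
        using integrable_on_cmult_left[OF sub(1)[OF xy(1,3)], of "A x"] integrable_on_cmult_left[OF sub(2)[OF xy(1,3)], of \<omega>]
        by simp_all
      have "A x * ?z - \<omega> * ?w = integral {x..y} (\<lambda>r. A x * \<alpha> r - \<omega> * \<bar>\<alpha> r\<bar>)"
        by (simp add: Henstock_Kurzweil_Integration.integral_diff[OF i])
      also have "\<dots> \<le> integral {x..y} (\<lambda>r. \<alpha> r * A r)"
      proof (rule integral_le)
        show "(\<lambda>r. A x * \<alpha> r - \<omega> * \<bar>\<alpha> r\<bar>) integrable_on {x..y}"
          by (rule Henstock_Kurzweil_Integration.integrable_diff[OF i])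
        fix r assume r: "r \<in> {x..y}"
        have "\<bar>A x - A r\<bar> \<le> \<omega>"
          using d(2)[of r x] xy r by (force simp: dist_real_def)
        then have "\<alpha> r * (A x - A r) \<le> \<bar>\<alpha> r\<bar> * \<omega>"
          using mult_left_mono[OF _ abs_ge_zero[of "\<alpha> r"]] abs_ge_self[of "\<alpha> r * (A x - A r)"]
          by (fastforce simp: abs_mult)
        then show "A x * \<alpha> r - \<omega> * \<bar>\<alpha> r\<bar> \<le> \<alpha> r * A r" by (simp add: algebra_simps)
      qed (intro \<alpha>A xy)
      finally have "A y \<le> A x * (1 - ?z) + (\<beta> * (y - x) + \<omega> * ?w)"
        using le[OF xy(1-3)] by (simp add: algebra_simps)
      also have "A x * (1 - ?z) \<le> A x * exp (- ?z)"
        using exp_ge_add_one_self[of "- ?z"] A(2)[of x] xy by (intro mult_left_mono) auto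
      finally have "A y * exp (\<theta> y) \<le> (A x * exp (- ?z) + (\<beta> * (y - x) + \<omega> * ?w)) * exp (\<theta> y)" by simp
      also have "\<dots> = A x * exp (\<theta> x) + (\<beta> * (y - x) + \<omega> * ?w) * exp (\<theta> y)"
        using comb(1)[OF xy(1-3)] by (simp add: distrib_right mult.assoc flip: exp_add)
      also have "(\<beta> * (y - x) + \<omega> * ?w) * exp (\<theta> y) \<le> (\<beta> * (y - x) + \<omega> * ?w) * C"
      proof (rule mult_left_mono)
        have "\<theta> y \<le> \<theta> b + M" using comb(1)[of y b] M[of y] xy by simp
        then show "exp (\<theta> y) \<le> C" by (simp add: C_def)
        show "0 \<le> \<beta> * (y - x) + \<omega> * ?w"
          using \<beta> xy \<omega> by (intro add_nonneg_nonneg mult_nonneg_nonneg Henstock_Kurzweil_Integration.integral_nonneg sub) auto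
      qed
      finally show "F y \<le> F x"
        using comb(2)[OF xy(1-3)] by (simp add: F_def algebra_simps)
    qed
    then show ?thesis by (simp add: F_def \<theta>_def \<Theta>_def algebra_simps)
  qed
  have "A b * exp (\<theta> b) \<le> A a + C * (\<beta> * (b - a))"
  proof (rule tendsto_lowerbound)
    have "((\<lambda>\<omega>. A a + C * (\<beta> * (b - a) + \<omega> * \<Theta> b)) \<longlongrightarrow> A a + C * (\<beta> * (b - a) + 0 * \<Theta> b)) (at_right 0)"
      by (intro tendsto_intros)
    then show "((\<lambda>\<omega>. A a + C * (\<beta> * (b - a) + \<omega> * \<Theta> b)) \<longlongrightarrow> A a + C * (\<beta> * (b - a))) (at_right 0)" by simp
    show "\<forall>\<^sub>F \<omega> in at_right 0. A b * exp (\<theta> b) \<le> A a + C * (\<beta> * (b - a) + \<omega> * \<Theta> b)"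
      using step by (auto simp: eventually_at_right_field intro: exI[of _ 1])
  qed simp
  then have "A b * exp (\<theta> b) * exp (- \<theta> b) \<le> (A a + C * (\<beta> * (b - a))) * exp (- \<theta> b)"
    by (intro mult_right_mono) auto
  moreover have "A b * exp (\<theta> b) * exp (- \<theta> b) = A b" by (simp add: mult.assoc flip: exp_add)
  moreover have "C * (\<beta> * (b - a)) * exp (- \<theta> b) = exp M * \<beta> * (b - a)"
    by (simp add: C_def exp_add exp_minus field_simps)
  ultimately have "A b \<le> A a * exp (- \<theta> b) + exp M * \<beta> * (b - a)"
    by (simp only: distrib_right)
  then show ?thesis by (simp add: \<theta>_def mult.commute[of "A a"])
qed

subsection \<open>Strongly measurable functions\<close>

text \<open>Completeness of Lebesgue measure allows changes on null sets; the functions are extended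
  by 0 to apply this on the whole space.\<close>

lemma borel_measurable_lebesgue_on_AE:
  fixes f g :: "'a::euclidean_space \<Rightarrow> real"
  assumes S: "S \<in> sets lebesgue" and f: "f \<in> borel_measurable (lebesgue_on S)"
    and ae: "AE x in lebesgue_on S. f x = g x"
  shows "g \<in> borel_measurable (lebesgue_on S)"
proof -
  have "AE x in lebesgue. x \<in> S \<longrightarrow> f x = g x"
    using ae S by (subst (asm) AE_restrict_space_iff) auto
  then have "AE x in lebesgue. (if x \<in> S then f x else 0) = (if x \<in> S then g x else 0)"
    by eventually_elim auto
  with borel_measurable_if_I[OF f S] have "(\<lambda>x. if x \<in> S then g x else 0) \<in> borel_measurable lebesgue"
    by (rule borel_measurable_AE)
  then show ?thesis by (rule borel_measurable_if_D)
qed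

lemma borel_measurable_lebesgue_on_AE_limit:
  fixes f :: "nat \<Rightarrow> 'a::euclidean_space \<Rightarrow> real"
  assumes S: "S \<in> sets lebesgue" and f: "\<And>n. f n \<in> borel_measurable (lebesgue_on S)"
    and lim: "AE x in lebesgue_on S. (\<lambda>n. f n x) \<longlonglongrightarrow> g x"
  shows "g \<in> borel_measurable (lebesgue_on S)"
proof (rule borel_measurable_lebesgue_on_AE[OF S])
  show "(\<lambda>x. lim (\<lambda>n. f n x)) \<in> borel_measurable (lebesgue_on S)"
    by (rule borel_measurable_lim_metric[OF f])
  show "AE x in lebesgue_on S. lim (\<lambda>n. f n x) = g x"
    using lim by eventually_elim (rule limI)
qed

text \<open>The finitely many values of \<open>\<sigma>\<close> split the space into measurable
  pieces, and on each of them the second argument of \<open>h\<close> is constant.\<close>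

lemma borel_measurable_simple_function_compose:
  fixes h :: "'a \<Rightarrow> 'b \<Rightarrow> real"
  assumes \<sigma>: "simple_function M \<sigma>" and h: "\<And>\<phi>. \<phi> \<in> \<sigma> ` space M \<Longrightarrow> (\<lambda>t. h t \<phi>) \<in> borel_measurable M"
  shows "(\<lambda>t. h t (\<sigma> t)) \<in> borel_measurable M"
proof -
  let ?A = "\<lambda>\<phi>. \<sigma> -` {\<phi>} \<inter> space M"
  have "(\<lambda>t. \<Sum>\<phi>\<in>\<sigma> ` space M. indicator (?A \<phi>) t * h t \<phi>) \<in> borel_measurable M"
    by (intro borel_measurable_sum borel_measurable_times h borel_measurable_indicator simple_functionD(2)[OF \<sigma>])
  moreover have "(\<Sum>\<phi>\<in>\<sigma> ` space M. indicator (?A \<phi>) t * h t \<phi>) = h t (\<sigma> t)" if t: "t \<in> space M" for t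
  proof -
    have "(\<Sum>\<phi>\<in>\<sigma> ` space M. indicator (?A \<phi>) t * h t \<phi>) = (\<Sum>\<phi>\<in>\<sigma> ` space M. if \<phi> = \<sigma> t then h t \<phi> else 0)"
      using t by (intro sum.cong) (auto simp: indicator_def)
    also have "\<dots> = h t (\<sigma> t)" using t simple_functionD(1)[OF \<sigma>] by simp
    finally show ?thesis .
  qed
  ultimately show ?thesis by (subst measurable_cong[symmetric]) auto
qed

text \<open>Passes to the limit in \<open>h t (s n t)\<close> for simple \<open>s n\<close>, which
  is how scalar functions of \<open>u t\<close> are shown to be measurable below. Continuity is
  asked only at \<open>x = u t\<close>, so that facts available at times with
  \<open>u t \<in> X\<close> may be used to verify it.\<close>

lemma strongly_measurable_compose:
  fixes h :: "real \<Rightarrow> ('a \<Rightarrow> 'b::real_normed_vector) \<Rightarrow> real"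
  assumes u: "strongly_measurable I X nrm u" and I: "I \<in> sets lebesgue"
    and h: "\<And>\<phi>. \<phi> \<in> X \<Longrightarrow> (\<lambda>t. h t \<phi>) \<in> borel_measurable (lebesgue_on I)"
    and cont: "\<And>t w x. t \<in> I \<Longrightarrow> (\<And>n. w n \<in> X) \<Longrightarrow> x \<in> X \<Longrightarrow> x = u t \<Longrightarrow>
      (\<lambda>n. nrm (x - w n)) \<longlonglongrightarrow> 0 \<Longrightarrow> (\<lambda>n::nat. h t (w n)) \<longlonglongrightarrow> h t x"
  shows "(\<lambda>t. h t (u t)) \<in> borel_measurable (lebesgue_on I)"
proof -
  obtain s where s: "\<And>n::nat. simple_function (lebesgue_on I) (s n)" "\<And>n. s n ` I \<subseteq> X"
    "AE t in lebesgue_on I. u t \<in> X \<and> (\<lambda>n. nrm (u t - s n t)) \<longlonglongrightarrow> 0"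
    using u unfolding strongly_measurable_def by blast
  have I': "space (lebesgue_on I) = I" by (simp add: space_restrict_space)
  show ?thesis
  proof (rule borel_measurable_lebesgue_on_AE_limit[OF I])
    show "(\<lambda>t. h t (s n t)) \<in> borel_measurable (lebesgue_on I)" for n
      by (rule borel_measurable_simple_function_compose[OF s(1)]) (use s(2)[of n] h in \<open>auto simp: I'\<close>)
    have "AE t in lebesgue_on I. t \<in> I" by (rule AE_I2) (simp add: I')
    then show "AE t in lebesgue_on I. (\<lambda>n. h t (s n t)) \<longlonglongrightarrow> h t (u t)"
      using s(3)
    proof eventually_elim
      case (elim t)
      then show ?case using s(2) by (intro cont) auto
    qed
  qed
qed

lemma strongly_measurable_AE_in: "strongly_measurable I X nrm u \<Longrightarrow> AE t in lebesgue_on I. u t \<in> X"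
  unfolding strongly_measurable_def by (auto elim: eventually_mono)

lemma finite_disjoint_compact_separated:
  fixes K :: "'i \<Rightarrow> 'a::euclidean_space set"
  assumes fin: "finite R" and K: "\<And>i. i \<in> R \<Longrightarrow> compact (K i)"
    and disj: "\<And>i j. i \<in> R \<Longrightarrow> j \<in> R \<Longrightarrow> i \<noteq> j \<Longrightarrow> K i \<inter> K j = {}"
  shows "\<exists>d>0. \<forall>i\<in>R. \<forall>j\<in>R. \<forall>x\<in>K i. \<forall>y\<in>K j. dist x y < d \<longrightarrow> i = j"
proof -
  have "\<forall>\<^sub>F d in at_right 0. \<forall>x\<in>K i. \<forall>y\<in>K j. dist x y < d \<longrightarrow> i = j" if ij: "i \<in> R" "j \<in> R" for i j
  proof (cases "i = j")
    case False
    obtain d where "d > 0" "\<forall>x\<in>K i. \<forall>y\<in>K j. d \<le> dist x y"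
      using separate_compact_closed[OF K[OF ij(1)] compact_imp_closed[OF K[OF ij(2)]] disj[OF ij False]] by blast
    then show ?thesis unfolding eventually_at_right_field by (intro exI[of _ d]) force
  qed simp
  then have "\<forall>\<^sub>F d in at_right 0. \<forall>i\<in>R. \<forall>j\<in>R. \<forall>x\<in>K i. \<forall>y\<in>K j. dist x y < d \<longrightarrow> i = j"
    by (intro eventually_ball_finite[OF fin] ballI)
  then have "\<forall>\<^sub>F d in at_right (0::real). 0 < d \<and> (\<forall>i\<in>R. \<forall>j\<in>R. \<forall>x\<in>K i. \<forall>y\<in>K j. dist x y < d \<longrightarrow> i = j)"
    by (intro eventually_conj eventually_at_right_less)
  then show ?thesis using eventually_happens trivial_limit_at_right_real by blast
qed

context bounded_open_set begin

lemma V_norm_diff_commute: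
  assumes "u \<in> H1_space \<Omega>" "v \<in> H1_space \<Omega>"
  shows "V_norm \<Omega> (\<lambda>x. u x - v x) = V_norm \<Omega> (\<lambda>x. v x - u x)"
  using V_norm_scaleR[OF H1_diff(1)[OF assms], of "-1"] by simp

lemma V_norm_diff_le:
  assumes "u \<in> H1_space \<Omega>" "v \<in> H1_space \<Omega>"
  shows "V_norm \<Omega> (\<lambda>x. u x - v x) \<le> V_norm \<Omega> u + V_norm \<Omega> v"
  using V_norm_add[OF assms(1) H1_scaleR(1)[OF assms(2), of "-1"]] V_norm_scaleR[OF assms(2), of "-1"] by simp

lemma V_norm_diff_triangle:
  assumes "u \<in> H1_space \<Omega>" "v \<in> H1_space \<Omega>" "w \<in> H1_space \<Omega>"
  shows "V_norm \<Omega> (\<lambda>x. u x - v x) \<le> V_norm \<Omega> (\<lambda>x. u x - w x) + V_norm \<Omega> (\<lambda>x. v x - w x)"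
  using V_norm_diff_le[OF H1_diff(1)[OF assms(1,3)] H1_diff(1)[OF assms(2,3)]] by simp

text \<open>
  A Lusin-type property: up to functions that are small in \<open>L\<^sup>2\<close>, a strongly measurable
  function is uniformly continuous.
\<close>

lemma strongly_measurable_V_lusin:
  assumes u: "strongly_measurable {0..T} (V_space \<Omega>) (V_norm \<Omega>) u"
    and int: "integrable (lebesgue_on {0..T}) (\<lambda>t. (V_norm \<Omega> (u t))\<^sup>2)" and \<epsilon>: "\<epsilon> > 0"
  shows "\<exists>e d. d > 0 \<and> integrable (lebesgue_on {0..T}) (\<lambda>t. (e t)\<^sup>2) \<and> (LINT t|lebesgue_on {0..T}. (e t)\<^sup>2) < \<epsilon> \<and>
    (\<forall>t. 0 \<le> e t) \<and>
    (\<forall>s\<in>{0..T}. \<forall>r\<in>{0..T}. u s \<in> V_space \<Omega> \<longrightarrow> u r \<in> V_space \<Omega> \<longrightarrow> \<bar>s - r\<bar> < d \<longrightarrow>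
      V_norm \<Omega> (\<lambda>x. u s x - u r x) \<le> e s + e r + \<epsilon>)"
proof -
  define L where "L = lebesgue_on {0..T}"
  have sL: "space L = {0..T}" by (simp add: L_def space_restrict_space)
  interpret L: finite_measure L unfolding L_def by (rule finite_measure_lebesgue_on) simp
  define N where "N t = V_norm \<Omega> (u t)" for t
  have N0: "0 \<le> N t" for t by (simp add: N_def V_norm_nonneg)
  have N2: "integrable L (\<lambda>t. (N t)\<^sup>2)" using int by (simp add: L_def N_def)
  have [measurable]: "N \<in> borel_measurable L"
  proof -
    have "(\<lambda>t. sqrt ((N t)\<^sup>2)) \<in> borel_measurable L"
      using borel_measurable_integrable[OF N2] by measurable
    then show ?thesis using N0 by simp
  qed
  obtain s where s: "\<And>n::nat. simple_function L (s n)" "\<And>n. s n ` {0..T} \<subseteq> V_space \<Omega>"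
    "AE t in L. u t \<in> V_space \<Omega> \<and> (\<lambda>n. V_norm \<Omega> (\<lambda>x. u t x - s n t x)) \<longlonglongrightarrow> 0"
    using u unfolding strongly_measurable_def L_def fun_diff_def by blast
  \<comment> \<open>The times at which ||u|| exceeds a high level carry little of the integral of
    ||u||^2; this fixes the level \<open>M\<close>.\<close>
  have "(\<lambda>m::nat. LINT t|L. indicator {t. N t > real m} t * (N t)\<^sup>2) \<longlonglongrightarrow> (LINT t|L. 0)"
  proof (rule integral_dominated_convergence[where w="\<lambda>t. (N t)\<^sup>2"])
    show "AE t in L. (\<lambda>m. indicator {t. N t > real m} t * (N t)\<^sup>2) \<longlonglongrightarrow> 0"
    proof (rule AE_I2)
      fix t
      obtain m0 :: nat where "N t \<le> real m0" using real_arch_simple by blast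
      then have "indicator {t. N t > real m} t * (N t)\<^sup>2 = 0" if "m \<ge> m0" for m
        using that by (auto simp: indicator_def)
      then show "(\<lambda>m. indicator {t. N t > real m} t * (N t)\<^sup>2) \<longlonglongrightarrow> 0"
        by (intro tendsto_eventually eventually_sequentiallyI[of m0])
    qed
  qed (use N2 in \<open>auto simp: indicator_def\<close>)
  then have "\<forall>\<^sub>F m in sequentially. (LINT t|L. indicator {t. N t > real m} t * (N t)\<^sup>2) < \<epsilon> / 16"
    using \<epsilon> by (intro order_tendstoD(2)[where y=0]) auto
  then obtain m0 where m0: "(LINT t|L. indicator {t. N t > real m0} t * (N t)\<^sup>2) < \<epsilon> / 16"
    using eventually_happens'[OF sequentially_bot] by blast
  define M where "M = real m0"
  have M: "M \<ge> 0" by (simp add: M_def)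
  \<comment> \<open>Chosen so that 8 M^2 * (2 \<mu>), the contribution of an exceptional set of
    measure 2 \<mu>, stays below \<epsilon> / 2; the 1 in the denominator covers M = 0.\<close>
  define \<mu> where "\<mu> = \<epsilon> / (32 * (M\<^sup>2 + 1))"
  have M1: "M\<^sup>2 + 1 > 0" by (intro add_nonneg_pos) auto
  then have \<mu>: "\<mu> > 0" using \<epsilon> by (simp add: \<mu>_def)
  have dm: "(\<lambda>t. V_norm \<Omega> (\<lambda>x. u t x - s n t x)) \<in> borel_measurable L" for n
  proof -
    have *: "(\<lambda>t. V_norm \<Omega> (\<lambda>x. u t x - \<phi> x)) \<in> borel_measurable L" if \<phi>: "\<phi> \<in> V_space \<Omega>" for \<phi>
      unfolding L_def
    proof (rule strongly_measurable_compose[OF u, where h="\<lambda>t w. V_norm \<Omega> (\<lambda>x. w x - \<phi> x)"])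
      fix t :: real and w :: "nat \<Rightarrow> field2" and x
      assume w: "\<And>n. w n \<in> V_space \<Omega>" "x \<in> V_space \<Omega>" "(\<lambda>n. V_norm \<Omega> (x - w n)) \<longlonglongrightarrow> 0"
      have eq: "(\<lambda>y. x y - \<phi> y - (w n y - \<phi> y)) = (\<lambda>y. x y - w n y)" for n by auto
      show "(\<lambda>n. V_norm \<Omega> (\<lambda>y. w n y - \<phi> y)) \<longlonglongrightarrow> V_norm \<Omega> (\<lambda>y. x y - \<phi> y)"
        by (rule V_norm_approx) (use w \<phi> in \<open>auto intro!: H1_diff intro: V_H1 simp: eq fun_diff_def\<close>)
    qed auto
    show ?thesis
      by (rule borel_measurable_simple_function_compose[OF s(1)]) (use * s(2)[of n] sL in auto)
  qed
  define D where "D n = {t\<in>{0..T}. V_norm \<Omega> (\<lambda>x. u t x - s n t x) > \<epsilon> / 2}" for n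
  have Dm: "D n \<in> sets L" for n
    using measurable_sets[OF dm[of n], of "{\<epsilon>/2<..}"] by (simp add: D_def sL vimage_def Int_def conj_commute)
  have "(\<lambda>n. LINT t|L. indicat_real (D n) t) \<longlonglongrightarrow> (LINT t|L. 0)"
  proof (rule integral_dominated_convergence[where w="\<lambda>t. 1"])
    show "AE t in L. (\<lambda>n. indicat_real (D n) t) \<longlonglongrightarrow> 0"
      using s(3)
    proof eventually_elim
      case (elim t)
      then have "\<forall>\<^sub>F n in sequentially. V_norm \<Omega> (\<lambda>x. u t x - s n t x) < \<epsilon> / 2"
        using \<epsilon> by (intro order_tendstoD(2)[where y=0]) auto
      then have "\<forall>\<^sub>F n in sequentially. indicat_real (D n) t = 0"
        by eventually_elim (auto simp: D_def)
      then show ?case by (rule tendsto_eventually)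
    qed
  qed (use Dm in \<open>auto simp: indicator_def\<close>)
  then have "\<forall>\<^sub>F n in sequentially. (LINT t|L. indicat_real (D n) t) < \<mu>"
    using \<mu> by (intro order_tendstoD(2)[where y=0]) auto
  then obtain n where n: "(LINT t|L. indicat_real (D n) t) < \<mu>"
    using eventually_happens'[OF sequentially_bot] by blast
  define \<sigma> where "\<sigma> = s n"
  define R where "R = \<sigma> ` {0..T}"
  have R: "finite R" using simple_functionD(1)[OF s(1)[of n]] by (simp add: R_def \<sigma>_def sL)
  define A where "A \<phi> = {t\<in>{0..T}. \<sigma> t = \<phi>}" for \<phi>
  have A: "A \<phi> \<in> sets lebesgue" for \<phi>
  proof -
    have "\<sigma> -` {\<phi>} \<inter> {0..T} \<in> sets L" using simple_functionD(2)[OF s(1)[of n], of "{\<phi>}"] by (simp add: \<sigma>_def sL)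
    moreover have "\<sigma> -` {\<phi>} \<inter> {0..T} = A \<phi>" by (auto simp: A_def)
    ultimately show ?thesis by (auto simp: L_def sets_restrict_space_iff)
  qed
  have "\<exists>K. closed K \<and> K \<subseteq> A \<phi> \<and> A \<phi> - K \<in> lmeasurable \<and> measure lebesgue (A \<phi> - K) < \<mu> / (real (card R) + 1)" for \<phi>
  proof -
    have p: "\<mu> / (real (card R) + 1) > 0" using \<mu> by simp
    obtain K where K: "closed K" "K \<subseteq> A \<phi>" "A \<phi> - K \<in> lmeasurable"
      "emeasure lebesgue (A \<phi> - K) < ennreal (\<mu> / (real (card R) + 1))"
      by (rule sets_lebesgue_inner_closed[OF A p]) blast
    have "measure lebesgue (A \<phi> - K) < \<mu> / (real (card R) + 1)"
      using K(3,4) p by (simp add: emeasure_eq_measure2 ennreal_less_iff)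
    with K show ?thesis by blast
  qed
  then obtain K where K: "\<And>\<phi>. closed (K \<phi>)" "\<And>\<phi>. K \<phi> \<subseteq> A \<phi>" "\<And>\<phi>. A \<phi> - K \<phi> \<in> lmeasurable"
    "\<And>\<phi>. measure lebesgue (A \<phi> - K \<phi>) < \<mu> / (real (card R) + 1)" by metis
  have Kc: "compact (K \<phi>)" for \<phi>
  proof -
    have "K \<phi> \<subseteq> {0..T}" using K(2)[of \<phi>] by (auto simp: A_def)
    then show ?thesis using K(1) by (meson bounded_closed_interval bounded_subset compact_eq_bounded_closed)
  qed
  have "\<exists>d>0. \<forall>i\<in>R. \<forall>j\<in>R. \<forall>x\<in>K i. \<forall>y\<in>K j. dist x y < d \<longrightarrow> i = j"
  proof (rule finite_disjoint_compact_separated[OF R Kc])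
    fix \<phi> \<psi> :: field2 assume "\<phi> \<noteq> \<psi>"
    then have "A \<phi> \<inter> A \<psi> = {}" by (auto simp: A_def)
    then show "K \<phi> \<inter> K \<psi> = {}" using K(2)[of \<phi>] K(2)[of \<psi>] by blast
  qed
  then obtain d where d: "d > 0" "\<And>i j x y. i \<in> R \<Longrightarrow> j \<in> R \<Longrightarrow> x \<in> K i \<Longrightarrow> y \<in> K j \<Longrightarrow> dist x y < d \<Longrightarrow> i = j"
    by blast
  \<comment> \<open>Outside \<open>B\<close> the simple function is within \<epsilon> / 2 of
    \<open>u\<close>, and its level sets are cut down to compact sets at positive distance from each
    other. At two such times closer than \<open>d\<close> it therefore takes the same value.\<close>
  define B where "B = D n \<union> (\<Union>\<phi>\<in>R. A \<phi> - K \<phi>)"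
  have AK: "A \<phi> - K \<phi> \<in> sets L" for \<phi>
    using K(3) by (auto simp: L_def sets_restrict_space_iff A_def)
  have Bm [measurable]: "B \<in> sets L" unfolding B_def using Dm AK R by auto
  have "measure L B \<le> measure L (D n) + measure L (\<Union>\<phi>\<in>R. A \<phi> - K \<phi>)"
    unfolding B_def using Dm AK R by (intro measure_Un_le) auto
  also have "measure L (D n) < \<mu>"
    using n Dm by (simp add: sets.Int_space_eq2)
  also have "measure L (\<Union>\<phi>\<in>R. A \<phi> - K \<phi>) \<le> (\<Sum>\<phi>\<in>R. measure L (A \<phi> - K \<phi>))"
    using AK R by (intro measure_UNION_le) auto
  also have "\<dots> \<le> (\<Sum>\<phi>\<in>R. \<mu> / (real (card R) + 1))"
  proof (rule sum_mono)
    fix \<phi>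
    have "measure L (A \<phi> - K \<phi>) = measure lebesgue (A \<phi> - K \<phi>)"
      unfolding L_def by (rule measure_restrict_space) (auto simp: A_def)
    then show "measure L (A \<phi> - K \<phi>) \<le> \<mu> / (real (card R) + 1)" using K(4)[of \<phi>] by simp
  qed
  also have "\<dots> \<le> \<mu>" using \<mu> by (simp add: field_simps)
  finally have B: "measure L B < 2 * \<mu>" by simp
  \<comment> \<open>At an exceptional time the difference is only bounded by the sum of the two
    norms, and \<open>e\<close> has to pay for it: 2 ||u|| where ||u|| exceeds \<open>M\<close>, and
    2 M on \<open>B\<close>.\<close>
  define e where "e t = 2 * (indicator {t. N t > M} t * N t) + 2 * M * indicator B t" for t
  have e0: "0 \<le> e t" for t using N0 M by (simp add: e_def)
  have e1: "2 * N t \<le> e t" if "N t > M" for t using that M by (simp add: e_def)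
  have e2: "2 * M \<le> e t" if "t \<in> B" for t using that M N0 by (simp add: e_def)
  have esq: "(e t)\<^sup>2 \<le> 8 * (indicator {t. N t > M} t * (N t)\<^sup>2) + 8 * M\<^sup>2 * indicator B t" for t
  proof -
    have "(a + b)\<^sup>2 \<le> 2 * a\<^sup>2 + 2 * b\<^sup>2" for a b :: real
      using sum_squares_bound[of a b] by (simp add: power2_sum)
    from this[of "2 * (indicator {t. N t > M} t * N t)" "2 * M * indicator B t"] show ?thesis
      by (auto simp: e_def indicator_def power_mult_distrib)
  qed
  have bd: "integrable L (\<lambda>t. 8 * (indicator {t. N t > M} t * (N t)\<^sup>2) + 8 * M\<^sup>2 * indicator B t)"
  proof (intro Bochner_Integration.integrable_add integrable_mult_right)
    show "integrable L (\<lambda>t. indicator {t. N t > M} t * (N t)\<^sup>2)"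
      by (rule Bochner_Integration.integrable_bound[OF N2]) (auto simp: indicator_def)
    show "integrable L (\<lambda>t. indicat_real B t)" by (rule integrable_real_indicator[OF Bm]) (use L.emeasure_finite[of B] in \<open>simp add: less_top[symmetric]\<close>)
  qed
  have em: "e \<in> borel_measurable L" unfolding e_def by measurable
  have eint: "integrable L (\<lambda>t. (e t)\<^sup>2)"
    by (rule Bochner_Integration.integrable_bound[OF bd]) (use em esq in \<open>auto intro!: AE_I2 order_trans[OF _ abs_ge_self]\<close>)
  have "(LINT t|L. (e t)\<^sup>2) \<le> (LINT t|L. 8 * (indicator {t. N t > M} t * (N t)\<^sup>2) + 8 * M\<^sup>2 * indicator B t)"
    by (intro integral_mono eint bd esq)
  also have "\<dots> = 8 * (LINT t|L. indicator {t. N t > M} t * (N t)\<^sup>2) + 8 * M\<^sup>2 * measure L B"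
  proof -
    have "integrable L (\<lambda>t. indicator {t. N t > M} t * (N t)\<^sup>2)"
      by (rule Bochner_Integration.integrable_bound[OF N2]) (auto simp: indicator_def)
    moreover have "integrable L (\<lambda>t. indicat_real B t)" by (rule integrable_real_indicator[OF Bm]) (use L.emeasure_finite[of B] in \<open>simp add: less_top[symmetric]\<close>)
    ultimately show ?thesis using Bm by (simp add: sets.Int_space_eq2)
  qed
  also have "\<dots> \<le> 8 * (\<epsilon> / 16) + 8 * M\<^sup>2 * (2 * \<mu>)"
    using m0 B by (intro add_mono mult_left_mono) (auto simp: M_def)
  also have "\<dots> < \<epsilon>"
  proof -
    have "8 * M\<^sup>2 * (2 * \<mu>) = \<epsilon> / 2 * (M\<^sup>2 / (M\<^sup>2 + 1))"
    proof -
      have "8 * a * (2 * (b / (32 * z))) = b / 2 * (a / z)" for a b z :: real by simp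
      then show ?thesis unfolding \<mu>_def .
    qed
    also have "\<dots> < \<epsilon> / 2 * 1" using \<epsilon> M1 by (intro mult_strict_left_mono) auto
    finally show ?thesis by simp
  qed
  finally have small: "(LINT t|L. (e t)\<^sup>2) < \<epsilon>" .
  have main: "V_norm \<Omega> (\<lambda>x. u a x - u b x) \<le> e a + e b + \<epsilon>"
    if ab: "a \<in> {0..T}" "b \<in> {0..T}" "u a \<in> V_space \<Omega>" "u b \<in> V_space \<Omega>" "\<bar>a - b\<bar> < d" for a b
  proof -
    have le: "V_norm \<Omega> (\<lambda>x. u a x - u b x) \<le> N a + N b"
      unfolding N_def by (intro V_norm_diff_le V_H1 ab)
    consider "N a > M" "N b \<le> N a" | "N b > M" "N a \<le> N b" | "N a \<le> M" "N b \<le> M" by linarith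
    then show ?thesis
    proof cases
      case 1
      then show ?thesis using le e1[of a] e0[of b] \<epsilon> by linarith
    next
      case 2
      then show ?thesis using le e1[of b] e0[of a] \<epsilon> by linarith
    next
      case 3
      show ?thesis
      proof (cases "a \<in> B \<or> b \<in> B")
        case True
        then show ?thesis using 3 le e2 e0[of a] e0[of b] \<epsilon> by (smt (verit))
      next
        case False
        have in_K: "t \<in> K (\<sigma> t)" "\<sigma> t \<in> R" "V_norm \<Omega> (\<lambda>x. u t x - \<sigma> t x) \<le> \<epsilon> / 2" "\<sigma> t \<in> V_space \<Omega>"
          if "t \<in> {0..T}" "t \<notin> B" for t
        proof -
          show R': "\<sigma> t \<in> R" using that by (simp add: R_def)
          have "t \<in> A (\<sigma> t)" using that by (simp add: A_def)
          then show "t \<in> K (\<sigma> t)" using that R' by (auto simp: B_def)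
          show "V_norm \<Omega> (\<lambda>x. u t x - \<sigma> t x) \<le> \<epsilon> / 2" using that by (auto simp: B_def D_def \<sigma>_def)
          show "\<sigma> t \<in> V_space \<Omega>" using s(2)[of n] that by (auto simp: \<sigma>_def)
        qed
        have "\<sigma> a = \<sigma> b"
          by (rule d(2)) (use in_K[of a] in_K[of b] False ab in \<open>auto simp: dist_real_def\<close>)
        then have "V_norm \<Omega> (\<lambda>x. u a x - u b x) \<le> \<epsilon> / 2 + \<epsilon> / 2"
          using V_norm_diff_triangle[OF V_H1[OF ab(3)] V_H1[OF ab(4)] V_H1[OF in_K(4)[of a]]]
            in_K(3)[of a] in_K(3)[of b] False ab by auto
        then show ?thesis using e0[of a] e0[of b] by simp
      qed
    qed
  qed
  show ?thesis
    using d(1) eint small e0 main unfolding L_def by (intro exI[of _ e] exI[of _ d]) auto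
qed

end

subsection \<open>The energy identity\<close>

lemma integral_mono_negligible:
  fixes f g :: "real \<Rightarrow> real"
  assumes "f integrable_on S" "g integrable_on S" "negligible N" "\<And>x. x \<in> S - N \<Longrightarrow> f x \<le> g x"
  shows "integral S f \<le> integral S g"
proof -
  have "integral S f \<le> integral S (\<lambda>x. if x \<in> N then f x else g x)"
    by (rule integral_le[OF assms(1) integrable_spike[OF assms(2,3)]]) (use assms(4) in auto)
  also have "\<dots> = integral S g" by (rule integral_spike[OF assms(3)]) auto
  finally show ?thesis .
qed

lemma integral_abs_le_negligible:
  fixes f g :: "real \<Rightarrow> real"
  assumes "f integrable_on S" "g integrable_on S" "negligible N" "\<And>x. x \<in> S - N \<Longrightarrow> \<bar>f x\<bar> \<le> g x"
  shows "\<bar>integral S f\<bar> \<le> integral S g"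
proof -
  have "integral S f \<le> integral S g"
    by (rule integral_mono_negligible[OF assms(1-3)]) (use assms(4) in force)
  moreover have "integral S (\<lambda>x. - f x) \<le> integral S g"
    by (rule integral_mono_negligible[OF integrable_neg[OF assms(1)] assms(2,3)]) (use assms(4) in force)
  ultimately show ?thesis by simp
qed

lemma AE_lebesgue_on_negligible:
  assumes "AE t in lebesgue_on S. P t" "S \<in> sets lebesgue"
  shows "negligible {t\<in>S. \<not> P t}"
proof -
  have "AE t in lebesgue. t \<in> S \<longrightarrow> P t"
    using assms by (subst (asm) AE_restrict_space_iff) auto
  then have "{t. \<not> (t \<in> S \<longrightarrow> P t)} \<in> null_sets lebesgue"
    by (subst (asm) completion.AE_iff_null_sets) (auto simp: null_sets_completion_subset)
  then show ?thesis by (simp add: negligible_iff_null_sets)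
qed

lemma integral_shift_diff:
  fixes f :: "real \<Rightarrow> real"
  assumes f: "f integrable_on {a..b+h}" and "0 \<le> h" "a \<le> b"
  shows "(\<lambda>t. f (t + h)) integrable_on {a..b}"
    and "integral {a..b} (\<lambda>t. f (t + h)) = integral {a+h..b+h} f"
    and "integral {a..b} (\<lambda>t. f (t + h) - f t) = integral {b..b+h} f - integral {a..a+h} f"
proof -
  have sub: "f integrable_on {x..y}" if "a \<le> x" "y \<le> b + h" for x y
    by (rule integrable_subinterval_real[OF f]) (use that in auto)
  have eq: "f \<circ> (+) h = (\<lambda>t. f (t + h))" by (auto simp: add.commute)
  show i: "(\<lambda>t. f (t + h)) integrable_on {a..b}"
    using integrable_on_shift_Icc_real[of f h a b] sub[of "a + h" "b + h"] assms(2) by (simp add: eq)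
  show s: "integral {a..b} (\<lambda>t. f (t + h)) = integral {a+h..b+h} f"
    using integral_shift_Icc_real[of a b f h] by (simp add: eq)
  have "integral {a..a+h} f + integral {a+h..b+h} f = integral {a..b+h} f"
    by (rule Henstock_Kurzweil_Integration.integral_combine) (use assms in auto)
  moreover have "integral {a..b} f + integral {b..b+h} f = integral {a..b+h} f"
    by (rule Henstock_Kurzweil_Integration.integral_combine) (use assms in auto)
  ultimately show "integral {a..b} (\<lambda>t. f (t + h) - f t) = integral {b..b+h} f - integral {a..a+h} f"
    using Henstock_Kurzweil_Integration.integral_diff[OF i sub[of a b]] assms(2) s by simp
qed

text \<open>A negative value would persist on a nonempty open set, which is not negligible.
  Inequalities between continuous functions are upgraded in this way from almost every time to every
  time.\<close>

lemma nonneg_from_negligible: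
  fixes F :: "real \<Rightarrow> real"
  assumes F: "continuous_on {0<..<T} F" and N: "negligible N" "\<And>s. s \<in> {0<..<T} - N \<Longrightarrow> 0 \<le> F s"
    and t: "t \<in> {0<..<T}"
  shows "0 \<le> F t"
proof (rule ccontr)
  assume "\<not> 0 \<le> F t"
  let ?U = "{s\<in>{0<..<T}. F s < 0}"
  have "open ({0<..<T} \<inter> F -` {..<0})"
    by (rule continuous_open_preimage[OF F]) auto
  moreover have "{0<..<T} \<inter> F -` {..<0} = ?U" by auto
  moreover have "t \<in> ?U" using t \<open>\<not> 0 \<le> F t\<close> by auto
  ultimately have "\<not> negligible ?U" using open_not_negligible[of ?U] by auto
  moreover have "?U \<subseteq> N" using N(2) by (force simp: not_less[symmetric])
  ultimately show False using N(1) negligible_subset by blast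
qed

text \<open>
  \<open>G\<close> is the weak time derivative of \<open>u\<close>, with values in the dual of \<open>V\<close> and norm at most \<open>K\<close>.
\<close>

locale evolution = bounded_open_set +
  fixes T B :: real and u :: "real \<Rightarrow> field2" and G :: "real \<Rightarrow> field2 \<Rightarrow> real" and K :: "real \<Rightarrow> real"
  assumes T_pos: "0 < T"
    and in_H: "\<And>t. t \<in> {0..T} \<Longrightarrow> u t \<in> H_space \<Omega>"
    and weakly_continuous: "\<And>h. h \<in> H_space \<Omega> \<Longrightarrow> continuous_on {0..T} (\<lambda>t. L2_inner \<Omega> (u t) h)"
    and H_bound: "\<And>t. t \<in> {0..T} \<Longrightarrow> L2_norm \<Omega> (u t) \<le> B"
    and measurable_in_V: "strongly_measurable {0..T} (V_space \<Omega>) (V_norm \<Omega>) u"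
    and V_norm_square_integrable: "integrable (lebesgue_on {0..T}) (\<lambda>t. (V_norm \<Omega> (u t))\<^sup>2)"
    and G_add: "\<And>t \<phi> \<psi>. t \<in> {0..T} \<Longrightarrow> u t \<in> V_space \<Omega> \<Longrightarrow> \<phi> \<in> V_space \<Omega> \<Longrightarrow> \<psi> \<in> V_space \<Omega> \<Longrightarrow>
      G t (\<lambda>x. \<phi> x + \<psi> x) = G t \<phi> + G t \<psi>"
    and G_scaleR: "\<And>t \<phi> c. t \<in> {0..T} \<Longrightarrow> u t \<in> V_space \<Omega> \<Longrightarrow> \<phi> \<in> V_space \<Omega> \<Longrightarrow>
      G t (\<lambda>x. c *\<^sub>R \<phi> x) = c * G t \<phi>"
    and G_bound: "\<And>t \<phi>. t \<in> {0..T} \<Longrightarrow> u t \<in> V_space \<Omega> \<Longrightarrow> \<phi> \<in> V_space \<Omega> \<Longrightarrow>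
      \<bar>G t \<phi>\<bar> \<le> K t * V_norm \<Omega> \<phi>"
    and K_nonneg: "\<And>t. t \<in> {0..T} \<Longrightarrow> 0 \<le> K t"
    and K_measurable: "K \<in> borel_measurable (lebesgue_on {0..T})"
    and K_square_integrable: "integrable (lebesgue_on {0..T}) (\<lambda>t. (K t)\<^sup>2)"
    and G_measurable: "\<And>\<phi>. \<phi> \<in> V_space \<Omega> \<Longrightarrow> (\<lambda>t. G t \<phi>) \<in> borel_measurable (lebesgue_on {0..T})"
    and weak_derivative: "\<And>\<phi> \<theta>. \<phi> \<in> V_space \<Omega> \<Longrightarrow> \<theta> \<in> test_functions {0<..<T} \<Longrightarrow>
      (LINT t|lebesgue_on {0<..<T}. L2_inner \<Omega> (u t) \<phi> * deriv \<theta> t)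
        = - (LINT t|lebesgue_on {0<..<T}. G t \<phi> * \<theta> t)"
begin

section \<open>Energy and energy defect of an evolution\<close>

definition bad_times :: "real set" where
  "bad_times = {t\<in>{0..T}. u t \<notin> V_space \<Omega>}"

definition energy :: "real \<Rightarrow> real" where
  "energy t = (L2_norm \<Omega> (u t))\<^sup>2"

definition power_density :: "real \<Rightarrow> real" where
  "power_density t = 2 * G t (u t)"

definition energy_defect :: "real \<Rightarrow> real" where
  "energy_defect t = energy t - integral {0..t} power_density"

lemma negligible_bad_times: "negligible bad_times"
  unfolding bad_times_def
  by (rule AE_lebesgue_on_negligible[OF strongly_measurable_AE_in[OF measurable_in_V]]) simp

lemma good_times: "t \<in> {0..T} \<Longrightarrow> t \<notin> bad_times \<Longrightarrow> u t \<in> V_space \<Omega>"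
  by (simp add: bad_times_def)

lemma finite_measure_times: "finite_measure (lebesgue_on {0..T})"
  by (rule finite_measure_lebesgue_on) simp

lemma G_diff:
  assumes "t \<in> {0..T}" "u t \<in> V_space \<Omega>" "\<phi> \<in> V_space \<Omega>" "\<psi> \<in> V_space \<Omega>"
  shows "G t (\<lambda>x. \<phi> x - \<psi> x) = G t \<phi> - G t \<psi>"
  using G_add[OF assms(1,2,3) V_scaleR[OF assms(4), of "-1"]] G_scaleR[OF assms(1,2,4), of "-1"] by simp

lemma sub_integrable:
  fixes f :: "real \<Rightarrow> real"
  assumes "integrable (lebesgue_on {0..T}) f" "0 \<le> a" "b \<le> T"
  shows "f integrable_on {a..b}"
  by (rule integrable_on_lebesgue_on[OF integrable_lebesgue_on_subset[OF assms(1)]]) (use assms in auto)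

lemma V_norm_measurable: "(\<lambda>t. V_norm \<Omega> (u t)) \<in> borel_measurable (lebesgue_on {0..T})"
proof -
  have "(\<lambda>t. sqrt ((V_norm \<Omega> (u t))\<^sup>2)) \<in> borel_measurable (lebesgue_on {0..T})"
    using borel_measurable_integrable[OF V_norm_square_integrable] by measurable
  then show ?thesis by (simp add: V_norm_nonneg)
qed

lemma K_integrable: "integrable (lebesgue_on {0..T}) K"
proof -
  interpret finite_measure "lebesgue_on {0..T}" by (rule finite_measure_times)
  show ?thesis
    using cauchy_schwarz_integral(1)[OF K_measurable _ K_square_integrable, of "\<lambda>_. 1"] by simp
qed

text \<open>The bound 2 K ||u|| is a product of two square integrable functions. In
  \<open>G t (u t)\<close> the functional and its argument both vary, so measurability is obtained
  by approximating \<open>u\<close> by simple functions.\<close>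

lemma power_density_integrable: "integrable (lebesgue_on {0..T}) power_density"
proof (rule Bochner_Integration.integrable_bound)
  show "integrable (lebesgue_on {0..T}) (\<lambda>t. 2 * (K t * V_norm \<Omega> (u t)))"
    by (intro integrable_mult_right cauchy_schwarz_integral(1) K_measurable V_norm_measurable
        K_square_integrable V_norm_square_integrable)
  have "(\<lambda>t. G t (u t)) \<in> borel_measurable (lebesgue_on {0..T})"
  proof (rule strongly_measurable_compose[OF measurable_in_V])
    fix t and w :: "nat \<Rightarrow> field2" and x
    assume *: "t \<in> {0..T}" "\<And>n. w n \<in> V_space \<Omega>" "x \<in> V_space \<Omega>" "x = u t"
      "(\<lambda>n. V_norm \<Omega> (x - w n)) \<longlonglongrightarrow> 0"
    have V: "V_norm \<Omega> (\<lambda>y. w n y - x y) = V_norm \<Omega> (x - w n)" for n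
      unfolding fun_diff_def by (intro V_norm_diff_commute V_H1 *)
    show "(\<lambda>n. G t (w n)) \<longlonglongrightarrow> G t x"
    proof (rule LIM_zero_cancel, rule Lim_null_comparison[OF always_eventually tendsto_mult_right_zero[OF *(5), of "K t"]], rule allI)
      fix n
      show "norm (G t (w n) - G t x) \<le> K t * V_norm \<Omega> (x - w n)"
        using G_bound[OF *(1) _ V_diff[OF *(2,3)], of n] G_diff[OF *(1) _ *(2,3), of n] * V[of n] by simp
    qed
  qed (use G_measurable in auto)
  then show "power_density \<in> borel_measurable (lebesgue_on {0..T})"
    unfolding power_density_def by measurable
  have "AE t in lebesgue_on {0..T}. t \<in> {0..T}" by (rule AE_I2) (simp add: space_restrict_space)
  then show "AE t in lebesgue_on {0..T}. norm (power_density t) \<le> norm (2 * (K t * V_norm \<Omega> (u t)))"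
    using strongly_measurable_AE_in[OF measurable_in_V]
  proof eventually_elim
    case (elim t)
    then show ?case
      using G_bound[of t "u t"] K_nonneg[of t] V_norm_nonneg[of \<Omega> "u t"]
      by (simp add: power_density_def abs_mult)
  qed
qed

lemma energy_integrable: "integrable (lebesgue_on {0..T}) energy"
proof -
  interpret finite_measure "lebesgue_on {0..T}" by (rule finite_measure_times)
  have "(\<lambda>t. L2_norm \<Omega> (u t)) \<in> borel_measurable (lebesgue_on {0..T})"
  proof (rule strongly_measurable_compose[OF measurable_in_V])
    fix t :: real and w :: "nat \<Rightarrow> field2" and x
    assume *: "\<And>n. w n \<in> V_space \<Omega>" "x \<in> V_space \<Omega>" "(\<lambda>n. V_norm \<Omega> (x - w n)) \<longlonglongrightarrow> 0"
    show "(\<lambda>n. L2_norm \<Omega> (w n)) \<longlonglongrightarrow> L2_norm \<Omega> x"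
    proof (rule L2_norm_approx)
      show "(\<lambda>n. L2_norm \<Omega> (\<lambda>y. x y - w n y)) \<longlonglongrightarrow> 0"
        by (rule Lim_null_comparison[OF always_eventually tendsto_mult_right_zero[OF *(3), of poincare_const]])
          (use poincare[OF V_diff[OF *(2,1)]] in \<open>simp add: L2_norm_nonneg fun_diff_def\<close>)
    qed (use * V_L2 in auto)
  qed auto
  then have "energy \<in> borel_measurable (lebesgue_on {0..T})"
    unfolding energy_def by measurable
  moreover have "norm (energy t) \<le> B\<^sup>2" if "t \<in> {0..T}" for t
    using H_bound[OF that] L2_norm_nonneg[of \<Omega> "u t"] by (simp add: energy_def power_mono)
  ultimately show ?thesis
    by (intro integrable_const_bound[where B="B\<^sup>2"] AE_I2) (auto simp: space_restrict_space)
qed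

lemma continuous_primitive:
  "integrable (lebesgue_on {0..T}) f \<Longrightarrow> continuous_on {0..T} (\<lambda>t. integral {0..t} f)" for f :: "real \<Rightarrow> real"
  by (intro indefinite_integral_continuous_1 sub_integrable) auto

lemma primitive_diff:
  fixes f :: "real \<Rightarrow> real"
  assumes "integrable (lebesgue_on {0..T}) f" "0 \<le> s" "s \<le> t" "t \<le> T"
  shows "integral {0..t} f - integral {0..s} f = integral {s..t} f"
proof -
  have "integral {0..s} f + integral {s..t} f = integral {0..t} f"
    by (rule Henstock_Kurzweil_Integration.integral_combine) (use assms in \<open>auto intro: sub_integrable\<close>)
  then show ?thesis by simp
qed

lemma G_integrable:
  assumes "\<phi> \<in> V_space \<Omega>"
  shows "integrable (lebesgue_on {0..T}) (\<lambda>t. G t \<phi>)"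
proof (rule Bochner_Integration.integrable_bound)
  show "integrable (lebesgue_on {0..T}) (\<lambda>t. K t * V_norm \<Omega> \<phi>)" using K_integrable by simp
  show "(\<lambda>t. G t \<phi>) \<in> borel_measurable (lebesgue_on {0..T})" by (rule G_measurable[OF assms])
  have "AE t in lebesgue_on {0..T}. t \<in> {0..T}" by (rule AE_I2) (simp add: space_restrict_space)
  then show "AE t in lebesgue_on {0..T}. norm (G t \<phi>) \<le> norm (K t * V_norm \<Omega> \<phi>)"
    using strongly_measurable_AE_in[OF measurable_in_V]
    by eventually_elim (use G_bound[OF _ _ assms] K_nonneg V_norm_nonneg in \<open>simp add: abs_mult\<close>)
qed

text \<open>For a fixed element of V the pairing is a continuous scalar function with an integrable
  weak derivative. The two times are arbitrary, so \<open>\<phi>\<close> may be chosen in dependence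
  on them.\<close>

lemma pairing_increment:
  assumes \<phi>: "\<phi> \<in> V_space \<Omega>" and "0 < s" "s < t" "t < T"
  shows "L2_inner \<Omega> (u t) \<phi> - L2_inner \<Omega> (u s) \<phi> = integral {s..t} (\<lambda>r. G r \<phi>)"
proof (rule weak_derivative_integral[OF weakly_continuous[OF V_H[OF \<phi>]] _ weak_derivative[OF \<phi>] assms(2-4)])
  show "integrable (lebesgue_on {0<..<T}) (\<lambda>t. G t \<phi>)"
    by (rule integrable_lebesgue_on_subset[OF G_integrable[OF \<phi>]]) auto
qed

text \<open>For \<phi> = u (t + h) + u t the integrand G r \<phi> - 2 G r (u r) is the functional
  applied to the two increments from \<open>u r\<close>, which the Lusin-type bound controls.
  Young's inequality with weight \<open>\<delta>\<close> separates \<open>K\<close> from them; the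
  terms at the end points do not depend on \<open>r\<close> and come with a factor
  \<open>h\<close>.\<close>

lemma energy_increment_bound:
  assumes \<delta>: "\<delta> > 0" and e: "integrable (lebesgue_on {0..T}) (\<lambda>t. (e t)\<^sup>2)" "\<And>t. 0 \<le> e t" and \<epsilon>: "\<epsilon> > 0"
    and lusin: "\<And>s r. s \<in> {0..T} \<Longrightarrow> r \<in> {0..T} \<Longrightarrow> u s \<in> V_space \<Omega> \<Longrightarrow> u r \<in> V_space \<Omega> \<Longrightarrow> \<bar>s - r\<bar> < d \<Longrightarrow>
      V_norm \<Omega> (\<lambda>x. u s x - u r x) \<le> e s + e r + \<epsilon>"
    and t: "0 < t" "0 < h" "h < d" "t + h < T" "t \<notin> bad_times" "t + h \<notin> bad_times"
  shows "\<bar>energy_defect (t + h) - energy_defect t\<bar> \<le>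
    integral {t..t+h} (\<lambda>r. \<delta> * (K r)\<^sup>2 + 16 / \<delta> * ((e r)\<^sup>2 + \<epsilon>\<^sup>2)) + h * (4 / \<delta> * ((e (t + h))\<^sup>2 + (e t)\<^sup>2))"
proof -
  let ?\<omega> = "\<lambda>r. \<delta> * (K r)\<^sup>2 + 16 / \<delta> * ((e r)\<^sup>2 + \<epsilon>\<^sup>2)" and ?c = "4 / \<delta> * ((e (t + h))\<^sup>2 + (e t)\<^sup>2)"
  interpret finite_measure "lebesgue_on {0..T}" by (rule finite_measure_times)
  have V: "u t \<in> V_space \<Omega>" "u (t + h) \<in> V_space \<Omega>" using t by (auto intro: good_times)
  define \<phi> where "\<phi> = (\<lambda>x. u (t + h) x + u t x)"
  have \<phi>: "\<phi> \<in> V_space \<Omega>" unfolding \<phi>_def by (intro V_add V)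
  have "energy (t + h) - energy t = L2_inner \<Omega> (u (t + h)) \<phi> - L2_inner \<Omega> (u t) \<phi>"
    by (simp add: energy_def L2_norm_squared \<phi>_def L2_inner_add_right V_L2 V L2_inner_commute[of \<Omega> "u t" "u (t + h)"])
  also have "\<dots> = integral {t..t+h} (\<lambda>r. G r \<phi>)"
    by (rule pairing_increment[OF \<phi>]) (use t in auto)
  finally have "energy_defect (t + h) - energy_defect t
      = integral {t..t+h} (\<lambda>r. G r \<phi>) - integral {t..t+h} power_density"
    using primitive_diff[OF power_density_integrable, of t "t + h"] t by (simp add: energy_defect_def)
  also have "\<dots> = integral {t..t+h} (\<lambda>r. G r \<phi> - power_density r)"
    by (rule Henstock_Kurzweil_Integration.integral_diff[symmetric])
      (use t in \<open>auto intro!: sub_integrable G_integrable \<phi> power_density_integrable\<close>)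
  finally have increment: "energy_defect (t + h) - energy_defect t = integral {t..t+h} (\<lambda>r. G r \<phi> - power_density r)" .
  have bound: "\<bar>integral {t..t+h} (\<lambda>r. G r \<phi> - power_density r)\<bar> \<le> integral {t..t+h} (\<lambda>r. ?\<omega> r + ?c)"
  proof (rule integral_abs_le_negligible[OF _ _ negligible_bad_times])
    show "(\<lambda>r. G r \<phi> - power_density r) integrable_on {t..t+h}"
      by (rule sub_integrable) (use t G_integrable[OF \<phi>] power_density_integrable in auto)
    show "(\<lambda>r. ?\<omega> r + ?c) integrable_on {t..t+h}"
      by (rule sub_integrable) (use t e(1) K_square_integrable in auto)
    fix r assume r': "r \<in> {t..t+h} - bad_times"
    then have r: "r \<in> {0..T}" "u r \<in> V_space \<Omega>" using t by (auto intro: good_times)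
    have d1: "V_norm \<Omega> (\<lambda>x. u (t + h) x - u r x) \<le> e (t + h) + e r + \<epsilon>"
      by (rule lusin) (use t r r' V in auto)
    have d2: "V_norm \<Omega> (\<lambda>x. u t x - u r x) \<le> e t + e r + \<epsilon>"
      by (rule lusin) (use t r r' V in auto)
    \<comment> \<open>The sum of the two increment bounds, grouped so that splitting the square
      twice gives the factor 4 at the end points and 16 at \<open>e r\<close> and
      \<open>\<epsilon>\<close>.\<close>
    define x where "x = (e (t + h) + e t) + (2 * e r + 2 * \<epsilon>)"
    have "G r \<phi> - power_density r = G r (\<lambda>x. u (t + h) x - u r x) + G r (\<lambda>x. u t x - u r x)"
      using G_add[OF r V(2,1)] G_diff[OF r V(1) r(2)] G_diff[OF r V(2) r(2)] by (simp add: \<phi>_def power_density_def)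
    then have "\<bar>G r \<phi> - power_density r\<bar> \<le> \<bar>G r (\<lambda>x. u (t + h) x - u r x)\<bar> + \<bar>G r (\<lambda>x. u t x - u r x)\<bar>"
      by simp
    also have "\<dots> \<le> K r * V_norm \<Omega> (\<lambda>x. u (t + h) x - u r x) + K r * V_norm \<Omega> (\<lambda>x. u t x - u r x)"
      by (intro add_mono G_bound r V_diff V)
    also have "\<dots> \<le> K r * (e (t + h) + e r + \<epsilon>) + K r * (e t + e r + \<epsilon>)"
      by (intro add_mono mult_left_mono d1 d2 K_nonneg r)
    also have "\<dots> = K r * x" by (simp add: x_def algebra_simps)
    also have "\<dots> \<le> \<delta> * (K r)\<^sup>2 + x\<^sup>2 / \<delta>"
    proof -
      have "0 \<le> (\<delta> * K r - x)\<^sup>2 + (\<delta> * K r)\<^sup>2 + x\<^sup>2" by simp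
      then have "2 * (\<delta> * (K r * x)) \<le> 2 * (\<delta> * (\<delta> * (K r)\<^sup>2) + x\<^sup>2)"
        by (simp add: power2_diff power_mult_distrib) (simp add: power2_eq_square algebra_simps)
      then show ?thesis using \<delta> by (simp add: field_simps)
    qed
    also have "x\<^sup>2 / \<delta> \<le> (4 * ((e (t + h))\<^sup>2 + (e t)\<^sup>2) + 16 * ((e r)\<^sup>2 + \<epsilon>\<^sup>2)) / \<delta>"
    proof (rule divide_right_mono)
      have sq: "(a + b)\<^sup>2 \<le> 2 * (a\<^sup>2 + b\<^sup>2)" for a b :: real
        using sum_squares_bound[of a b] by (simp add: power2_sum)
      have "x\<^sup>2 \<le> 2 * ((e (t + h) + e t)\<^sup>2 + (2 * e r + 2 * \<epsilon>)\<^sup>2)" unfolding x_def by (rule sq)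
      also have "\<dots> \<le> 2 * (2 * ((e (t + h))\<^sup>2 + (e t)\<^sup>2) + 2 * ((2 * e r)\<^sup>2 + (2 * \<epsilon>)\<^sup>2))"
        by (intro mult_left_mono add_mono sq) simp
      finally show "x\<^sup>2 \<le> 4 * ((e (t + h))\<^sup>2 + (e t)\<^sup>2) + 16 * ((e r)\<^sup>2 + \<epsilon>\<^sup>2)"
        by (simp add: power_mult_distrib)
    qed (use \<delta> in simp)
    also have "\<delta> * (K r)\<^sup>2 + (4 * ((e (t + h))\<^sup>2 + (e t)\<^sup>2) + 16 * ((e r)\<^sup>2 + \<epsilon>\<^sup>2)) / \<delta> = ?\<omega> r + ?c"
      by (simp add: add_divide_distrib)
    finally show "\<bar>G r \<phi> - power_density r\<bar> \<le> ?\<omega> r + ?c" by simp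
  qed
  have "integral {t..t+h} (\<lambda>r. ?\<omega> r + ?c) = integral {t..t+h} ?\<omega> + integral {t..t+h} (\<lambda>r. ?c)"
  proof (rule Henstock_Kurzweil_Integration.integral_add[OF _ integrable_const_ivl])
    show "?\<omega> integrable_on {t..t+h}"
      by (rule sub_integrable) (use t e(1) K_square_integrable in auto)
  qed
  moreover have "integral {t..t+h} (\<lambda>r. ?c) = h * ?c" using t by simp
  ultimately show ?thesis using bound by (simp only: increment)
qed

lemma energy_defect_integrable: "0 \<le> a \<Longrightarrow> b \<le> T \<Longrightarrow> energy_defect integrable_on {a..b}"
proof -
  assume ab: "0 \<le> a" "b \<le> T"
  have "energy integrable_on {a..b}" by (intro sub_integrable energy_integrable ab)
  moreover have "(\<lambda>t. integral {0..t} power_density) integrable_on {a..b}"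
    by (intro integrable_continuous_real continuous_on_subset[OF continuous_primitive[OF power_density_integrable]]) (use ab in auto)
  ultimately show ?thesis unfolding energy_defect_def[abs_def] by (rule Henstock_Kurzweil_Integration.integrable_diff)
qed

text \<open>The pointwise bound is integrated over \<open>t\<close>. Integrals of increments over a
  shift by \<open>h\<close> telescope: on the left they leave the difference of two windows, and for
  the primitive \<open>W\<close> they give at most \<open>h * W T\<close>. Every term thus carries
  the factor \<open>h\<close>, and its coefficient is made smaller than
  \<open>\<eta>\<close>.\<close>

lemma energy_defect_window:
  assumes \<eta>: "\<eta> > 0"
  shows "\<exists>h0>0. \<forall>h a b. 0 < h \<and> h < h0 \<and> 0 < a \<and> a \<le> b \<and> b + h < T \<longrightarrow>
    \<bar>integral {b..b+h} energy_defect - integral {a..a+h} energy_defect\<bar> \<le> h * \<eta>"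
proof -
  interpret finite_measure "lebesgue_on {0..T}" by (rule finite_measure_times)
  define k2 where "k2 = integral {0..T} (\<lambda>t. (K t)\<^sup>2)"
  have k2: "k2 \<ge> 0" unfolding k2_def
    by (intro Henstock_Kurzweil_Integration.integral_nonneg sub_integrable K_square_integrable) auto
  \<comment> \<open>The weight of the integral of K^2, whose contribution is to stay below \<eta> /
    2; the 1 covers k2 = 0.\<close>
  define \<delta> where "\<delta> = \<eta> / (2 * (k2 + 1))"
  have \<delta>: "\<delta> > 0" using \<eta> k2 by (simp add: \<delta>_def)
  have \<delta>k: "\<delta> * k2 \<le> \<eta> / 2"
  proof -
    have "\<delta> * k2 \<le> \<delta> * (k2 + 1)" using \<delta> by simp
    also have "\<dots> = \<eta> / 2"
    proof -
      have "x / (2 * z) * z = x / 2" if "z \<noteq> 0" for x z :: real using that by simp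
      from this[of "k2 + 1" \<eta>] show ?thesis using k2 by (simp add: \<delta>_def)
    qed
    finally show ?thesis .
  qed
  \<comment> \<open>The other terms add up to \<epsilon> (16 (1 + T) + 8) / \<delta>, where 8 comes
    from the two end points, and are to stay below \<eta> / 2. The cap 1 gives \<epsilon>^2 \<le>
    \<epsilon>.\<close>
  define \<epsilon> where "\<epsilon> = min 1 (\<eta> * \<delta> / (2 * (24 + 16 * T)))"
  have \<epsilon>: "\<epsilon> > 0" "\<epsilon> \<le> 1" using \<eta> \<delta> T_pos by (auto simp: \<epsilon>_def)
  have \<epsilon>2: "\<epsilon>\<^sup>2 \<le> \<epsilon>" using \<epsilon> by (simp add: power2_eq_square mult_left_le)
  have \<epsilon>\<delta>: "\<epsilon> * (24 + 16 * T) / \<delta> \<le> \<eta> / 2"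
  proof -
    have p: "24 + 16 * T > 0" using T_pos by simp
    have "\<epsilon> * (24 + 16 * T) \<le> \<eta> * \<delta> / (2 * (24 + 16 * T)) * (24 + 16 * T)"
      using p by (intro mult_right_mono) (auto simp: \<epsilon>_def)
    also have "\<dots> = \<eta> * \<delta> / 2"
    proof -
      have "x / (2 * z) * z = x / 2" if "z \<noteq> 0" for x z :: real using that by simp
      from this[of "24 + 16 * T" "\<eta> * \<delta>"] show ?thesis using p by simp
    qed
    finally show ?thesis using \<delta> by (simp add: field_simps)
  qed
  obtain e d where d: "d > 0" and e: "integrable (lebesgue_on {0..T}) (\<lambda>t. (e t)\<^sup>2)"
      "(LINT t|lebesgue_on {0..T}. (e t)\<^sup>2) < \<epsilon>" "\<And>t. 0 \<le> e t"
    and lusin: "\<And>s r. s \<in> {0..T} \<Longrightarrow> r \<in> {0..T} \<Longrightarrow> u s \<in> V_space \<Omega> \<Longrightarrow> u r \<in> V_space \<Omega> \<Longrightarrow> \<bar>s - r\<bar> < d \<Longrightarrow>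
      V_norm \<Omega> (\<lambda>x. u s x - u r x) \<le> e s + e r + \<epsilon>"
    using strongly_measurable_V_lusin[OF measurable_in_V V_norm_square_integrable \<epsilon>(1)] by blast
  have e_int: "integral {0..T} (\<lambda>t. (e t)\<^sup>2) < \<epsilon>"
    using e(2) lebesgue_integral_eq_integral[OF e(1)] by simp
  define \<omega> where "\<omega> r = \<delta> * (K r)\<^sup>2 + 16 / \<delta> * ((e r)\<^sup>2 + \<epsilon>\<^sup>2)" for r
  have \<omega>_int: "integrable (lebesgue_on {0..T}) \<omega>"
    unfolding \<omega>_def using e(1) K_square_integrable by auto
  have \<omega>0: "\<omega> r \<ge> 0" for r using \<delta> by (simp add: \<omega>_def)
  define W where "W t = integral {0..t} \<omega>" for t
  have Wcont: "continuous_on {0..T} W" unfolding W_def by (rule continuous_primitive[OF \<omega>_int])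
  have W_int: "W integrable_on {a..b}" if "0 \<le> a" "b \<le> T" for a b
    by (intro integrable_continuous_real continuous_on_subset[OF Wcont]) (use that in auto)
  have W0: "0 \<le> W t" if "t \<le> T" for t
    unfolding W_def using that by (intro Henstock_Kurzweil_Integration.integral_nonneg sub_integrable \<omega>_int) (auto simp: \<omega>0)
  have WT: "W t \<le> W T" if "t \<le> T" "0 \<le> t" for t
  proof -
    have "0 \<le> integral {t..T} \<omega>" using that by (intro Henstock_Kurzweil_Integration.integral_nonneg sub_integrable \<omega>_int) (auto simp: \<omega>0)
    then show ?thesis using primitive_diff[OF \<omega>_int that(2,1)] by (simp add: W_def)
  qed
  have WT_le: "W T \<le> \<eta> / 2 + 16 / \<delta> * (\<epsilon> + \<epsilon> * T)"
  proof -
    have "W T = \<delta> * k2 + 16 / \<delta> * (integral {0..T} (\<lambda>t. (e t)\<^sup>2) + \<epsilon>\<^sup>2 * T)"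
    proof -
      have i1: "(\<lambda>t. (K t)\<^sup>2) integrable_on {0..T}" "(\<lambda>t. (e t)\<^sup>2) integrable_on {0..T}"
        by (intro sub_integrable K_square_integrable e; simp)+
      then have "((\<lambda>r. \<delta> * (K r)\<^sup>2 + 16 / \<delta> * ((e r)\<^sup>2 + \<epsilon>\<^sup>2)) has_integral
          (\<delta> * k2 + 16 / \<delta> * (integral {0..T} (\<lambda>t. (e t)\<^sup>2) + T * \<epsilon>\<^sup>2))) {0..T}"
        unfolding k2_def
        using has_integral_const_real[of "\<epsilon>\<^sup>2" 0 T] T_pos
        by (intro has_integral_add has_integral_mult_right integrable_integral) auto
      then show ?thesis unfolding W_def \<omega>_def by (simp add: integral_unique mult.commute)
    qed
    also have "\<dots> \<le> \<eta> / 2 + 16 / \<delta> * (\<epsilon> + \<epsilon> * T)"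
      using \<delta>k e_int \<epsilon>2 \<delta> T_pos by (intro add_mono mult_left_mono mult_right_mono) auto
    finally show ?thesis .
  qed
  show ?thesis
  proof (intro exI conjI allI impI)
    fix h a b assume "0 < h \<and> h < d \<and> 0 < a \<and> a \<le> b \<and> b + h < T"
    then have h: "0 < h" "h < d" "0 < a" "a \<le> b" "b + h < T" by auto
    \<comment> \<open>Both \<open>t\<close> and \<open>t + h\<close> must be regular, so the
      exceptional set is joined with its translate.\<close>
    let ?Z = "bad_times \<union> {t. t + h \<in> bad_times}"
    have neg: "negligible ?Z"
    proof -
      have "{t. t + h \<in> bad_times} = (+) (- h) ` bad_times"
        by (auto simp: image_iff intro!: bexI[of _ "x + h" for x])
      then show ?thesis using negligible_bad_times negligible_translation[of bad_times "- h"] by simp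
    qed
    note sD = integral_shift_diff[of energy_defect a b h, OF energy_defect_integrable]
    note sW = integral_shift_diff[of W a b h, OF W_int]
    have "(\<lambda>t. (e t)\<^sup>2) integrable_on {a..b+h}" by (rule sub_integrable[OF e(1)]) (use h in auto)
    note se = integral_shift_diff[OF this less_imp_le[OF h(1)] h(4)]
    have ei: "(\<lambda>t. (e t)\<^sup>2) integrable_on {x..y}" if "0 \<le> x" "y \<le> T" for x y
      using that by (rule sub_integrable[OF e(1)])
    have ele: "integral {x..y} (\<lambda>t. (e t)\<^sup>2) \<le> \<epsilon>" if "0 \<le> x" "y \<le> T" for x y
    proof -
      have "integral {x..y} (\<lambda>t. (e t)\<^sup>2) \<le> integral {0..T} (\<lambda>t. (e t)\<^sup>2)"
        by (rule integral_subset_le) (use that ei in auto)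
      then show ?thesis using e_int by simp
    qed
    let ?R = "\<lambda>t. (W (t + h) - W t) + h * (4 / \<delta>) * ((e (t + h))\<^sup>2 + (e t)\<^sup>2)"
    have R1: "(\<lambda>t. W (t + h) - W t) integrable_on {a..b}"
      using h by (intro Henstock_Kurzweil_Integration.integrable_diff sW(1) W_int) auto
    have R2: "(\<lambda>t. (e (t + h))\<^sup>2 + (e t)\<^sup>2) integrable_on {a..b}"
      using h by (intro Henstock_Kurzweil_Integration.integrable_add se(1) ei) auto
    have R3: "(\<lambda>t. h * (4 / \<delta>) * ((e (t + h))\<^sup>2 + (e t)\<^sup>2)) integrable_on {a..b}"
      using integrable_on_cmult_left[OF R2, of "h * (4 / \<delta>)"] by simp
    have "\<bar>integral {a..b} (\<lambda>t. energy_defect (t + h) - energy_defect t)\<bar> \<le> integral {a..b} ?R"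
    proof (rule integral_abs_le_negligible[OF _ _ neg])
      show "(\<lambda>t. energy_defect (t + h) - energy_defect t) integrable_on {a..b}"
        using h by (intro Henstock_Kurzweil_Integration.integrable_diff sD(1) energy_defect_integrable) auto
      show "?R integrable_on {a..b}" by (rule Henstock_Kurzweil_Integration.integrable_add[OF R1 R3])
      fix t assume t: "t \<in> {a..b} - ?Z"
      have "\<bar>energy_defect (t + h) - energy_defect t\<bar> \<le>
          integral {t..t+h} \<omega> + h * (4 / \<delta> * ((e (t + h))\<^sup>2 + (e t)\<^sup>2))"
        unfolding \<omega>_def
        by (rule energy_increment_bound[OF \<delta> e(1,3) \<epsilon>(1) lusin]) (use t h in auto)
      also have "integral {t..t+h} \<omega> = W (t + h) - W t"
        using primitive_diff[OF \<omega>_int, of t "t + h"] t h by (simp add: W_def)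
      finally show "\<bar>energy_defect (t + h) - energy_defect t\<bar> \<le> ?R t" by (simp add: mult.assoc)
    qed
    also have "integral {a..b} ?R = integral {a..b} (\<lambda>t. W (t + h) - W t)
        + h * (4 / \<delta>) * integral {a..b} (\<lambda>t. (e (t + h))\<^sup>2 + (e t)\<^sup>2)"
      by (simp only: Henstock_Kurzweil_Integration.integral_add[OF R1 R3]
          Henstock_Kurzweil_Integration.integral_mult_right)
    also have "integral {a..b} (\<lambda>t. W (t + h) - W t) \<le> h * W T"
    proof -
      have "integral {b..b+h} W \<le> integral {b..b+h} (\<lambda>t. W T)"
        using h by (intro integral_le W_int) (auto intro: WT)
      moreover have "0 \<le> integral {a..a+h} W"
        using h by (intro Henstock_Kurzweil_Integration.integral_nonneg W_int W0) auto
      ultimately show ?thesis using h sW(3) by simp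
    qed
    also have "h * (4 / \<delta>) * integral {a..b} (\<lambda>t. (e (t + h))\<^sup>2 + (e t)\<^sup>2) \<le> h * (4 / \<delta>) * (\<epsilon> + \<epsilon>)"
    proof (rule mult_left_mono)
      have "integral {a..b} (\<lambda>t. (e (t + h))\<^sup>2 + (e t)\<^sup>2) = integral {a+h..b+h} (\<lambda>t. (e t)\<^sup>2) + integral {a..b} (\<lambda>t. (e t)\<^sup>2)"
        using h se by (subst Henstock_Kurzweil_Integration.integral_add) (auto intro: ei)
      then show "integral {a..b} (\<lambda>t. (e (t + h))\<^sup>2 + (e t)\<^sup>2) \<le> \<epsilon> + \<epsilon>"
        using ele[of "a + h" "b + h"] ele[of a b] h by simp
    qed (use h \<delta> in simp)
    also have "h * W T + h * (4 / \<delta>) * (\<epsilon> + \<epsilon>) \<le> h * \<eta>"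
    proof -
      have "W T + 4 / \<delta> * (\<epsilon> + \<epsilon>) \<le> \<eta> / 2 + \<epsilon> * (24 + 16 * T) / \<delta>"
      proof -
        have "\<epsilon> * (24 + 16 * T) / \<delta> = 16 / \<delta> * (\<epsilon> + \<epsilon> * T) + 4 / \<delta> * (\<epsilon> + \<epsilon>)"
          using \<delta> by (simp add: field_simps)
        then show ?thesis using WT_le by simp
      qed
      also have "\<dots> \<le> \<eta>" using \<epsilon>\<delta> by linarith
      finally have "h * (W T + 4 / \<delta> * (\<epsilon> + \<epsilon>)) \<le> h * \<eta>" using h by (intro mult_left_mono) auto
      then show ?thesis by (simp add: distrib_left mult.assoc)
    qed
    finally show "\<bar>integral {b..b+h} energy_defect - integral {a..a+h} energy_defect\<bar> \<le> h * \<eta>"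
      using sD(3) h by simp
  qed (use d in simp)
qed

text \<open>At Lebesgue points of the defect the averages over [x, x + h] converge to its values,
  and the window estimate makes the averages at two such points differ by an arbitrarily small
  amount.\<close>

lemma energy_defect_constant:
  "\<exists>c N. negligible N \<and> (\<forall>t\<in>{0<..<T} - N. energy_defect t = c)"
proof -
  \<comment> \<open>The extension by 0 is integrable on every interval, as the differentiation
    theorem requires.\<close>
  define Q where "Q t = (if t \<in> {0..T} then energy_defect t else 0)" for t
  have Q: "Q integrable_on cbox a b" for a b
  proof -
    have "energy_defect integrable_on {0..T}" by (rule energy_defect_integrable) auto
    then have "Q integrable_on UNIV" unfolding Q_def integrable_restrict_UNIV .
    then show ?thesis by (rule integrable_on_subcbox) simp
  qed
  obtain N where N: "negligible N" "\<And>x e. x \<notin> N \<Longrightarrow> 0 < e \<Longrightarrow>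
      \<exists>d>0. \<forall>h. 0 < h \<and> h < d \<longrightarrow> norm (integral (cbox x (x + h *\<^sub>R One)) Q /\<^sub>R h ^ DIM(real) - Q x) < e"
    using integrable_ccontinuous_explicit[OF Q] by metis
  have eq: "energy_defect b = energy_defect a" if ab: "a \<in> {0<..<T} - N" "b \<in> {0<..<T} - N" "a \<le> b" for a b
  proof -
    have "\<bar>energy_defect b - energy_defect a\<bar> \<le> 0 + \<eta>" if \<eta>: "\<eta> > 0" for \<eta>
    proof -
      have \<eta>3: "\<eta> / 3 > 0" using \<eta> by simp
      obtain h0 where h0: "h0 > 0" "\<And>h a b. 0 < h \<Longrightarrow> h < h0 \<Longrightarrow> 0 < a \<Longrightarrow> a \<le> b \<Longrightarrow> b + h < T \<Longrightarrow>
          \<bar>integral {b..b+h} energy_defect - integral {a..a+h} energy_defect\<bar> \<le> h * (\<eta> / 3)"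
        using energy_defect_window[OF \<eta>3] by blast
      have lp: "\<exists>d>0. \<forall>h. 0 < h \<and> h < d \<longrightarrow> \<bar>integral {x..x+h} energy_defect / h - energy_defect x\<bar> < \<eta> / 3"
        if x: "x \<in> {0<..<T} - N" for x
      proof -
        obtain d where d: "d > 0" "\<And>h. 0 < h \<Longrightarrow> h < d \<Longrightarrow>
            norm (integral (cbox x (x + h *\<^sub>R One)) Q /\<^sub>R h ^ DIM(real) - Q x) < \<eta> / 3"
          using N(2)[of x, OF _ \<eta>3] x by auto
        have "\<bar>integral {x..x+h} energy_defect / h - energy_defect x\<bar> < \<eta> / 3"
          if h: "0 < h" "h < min d (T - x)" for h
        proof -
          have "integral {x..x+h} Q = integral {x..x+h} energy_defect"
            by (rule Henstock_Kurzweil_Integration.integral_cong) (use x h in \<open>auto simp: Q_def\<close>)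
          moreover have "Q x = energy_defect x" using x by (simp add: Q_def)
          moreover have "integral (cbox x (x + h *\<^sub>R One)) Q /\<^sub>R h ^ DIM(real) = integral {x..x+h} Q / h"
            by (simp add: divide_inverse_commute)
          ultimately show ?thesis using d(2)[of h] h by simp
        qed
        moreover have "min d (T - x) > 0" using d x by simp
        ultimately show ?thesis by blast
      qed
      obtain d1 where d1: "d1 > 0" "\<And>h. 0 < h \<Longrightarrow> h < d1 \<Longrightarrow> \<bar>integral {a..a+h} energy_defect / h - energy_defect a\<bar> < \<eta> / 3"
        using lp[OF ab(1)] by blast
      obtain d2 where d2: "d2 > 0" "\<And>h. 0 < h \<Longrightarrow> h < d2 \<Longrightarrow> \<bar>integral {b..b+h} energy_defect / h - energy_defect b\<bar> < \<eta> / 3"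
        using lp[OF ab(2)] by blast
      define m where "m = min (min d1 d2) (min h0 (T - b))"
      have m: "m > 0" "m \<le> d1" "m \<le> d2" "m \<le> h0" "m \<le> T - b"
        using d1 d2 h0 ab by (auto simp: m_def)
      define h where "h = m / 2"
      have h: "0 < h" "h < d1" "h < d2" "h < h0" "b + h < T" using m unfolding h_def by linarith+
      have "\<bar>integral {b..b+h} energy_defect - integral {a..a+h} energy_defect\<bar> \<le> h * (\<eta> / 3)"
        by (rule h0(2)) (use h ab in auto)
      then have "\<bar>integral {b..b+h} energy_defect / h - integral {a..a+h} energy_defect / h\<bar> \<le> \<eta> / 3"
        using h by (simp add: diff_divide_distrib[symmetric] abs_divide pos_divide_le_eq mult.commute)
      then show ?thesis using d1(2)[OF h(1,2)] d2(2)[OF h(1,3)] by linarith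
    qed
    then have "\<bar>energy_defect b - energy_defect a\<bar> \<le> 0" by (rule field_le_epsilon)
    then show ?thesis by simp
  qed
  have "\<not> negligible {0<..<T}" using open_not_negligible[of "{0<..<T}"] T_pos by simp
  then have "\<not> {0<..<T} \<subseteq> N" using N(1) negligible_subset by blast
  then obtain a where a: "a \<in> {0<..<T} - N" by blast
  have "energy_defect t = energy_defect a" if "t \<in> {0<..<T} - N" for t
    using eq[OF a that] eq[OF that a] by (cases "a \<le> t") auto
  then show ?thesis using N(1) by blast
qed

text \<open>
  Weak continuity in \<open>H\<close> only gives lower semicontinuity of the norm, hence an inequality at
  the exceptional times.
\<close>

theorem energy_identity:
  "\<exists>c N. negligible N \<and>
    (\<forall>t\<in>{0<..<T} - N. (L2_norm \<Omega> (u t))\<^sup>2 = integral {0..t} (\<lambda>r. 2 * G r (u r)) + c) \<and>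
    (\<forall>t\<in>{0<..<T}. (L2_norm \<Omega> (u t))\<^sup>2 \<le> integral {0..t} (\<lambda>r. 2 * G r (u r)) + c)"
proof -
  obtain c N where c: "negligible N" "\<And>t. t \<in> {0<..<T} - N \<Longrightarrow> energy_defect t = c"
    using energy_defect_constant by blast
  define A where "A t = integral {0..t} power_density + c" for t
  have A: "energy t = A t" if "t \<in> {0<..<T} - N" for t
    using c(2)[OF that] by (simp add: energy_defect_def A_def)
  have "continuous_on {0..T} A"
    unfolding A_def by (intro continuous_intros continuous_primitive power_density_integrable)
  then have Ac: "continuous_on {0<..<T} A" by (rule continuous_on_subset) auto
  have E0: "0 \<le> energy t" for t by (simp add: energy_def)
  have A0: "0 \<le> A t" if "t \<in> {0<..<T}" for t
    by (rule nonneg_from_negligible[OF Ac c(1) _ that]) (use A E0 in metis)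
  have le: "energy t \<le> A t" if t: "t \<in> {0<..<T}" for t
  proof (cases "energy t = 0")
    case True
    then show ?thesis using A0[OF t] by simp
  next
    case False
    then have pos: "energy t > 0" using E0[of t] by simp
    have tH: "u t \<in> H_space \<Omega>" using t in_H by auto
    define f where "f s = L2_inner \<Omega> (u s) (u t)" for s
    have fc: "continuous_on {0<..<T} f"
      unfolding f_def by (rule continuous_on_subset[OF weakly_continuous[OF tH]]) auto
    \<comment> \<open>Cauchy--Schwarz gives f(s)^2 \<le> A(s) |u(t)|^2 at almost every
      \<open>s\<close>. Both sides are continuous in \<open>s\<close>, so this holds at s = t, where
      f(t) = |u(t)|^2.\<close>
    have "0 \<le> A t * energy t - (f t)\<^sup>2"
    proof (rule nonneg_from_negligible[where F="\<lambda>s. A s * energy t - (f s)\<^sup>2", OF _ c(1) _ t])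
      show "continuous_on {0<..<T} (\<lambda>s. A s * energy t - (f s)\<^sup>2)"
        by (intro continuous_intros Ac fc)
      fix s assume s: "s \<in> {0<..<T} - N"
      have "\<bar>f s\<bar> \<le> L2_norm \<Omega> (u s) * L2_norm \<Omega> (u t)"
        unfolding f_def using s t by (intro L2_inner_bound H_L2 in_H) auto
      then have "\<bar>f s\<bar>\<^sup>2 \<le> (L2_norm \<Omega> (u s) * L2_norm \<Omega> (u t))\<^sup>2" by (rule power_mono) simp
      then show "0 \<le> A s * energy t - (f s)\<^sup>2"
        using A[OF s] by (simp add: energy_def power_mult_distrib)
    qed
    moreover have "f t = energy t" by (simp add: f_def energy_def L2_norm_squared)
    ultimately have "energy t * energy t \<le> A t * energy t" by (simp add: power2_eq_square)
    then show ?thesis using pos by simp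
  qed
  show ?thesis using c(1) A le unfolding A_def energy_def power_density_def[abs_def] by blast
qed

end

subsection \<open>Weak solutions as evolutions in the dual of \<open>V\<close>\<close>

lemma AE_lebesgue_on_subset:
  assumes "AE t in lebesgue_on S. P t" "S \<in> sets lebesgue" "T \<in> sets lebesgue" "T \<subseteq> S"
  shows "AE t in lebesgue_on T. P t"
proof -
  have "AE t in lebesgue. t \<in> S \<longrightarrow> P t"
    using assms(1,2) by (subst (asm) AE_restrict_space_iff) auto
  then have "AE t in lebesgue. t \<in> T \<longrightarrow> P t" using assms(4) by (auto elim: eventually_mono)
  then show ?thesis using assms(3) by (subst AE_restrict_space_iff) auto
qed

section \<open>Bounds and measurability for the terms of the equation\<close>

context bounded_open_set begin

text \<open>The essential bound holds at almost every time; pairing with u(t) and weak continuity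
  carry it to every interior \<open>t\<close>. The norms at the two end points are included by
  taking a maximum.\<close>

lemma Cw_H_bounded:
  assumes u: "u \<in> Cw_H T \<Omega>"
  shows "\<exists>B. \<forall>t\<in>{0..T}. L2_norm \<Omega> (u t) \<le> B"
proof -
  obtain k where "AE t in lebesgue_on {0..T}. L2_norm \<Omega> (u t) \<le> k"
    using u by (auto simp: Cw_H_def Bochner_Linf_def)
  then have N: "negligible {t\<in>{0..T}. \<not> L2_norm \<Omega> (u t) \<le> k}"
    by (rule AE_lebesgue_on_negligible) simp
  define B where "B = max k 0"
  have H: "u t \<in> H_space \<Omega>" if "t \<in> {0..T}" for t using u that by (simp add: Cw_H_def)
  have le: "L2_norm \<Omega> (u t) \<le> B" if t: "t \<in> {0<..<T}" for t
  proof (cases "L2_norm \<Omega> (u t) = 0")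
    case False
    then have pos: "L2_norm \<Omega> (u t) > 0" using L2_norm_nonneg[of \<Omega> "u t"] by simp
    have tH: "u t \<in> H_space \<Omega>" using t by (intro H) auto
    have "continuous_on {0..T} (\<lambda>s. L2_inner \<Omega> (u s) (u t))"
      using u tH by (simp add: Cw_H_def)
    then have c: "continuous_on {0<..<T} (\<lambda>s. L2_inner \<Omega> (u s) (u t))"
      by (rule continuous_on_subset) auto
    have "0 \<le> B * L2_norm \<Omega> (u t) - L2_inner \<Omega> (u t) (u t)"
    proof (rule nonneg_from_negligible[where F="\<lambda>s. B * L2_norm \<Omega> (u t) - L2_inner \<Omega> (u s) (u t)", OF _ N _ t])
      show "continuous_on {0<..<T} (\<lambda>s. B * L2_norm \<Omega> (u t) - L2_inner \<Omega> (u s) (u t))"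
        by (intro continuous_intros c)
      fix s assume s: "s \<in> {0<..<T} - {t\<in>{0..T}. \<not> L2_norm \<Omega> (u t) \<le> k}"
      have "L2_inner \<Omega> (u s) (u t) \<le> L2_norm \<Omega> (u s) * L2_norm \<Omega> (u t)"
        using L2_inner_bound[OF H_L2[OF H] H_L2[OF tH], of s] s by auto
      also have "\<dots> \<le> B * L2_norm \<Omega> (u t)"
        using s pos by (intro mult_right_mono) (auto simp: B_def)
      finally show "0 \<le> B * L2_norm \<Omega> (u t) - L2_inner \<Omega> (u s) (u t)" by simp
    qed
    then have "L2_norm \<Omega> (u t) * L2_norm \<Omega> (u t) \<le> B * L2_norm \<Omega> (u t)"
      by (simp add: L2_norm_squared[symmetric] power2_eq_square)
    then show ?thesis using pos by simp
  qed (simp add: B_def)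
  have "L2_norm \<Omega> (u t) \<le> max B (max (L2_norm \<Omega> (u 0)) (L2_norm \<Omega> (u T)))" if "t \<in> {0..T}" for t
    using le[of t] that by (cases "t = 0 \<or> t = T") auto
  then show ?thesis by blast
qed

lemma forcing_pairing_measurable:
  assumes f: "strongly_measurable {0..T} (V_dual \<Omega>) (V_dual_norm \<Omega>) f" and \<phi>: "\<phi> \<in> V_space \<Omega>"
  shows "(\<lambda>t. f t \<phi>) \<in> borel_measurable (lebesgue_on {0..T})"
proof (rule strongly_measurable_compose[OF f, where h="\<lambda>t F. F \<phi>"])
  fix t :: real and w :: "nat \<Rightarrow> functional" and x
  assume *: "\<And>n. w n \<in> V_dual \<Omega>" "x \<in> V_dual \<Omega>" "(\<lambda>n. V_dual_norm \<Omega> (x - w n)) \<longlonglongrightarrow> 0"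
  show "(\<lambda>n. w n \<phi>) \<longlonglongrightarrow> x \<phi>"
  proof (rule LIM_zero_cancel, rule Lim_null_comparison[OF always_eventually tendsto_mult_left_zero[OF *(3), of "V_norm \<Omega> \<phi>"]], rule allI)
    show "norm (w n \<phi> - x \<phi>) \<le> V_dual_norm \<Omega> (x - w n) * V_norm \<Omega> \<phi>" for n
      using V_dual_bound[OF V_dual_diff[OF *(2,1)] \<phi>, of n] by (simp add: abs_minus_commute)
  qed
qed auto

lemma V_inner_measurable:
  assumes u: "strongly_measurable {0..T} (V_space \<Omega>) (V_norm \<Omega>) u" and \<phi>: "\<phi> \<in> V_space \<Omega>"
  shows "(\<lambda>t. V_inner \<Omega> (u t) \<phi>) \<in> borel_measurable (lebesgue_on {0..T})"
proof (rule strongly_measurable_compose[OF u])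
  fix t :: real and w :: "nat \<Rightarrow> field2" and x
  assume *: "\<And>n. w n \<in> V_space \<Omega>" "x \<in> V_space \<Omega>" "(\<lambda>n. V_norm \<Omega> (x - w n)) \<longlonglongrightarrow> 0"
  show "(\<lambda>n. V_inner \<Omega> (w n) \<phi>) \<longlonglongrightarrow> V_inner \<Omega> x \<phi>"
  proof (rule LIM_zero_cancel, rule Lim_null_comparison[OF always_eventually tendsto_mult_left_zero[OF *(3), of "V_norm \<Omega> \<phi>"]], rule allI)
    fix n
    have "V_inner \<Omega> (\<lambda>y. x y - w n y) \<phi> = V_inner \<Omega> x \<phi> - V_inner \<Omega> (w n) \<phi>"
      by (intro V_inner_diff_left V_H1 * \<phi>)
    then show "norm (V_inner \<Omega> (w n) \<phi> - V_inner \<Omega> x \<phi>) \<le> V_norm \<Omega> (x - w n) * V_norm \<Omega> \<phi>"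
      using V_inner_bound[OF V_H1[OF V_diff[OF *(2,1)]] V_H1[OF \<phi>], of n]
      by (simp add: abs_minus_commute fun_diff_def)
  qed
qed auto

lemma nse_b_measurable:
  assumes u: "strongly_measurable {0..T} (V_space \<Omega>) (V_norm \<Omega>) u" and \<phi>: "\<phi> \<in> V_space \<Omega>"
  shows "(\<lambda>t. nse_b \<Omega> (u t) (u t) \<phi>) \<in> borel_measurable (lebesgue_on {0..T})"
proof (rule strongly_measurable_compose[OF u, where h="\<lambda>t w. nse_b \<Omega> w w \<phi>"])
  fix t :: real and w :: "nat \<Rightarrow> field2" and x
  assume w: "\<And>n. w n \<in> V_space \<Omega>" and x: "x \<in> V_space \<Omega>" and "(\<lambda>n. V_norm \<Omega> (x - w n)) \<longlonglongrightarrow> 0"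
  then have lim: "(\<lambda>n. V_norm \<Omega> (\<lambda>y. x y - w n y)) \<longlonglongrightarrow> 0" by (simp add: fun_diff_def)
  let ?C = "2 * poincare_const"
  let ?d = "\<lambda>n. V_norm \<Omega> (\<lambda>y. x y - w n y)"
  have "(\<lambda>n. ?C * (?d n * V_norm \<Omega> x * V_norm \<Omega> \<phi>) + ?C * (V_norm \<Omega> (w n) * ?d n * V_norm \<Omega> \<phi>))
      \<longlonglongrightarrow> ?C * (0 * V_norm \<Omega> x * V_norm \<Omega> \<phi>) + ?C * (V_norm \<Omega> x * 0 * V_norm \<Omega> \<phi>)"
    by (intro tendsto_add tendsto_mult tendsto_const lim V_norm_approx[OF V_H1[OF x] V_H1[OF w] lim])
  then have lim0: "(\<lambda>n. ?C * (?d n * V_norm \<Omega> x * V_norm \<Omega> \<phi>) + ?C * (V_norm \<Omega> (w n) * ?d n * V_norm \<Omega> \<phi>)) \<longlonglongrightarrow> 0"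
    by simp
  show "(\<lambda>n. nse_b \<Omega> (w n) (w n) \<phi>) \<longlonglongrightarrow> nse_b \<Omega> x x \<phi>"
  proof (rule LIM_zero_cancel, rule Lim_null_comparison[OF always_eventually lim0], rule allI)
    fix n
    have "nse_b \<Omega> x x \<phi> - nse_b \<Omega> (w n) (w n) \<phi>
        = nse_b \<Omega> (\<lambda>y. x y - w n y) x \<phi> + nse_b \<Omega> (w n) (\<lambda>y. x y - w n y) \<phi>"
      using nse_b_diff1[OF x w[of n] x \<phi>] nse_b_diff2[OF w[of n] x w[of n] \<phi>] by simp
    then show "norm (nse_b \<Omega> (w n) (w n) \<phi> - nse_b \<Omega> x x \<phi>)
        \<le> ?C * (?d n * V_norm \<Omega> x * V_norm \<Omega> \<phi>) + ?C * (V_norm \<Omega> (w n) * ?d n * V_norm \<Omega> \<phi>)"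
      using nse_b_bound_V[OF V_diff[OF x w[of n]] x \<phi>] nse_b_bound_V[OF w[of n] V_diff[OF x w[of n]] \<phi>]
      unfolding real_norm_def by linarith
  qed
qed auto

text \<open>Stands for the time derivative. The derivative in the definition of a weak solution
  agrees with it, for each \<phi>, off a null set of times that depends on \<phi>; for admissible
  forcing the present expression is linear and bounded on V at every t \<ge> 0 with u(t) in
  V.\<close>

definition nse_rhs :: "real \<Rightarrow> (real \<Rightarrow> functional) \<Rightarrow> (real \<Rightarrow> field2) \<Rightarrow> real \<Rightarrow> field2 \<Rightarrow> real" where
  "nse_rhs \<nu> f u t \<phi> = f t \<phi> - \<nu> * V_inner \<Omega> (u t) \<phi> - nse_b \<Omega> (u t) (u t) \<phi>"

text \<open>The point is that the right-hand side has a square integrable dual norm: the nonlinear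
  term is at most 2 |u| ||u|| and |u| is bounded on [0, T], so \<open>K\<close> is the norm of
  \<open>f t\<close> plus a multiple of ||u||.\<close>

lemma weak_solution_evolution:
  assumes \<nu>: "\<nu> > 0" and adm: "admissible_forcing \<Omega> f" and sol: "weak_solution \<Omega> \<nu> f u0 u" and T: "T > 0"
  shows "\<exists>B K. evolution \<Omega> T B u (nse_rhs \<nu> f u) K"
proof -
  have fV: "f t \<in> V_dual \<Omega>" if "t \<in> {0..T}" for t
    using adm that by (simp add: admissible_forcing_def)
  have f: "strongly_measurable {0..T} (V_dual \<Omega>) (V_dual_norm \<Omega>) f"
      "integrable (lebesgue_on {0..T}) (\<lambda>t. (V_dual_norm \<Omega> (f t))\<^sup>2)"
    using adm T by (auto simp: admissible_forcing_def Bochner_Lp_def)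
  have "u \<in> Bochner_Lp 2 {0..T} (V_space \<Omega>) (V_norm \<Omega>) \<and> u \<in> Cw_H T \<Omega> \<and>
        (\<exists>w \<in> Bochner_L1_loc T (V_dual \<Omega>) (V_dual_norm \<Omega>).
           is_time_deriv T \<Omega> (\<lambda>t. H_to_V_dual \<Omega> (u t)) w \<and>
           (\<forall>\<phi>\<in>V_space \<Omega>. AE t in lebesgue_on {0..T}.
              w t \<phi> + \<nu> * V_inner \<Omega> (u t) \<phi> + nse_b \<Omega> (u t) (u t) \<phi> = f t \<phi>))"
    using sol T unfolding weak_solution_def by blast
  then obtain w where u: "strongly_measurable {0..T} (V_space \<Omega>) (V_norm \<Omega>) u"
      "integrable (lebesgue_on {0..T}) (\<lambda>t. (V_norm \<Omega> (u t))\<^sup>2)" "u \<in> Cw_H T \<Omega>"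
    and w: "is_time_deriv T \<Omega> (\<lambda>t. H_to_V_dual \<Omega> (u t)) w"
      "\<And>\<phi>. \<phi> \<in> V_space \<Omega> \<Longrightarrow> AE t in lebesgue_on {0..T}. w t \<phi> + \<nu> * V_inner \<Omega> (u t) \<phi> + nse_b \<Omega> (u t) (u t) \<phi> = f t \<phi>"
    unfolding Bochner_Lp_def by blast
  obtain B' where B': "\<And>t. t \<in> {0..T} \<Longrightarrow> L2_norm \<Omega> (u t) \<le> B'" using Cw_H_bounded[OF u(3)] by blast
  define B where "B = max B' 0"
  have B: "L2_norm \<Omega> (u t) \<le> B" if "t \<in> {0..T}" for t using B'[OF that] by (simp add: B_def)
  have B0: "B \<ge> 0" by (simp add: B_def)
  define K where "K t = V_dual_norm \<Omega> (f t) + (\<nu> + 2 * B) * V_norm \<Omega> (u t)" for t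
  have fm: "(\<lambda>t. V_dual_norm \<Omega> (f t)) \<in> borel_measurable (lebesgue_on {0..T})"
  proof -
    have "(\<lambda>t. sqrt ((V_dual_norm \<Omega> (f t))\<^sup>2)) \<in> borel_measurable (lebesgue_on {0..T})"
      using borel_measurable_integrable[OF f(2)] by measurable
    then show ?thesis
      by (subst measurable_cong[where g="\<lambda>t. sqrt ((V_dual_norm \<Omega> (f t))\<^sup>2)"])
        (auto simp: space_restrict_space V_dual_norm_nonneg fV)
  qed
  have um: "(\<lambda>t. V_norm \<Omega> (u t)) \<in> borel_measurable (lebesgue_on {0..T})"
  proof -
    have "(\<lambda>t. sqrt ((V_norm \<Omega> (u t))\<^sup>2)) \<in> borel_measurable (lebesgue_on {0..T})"
      using borel_measurable_integrable[OF u(2)] by measurable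
    then show ?thesis by (simp add: V_norm_nonneg)
  qed
  have Km: "K \<in> borel_measurable (lebesgue_on {0..T})" unfolding K_def using fm um by measurable
  have Gm: "(\<lambda>t. nse_rhs \<nu> f u t \<phi>) \<in> borel_measurable (lebesgue_on {0..T})" if "\<phi> \<in> V_space \<Omega>" for \<phi>
    unfolding nse_rhs_def
    using forcing_pairing_measurable[OF f(1) that] V_inner_measurable[OF u(1) that] nse_b_measurable[OF u(1) that]
    by measurable
  have "evolution \<Omega> T B u (nse_rhs \<nu> f u) K"
  proof
    show "0 < T" by (rule T)
    show "u t \<in> H_space \<Omega>" if "t \<in> {0..T}" for t using u(3) that by (simp add: Cw_H_def)
    show "continuous_on {0..T} (\<lambda>t. L2_inner \<Omega> (u t) h)" if "h \<in> H_space \<Omega>" for h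
      using u(3) that by (simp add: Cw_H_def)
    show "L2_norm \<Omega> (u t) \<le> B" if "t \<in> {0..T}" for t by (rule B[OF that])
    show "strongly_measurable {0..T} (V_space \<Omega>) (V_norm \<Omega>) u" by (rule u(1))
    show "integrable (lebesgue_on {0..T}) (\<lambda>t. (V_norm \<Omega> (u t))\<^sup>2)" by (rule u(2))
    show "nse_rhs \<nu> f u t (\<lambda>x. \<phi> x + \<psi> x) = nse_rhs \<nu> f u t \<phi> + nse_rhs \<nu> f u t \<psi>"
      if "t \<in> {0..T}" "u t \<in> V_space \<Omega>" "\<phi> \<in> V_space \<Omega>" "\<psi> \<in> V_space \<Omega>" for t \<phi> \<psi>
      using that V_dual_add[OF fV[OF that(1)] that(3,4)] V_inner_add_left[OF V_H1[OF that(3)] V_H1[OF that(4)] V_H1[OF that(2)]]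
      by (simp add: nse_rhs_def nse_b_add3 V_inner_commute[of "u t"] distrib_left)
    show "nse_rhs \<nu> f u t (\<lambda>x. c *\<^sub>R \<phi> x) = c * nse_rhs \<nu> f u t \<phi>"
      if "t \<in> {0..T}" "u t \<in> V_space \<Omega>" "\<phi> \<in> V_space \<Omega>" for t \<phi> c
      using that V_dual_scaleR[OF fV[OF that(1)] that(3)] V_inner_scaleR_left[OF V_H1[OF that(3)] V_H1[OF that(2)]]
      by (simp add: nse_rhs_def nse_b_scaleR3 V_inner_commute[of "u t"] right_diff_distrib)
    show "\<bar>nse_rhs \<nu> f u t \<phi>\<bar> \<le> K t * V_norm \<Omega> \<phi>"
      if t: "t \<in> {0..T}" "u t \<in> V_space \<Omega>" "\<phi> \<in> V_space \<Omega>" for t \<phi>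
    proof -
      have "\<bar>f t \<phi>\<bar> \<le> V_dual_norm \<Omega> (f t) * V_norm \<Omega> \<phi>" by (rule V_dual_bound[OF fV[OF t(1)] t(3)])
      moreover have "\<bar>\<nu> * V_inner \<Omega> (u t) \<phi>\<bar> \<le> \<nu> * (V_norm \<Omega> (u t) * V_norm \<Omega> \<phi>)"
        using V_inner_bound[OF V_H1[OF t(2)] V_H1[OF t(3)]] \<nu> by (simp add: abs_mult)
      moreover have "\<bar>nse_b \<Omega> (u t) (u t) \<phi>\<bar> \<le> 2 * (B * V_norm \<Omega> (u t)) * V_norm \<Omega> \<phi>"
        by (rule order_trans[OF nse_b_bound_energy[OF t(2,3)]])
          (intro mult_right_mono mult_left_mono B t V_norm_nonneg, simp)
      moreover have "K t * V_norm \<Omega> \<phi> = V_dual_norm \<Omega> (f t) * V_norm \<Omega> \<phi> + \<nu> * (V_norm \<Omega> (u t) * V_norm \<Omega> \<phi>)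
          + 2 * (B * V_norm \<Omega> (u t)) * V_norm \<Omega> \<phi>"
        by (simp add: K_def algebra_simps)
      ultimately show ?thesis unfolding nse_rhs_def by linarith
    qed
    show "0 \<le> K t" if "t \<in> {0..T}" for t
      unfolding K_def using V_dual_norm_nonneg[OF fV[OF that]] V_norm_nonneg[of \<Omega> "u t"] \<nu> B0 by simp
    show "K \<in> borel_measurable (lebesgue_on {0..T})" by (rule Km)
    show "integrable (lebesgue_on {0..T}) (\<lambda>t. (K t)\<^sup>2)"
    proof (rule Bochner_Integration.integrable_bound)
      show "integrable (lebesgue_on {0..T}) (\<lambda>t. 2 * (V_dual_norm \<Omega> (f t))\<^sup>2 + 2 * (\<nu> + 2 * B)\<^sup>2 * (V_norm \<Omega> (u t))\<^sup>2)"
        using f(2) u(2) by auto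
      have "(a + b)\<^sup>2 \<le> 2 * a\<^sup>2 + 2 * b\<^sup>2" for a b :: real
        using sum_squares_bound[of a b] by (simp add: power2_sum)
      from this[of "V_dual_norm \<Omega> (f t)" "(\<nu> + 2 * B) * V_norm \<Omega> (u t)" for t]
      have "(K t)\<^sup>2 \<le> 2 * (V_dual_norm \<Omega> (f t))\<^sup>2 + 2 * (\<nu> + 2 * B)\<^sup>2 * (V_norm \<Omega> (u t))\<^sup>2" for t
        by (simp add: K_def power_mult_distrib mult.assoc)
      then show "AE t in lebesgue_on {0..T}. norm ((K t)\<^sup>2) \<le> norm (2 * (V_dual_norm \<Omega> (f t))\<^sup>2 + 2 * (\<nu> + 2 * B)\<^sup>2 * (V_norm \<Omega> (u t))\<^sup>2)"
        by (intro AE_I2) (simp add: order_trans[OF _ abs_ge_self])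
    qed (use Km in measurable)
    show "(\<lambda>t. nse_rhs \<nu> f u t \<phi>) \<in> borel_measurable (lebesgue_on {0..T})" if "\<phi> \<in> V_space \<Omega>" for \<phi>
      by (rule Gm[OF that])
    show "(LINT t|lebesgue_on {0<..<T}. L2_inner \<Omega> (u t) \<phi> * deriv \<theta> t)
        = - (LINT t|lebesgue_on {0<..<T}. nse_rhs \<nu> f u t \<phi> * \<theta> t)"
      if \<phi>: "\<phi> \<in> V_space \<Omega>" and \<theta>: "\<theta> \<in> test_functions {0<..<T}" for \<phi> \<theta>
    proof -
      \<comment> \<open>The null set may depend on \<open>\<phi>\<close>, as \<open>\<phi>\<close>
        is fixed in the integrals to be compared.\<close>
      have "AE t in lebesgue_on {0..T}. nse_rhs \<nu> f u t \<phi> = w t \<phi>"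
        using w(2)[OF \<phi>] by eventually_elim (simp add: nse_rhs_def)
      then have ae: "AE t in lebesgue_on {0<..<T}. nse_rhs \<nu> f u t \<phi> = w t \<phi>"
        by (rule AE_lebesgue_on_subset) auto
      have m: "(\<lambda>t. nse_rhs \<nu> f u t \<phi>) \<in> borel_measurable (lebesgue_on {0<..<T})"
        by (rule measurable_restrict_mono[OF Gm[OF \<phi>]]) auto
      have m': "(\<lambda>t. w t \<phi>) \<in> borel_measurable (lebesgue_on {0<..<T})"
        by (rule borel_measurable_lebesgue_on_AE[OF _ m ae]) simp
      have m\<theta>: "\<theta> \<in> borel_measurable (lebesgue_on {0<..<T})"
        by (rule continuous_imp_measurable_on_sets_lebesgue[OF continuous_on_subset[OF test_continuous[OF \<theta>]]]) auto
      have "(LINT t|lebesgue_on {0<..<T}. nse_rhs \<nu> f u t \<phi> * \<theta> t) = (LINT t|lebesgue_on {0<..<T}. w t \<phi> * \<theta> t)"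
      proof (rule integral_cong_AE)
        show "AE t in lebesgue_on {0<..<T}. nse_rhs \<nu> f u t \<phi> * \<theta> t = w t \<phi> * \<theta> t"
          using ae by eventually_elim simp
      qed (use m m' m\<theta> in measurable)
      moreover have "(LINT t|lebesgue_on {0<..<T}. H_to_V_dual \<Omega> (u t) \<phi> * deriv \<theta> t)
          = - (LINT t|lebesgue_on {0<..<T}. w t \<phi> * \<theta> t)"
        using w(1) \<phi> \<theta> by (simp add: is_time_deriv_def)
      ultimately show ?thesis by (simp add: H_to_V_dual_def)
    qed
  qed
  then show ?thesis by blast
qed

section \<open>The difference of two evolutions\<close>

lemma strongly_measurable_V_diff:
  assumes u: "strongly_measurable I (V_space \<Omega>) (V_norm \<Omega>) u" and v: "strongly_measurable I (V_space \<Omega>) (V_norm \<Omega>) v"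
  shows "strongly_measurable I (V_space \<Omega>) (V_norm \<Omega>) (\<lambda>t x. u t x - v t x)"
proof -
  obtain s where s: "\<And>n::nat. simple_function (lebesgue_on I) (s n)" "\<And>n. s n ` I \<subseteq> V_space \<Omega>"
    "AE t in lebesgue_on I. u t \<in> V_space \<Omega> \<and> (\<lambda>n. V_norm \<Omega> (\<lambda>x. u t x - s n t x)) \<longlonglongrightarrow> 0"
    using u unfolding strongly_measurable_def fun_diff_def by blast
  obtain r where r: "\<And>n::nat. simple_function (lebesgue_on I) (r n)" "\<And>n. r n ` I \<subseteq> V_space \<Omega>"
    "AE t in lebesgue_on I. v t \<in> V_space \<Omega> \<and> (\<lambda>n. V_norm \<Omega> (\<lambda>x. v t x - r n t x)) \<longlonglongrightarrow> 0"
    using v unfolding strongly_measurable_def fun_diff_def by blast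
  have sp: "space (lebesgue_on I) = I" by (simp add: space_restrict_space)
  show ?thesis
    unfolding strongly_measurable_def fun_diff_def
  proof (intro exI[of _ "\<lambda>n t x. s n t x - r n t x"] conjI allI)
    fix n
    show "simple_function (lebesgue_on I) (\<lambda>t x. s n t x - r n t x)"
      using simple_function_compose2[OF s(1) r(1), of "\<lambda>a b x. a x - b x" n n] .
    show "(\<lambda>t x. s n t x - r n t x) ` I \<subseteq> V_space \<Omega>"
      using s(2)[of n] r(2)[of n] by (auto intro!: V_diff)
  next
    have "AE t in lebesgue_on I. t \<in> I" by (rule AE_I2) (simp add: sp)
    then show "AE t in lebesgue_on I. (\<lambda>x. u t x - v t x) \<in> V_space \<Omega> \<and>
        (\<lambda>n. V_norm \<Omega> (\<lambda>x. u t x - v t x - (s n t x - r n t x))) \<longlonglongrightarrow> 0"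
      using s(3) r(3)
    proof eventually_elim
      case (elim t)
      have sV: "s n t \<in> V_space \<Omega>" and rV: "r n t \<in> V_space \<Omega>" for n
        using elim(1) s(2)[of n] r(2)[of n] by auto
      have eq: "(\<lambda>x. u t x - v t x - (s n t x - r n t x)) = (\<lambda>x. (u t x - s n t x) - (v t x - r n t x))" for n by auto
      have "(\<lambda>n. V_norm \<Omega> (\<lambda>x. u t x - v t x - (s n t x - r n t x))) \<longlonglongrightarrow> 0"
        unfolding eq
      proof (rule Lim_null_comparison[OF always_eventually tendsto_add_zero], rule allI)
        show "norm (V_norm \<Omega> (\<lambda>x. (u t x - s n t x) - (v t x - r n t x)))
            \<le> V_norm \<Omega> (\<lambda>x. u t x - s n t x) + V_norm \<Omega> (\<lambda>x. v t x - r n t x)" for n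
          using V_norm_diff_le[OF V_H1[OF V_diff] V_H1[OF V_diff], of "u t" "s n t" "v t" "r n t"] elim sV rV
          by (simp add: V_norm_nonneg)
      qed (use elim in auto)
      then show ?case using elim by (auto intro: V_diff)
    qed
  qed
qed

text \<open>
  The difference of the derivatives is cut off at the times at which one of the functions is not
  in \<open>V\<close>, because linearity and the bounds are only available at the other times.
\<close>

definition difference_rhs :: "(real \<Rightarrow> field2) \<Rightarrow> (real \<Rightarrow> field2 \<Rightarrow> real) \<Rightarrow> (real \<Rightarrow> field2) \<Rightarrow> (real \<Rightarrow> field2 \<Rightarrow> real)
    \<Rightarrow> real \<Rightarrow> field2 \<Rightarrow> real" where
  "difference_rhs u G v G' t \<phi> = (if u t \<in> V_space \<Omega> \<and> v t \<in> V_space \<Omega> then G t \<phi> - G' t \<phi> else 0)"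

text \<open>Every clause is stable under differences, with the bounds added. The energy identity
  thereby becomes available for u - v, whose equation is not of Navier--Stokes form.\<close>

lemma evolution_difference:
  assumes u: "evolution \<Omega> T B u G K" and v: "evolution \<Omega> T B' v G' K'"
  shows "evolution \<Omega> T (B + B') (\<lambda>t x. u t x - v t x) (difference_rhs u G v G') (\<lambda>t. K t + K' t)"
proof -
  interpret u: evolution \<Omega> T B u G K by (rule u)
  interpret v: evolution \<Omega> T B' v G' K' by (rule v)
  let ?w = "\<lambda>t x. u t x - v t x" and ?D = "difference_rhs u G v G'"
  have aeD: "AE t in lebesgue_on {0..T}. G t \<phi> - G' t \<phi> = ?D t \<phi>" for \<phi>
    using strongly_measurable_AE_in[OF u.measurable_in_V] strongly_measurable_AE_in[OF v.measurable_in_V]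
    by eventually_elim (simp add: difference_rhs_def)
  have Dm: "(\<lambda>t. ?D t \<phi>) \<in> borel_measurable (lebesgue_on {0..T})" if "\<phi> \<in> V_space \<Omega>" for \<phi>
    by (rule borel_measurable_lebesgue_on_AE[OF _ _ aeD])
      (use u.G_measurable[OF that] v.G_measurable[OF that] in auto)
  have wsm: "strongly_measurable {0..T} (V_space \<Omega>) (V_norm \<Omega>) ?w"
    by (rule strongly_measurable_V_diff[OF u.measurable_in_V v.measurable_in_V])
  show ?thesis
  proof
    show "0 < T" by (rule u.T_pos)
    show "?w t \<in> H_space \<Omega>" if "t \<in> {0..T}" for t
      by (intro H_diff u.in_H v.in_H that)
    show "continuous_on {0..T} (\<lambda>t. L2_inner \<Omega> (?w t) h)" if "h \<in> H_space \<Omega>" for h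
    proof -
      have "continuous_on {0..T} (\<lambda>t. L2_inner \<Omega> (u t) h - L2_inner \<Omega> (v t) h)"
        by (intro continuous_intros u.weakly_continuous v.weakly_continuous that)
      then show ?thesis
        by (rule continuous_on_eq) (use that u.in_H v.in_H in \<open>auto simp: L2_inner_diff_left H_L2\<close>)
    qed
    show "L2_norm \<Omega> (?w t) \<le> B + B'" if t: "t \<in> {0..T}" for t
      using L2_norm_add[OF H_L2[OF u.in_H[OF t]] L2_scaleR[OF H_L2[OF v.in_H[OF t]], of "-1"]]
        L2_norm_scaleR[of \<Omega> "-1" "v t"] u.H_bound[OF t] v.H_bound[OF t] by simp
    show "strongly_measurable {0..T} (V_space \<Omega>) (V_norm \<Omega>) ?w" by (rule wsm)
    have sq: "(a + b)\<^sup>2 \<le> 2 * a\<^sup>2 + 2 * b\<^sup>2" for a b :: real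
      using sum_squares_bound[of a b] by (simp add: power2_sum)
    show "integrable (lebesgue_on {0..T}) (\<lambda>t. (V_norm \<Omega> (?w t))\<^sup>2)"
    proof (rule Bochner_Integration.integrable_bound)
      show "integrable (lebesgue_on {0..T}) (\<lambda>t. 2 * (V_norm \<Omega> (u t))\<^sup>2 + 2 * (V_norm \<Omega> (v t))\<^sup>2)"
        using u.V_norm_square_integrable v.V_norm_square_integrable by auto
      have "(\<lambda>t. V_norm \<Omega> (?w t)) \<in> borel_measurable (lebesgue_on {0..T})"
      proof (rule strongly_measurable_compose[OF wsm, where h="\<lambda>t. V_norm \<Omega>"])
        fix t :: real and z :: "nat \<Rightarrow> field2" and x
        assume "\<And>n. z n \<in> V_space \<Omega>" "x \<in> V_space \<Omega>" "(\<lambda>n. V_norm \<Omega> (x - z n)) \<longlonglongrightarrow> 0"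
        then show "(\<lambda>n. V_norm \<Omega> (z n)) \<longlonglongrightarrow> V_norm \<Omega> x"
          by (intro V_norm_approx) (auto intro: V_H1 simp: fun_diff_def)
      qed auto
      then show "(\<lambda>t. (V_norm \<Omega> (?w t))\<^sup>2) \<in> borel_measurable (lebesgue_on {0..T})" by measurable
      show "AE t in lebesgue_on {0..T}. norm ((V_norm \<Omega> (?w t))\<^sup>2) \<le> norm (2 * (V_norm \<Omega> (u t))\<^sup>2 + 2 * (V_norm \<Omega> (v t))\<^sup>2)"
        using strongly_measurable_AE_in[OF u.measurable_in_V] strongly_measurable_AE_in[OF v.measurable_in_V]
      proof eventually_elim
        case (elim t)
        have "(V_norm \<Omega> (?w t))\<^sup>2 \<le> (V_norm \<Omega> (u t) + V_norm \<Omega> (v t))\<^sup>2"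
          by (intro power_mono V_norm_diff_le V_H1 elim V_norm_nonneg)
        also have "\<dots> \<le> 2 * (V_norm \<Omega> (u t))\<^sup>2 + 2 * (V_norm \<Omega> (v t))\<^sup>2" by (rule sq)
        finally show ?case by simp
      qed
    qed
    show "?D t (\<lambda>x. \<phi> x + \<psi> x) = ?D t \<phi> + ?D t \<psi>" if "t \<in> {0..T}" "\<phi> \<in> V_space \<Omega>" "\<psi> \<in> V_space \<Omega>" for t \<phi> \<psi>
      using that by (simp add: difference_rhs_def u.G_add v.G_add)
    show "?D t (\<lambda>x. c *\<^sub>R \<phi> x) = c * ?D t \<phi>" if "t \<in> {0..T}" "\<phi> \<in> V_space \<Omega>" for t \<phi> c
      using that by (simp add: difference_rhs_def u.G_scaleR v.G_scaleR right_diff_distrib)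
    show "0 \<le> K t + K' t" if "t \<in> {0..T}" for t
      using u.K_nonneg[OF that] v.K_nonneg[OF that] by simp
    show "\<bar>?D t \<phi>\<bar> \<le> (K t + K' t) * V_norm \<Omega> \<phi>" if t: "t \<in> {0..T}" "\<phi> \<in> V_space \<Omega>" for t \<phi>
    proof (cases "u t \<in> V_space \<Omega> \<and> v t \<in> V_space \<Omega>")
      case True
      then show ?thesis
        using u.G_bound[of t \<phi>] v.G_bound[of t \<phi>] t by (simp add: difference_rhs_def distrib_right)
    next
      case False
      then show ?thesis
        using u.K_nonneg[OF t(1)] v.K_nonneg[OF t(1)] V_norm_nonneg[of \<Omega> \<phi>] by (auto simp: difference_rhs_def)
    qed
    show Km: "(\<lambda>t. K t + K' t) \<in> borel_measurable (lebesgue_on {0..T})"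
      using u.K_measurable v.K_measurable by measurable
    show "integrable (lebesgue_on {0..T}) (\<lambda>t. (K t + K' t)\<^sup>2)"
    proof (rule Bochner_Integration.integrable_bound)
      show "integrable (lebesgue_on {0..T}) (\<lambda>t. 2 * (K t)\<^sup>2 + 2 * (K' t)\<^sup>2)"
        using u.K_square_integrable v.K_square_integrable by auto
      show "AE t in lebesgue_on {0..T}. norm ((K t + K' t)\<^sup>2) \<le> norm (2 * (K t)\<^sup>2 + 2 * (K' t)\<^sup>2)"
        using sq by (intro AE_I2) simp
    qed (use Km in measurable)
    show "(\<lambda>t. ?D t \<phi>) \<in> borel_measurable (lebesgue_on {0..T})" if "\<phi> \<in> V_space \<Omega>" for \<phi>
      by (rule Dm[OF that])
    show "(LINT t|lebesgue_on {0<..<T}. L2_inner \<Omega> (?w t) \<phi> * deriv \<theta> t)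
        = - (LINT t|lebesgue_on {0<..<T}. ?D t \<phi> * \<theta> t)"
      if \<phi>: "\<phi> \<in> V_space \<Omega>" and \<theta>: "\<theta> \<in> test_functions {0<..<T}" for \<phi> \<theta>
    proof -
      have c\<theta>: "continuous_on UNIV \<theta>" "continuous_on UNIV (deriv \<theta>)"
      proof -
        show "continuous_on UNIV \<theta>" by (rule test_continuous[OF \<theta>])
        have "deriv \<theta> t = frechet_derivative \<theta> (at t) 1" for t
        proof (rule DERIV_imp_deriv)
          have lin: "linear (frechet_derivative \<theta> (at t))" by (rule has_derivative_linear[OF test_has_derivative[OF \<theta>]])
          have "frechet_derivative \<theta> (at t) = (*) (frechet_derivative \<theta> (at t) 1)"
          proof
            show "frechet_derivative \<theta> (at t) x = frechet_derivative \<theta> (at t) 1 * x" for x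
              using linear_scale[OF lin, of x 1] by simp
          qed
          then show "(\<theta> has_real_derivative frechet_derivative \<theta> (at t) 1) (at t)"
            using test_has_derivative[OF \<theta>, of t] by (simp add: has_field_derivative_def)
        qed
        then show "continuous_on UNIV (deriv \<theta>)"
          using test_derivative_continuous[OF \<theta>, of 1] by (simp add: fun_eq_iff[symmetric])
      qed
      have bounded\<theta>: "bounded (\<theta> ` {0<..<T})"
        by (rule bounded_subset[of "\<theta> ` {0..T}"])
          (auto intro!: compact_imp_bounded compact_continuous_image continuous_on_subset[OF c\<theta>(1)])
      have m\<theta>: "\<theta> \<in> borel_measurable (lebesgue_on {0<..<T})"
        by (rule continuous_imp_measurable_on_sets_lebesgue[OF continuous_on_subset[OF c\<theta>(1)]]) auto
      have i1: "integrable (lebesgue_on {0<..<T}) (\<lambda>t. L2_inner \<Omega> (z t) \<phi> * deriv \<theta> t)"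
        if "continuous_on {0..T} (\<lambda>t. L2_inner \<Omega> (z t) \<phi>)" for z
        by (intro integrable_lebesgue_on_continuous continuous_intros that continuous_on_subset[OF c\<theta>(2)]) simp
      have i2: "integrable (lebesgue_on {0<..<T}) (\<lambda>t. y t * \<theta> t)"
        if y: "integrable (lebesgue_on {0..T}) y" for y
      proof -
        have "integrable (lebesgue_on {0<..<T}) y" by (rule integrable_lebesgue_on_subset[OF y]) auto
        then have "y absolutely_integrable_on {0<..<T}" by (simp add: absolutely_integrable_on_iff_lebesgue_on)
        then have "(\<lambda>t. \<theta> t * y t) absolutely_integrable_on {0<..<T}"
          by (intro absolutely_integrable_bounded_measurable_product_real m\<theta> bounded\<theta>) auto
        then show ?thesis by (simp add: absolutely_integrable_on_iff_lebesgue_on mult.commute)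
      qed
      have V_H': "\<phi> \<in> H_space \<Omega>" by (rule V_H[OF \<phi>])
      have "(LINT t|lebesgue_on {0<..<T}. L2_inner \<Omega> (?w t) \<phi> * deriv \<theta> t)
          = (LINT t|lebesgue_on {0<..<T}. L2_inner \<Omega> (u t) \<phi> * deriv \<theta> t - L2_inner \<Omega> (v t) \<phi> * deriv \<theta> t)"
        by (rule Bochner_Integration.integral_cong)
          (use u.in_H v.in_H in \<open>auto simp: space_restrict_space L2_inner_diff_left H_L2 V_L2[OF \<phi>] left_diff_distrib\<close>)
      also have "\<dots> = - ((LINT t|lebesgue_on {0<..<T}. G t \<phi> * \<theta> t) - (LINT t|lebesgue_on {0<..<T}. G' t \<phi> * \<theta> t))"
        using i1[OF u.weakly_continuous[OF V_H']] i1[OF v.weakly_continuous[OF V_H']]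
          u.weak_derivative[OF \<phi> \<theta>] v.weak_derivative[OF \<phi> \<theta>] by simp
      also have "(LINT t|lebesgue_on {0<..<T}. G t \<phi> * \<theta> t) - (LINT t|lebesgue_on {0<..<T}. G' t \<phi> * \<theta> t)
          = (LINT t|lebesgue_on {0<..<T}. G t \<phi> * \<theta> t - G' t \<phi> * \<theta> t)"
        using i2[OF u.G_integrable[OF \<phi>]] i2[OF v.G_integrable[OF \<phi>]] by simp
      also have "\<dots> = (LINT t|lebesgue_on {0<..<T}. ?D t \<phi> * \<theta> t)"
      proof (rule integral_cong_AE)
        have ae: "AE t in lebesgue_on {0<..<T}. G t \<phi> - G' t \<phi> = ?D t \<phi>"
          by (rule AE_lebesgue_on_subset[OF aeD]) auto
        then show "AE t in lebesgue_on {0<..<T}. G t \<phi> * \<theta> t - G' t \<phi> * \<theta> t = ?D t \<phi> * \<theta> t"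
          by eventually_elim (simp add: left_diff_distrib[symmetric])
        have "(\<lambda>t. ?D t \<phi>) \<in> borel_measurable (lebesgue_on {0<..<T})"
          by (rule measurable_restrict_mono[OF Dm[OF \<phi>]]) auto
        then show "(\<lambda>t. ?D t \<phi> * \<theta> t) \<in> borel_measurable (lebesgue_on {0<..<T})"
          using m\<theta> by measurable
        show "(\<lambda>t. G t \<phi> * \<theta> t - G' t \<phi> * \<theta> t) \<in> borel_measurable (lebesgue_on {0<..<T})"
          by (intro borel_measurable_diff borel_measurable_integrable i2 u.G_integrable v.G_integrable \<phi>)
      qed
      finally show ?thesis .
    qed
  qed
qed

end

subsection \<open>Decay of the difference\<close>

text \<open>The fixed point of the map taking x to q x + c is c / (1 - q). Along multiples of
  \<open>\<tau>\<close> the upper bound for the excess over it shrinks by \<open>q\<close> at each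
  step, and \<open>e\<close> absorbs what is left; \<open>C\<close> and \<open>c'\<close> carry the
  bound into the interior of a window.\<close>

lemma window_iteration:
  fixes A :: "real \<Rightarrow> real"
  assumes \<tau>: "\<tau> > 0" and q: "0 \<le> q" "q < 1" and C: "0 \<le> C" and e: "e > 0"
    and step: "\<And>t. t \<ge> t0 \<Longrightarrow> A (t + \<tau>) \<le> q * A t + c"
    and between: "\<And>t s. t \<ge> t0 \<Longrightarrow> 0 \<le> s \<Longrightarrow> s \<le> \<tau> \<Longrightarrow> A (t + s) \<le> C * A t + c'"
  shows "\<exists>t1\<ge>t0. \<forall>t\<ge>t1. A t \<le> C * (c / (1 - q) + e) + c'"
proof -
  define L where "L = c / (1 - q)"
  have L: "q * L + c = L" using q by (simp add: L_def field_simps)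
  define d where "d = A t0 - L"
  have a: "A (t0 + real n * \<tau>) \<le> L + q ^ n * d" for n
  proof (induction n)
    case (Suc n)
    have "A (t0 + real n * \<tau> + \<tau>) \<le> q * A (t0 + real n * \<tau>) + c"
      using \<tau> by (intro step) simp
    also have "\<dots> \<le> q * (L + q ^ n * d) + c"
      using q Suc by (intro add_right_mono mult_left_mono) auto
    also have "\<dots> = (q * L + c) + q ^ Suc n * d" by (simp add: algebra_simps)
    finally show ?case unfolding L by (simp add: algebra_simps)
  qed (simp add: d_def)
  have "(\<lambda>n. q ^ n * d) \<longlonglongrightarrow> 0 * d"
    using q by (intro tendsto_mult tendsto_const LIMSEQ_realpow_zero) auto
  then have "\<forall>\<^sub>F n in sequentially. q ^ n * d < e" using e by (intro order_tendstoD(2)) auto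
  then obtain n0 where n0: "\<And>n. n \<ge> n0 \<Longrightarrow> q ^ n * d < e" by (auto simp: eventually_sequentially)
  have "A t \<le> C * (L + e) + c'" if t: "t \<ge> t0 + real n0 * \<tau>" for t
  proof -
    define n where "n = nat \<lfloor>(t - t0) / \<tau>\<rfloor>"
    have "real n0 \<le> (t - t0) / \<tau>" using t \<tau> by (simp add: field_simps)
    then have n: "n \<ge> n0" "real n \<le> (t - t0) / \<tau>" "(t - t0) / \<tau> \<le> real n + 1"
      by (auto simp: n_def le_nat_floor)
    define s where "s = t - (t0 + real n * \<tau>)"
    have s: "0 \<le> s" "s \<le> \<tau>" using n(2,3) \<tau> by (auto simp: s_def field_simps)
    have "A t = A (t0 + real n * \<tau> + s)" by (simp add: s_def)
    also have "\<dots> \<le> C * A (t0 + real n * \<tau>) + c'" using s \<tau> by (intro between) auto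
    also have "\<dots> \<le> C * (L + e) + c'"
      using a[of n] n0[OF n(1)] C by (intro add_right_mono mult_left_mono) auto
    finally show ?thesis .
  qed
  moreover have "t0 + real n0 * \<tau> \<ge> t0" using \<tau> by simp
  ultimately show ?thesis unfolding L_def by blast
qed

text \<open>The form in which the energy balance delivers the hypotheses: \<open>A\<close> is the
  primitive of a density that is estimated at almost every time only.\<close>

lemma gronwall_density:
  fixes A \<alpha> g :: "real \<Rightarrow> real"
  assumes ab: "a \<le> b" and A: "continuous_on {a..b} A" "\<And>t. t \<in> {a..b} \<Longrightarrow> 0 \<le> A t"
    and \<alpha>: "\<alpha> absolutely_integrable_on {a..b}" and \<beta>: "\<beta> \<ge> 0"
    and diff: "\<And>x y. a \<le> x \<Longrightarrow> x \<le> y \<Longrightarrow> y \<le> b \<Longrightarrow> g integrable_on {x..y} \<and> A y - A x = integral {x..y} g"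
    and N: "negligible N" and le: "\<And>r. r \<in> {a..b} - N \<Longrightarrow> g r \<le> \<beta> - \<alpha> r * A r"
    and M: "\<And>x. x \<in> {a..b} \<Longrightarrow> - integral {x..b} \<alpha> \<le> M"
  shows "A b \<le> exp (- integral {a..b} \<alpha>) * A a + exp M * \<beta> * (b - a)"
proof (rule gronwall[OF ab A \<alpha> \<beta> _ M])
  fix x y assume xy: "a \<le> x" "x \<le> y" "y \<le> b"
  have i: "(\<lambda>t. \<alpha> t * A t) integrable_on {x..y}"
    by (rule integrable_mult_continuous[OF A(1) \<alpha> xy(1,3)])
  have "integral {x..y} g \<le> integral {x..y} (\<lambda>t. \<beta> - \<alpha> t * A t)"
    by (rule integral_mono_negligible[OF _ _ N])
      (use diff[OF xy] i le xy in \<open>auto intro!: Henstock_Kurzweil_Integration.integrable_diff integrable_const_ivl\<close>)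
  also have "\<dots> = \<beta> * (y - x) - integral {x..y} (\<lambda>t. \<alpha> t * A t)"
    using xy by (subst Henstock_Kurzweil_Integration.integral_diff[OF integrable_const_ivl i]) simp
  finally show "A y - A x \<le> \<beta> * (y - x) - integral {x..y} (\<lambda>t. \<alpha> t * A t)"
    using diff[OF xy] by simp
qed

context bounded_open_set begin

text \<open>Glues the identities on the intervals (0, T) into one continuous function on (0,
  \<infinity>). It equals the energy at almost every time and dominates it at every positive time,
  so Gronwall's inequality is applied to it in place of the energy.\<close>

lemma energy_balance:
  assumes ev: "\<And>T. T > 0 \<Longrightarrow> \<exists>B K. evolution \<Omega> T B u G K"
  obtains A where "continuous_on {0<..} A" "\<And>t. 0 < t \<Longrightarrow> 0 \<le> A t"
    "\<And>t. 0 < t \<Longrightarrow> (L2_norm \<Omega> (u t))\<^sup>2 \<le> A t"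
    "\<And>T. 0 < T \<Longrightarrow> \<exists>N. negligible N \<and> (\<forall>t\<in>{0<..<T} - N. (L2_norm \<Omega> (u t))\<^sup>2 = A t)"
    "\<And>s t. 0 < s \<Longrightarrow> s \<le> t \<Longrightarrow> (\<lambda>r. 2 * G r (u r)) integrable_on {s..t} \<and>
      A t - A s = integral {s..t} (\<lambda>r. 2 * G r (u r))"
proof -
  let ?g = "\<lambda>r. 2 * G r (u r)"
  define P where "P t = integral {0..t} ?g" for t
  have "\<exists>c N. negligible N \<and> (\<forall>t\<in>{0<..<T} - N. (L2_norm \<Omega> (u t))\<^sup>2 = P t + c) \<and>
      (\<forall>t\<in>{0<..<T}. (L2_norm \<Omega> (u t))\<^sup>2 \<le> P t + c)" if T: "T > 0" for T
  proof -
    obtain B K where "evolution \<Omega> T B u G K" using ev[OF T] by blast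
    from evolution.energy_identity[OF this] show ?thesis unfolding P_def .
  qed
  then obtain c N where cN: "\<And>T. T > 0 \<Longrightarrow> negligible (N T)"
    "\<And>T t. T > 0 \<Longrightarrow> t \<in> {0<..<T} - N T \<Longrightarrow> (L2_norm \<Omega> (u t))\<^sup>2 = P t + c T"
    "\<And>T t. T > 0 \<Longrightarrow> t \<in> {0<..<T} \<Longrightarrow> (L2_norm \<Omega> (u t))\<^sup>2 \<le> P t + c T" by metis
  \<comment> \<open>The intervals overlap in a set of positive measure, which contains a time at
    which both identities hold.\<close>
  have c1: "c T = c 1" if T: "T > 0" for T
  proof -
    have "\<not> negligible {0<..<min 1 T}" using open_not_negligible[of "{0<..<min 1 T}"] T by simp
    moreover have "negligible (N 1 \<union> N T)" using cN(1) T by simp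
    ultimately have "\<not> {0<..<min 1 T} \<subseteq> N 1 \<union> N T" using negligible_subset by blast
    then obtain t where "t \<in> {0<..<min 1 T}" "t \<notin> N 1" "t \<notin> N T" by blast
    then show ?thesis using cN(2)[of 1 t] cN(2)[OF T, of t] by simp
  qed
  define A where "A t = P t + c 1" for t
  have int: "?g integrable_on {s..t}" if st: "0 \<le> s" "0 < t" for s t
  proof -
    obtain B K where "evolution \<Omega> t B u G K" using ev[OF st(2)] by blast
    then interpret evolution \<Omega> t B u G K .
    show ?thesis using sub_integrable[OF power_density_integrable st(1), of t] by (simp add: power_density_def[abs_def])
  qed
  have le: "(L2_norm \<Omega> (u t))\<^sup>2 \<le> A t" if "0 < t" for t
    using cN(3)[of "t + 1" t] c1[of "t + 1"] that by (simp add: A_def)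
  show thesis
  proof (rule that)
    show "continuous_on {0<..} A"
      unfolding continuous_on_eq_continuous_at[OF open_greaterThan]
    proof
      fix t :: real assume t: "t \<in> {0<..}"
      have "continuous_on {0..t+1} P" unfolding P_def
        by (rule indefinite_integral_continuous_1[OF int]) (use t in auto)
      then have "continuous_on {0<..<t+1} P" by (rule continuous_on_subset) auto
      then have "isCont P t" using t by (simp add: continuous_on_eq_continuous_at)
      then show "isCont A t" unfolding A_def by (intro continuous_intros)
    qed
    show "0 \<le> A t" if "0 < t" for t using le[OF that] by (rule order_trans[OF zero_le_power2])
    show "(L2_norm \<Omega> (u t))\<^sup>2 \<le> A t" if "0 < t" for t by (rule le[OF that])
    show "\<exists>N. negligible N \<and> (\<forall>t\<in>{0<..<T} - N. (L2_norm \<Omega> (u t))\<^sup>2 = A t)" if "0 < T" for T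
      using cN(1,2)[OF that] c1[OF that] by (intro exI[of _ "N T"]) (auto simp: A_def)
    show "?g integrable_on {s..t} \<and> A t - A s = integral {s..t} ?g" if "0 < s" "s \<le> t" for s t
    proof
      show "?g integrable_on {s..t}" using that by (intro int) auto
      have "integral {0..s} ?g + integral {s..t} ?g = integral {0..t} ?g"
        by (rule Henstock_Kurzweil_Integration.integral_combine) (use that int[of 0 t] in auto)
      then show "A t - A s = integral {s..t} ?g" by (simp add: A_def P_def)
    qed
  qed
qed

lemma evolution_regular_times:
  assumes ev: "\<And>T. T > 0 \<Longrightarrow> \<exists>B K. evolution \<Omega> T B u G K" and T: "T > 0"
  shows "negligible {t\<in>{0..T}. u t \<notin> V_space \<Omega>}"
    and "0 \<le> s \<Longrightarrow> (\<lambda>t. (V_norm \<Omega> (u t))\<^sup>2) absolutely_integrable_on {s..T}"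
proof -
  obtain B K where "evolution \<Omega> T B u G K" using ev[OF T] by blast
  then interpret evolution \<Omega> T B u G K .
  show "negligible {t\<in>{0..T}. u t \<notin> V_space \<Omega>}"
    using negligible_bad_times by (simp add: bad_times_def)
  show "(\<lambda>t. (V_norm \<Omega> (u t))\<^sup>2) absolutely_integrable_on {s..T}" if "0 \<le> s"
    using integrable_lebesgue_on_subset[OF V_norm_square_integrable, of "{s..T}"] that
    by (simp add: absolutely_integrable_on_iff_lebesgue_on)
qed

text \<open>The nonlinear term vanishes, and Young's inequality gives A' \<le> D - \<nu> ||u||^2
  with D = F1^2 / \<nu>. By Poincare's inequality the homogeneous part contracts by exp (- 1) \<le>
  1 / 2 over a window of length \<tau>, and the energy is finally at most 4 D \<tau>. Integrating
  the same inequality once more bounds \<nu> times the integral of ||u||^2 by 5 D \<tau>.\<close>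

lemma dissipation_window:
  assumes \<nu>: "\<nu> > 0" and adm: "admissible_forcing \<Omega> f" and sol: "weak_solution \<Omega> \<nu> f u0 u"
    and F1: "F1 > 0" and f: "\<And>t. t \<ge> t0 \<Longrightarrow> V_dual_norm \<Omega> (f t) \<le> F1"
  shows "\<exists>t1. \<forall>t\<ge>t1. \<forall>s. 0 \<le> s \<and> s \<le> poincare_const\<^sup>2 / \<nu> \<longrightarrow>
    integral {t..t+s} (\<lambda>r. (V_norm \<Omega> (u r))\<^sup>2) \<le> 5 * F1\<^sup>2 * poincare_const\<^sup>2 / \<nu> ^ 3"
proof -
  let ?P = poincare_const and ?g = "\<lambda>r. 2 * nse_rhs \<nu> f u r (u r)"
  note P = poincare_const_props(1)
  have ev: "\<exists>B K. evolution \<Omega> T B u (nse_rhs \<nu> f u) K" if "T > 0" for T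
    by (rule weak_solution_evolution[OF \<nu> adm sol that])
  obtain A where A: "continuous_on {0<..} A" "\<And>t. 0 < t \<Longrightarrow> 0 \<le> A t"
    "\<And>t. 0 < t \<Longrightarrow> (L2_norm \<Omega> (u t))\<^sup>2 \<le> A t"
    "\<And>T. 0 < T \<Longrightarrow> \<exists>N. negligible N \<and> (\<forall>t\<in>{0<..<T} - N. (L2_norm \<Omega> (u t))\<^sup>2 = A t)"
    "\<And>s t. 0 < s \<Longrightarrow> s \<le> t \<Longrightarrow> ?g integrable_on {s..t} \<and> A t - A s = integral {s..t} ?g"
    using energy_balance[OF ev] by blast
  define D where "D = F1\<^sup>2 / \<nu>"
  have D: "D > 0" using F1 \<nu> by (simp add: D_def)
  define \<tau> where "\<tau> = ?P\<^sup>2 / \<nu>"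
  have \<tau>: "\<tau> > 0" using P \<nu> by (simp add: \<tau>_def)
  define t2 where "t2 = max t0 1"
  have density: "?g r \<le> D - \<nu> * (V_norm \<Omega> (u r))\<^sup>2" if r: "r \<ge> t2" "u r \<in> V_space \<Omega>" for r
  proof -
    have fV: "f r \<in> V_dual \<Omega>" using adm r by (simp add: admissible_forcing_def t2_def)
    have "f r (u r) \<le> V_dual_norm \<Omega> (f r) * V_norm \<Omega> (u r)" using V_dual_bound[OF fV r(2)] by simp
    also have "\<dots> \<le> F1 * V_norm \<Omega> (u r)"
      using r by (intro mult_right_mono f V_norm_nonneg) (simp add: t2_def)
    finally have 1: "f r (u r) \<le> F1 * V_norm \<Omega> (u r)" .
    have "0 \<le> (\<nu> * V_norm \<Omega> (u r) - F1)\<^sup>2 / \<nu>" using \<nu> by simp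
    also have "\<dots> = \<nu> * (V_norm \<Omega> (u r))\<^sup>2 + D - 2 * (F1 * V_norm \<Omega> (u r))"
      using \<nu> by (simp add: D_def power2_eq_square field_simps)
    finally have 2: "2 * (F1 * V_norm \<Omega> (u r)) \<le> \<nu> * (V_norm \<Omega> (u r))\<^sup>2 + D" by simp
    have "nse_rhs \<nu> f u r (u r) = f r (u r) - \<nu> * (V_norm \<Omega> (u r))\<^sup>2"
      by (simp add: nse_rhs_def nse_b_eq_0[OF r(2,2)] V_norm_squared)
    then show ?thesis using 1 2 by linarith
  qed
  have grow: "A (t + s) \<le> exp (- (\<nu> / ?P\<^sup>2 * s)) * A t + D * s" if t: "t \<ge> t2" "0 \<le> s" for t s
  proof -
    have t0: "t > 0" using t by (simp add: t2_def)
    obtain N where N: "negligible N" "\<And>r. r \<in> {0<..<t+s+1} - N \<Longrightarrow> (L2_norm \<Omega> (u r))\<^sup>2 = A r"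
      using A(4)[of "t + s + 1"] t0 t by auto
    let ?Z = "N \<union> {r\<in>{0..t+s+1}. u r \<notin> V_space \<Omega>}"
    \<comment> \<open>The rate is a positive constant, so its negative integrals are bounded by M =
      0.\<close>
    have "A (t + s) \<le> exp (- integral {t..t+s} (\<lambda>r. \<nu> / ?P\<^sup>2)) * A t + exp 0 * D * (t + s - t)"
    proof (rule gronwall_density[where g="?g" and N="?Z"])
      show "continuous_on {t..t+s} A" by (rule continuous_on_subset[OF A(1)]) (use t0 in auto)
      show "negligible ?Z"
        using N(1) evolution_regular_times(1)[OF ev, of "t + s + 1"] t0 t by simp
      show "?g integrable_on {x..y} \<and> A y - A x = integral {x..y} ?g" if "t \<le> x" "x \<le> y" "y \<le> t + s" for x y
        by (rule A(5)) (use that t0 in auto)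
      show "?g r \<le> D - \<nu> / ?P\<^sup>2 * A r" if r: "r \<in> {t..t+s} - ?Z" for r
      proof -
        have rV: "u r \<in> V_space \<Omega>" using r t0 by auto
        have "A r = (L2_norm \<Omega> (u r))\<^sup>2" using N(2)[of r] r t0 by auto
        also have "\<dots> \<le> (?P * V_norm \<Omega> (u r))\<^sup>2" by (intro power_mono poincare rV L2_norm_nonneg)
        finally have "\<nu> / ?P\<^sup>2 * A r \<le> \<nu> / ?P\<^sup>2 * (?P\<^sup>2 * (V_norm \<Omega> (u r))\<^sup>2)"
          using \<nu> by (intro mult_left_mono) (auto simp: power_mult_distrib)
        also have "\<dots> = \<nu> * (V_norm \<Omega> (u r))\<^sup>2" using P by simp
        finally show ?thesis using density[of r] rV r t by auto
      qed
      show "- integral {x..t + s} (\<lambda>r. \<nu> / ?P\<^sup>2) \<le> 0" if "x \<in> {t..t+s}" for x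
        using that \<nu> by simp
      show "(\<lambda>r. \<nu> / ?P\<^sup>2) absolutely_integrable_on {t..t+s}"
        by (rule absolutely_integrable_continuous_real) (rule continuous_on_const)
    qed (use A(2) t0 t D in auto)
    then show ?thesis using t by (simp add: mult.commute)
  qed
  have q: "exp (- 1) \<le> (1 / 2 :: real)"
    using exp_ge_add_one_self[of "1::real"] by (simp add: exp_minus field_simps)
  \<comment> \<open>The margin \<open>e\<close> is taken as \<open>D * \<tau>\<close>, of the size
    of the other terms; in all there are at most 2 + 1 + 1 multiples of it.\<close>
  have "\<exists>t1\<ge>t2. \<forall>t\<ge>t1. A t \<le> 1 * (D * \<tau> / (1 - exp (- 1)) + D * \<tau>) + D * \<tau>"
  proof (rule window_iteration[OF \<tau>])
    show "A (t + \<tau>) \<le> exp (- 1) * A t + D * \<tau>" if "t \<ge> t2" for t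
    proof -
      have eq: "\<nu> / ?P\<^sup>2 * \<tau> = 1" using P \<nu> by (simp add: \<tau>_def)
      show ?thesis using grow[OF that, of \<tau>] less_imp_le[OF \<tau>] unfolding eq by simp
    qed
    show "A (t + s) \<le> 1 * A t + D * \<tau>" if "t \<ge> t2" "0 \<le> s" "s \<le> \<tau>" for t s
    proof -
      have "exp (- (\<nu> / ?P\<^sup>2 * s)) * A t \<le> 1 * A t"
        using that A(2)[of t] \<nu> by (intro mult_right_mono) (auto simp: t2_def)
      moreover have "D * s \<le> D * \<tau>" using that D by simp
      ultimately show ?thesis using grow[OF that(1,2)] by linarith
    qed
  qed (use D \<tau> in auto)
  then obtain t1 where t1: "t1 \<ge> t2" "\<And>t. t \<ge> t1 \<Longrightarrow> A t \<le> D * \<tau> / (1 - exp (- 1)) + D * \<tau> + D * \<tau>" by auto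
  have A4: "A t \<le> 4 * (D * \<tau>)" if "t \<ge> t1" for t
  proof -
    have "D * \<tau> / (1 - exp (- 1)) \<le> D * \<tau> / (1 / 2)"
      using q D \<tau> by (intro divide_left_mono mult_pos_pos) auto
    then show ?thesis using t1(2)[OF that] by simp
  qed
  show ?thesis
  proof (intro exI[of _ t1] allI impI)
    fix t s assume t: "t \<ge> t1" and s: "0 \<le> s \<and> s \<le> ?P\<^sup>2 / \<nu>"
    have t0: "t > 0" using t t1(1) by (simp add: t2_def)
    have Vi: "(\<lambda>r. (V_norm \<Omega> (u r))\<^sup>2) integrable_on {t..t+s}"
      using evolution_regular_times(2)[OF ev, of "t + s" t] t0 s by (simp add: absolutely_integrable_on_def)
    have Vi': "(\<lambda>r. \<nu> * (V_norm \<Omega> (u r))\<^sup>2) integrable_on {t..t+s}"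
      using integrable_on_cmult_left[OF Vi, of \<nu>] by simp
    have g: "?g integrable_on {t..t+s} \<and> A (t + s) - A t = integral {t..t+s} ?g"
      by (rule A(5)) (use t0 s in auto)
    have "integral {t..t+s} ?g \<le> integral {t..t+s} (\<lambda>r. D - \<nu> * (V_norm \<Omega> (u r))\<^sup>2)"
    proof (rule integral_mono_negligible)
      show "negligible {r\<in>{0..t+s}. u r \<notin> V_space \<Omega>}"
        by (rule evolution_regular_times(1)[OF ev]) (use t0 s in auto)
      show "(\<lambda>r. D - \<nu> * (V_norm \<Omega> (u r))\<^sup>2) integrable_on {t..t+s}"
        by (rule Henstock_Kurzweil_Integration.integrable_diff[OF integrable_const_ivl Vi'])
      show "?g r \<le> D - \<nu> * (V_norm \<Omega> (u r))\<^sup>2" if "r \<in> {t..t+s} - {r\<in>{0..t+s}. u r \<notin> V_space \<Omega>}" for r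
        using that t t0 t1(1) by (intro density) auto
    qed (use g in blast)
    also have "\<dots> = D * s - \<nu> * integral {t..t+s} (\<lambda>r. (V_norm \<Omega> (u r))\<^sup>2)"
      using s by (subst Henstock_Kurzweil_Integration.integral_diff[OF integrable_const_ivl Vi']) simp
    finally have "A (t + s) - A t \<le> D * s - \<nu> * integral {t..t+s} (\<lambda>r. (V_norm \<Omega> (u r))\<^sup>2)"
      using g by simp
    moreover have "D * s \<le> D * \<tau>" using s D by (intro mult_left_mono) (auto simp: \<tau>_def)
    moreover have "0 \<le> A (t + s)" using A(2)[of "t + s"] t0 s by simp
    ultimately have "\<nu> * integral {t..t+s} (\<lambda>r. (V_norm \<Omega> (u r))\<^sup>2) \<le> 5 * (D * \<tau>)"
      using A4[OF t] by linarith
    then have "integral {t..t+s} (\<lambda>r. (V_norm \<Omega> (u r))\<^sup>2) \<le> 5 * (D * \<tau>) / \<nu>"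
      using \<nu> by (simp add: pos_le_divide_eq mult.commute)
    also have "5 * (D * \<tau>) / \<nu> = 5 * F1\<^sup>2 * ?P\<^sup>2 / \<nu> ^ 3"
      by (simp add: D_def \<tau>_def power3_eq_cube)
    finally show "integral {t..t+s} (\<lambda>r. (V_norm \<Omega> (u r))\<^sup>2) \<le> 5 * F1\<^sup>2 * ?P\<^sup>2 / \<nu> ^ 3" .
  qed
qed

text \<open>Let a = |w|, y = ||w||, z = ||u||. Of the dissipation 2 \<nu> y^2 one quarter pays for
  the forcing and one quarter for the trilinear term, which leaves 8 / \<nu> z^2 a^2. The other half
  becomes damping of a^2 through a^2 \<le> 2 \<epsilon>^2 + 2 m^2 y^2.\<close>

lemma difference_density:
  assumes \<nu>: "\<nu> > 0" and m: "m > 0" and u: "u r \<in> V_space \<Omega>" and v: "v r \<in> V_space \<Omega>"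
    and fV: "f r \<in> V_dual \<Omega>" "g r \<in> V_dual \<Omega>" and fg: "V_dual_norm \<Omega> (f r - g r) \<le> \<epsilon>"
    and w_def: "w = (\<lambda>x. u r x - v r x)" and le: "L2_norm \<Omega> w \<le> \<epsilon> + m * V_norm \<Omega> w" and \<epsilon>: "\<epsilon> \<ge> 0"
  shows "2 * difference_rhs u (nse_rhs \<nu> f u) v (nse_rhs \<nu> g v) r w
    \<le> (\<nu> / m\<^sup>2 + 2 / \<nu>) * \<epsilon>\<^sup>2 - (\<nu> / (2 * m\<^sup>2) - 8 / \<nu> * (V_norm \<Omega> (u r))\<^sup>2) * (L2_norm \<Omega> w)\<^sup>2"
proof -
  have w: "w \<in> V_space \<Omega>" unfolding w_def by (rule V_diff[OF u v])
  define a where "a = L2_norm \<Omega> w"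
  define y where "y = V_norm \<Omega> w"
  define z where "z = V_norm \<Omega> (u r)"
  have nn: "a \<ge> 0" "y \<ge> 0" "z \<ge> 0" by (simp_all add: a_def y_def z_def L2_norm_nonneg V_norm_nonneg)
  have eq: "difference_rhs u (nse_rhs \<nu> f u) v (nse_rhs \<nu> g v) r w = (f r - g r) w - \<nu> * y\<^sup>2 - nse_b \<Omega> w (u r) w"
  proof -
    have "V_inner \<Omega> w w = V_inner \<Omega> (u r) w - V_inner \<Omega> (v r) w"
      unfolding w_def by (intro V_inner_diff_left V_H1 u v V_diff)
    moreover have "nse_b \<Omega> (u r) (u r) w - nse_b \<Omega> (v r) (v r) w = nse_b \<Omega> w (u r) w"
      by (rule nse_b_difference[OF u v w_def])
    ultimately show ?thesis
      using u v by (simp add: difference_rhs_def nse_rhs_def y_def V_norm_squared right_diff_distrib)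
  qed
  have "(f r - g r) w \<le> V_dual_norm \<Omega> (f r - g r) * y"
    using V_dual_bound[OF V_dual_diff[OF fV] w] by (simp add: y_def)
  also have "\<dots> \<le> \<epsilon> * y" using fg nn by (intro mult_right_mono)
  finally have 1: "(f r - g r) w \<le> \<epsilon> * y" .
  have 2: "- nse_b \<Omega> w (u r) w \<le> 2 * (z * a * y)"
    using nse_b_bound_self[OF w u] by (simp add: a_def y_def z_def mult_ac)
  have 3: "2 * (\<epsilon> * y) \<le> \<nu> / 2 * y\<^sup>2 + 2 / \<nu> * \<epsilon>\<^sup>2"
  proof -
    have "0 \<le> (\<nu> * y - 2 * \<epsilon>)\<^sup>2 / (2 * \<nu>)" using \<nu> by simp
    also have "\<dots> = \<nu> / 2 * y\<^sup>2 + 2 / \<nu> * \<epsilon>\<^sup>2 - 2 * (\<epsilon> * y)"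
      using \<nu> by (simp add: power2_eq_square field_simps)
    finally show ?thesis by simp
  qed
  have 4: "4 * (z * a * y) \<le> \<nu> / 2 * y\<^sup>2 + 8 / \<nu> * z\<^sup>2 * a\<^sup>2"
  proof -
    have "0 \<le> (\<nu> * y - 4 * (z * a))\<^sup>2 / (2 * \<nu>)" using \<nu> by simp
    also have "\<dots> = \<nu> / 2 * y\<^sup>2 + 8 / \<nu> * z\<^sup>2 * a\<^sup>2 - 4 * (z * a * y)"
      using \<nu> by (simp add: power2_eq_square field_simps)
    finally show ?thesis by simp
  qed
  have 5: "\<nu> / (2 * m\<^sup>2) * a\<^sup>2 \<le> \<nu> / m\<^sup>2 * \<epsilon>\<^sup>2 + \<nu> * y\<^sup>2"
  proof -
    have "a\<^sup>2 \<le> (\<epsilon> + m * y)\<^sup>2" using le nn by (intro power_mono) (auto simp: a_def y_def)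
    also have "\<dots> \<le> 2 * \<epsilon>\<^sup>2 + 2 * (m * y)\<^sup>2" using sum_squares_bound[of \<epsilon> "m * y"] by (simp add: power2_sum)
    finally have "\<nu> / (2 * m\<^sup>2) * a\<^sup>2 \<le> \<nu> / (2 * m\<^sup>2) * (2 * \<epsilon>\<^sup>2 + 2 * (m * y)\<^sup>2)"
      using \<nu> by (intro mult_left_mono) auto
    also have "\<dots> = \<nu> / m\<^sup>2 * \<epsilon>\<^sup>2 + \<nu> * y\<^sup>2" using m by (simp add: power_mult_distrib field_simps)
    finally show ?thesis .
  qed
  have "2 * difference_rhs u (nse_rhs \<nu> f u) v (nse_rhs \<nu> g v) r w
      \<le> 2 * (\<epsilon> * y) - 2 * (\<nu> * y\<^sup>2) + 4 * (z * a * y)"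
    unfolding eq right_diff_distrib using 1 2 by simp
  also have "\<dots> \<le> 2 / \<nu> * \<epsilon>\<^sup>2 - \<nu> * y\<^sup>2 + 8 / \<nu> * z\<^sup>2 * a\<^sup>2"
    using 3 4 by linarith
  also have "\<dots> \<le> 2 / \<nu> * \<epsilon>\<^sup>2 + \<nu> / m\<^sup>2 * \<epsilon>\<^sup>2 - \<nu> / (2 * m\<^sup>2) * a\<^sup>2 + 8 / \<nu> * z\<^sup>2 * a\<^sup>2"
    using 5 by linarith
  also have "\<dots> = (\<nu> / m\<^sup>2 + 2 / \<nu>) * \<epsilon>\<^sup>2 - (\<nu> / (2 * m\<^sup>2) - 8 / \<nu> * z\<^sup>2) * a\<^sup>2"
    by (simp add: left_diff_distrib distrib_right)
  finally show ?thesis by (simp add: a_def z_def)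
qed

text \<open>Over a late window of length P^2 / \<nu> the damping rate has integral at least P^2 / (2
  m^2) - 40 P^2 F1^2 / \<nu>^4. The hypothesis 9 m F1 \<le> \<nu>^2 makes this at least P^2 / m^2
  times 1 / 2 - 40 / 81 = 1 / 162, so every such window contracts the energy by a fixed factor, up
  to a small inhomogeneity.\<close>

lemma difference_tendsto_0:
  assumes \<nu>: "\<nu> > 0" and m: "m > 0" and F1: "F1 > 0" and mF: "9 * m * F1 \<le> \<nu>\<^sup>2"
    and adm: "admissible_forcing \<Omega> f" "admissible_forcing \<Omega> g"
    and sol: "weak_solution \<Omega> \<nu> f u0 u" "weak_solution \<Omega> \<nu> g v0 v"
    and fg: "((\<lambda>t. V_dual_norm \<Omega> (f t - g t)) \<longlongrightarrow> 0) at_top"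
    and f: "\<forall>\<^sub>F t in at_top. V_dual_norm \<Omega> (f t) \<le> F1"
    and near: "\<And>\<epsilon>. \<epsilon> > 0 \<Longrightarrow> \<exists>t0. \<forall>t\<ge>t0. u t \<in> V_space \<Omega> \<longrightarrow> v t \<in> V_space \<Omega> \<longrightarrow>
      L2_norm \<Omega> (\<lambda>x. u t x - v t x) \<le> \<epsilon> + m * V_norm \<Omega> (\<lambda>x. u t x - v t x)"
  shows "((\<lambda>t. L2_norm \<Omega> (\<lambda>x. u t x - v t x)) \<longlongrightarrow> 0) at_top"
proof -
  let ?P = poincare_const and ?w = "\<lambda>t x. u t x - v t x"
  let ?G = "difference_rhs u (nse_rhs \<nu> f u) v (nse_rhs \<nu> g v)"
  let ?g = "\<lambda>r. 2 * ?G r (?w r)"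
  note P = poincare_const_props(1)
  have evu: "\<exists>B K. evolution \<Omega> T B u (nse_rhs \<nu> f u) K" if "T > 0" for T
    by (rule weak_solution_evolution[OF \<nu> adm(1) sol(1) that])
  have evv: "\<exists>B K. evolution \<Omega> T B v (nse_rhs \<nu> g v) K" if "T > 0" for T
    by (rule weak_solution_evolution[OF \<nu> adm(2) sol(2) that])
  have evw: "\<exists>B K. evolution \<Omega> T B ?w ?G K" if "T > 0" for T
    using evolution_difference evu[OF that] evv[OF that] by blast
  obtain A where A: "continuous_on {0<..} A" "\<And>t. 0 < t \<Longrightarrow> 0 \<le> A t"
    "\<And>t. 0 < t \<Longrightarrow> (L2_norm \<Omega> (?w t))\<^sup>2 \<le> A t"
    "\<And>T. 0 < T \<Longrightarrow> \<exists>N. negligible N \<and> (\<forall>t\<in>{0<..<T} - N. (L2_norm \<Omega> (?w t))\<^sup>2 = A t)"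
    "\<And>s t. 0 < s \<Longrightarrow> s \<le> t \<Longrightarrow> ?g integrable_on {s..t} \<and> A t - A s = integral {s..t} ?g"
    using energy_balance[OF evw] by blast
  define \<tau> where "\<tau> = ?P\<^sup>2 / \<nu>"
  have \<tau>: "\<tau> > 0" using P \<nu> by (simp add: \<tau>_def)
  define S where "S = 5 * F1\<^sup>2 * ?P\<^sup>2 / \<nu> ^ 3"
  define \<alpha> where "\<alpha> r = \<nu> / (2 * m\<^sup>2) - 8 / \<nu> * (V_norm \<Omega> (u r))\<^sup>2" for r
  \<comment> \<open>On part of a window the damping rate may have a negative integral, but never
    below - M, since only the dissipation of \<open>u\<close> counts against it.\<close>
  define M where "M = 8 / \<nu> * S"
  have M: "M \<ge> 0" using \<nu> by (simp add: M_def S_def)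
  define \<delta> where "\<delta> = ?P\<^sup>2 / (162 * m\<^sup>2)"
  have \<delta>: "\<delta> > 0" using P m by (simp add: \<delta>_def)
  obtain t\<^sub>f where "\<And>t. t \<ge> t\<^sub>f \<Longrightarrow> V_dual_norm \<Omega> (f t) \<le> F1"
    using f by (auto simp: eventually_at_top_linorder)
  then obtain t1 where t1: "\<And>t s. t \<ge> t1 \<Longrightarrow> 0 \<le> s \<Longrightarrow> s \<le> \<tau> \<Longrightarrow> integral {t..t+s} (\<lambda>r. (V_norm \<Omega> (u r))\<^sup>2) \<le> S"
    using dissipation_window[OF \<nu> adm(1) sol(1) F1, of t\<^sub>f] unfolding \<tau>_def S_def by blast
  have V2: "(\<lambda>r. (V_norm \<Omega> (u r))\<^sup>2) absolutely_integrable_on {x..y}" if "0 < y" "0 \<le> x" for x y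
    by (rule evolution_regular_times(2)[OF evu that])
  have \<alpha>i: "\<alpha> absolutely_integrable_on {x..y}" if "0 < y" "0 \<le> x" for x y
    unfolding \<alpha>_def
    by (intro set_integral_diff(1) absolutely_integrable_continuous_real continuous_on_const set_integrable_mult_right V2 that)
  have \<alpha>int: "integral {x..y} \<alpha> = \<nu> / (2 * m\<^sup>2) * (y - x) - 8 / \<nu> * integral {x..y} (\<lambda>r. (V_norm \<Omega> (u r))\<^sup>2)"
    if "0 < x" "x \<le> y" for x y
  proof -
    have "(\<lambda>r. (V_norm \<Omega> (u r))\<^sup>2) integrable_on {x..y}"
      using V2[of y x] that by (simp add: absolutely_integrable_on_def)
    from integrable_on_cmult_left[OF this, of "8 / \<nu>"]
    have "(\<lambda>r. 8 / \<nu> * (V_norm \<Omega> (u r))\<^sup>2) integrable_on {x..y}" by simp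
    from Henstock_Kurzweil_Integration.integral_diff[OF integrable_const_ivl this, of "\<nu> / (2 * m\<^sup>2)"]
    have "integral {x..y} \<alpha> = integral {x..y} (\<lambda>r. \<nu> / (2 * m\<^sup>2)) - integral {x..y} (\<lambda>r. 8 / \<nu> * (V_norm \<Omega> (u r))\<^sup>2)"
      unfolding \<alpha>_def .
    also have "integral {x..y} (\<lambda>r. 8 / \<nu> * (V_norm \<Omega> (u r))\<^sup>2) = 8 / \<nu> * integral {x..y} (\<lambda>r. (V_norm \<Omega> (u r))\<^sup>2)"
      by (rule Henstock_Kurzweil_Integration.integral_mult_right)
    finally show ?thesis using that by simp
  qed
  have \<alpha>\<delta>: "integral {t..t+\<tau>} \<alpha> \<ge> \<delta>" if t: "t \<ge> t1" "t > 0" for t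
  proof -
    have "integral {t..t+\<tau>} \<alpha> \<ge> \<nu> / (2 * m\<^sup>2) * \<tau> - 8 / \<nu> * S"
      using \<alpha>int[of t "t + \<tau>"] t \<tau> t1[of t \<tau>] \<nu> by (simp add: divide_right_mono mult_left_mono)
    moreover have "\<nu> / (2 * m\<^sup>2) * \<tau> - 8 / \<nu> * S \<ge> \<delta>"
    proof -
      have "(9 * m * F1)\<^sup>2 \<le> (\<nu>\<^sup>2)\<^sup>2" using mF m F1 by (intro power_mono) auto
      then have "F1\<^sup>2 / \<nu> ^ 4 \<le> 1 / (81 * m\<^sup>2)" using m \<nu> by (simp add: field_simps power_mult_distrib)
      then have "40 * ?P\<^sup>2 * (F1\<^sup>2 / \<nu> ^ 4) \<le> 40 * ?P\<^sup>2 * (1 / (81 * m\<^sup>2))"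
        by (intro mult_left_mono) auto
      moreover have "8 / \<nu> * S = 40 * ?P\<^sup>2 * (F1\<^sup>2 / \<nu> ^ 4)"
        by (simp add: S_def power3_eq_cube power4_eq_xxxx mult_ac)
      moreover have "\<nu> / (2 * m\<^sup>2) * \<tau> = ?P\<^sup>2 / (2 * m\<^sup>2)" using \<nu> by (simp add: \<tau>_def)
      moreover have "?P\<^sup>2 / (2 * m\<^sup>2) - 40 * ?P\<^sup>2 * (1 / (81 * m\<^sup>2)) = \<delta>"
        using m by (simp add: \<delta>_def field_simps)
      ultimately show ?thesis by linarith
    qed
    ultimately show ?thesis by linarith
  qed
  have \<alpha>M: "- integral {x..b} \<alpha> \<le> M" if "t1 \<le> x" "0 < x" "x \<le> b" "b - x \<le> \<tau>" for x b
  proof -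
    have "8 / \<nu> * integral {x..b} (\<lambda>r. (V_norm \<Omega> (u r))\<^sup>2) \<le> M"
      using t1[of x "b - x"] that \<nu> unfolding M_def by (intro mult_left_mono) auto
    moreover have "0 \<le> \<nu> / (2 * m\<^sup>2) * (b - x)" using that \<nu> by simp
    ultimately show ?thesis using \<alpha>int[OF that(2,3)] by linarith
  qed
  have decay: "\<exists>t2. \<forall>t\<ge>t2. A t \<le> \<eta>" if \<eta>: "\<eta> > 0" for \<eta>
  proof -
    define q where "q = exp (- \<delta>)"
    have q: "0 \<le> q" "q < 1" using \<delta> by (auto simp: q_def)
    \<comment> \<open>Solves \<open>exp M * (c / (1 - q) + c) + c = \<eta>\<close>, where the
      left-hand side is the bound that the iteration over windows delivers.\<close>
    define c where "c = \<eta> / (exp M * (1 / (1 - q) + 1) + 1)"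
    have den: "exp M * (1 / (1 - q) + 1) + 1 > 0" using q by (intro add_nonneg_pos mult_nonneg_nonneg) auto
    have c: "c > 0" using \<eta> den by (simp add: c_def)
    have c\<eta>: "exp M * (c / (1 - q) + c) + c = \<eta>"
    proof -
      have "exp M * (c / (1 - q) + c) + c = c * (exp M * (1 / (1 - q) + 1) + 1)" by (simp add: algebra_simps)
      then show ?thesis using den by (simp add: c_def)
    qed
    define b where "b = \<nu> / m\<^sup>2 + 2 / \<nu>"
    have b: "b > 0" using \<nu> m by (simp add: b_def add_pos_pos)
    \<comment> \<open>Makes the inhomogeneous term of Gronwall's inequality over a full window equal
      to \<open>c\<close>.\<close>
    define \<epsilon> where "\<epsilon> = sqrt (c / (exp M * b * \<tau>))"
    have \<epsilon>: "\<epsilon> > 0" using c b \<tau> by (simp add: \<epsilon>_def)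
    have \<epsilon>c: "exp M * (b * \<epsilon>\<^sup>2) * \<tau> = c" using c b \<tau> by (simp add: \<epsilon>_def)
    obtain ta where ta: "\<And>t. t \<ge> ta \<Longrightarrow> u t \<in> V_space \<Omega> \<Longrightarrow> v t \<in> V_space \<Omega> \<Longrightarrow>
        L2_norm \<Omega> (?w t) \<le> \<epsilon> + m * V_norm \<Omega> (?w t)" using near[OF \<epsilon>] by blast
    obtain tb where tb: "\<And>t. t \<ge> tb \<Longrightarrow> V_dual_norm \<Omega> (f t - g t) < \<epsilon>"
      using order_tendstoD(2)[OF fg \<epsilon>] by (auto simp: eventually_at_top_linorder)
    define t0 where "t0 = max (max ta tb) (max t1 1)"
    have grow: "A (t + s) \<le> exp (- integral {t..t+s} \<alpha>) * A t + c" if t: "t \<ge> t0" "0 \<le> s" "s \<le> \<tau>" for t s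
    proof -
      have tt: "t > 0" "t \<ge> t1" "t \<ge> ta" "t \<ge> tb" using t by (auto simp: t0_def)
      obtain N where N: "negligible N" "\<And>r. r \<in> {0<..<t+s+1} - N \<Longrightarrow> (L2_norm \<Omega> (?w r))\<^sup>2 = A r"
        using A(4)[of "t + s + 1"] tt t by auto
      let ?Z = "N \<union> ({r\<in>{0..t+s+1}. u r \<notin> V_space \<Omega>} \<union> {r\<in>{0..t+s+1}. v r \<notin> V_space \<Omega>})"
      have "A (t + s) \<le> exp (- integral {t..t+s} \<alpha>) * A t + exp M * (b * \<epsilon>\<^sup>2) * (t + s - t)"
      proof (rule gronwall_density[where g="?g" and N="?Z"])
        show "continuous_on {t..t+s} A" by (rule continuous_on_subset[OF A(1)]) (use tt in auto)
        show "negligible ?Z"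
          using N(1) evolution_regular_times(1)[OF evu, of "t + s + 1"] evolution_regular_times(1)[OF evv, of "t + s + 1"] tt t
          by simp
        show "?g integrable_on {x..y} \<and> A y - A x = integral {x..y} ?g" if "t \<le> x" "x \<le> y" "y \<le> t + s" for x y
          by (rule A(5)) (use that tt in auto)
        show "?g r \<le> b * \<epsilon>\<^sup>2 - \<alpha> r * A r" if r: "r \<in> {t..t+s} - ?Z" for r
        proof -
          have rV: "u r \<in> V_space \<Omega>" "v r \<in> V_space \<Omega>" using r tt by auto
          have "A r = (L2_norm \<Omega> (?w r))\<^sup>2" using N(2)[of r] r tt by auto
          moreover have "?g r \<le> b * \<epsilon>\<^sup>2 - \<alpha> r * (L2_norm \<Omega> (?w r))\<^sup>2"
            unfolding b_def \<alpha>_def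
          proof (rule difference_density[OF \<nu> m, where u=u and v=v and f=f and g=g and r=r])
            show "f r \<in> V_dual \<Omega>" "g r \<in> V_dual \<Omega>" using adm r tt by (auto simp: admissible_forcing_def)
            show "V_dual_norm \<Omega> (f r - g r) \<le> \<epsilon>" using tb[of r] r tt by auto
            show "L2_norm \<Omega> (?w r) \<le> \<epsilon> + m * V_norm \<Omega> (?w r)" using ta[OF _ rV] r tt by auto
          qed (use \<epsilon> rV in simp_all)
          ultimately show ?thesis by simp
        qed
        show "- integral {x..t + s} \<alpha> \<le> M" if "x \<in> {t..t+s}" for x
          by (rule \<alpha>M) (use that tt t in auto)
        show "\<alpha> absolutely_integrable_on {t..t+s}" by (rule \<alpha>i) (use tt t in auto)
      qed (use A(2) tt t b in auto)
      moreover have "exp M * (b * \<epsilon>\<^sup>2) * (t + s - t) \<le> c"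
        unfolding \<epsilon>c[symmetric] using t b by (intro mult_left_mono) auto
      ultimately show ?thesis by linarith
    qed
    have "\<exists>t2\<ge>t0. \<forall>t\<ge>t2. A t \<le> exp M * (c / (1 - q) + c) + c"
    proof (rule window_iteration[OF \<tau> q])
      show "A (t + \<tau>) \<le> q * A t + c" if t: "t \<ge> t0" for t
      proof -
        have "exp (- integral {t..t+\<tau>} \<alpha>) * A t \<le> q * A t"
          using \<alpha>\<delta>[of t] t A(2)[of t] by (intro mult_right_mono) (auto simp: t0_def q_def)
        then show ?thesis using grow[OF t, of \<tau>] \<tau> by simp
      qed
      show "A (t + s) \<le> exp M * A t + c" if t: "t \<ge> t0" "0 \<le> s" "s \<le> \<tau>" for t s
      proof -
        have "exp (- integral {t..t+s} \<alpha>) * A t \<le> exp M * A t"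
          using \<alpha>M[of t "t + s"] t A(2)[of t] by (intro mult_right_mono) (auto simp: t0_def)
        then show ?thesis using grow[OF t] by simp
      qed
    qed (use c in auto)
    then show ?thesis using c\<eta> by auto
  qed
  show ?thesis
  proof (rule tendstoI)
    fix e :: real assume e: "e > 0"
    then have "(e / 2)\<^sup>2 > 0" by simp
    then obtain t2 where t2: "\<And>t. t \<ge> t2 \<Longrightarrow> A t \<le> (e / 2)\<^sup>2" using decay by blast
    have "dist (L2_norm \<Omega> (?w t)) 0 < e" if "t \<ge> max t2 1" for t
    proof -
      have "(L2_norm \<Omega> (?w t))\<^sup>2 \<le> (e / 2)\<^sup>2" using A(3)[of t] t2[of t] that by simp
      then have "L2_norm \<Omega> (?w t) \<le> e / 2" by (rule power2_le_imp_le) (use e in simp)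
      then show ?thesis using e L2_norm_nonneg[of \<Omega> "?w t"] by simp
    qed
    then show "\<forall>\<^sub>F t in at_top. dist (L2_norm \<Omega> (?w t)) 0 < e"
      unfolding eventually_at_top_linorder by blast
  qed
qed

end

section \<open>The threshold for N\<close>

theorem theorem4p3:
  fixes \<Omega> :: "(real^2) set" and \<gamma> C1 :: real
  assumes "bounded_lipschitz_domain \<Omega>" and "\<gamma> > 0" and "C1 > 0"
  shows "\<exists>C>0. \<forall>(\<nu>::real) (f::real \<Rightarrow> functional) (g::real \<Rightarrow> functional)
            (u0::field2) (v0::field2) (u::real \<Rightarrow> field2) (v::real \<Rightarrow> field2)
            (N::nat) (VN::field2 set) (R::field2 \<Rightarrow> field2) (F::real).
      \<nu> > 0 \<longrightarrow>
      admissible_forcing \<Omega> f \<longrightarrow> admissible_forcing \<Omega> g \<longrightarrow>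
      ((\<lambda>t. V_dual_norm \<Omega> (f t - g t)) \<longlongrightarrow> 0) at_top \<longrightarrow>
      u0 \<in> H_space \<Omega> \<longrightarrow> v0 \<in> H_space \<Omega> \<longrightarrow>
      weak_solution \<Omega> \<nu> f u0 u \<longrightarrow> weak_solution \<Omega> \<nu> g v0 v \<longrightarrow>
      L2_subspace_dim \<Omega> N VN \<longrightarrow> projection_operator \<Omega> VN R \<longrightarrow>
      ((\<lambda>t. L2_norm \<Omega> (R (u t - v t))) \<longlongrightarrow> 0) (at_top_in_V \<Omega> u v) \<longrightarrow>
      (\<forall>\<phi>\<in>V_space \<Omega>. L2_norm \<Omega> (\<phi> - R \<phi>) \<le> C1 * real N powr (- \<gamma>) * H1_norm \<Omega> \<phi>) \<longrightarrow>
      Limsup at_top (\<lambda>t. ereal (V_dual_norm \<Omega> (f t))) = ereal F \<longrightarrow>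
      real N > C * (1 / \<nu>\<^sup>2 * F) powr (1 / \<gamma>) \<longrightarrow>
      ((\<lambda>t. L2_norm \<Omega> (u t - v t)) \<longlongrightarrow> 0) at_top"
proof -
  interpret bounded_open_set \<Omega>
    using assms(1) by unfold_locales (auto simp: bounded_lipschitz_domain_def)
  \<comment> \<open>On V the H1 norm is at most (\<kappa> P + 1) ||\<phi>|| by Poincare's
    inequality, so the approximation error is at most c N^(-\<gamma>) ||\<phi>||.\<close>
  define c where "c = C1 * (\<kappa> * poincare_const + 1)"
  have c: "c > 0" using assms(3) \<kappa>_pos poincare_const_props(1) by (simp add: c_def add_pos_pos)
  \<comment> \<open>Raised to the power \<gamma>, the condition on N becomes, for positive F, 9 c F
    / \<nu>^2 < N^\<gamma>, that is 9 m F < \<nu>^2 with m = c N^(-\<gamma>).\<close>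
  define C where "C = (9 * c) powr (1 / \<gamma>)"
  have C: "C > 0" using c by (simp add: C_def)
  show ?thesis
  proof (intro exI[of _ C] conjI allI impI C)
    fix \<nu> F :: real and f g :: "real \<Rightarrow> functional" and u0 v0 :: field2 and u v :: "real \<Rightarrow> field2"
      and N :: nat and VN :: "field2 set" and R :: "field2 \<Rightarrow> field2"
    assume \<nu>: "\<nu> > 0" and adm: "admissible_forcing \<Omega> f" "admissible_forcing \<Omega> g"
      and fg: "((\<lambda>t. V_dual_norm \<Omega> (f t - g t)) \<longlongrightarrow> 0) at_top"
      and sol: "weak_solution \<Omega> \<nu> f u0 u" "weak_solution \<Omega> \<nu> g v0 v"
      and VN: "L2_subspace_dim \<Omega> N VN" and R: "projection_operator \<Omega> VN R"
      and lim: "((\<lambda>t. L2_norm \<Omega> (R (u t - v t))) \<longlongrightarrow> 0) (at_top_in_V \<Omega> u v)"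
      and approx: "\<forall>\<phi>\<in>V_space \<Omega>. L2_norm \<Omega> (\<phi> - R \<phi>) \<le> C1 * real N powr (- \<gamma>) * H1_norm \<Omega> \<phi>"
      and F: "Limsup at_top (\<lambda>t. ereal (V_dual_norm \<Omega> (f t))) = ereal F"
      and N: "real N > C * (1 / \<nu>\<^sup>2 * F) powr (1 / \<gamma>)"
    \<comment> \<open>The right-hand side of the threshold is nonnegative, so the strict inequality
      excludes N = 0, at which \<open>powr\<close> has the default value 0.\<close>
    have N0: "real N > 0" using N C by (smt (verit) mult_nonneg_nonneg powr_ge_zero)
    define X where "X = real N powr \<gamma> * \<nu>\<^sup>2 / (9 * c)"
    have X0: "X > 0" using N0 \<nu> c by (simp add: X_def)
    have FX: "F < X"
    proof (cases "F > 0")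
      case True
      have "C * (1 / \<nu>\<^sup>2 * F) powr (1 / \<gamma>) = (9 * c * (1 / \<nu>\<^sup>2 * F)) powr (1 / \<gamma>)"
        unfolding C_def by (rule powr_mult[symmetric])
      then have "((9 * c * (1 / \<nu>\<^sup>2 * F)) powr (1 / \<gamma>)) powr \<gamma> < real N powr \<gamma>"
        using N assms(2) by (intro powr_less_mono2) auto
      then have "9 * c * (1 / \<nu>\<^sup>2 * F) < real N powr \<gamma>"
        using assms(2) c True \<nu> by (simp add: powr_powr)
      then show ?thesis using c \<nu> by (simp add: X_def field_simps)
    qed (use X0 in simp)
    \<comment> \<open>Strictly above the limit superior, so that it bounds the norm of
      \<open>f t\<close> for large \<open>t\<close>; not above \<open>X\<close>; and positive also
      when F is 0.\<close>
    define F1 where "F1 = (max F 0 + X) / 2"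
    have F1: "F1 > 0" "F < F1" "F1 \<le> X" using FX X0 by (auto simp: F1_def)
    define m where "m = c * real N powr (- \<gamma>)"
    have m: "m > 0" using c N0 by (simp add: m_def)
    have R_L2: "R \<phi> \<in> L2_space \<Omega>" if "\<phi> \<in> V_space \<Omega>" for \<phi>
      using R VN that by (auto simp: projection_operator_def L2_subspace_dim_def)
    have R_error: "L2_norm \<Omega> (\<lambda>x. \<phi> x - R \<phi> x) \<le> m * V_norm \<Omega> \<phi>" if \<phi>: "\<phi> \<in> V_space \<Omega>" for \<phi>
    proof -
      have "H1_norm \<Omega> \<phi> \<le> \<kappa> * (poincare_const * V_norm \<Omega> \<phi>) + V_norm \<Omega> \<phi>"
        using H1_norm_bounds(3)[of \<phi>] mult_left_mono[OF poincare[OF \<phi>] less_imp_le[OF \<kappa>_pos]] by linarith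
      then have "C1 * real N powr (- \<gamma>) * H1_norm \<Omega> \<phi>
          \<le> C1 * real N powr (- \<gamma>) * (\<kappa> * (poincare_const * V_norm \<Omega> \<phi>) + V_norm \<Omega> \<phi>)"
        using assms(3) by (intro mult_left_mono) auto
      also have "\<dots> = m * V_norm \<Omega> \<phi>" by (simp add: m_def c_def algebra_simps)
      finally show ?thesis using approx \<phi> by (fastforce simp: fun_diff_def)
    qed
    have "((\<lambda>t. L2_norm \<Omega> (\<lambda>x. u t x - v t x)) \<longlongrightarrow> 0) at_top"
    proof (rule difference_tendsto_0[OF \<nu> m F1(1) _ adm sol fg])
      have "9 * m * F1 \<le> 9 * m * X" using m F1 by simp
      also have "\<dots> = \<nu>\<^sup>2" using c N0 by (simp add: m_def X_def powr_minus field_simps)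
      finally show "9 * m * F1 \<le> \<nu>\<^sup>2" .
      have "\<forall>\<^sub>F t in at_top. ereal (V_dual_norm \<Omega> (f t)) < ereal F1"
        by (rule Limsup_lessD) (simp add: F F1)
      then show "\<forall>\<^sub>F t in at_top. V_dual_norm \<Omega> (f t) \<le> F1"
        by eventually_elim simp
      fix \<epsilon> :: real assume \<epsilon>: "\<epsilon> > 0"
      have "\<forall>\<^sub>F t in at_top_in_V \<Omega> u v. L2_norm \<Omega> (R (u t - v t)) < \<epsilon>"
        by (rule order_tendstoD(2)[OF lim \<epsilon>])
      \<comment> \<open>The filter only sees times at which both solutions are in V. The other times
        form a null set, which is harmless because the estimate enters a differential inequality
        that is required almost everywhere.\<close>
      then obtain t0 where t0: "\<And>t. t \<ge> t0 \<Longrightarrow> u t \<in> V_space \<Omega> \<Longrightarrow> v t \<in> V_space \<Omega> \<Longrightarrow>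
          L2_norm \<Omega> (R (u t - v t)) < \<epsilon>"
        unfolding at_top_in_V_def eventually_inf_principal eventually_at_top_linorder by blast
      have "L2_norm \<Omega> (\<lambda>x. u t x - v t x) \<le> \<epsilon> + m * V_norm \<Omega> (\<lambda>x. u t x - v t x)"
        if t: "t \<ge> t0" "u t \<in> V_space \<Omega>" "v t \<in> V_space \<Omega>" for t
      proof -
        let ?w = "\<lambda>x. u t x - v t x"
        have w: "?w \<in> V_space \<Omega>" by (rule V_diff[OF t(2,3)])
        have "L2_norm \<Omega> ?w \<le> L2_norm \<Omega> (R ?w) + L2_norm \<Omega> (\<lambda>x. ?w x - R ?w x)"
          using L2_norm_add[OF R_L2[OF w] L2_diff[OF V_L2[OF w] R_L2[OF w]]] by simp
        moreover have "L2_norm \<Omega> (R ?w) < \<epsilon>" using t0[OF t] by (simp add: fun_diff_def)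
        ultimately show ?thesis using R_error[OF w] by linarith
      qed
      then show "\<exists>t0. \<forall>t\<ge>t0. u t \<in> V_space \<Omega> \<longrightarrow> v t \<in> V_space \<Omega> \<longrightarrow>
          L2_norm \<Omega> (\<lambda>x. u t x - v t x) \<le> \<epsilon> + m * V_norm \<Omega> (\<lambda>x. u t x - v t x)" by blast
    qed
    then show "((\<lambda>t. L2_norm \<Omega> (u t - v t)) \<longlongrightarrow> 0) at_top" by (simp add: fun_diff_def)
  qed
qed

end
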